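(* For the rectangles cluster tilting object $T^\square$ in $\mathrm{CM}\,C$, $$\widetilde{\mathsf{wt}}\bigl(\mathsf{Mon}_{\mathrm{GV}}(T^\square)\bigr)=\mathsf{Mon}_{\mathrm{GT}}.$$ Consequently, $\mathsf{Mon}_{\mathrm{GV}}(T^\square)$ consists of the integral points of $\mathsf{Cone}_{\mathrm{GV}}(T^\square)$, which is a rational polyhedral cone.
   Context: Fix integers $0<k<n$, $[n]=\{1,\dots,n\}$. Let $R=\mathbb C[[t]]$. $C=C(k,n)$ is the path $R$-algebra of the quiver with vertex set $\mathbb Z/n$ and arrows $x_i\colon i-1\to i$, $y_i\colon i\to i-1$ ($i\in\mathbb Z/n$), modulo the relations $xy=t=yx$ and $x^k=y^{n-k}$ starting at every vertex; $e_i$ are the vertex idempotents. $\mathrm{CM}\,C$ is the category of finitely generated left $C$-modules free over $R$; $\mathrm{rk}_CM=\mathrm{rk}_R(e_iM)$. For a $k$-subset $J\subset[n]$, $M_J$ is the rank one module with $e_iM_J=R$, $x_i$ acting by $1$ and $y_i$ by $t$ if $i\in J$, and $x_i$ by $t$, $y_i$ by $1$ if $i\notin J$. Let $\Gamma=\{(i,j)\in\mathbb Z^2:1\le i\le k,\ 1\le j\le n-k\}$. The rectangles cluster tilting object is $T^\square=T_\emptyset\oplus\bigoplus_{ij\in\Gamma}T_{ij}$, where $T_\emptyset=M_{[1,k]}=Ce_*$ with $*=0=n$, and $T_{ij}=M_{K_{ij}}$ with $K_{ij}=[1,k-i]\cup[k-i+j+1,k+j]$. (It is cluster tilting: $\mathrm{add}\,T^\square=\{X:\mathrm{Ext}^1_C(T^\square,X)=0\}$.)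 For $T=T^\square$, $A=\mathrm{End}_C(T)^{\mathrm{op}}$: $[T,M]$ is the class of $\mathrm{Hom}_C(T,M)$ in the Grothendieck group $K(\mathrm{CM}\,A)$ of $A$-modules free of finite rank over $R$; $\mathsf{Mon}_{\mathrm{GV}}(T)=\{[T,M]:M\in\mathrm{CM}\,C\}$ and $\mathsf{Cone}_{\mathrm{GV}}(T)$ is the closure of its $\mathbb R_{\ge0}$-span in $K(\mathrm{CM}\,A)\otimes\mathbb R$. Let $\mathsf JM=\mathrm{Hom}_R(e_*C,e_*M)$ with natural embedding $M\to\mathsf JM$; $\kappa(N,M)$ is the dimension of the cokernel of $\mathrm{Hom}_C(N,M)\to\mathrm{Hom}_C(N,\mathsf JM)$. Then $\kappa(T_\emptyset,M)=0$, so $\boldsymbol\kappa(T,M)=(\kappa(T_{ij},M))_{ij}\in\mathbb Z^\Gamma$. There is a lattice isomorphism $\widetilde{\mathsf{wt}}\colon K(\mathrm{CM}\,A)\to\mathbb Z\oplus\mathbb Z^\Gamma$ with $[T,M]\mapsto(\mathrm{rk}_CM,\boldsymbol\kappa(T,M))$ for all $M\in\mathrm{CM}\,C$. $\mathsf{Mon}_{\mathrm{GT}}$ is the monoid of cumulative Gelfand--Tsetlin patterns: the set of $(r,v)\in\mathbb Z\oplus\mathbb Z^\Gamma$ satisfying, with the convention $v_{ij}=0$ if $i\le 0$ or $j\le 0$, $v_{11}\ge0$; $v_{k(n-k)}-v_{(k-1)(n-k-1)}\le r$; $v_{ij}-v_{(i-1)(j-1)}\ge v_{(i-1)j}-v_{(i-2)(j-1)}$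 for $2\le i\le k$, $1\le j\le n-k$; $v_{ij}-v_{(i-1)(j-1)}\ge v_{i(j-1)}-v_{(i-1)(j-2)}$ for $1\le i\le k$, $2\le j\le n-k$. *)

theory Defs
  imports
    "Jordan_Normal_Form.VS_Connect"
    "Graph_Theory.Arc_Walk"
    "HOL-Algebra.QuotRing"
    "HOL-Algebra.Free_Abelian_Groups"
    "HOL-Computational_Algebra.Formal_Power_Series"
    "HOL-Analysis.Abstract_Topology"
begin

text \<open>The ground ring \<open>R = \<complex>[[t]]\<close> is \<^typ>\<open>complex fps\<close> with \<open>t = fps_X\<close>; as a ring record
it is \<^term>\<open>class_ring\<close>. An algebra over \<open>R\<close> is a record of type \<open>(complex fps, 'a) module\<close>:
its ring part need not be commutative and the field \<open>smult\<close> is the \<open>R\<close>-action. A left module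
over an algebra \<open>\<Lambda>\<close> is a record of type \<open>('a, 'm) module\<close>, whose fields \<open>mult\<close> and \<open>one\<close>
are never used.\<close>


section \<open>Modules over an algebra\<close>

locale left_module = \<Lambda>?: ring \<Lambda> + M?: abelian_group M
  for \<Lambda> :: "('a, 'b) ring_scheme" (structure) and M :: "('a, 'm, 'c) module_scheme" (structure) +
  assumes smult_closed: "\<lbrakk>a \<in> carrier \<Lambda>; x \<in> carrier M\<rbrakk> \<Longrightarrow> a \<odot>\<^bsub>M\<^esub> x \<in> carrier M"
    and smult_l_distr: "\<lbrakk>a \<in> carrier \<Lambda>; b \<in> carrier \<Lambda>; x \<in> carrier M\<rbrakk> \<Longrightarrow>
      (a \<oplus>\<^bsub>\<Lambda>\<^esub> b) \<odot>\<^bsub>M\<^esub> x = a \<odot>\<^bsub>M\<^esub> x \<oplus>\<^bsub>M\<^esub> b \<odot>\<^bsub>M\<^esub> x"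
    and smult_r_distr: "\<lbrakk>a \<in> carrier \<Lambda>; x \<in> carrier M; y \<in> carrier M\<rbrakk> \<Longrightarrow>
      a \<odot>\<^bsub>M\<^esub> (x \<oplus>\<^bsub>M\<^esub> y) = a \<odot>\<^bsub>M\<^esub> x \<oplus>\<^bsub>M\<^esub> a \<odot>\<^bsub>M\<^esub> y"
    and smult_assoc: "\<lbrakk>a \<in> carrier \<Lambda>; b \<in> carrier \<Lambda>; x \<in> carrier M\<rbrakk> \<Longrightarrow>
      (a \<otimes>\<^bsub>\<Lambda>\<^esub> b) \<odot>\<^bsub>M\<^esub> x = a \<odot>\<^bsub>M\<^esub> (b \<odot>\<^bsub>M\<^esub> x)"
    and smult_one: "x \<in> carrier M \<Longrightarrow> \<one>\<^bsub>\<Lambda>\<^esub> \<odot>\<^bsub>M\<^esub> x = x"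

definition scalar_act ::
    "('r, 'a) module \<Rightarrow> ('a, 'm) module \<Rightarrow> 'r \<Rightarrow> 'm \<Rightarrow> 'm" where
  "scalar_act \<Lambda> M r m = (r \<odot>\<^bsub>\<Lambda>\<^esub> \<one>\<^bsub>\<Lambda>\<^esub>) \<odot>\<^bsub>M\<^esub> m"

definition restrict_scalars :: "('r, 'a) module \<Rightarrow> ('a, 'm) module \<Rightarrow> ('r, 'm) module" where
  "restrict_scalars \<Lambda> M = \<lparr>carrier = carrier M, monoid.mult = undefined, one = undefined,
     ring.zero = \<zero>\<^bsub>M\<^esub>, add = add M, smult = scalar_act \<Lambda> M\<rparr>"

definition complex_scalars :: "(complex fps, 'm) module \<Rightarrow> (complex, 'm) module" where
  "complex_scalars V = \<lparr>carrier = carrier V, monoid.mult = undefined, one = undefined,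
     ring.zero = \<zero>\<^bsub>V\<^esub>, add = add V, smult = (\<lambda>z v. fps_const z \<odot>\<^bsub>V\<^esub> v)\<rparr>"

definition quotient_by :: "('r, 'a) module \<Rightarrow> 'a set \<Rightarrow> ('r, 'a set) module" where
  "quotient_by P I = \<lparr>carrier = carrier (P Quot I), monoid.mult = monoid.mult (P Quot I),
     one = \<one>\<^bsub>P Quot I\<^esub>, ring.zero = \<zero>\<^bsub>P Quot I\<^esub>, add = add (P Quot I),
     smult = (\<lambda>r X. \<Union>x\<in>X. I +>\<^bsub>P\<^esub> (r \<odot>\<^bsub>P\<^esub> x))\<rparr>"

text \<open>Homomorphisms are extensional functions, so that \<open>Hom\<close> is a set with literal equality.\<close>

definition Hom ::
    "('a, 'b) ring_scheme \<Rightarrow> ('a, 'm) module \<Rightarrow> ('a, 'n) module \<Rightarrow> ('m \<Rightarrow> 'n) set" where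
  "Hom \<Lambda> M N = LinearCombinations.module_hom \<Lambda> M N \<inter> extensional (carrier M)"

definition Hom_module ::
    "('r, 'a) module \<Rightarrow> ('a, 'm) module \<Rightarrow> ('a, 'n) module \<Rightarrow> ('r, 'm \<Rightarrow> 'n) module" where
  "Hom_module \<Lambda> M N = \<lparr>carrier = Hom \<Lambda> M N, monoid.mult = undefined, one = undefined,
     ring.zero = (\<lambda>m\<in>carrier M. \<zero>\<^bsub>N\<^esub>),
     add = (\<lambda>f g. \<lambda>m\<in>carrier M. f m \<oplus>\<^bsub>N\<^esub> g m),
     smult = (\<lambda>r f. \<lambda>m\<in>carrier M. scalar_act \<Lambda> N r (f m))\<rparr>"

definition End_op :: "('r, 'a) module \<Rightarrow> ('a, 'm) module \<Rightarrow> ('r, 'm \<Rightarrow> 'm) module" where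
  "End_op \<Lambda> T = \<lparr>carrier = Hom \<Lambda> T T,
     monoid.mult = (\<lambda>f g. compose (carrier T) g f), one = (\<lambda>x\<in>carrier T. x),
     ring.zero = \<zero>\<^bsub>Hom_module \<Lambda> T T\<^esub>, add = add (Hom_module \<Lambda> T T),
     smult = smult (Hom_module \<Lambda> T T)\<rparr>"

text \<open>\<open>Hom \<Lambda> T M\<close> as a left module over \<open>End_op \<Lambda> T\<close>, acting by precomposition.\<close>

definition Hom_from ::
    "('r, 'a) module \<Rightarrow> ('a, 't) module \<Rightarrow> ('a, 'm) module \<Rightarrow> ('t \<Rightarrow> 't, 't \<Rightarrow> 'm) module" where
  "Hom_from \<Lambda> T M = \<lparr>carrier = Hom \<Lambda> T M, monoid.mult = undefined, one = undefined,
     ring.zero = \<zero>\<^bsub>Hom_module \<Lambda> T M\<^esub>, add = add (Hom_module \<Lambda> T M),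
     smult = (\<lambda>a f. compose (carrier T) f a)\<rparr>"

definition isomorphic_modules ::
    "('a, 'b) ring_scheme \<Rightarrow> ('a, 'm) module \<Rightarrow> ('a, 'n) module \<Rightarrow> bool" where
  "isomorphic_modules \<Lambda> M N \<longleftrightarrow> (\<exists>f\<in>Hom \<Lambda> M N. bij_betw f (carrier M) (carrier N))"

definition short_exact ::
    "('a, 'b) ring_scheme \<Rightarrow> ('a, 'l) module \<Rightarrow> ('a, 'm) module \<Rightarrow> ('a, 'n) module \<Rightarrow> bool" where
  "short_exact \<Lambda> L M N \<longleftrightarrow>
     (\<exists>f\<in>Hom \<Lambda> L M. \<exists>g\<in>Hom \<Lambda> M N. inj_on f (carrier L) \<and>
        f ` carrier L = {m \<in> carrier M. g m = \<zero>\<^bsub>N\<^esub>} \<and> g ` carrier M = carrier N)"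

definition direct_sum_family ::
    "'i set \<Rightarrow> ('i \<Rightarrow> ('a, 'm) module) \<Rightarrow> ('a, 'i \<Rightarrow> 'm) module" where
  "direct_sum_family I M = \<lparr>carrier = (\<Pi>\<^sub>E i\<in>I. carrier (M i)),
     monoid.mult = undefined, one = undefined,
     ring.zero = (\<lambda>i\<in>I. \<zero>\<^bsub>M i\<^esub>), add = (\<lambda>x y. \<lambda>i\<in>I. x i \<oplus>\<^bsub>M i\<^esub> y i),
     smult = (\<lambda>a x. \<lambda>i\<in>I. a \<odot>\<^bsub>M i\<^esub> x i)\<rparr>"

definition finitely_generated :: "('a, 'b) ring_scheme \<Rightarrow> ('a, 'm) module \<Rightarrow> bool" where
  "finitely_generated \<Lambda> M \<longleftrightarrow> (\<exists>S. finite S \<and> S \<subseteq> carrier M \<and>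
     (\<forall>m\<in>carrier M. \<exists>a\<in>S \<rightarrow> carrier \<Lambda>. m = (\<Oplus>\<^bsub>M\<^esub>s\<in>S. a s \<odot>\<^bsub>M\<^esub> s)))"

definition is_basis :: "('r::comm_ring_1, 'm) module \<Rightarrow> 'm set \<Rightarrow> bool" where
  "is_basis V B \<longleftrightarrow> B \<subseteq> carrier V \<and> module.lin_indpt class_ring V B \<and> module.gen_set class_ring V B"

definition free_rank :: "('r::comm_ring_1, 'm) module \<Rightarrow> nat" where
  "free_rank V = card (SOME B. is_basis V B)"

text \<open>\<open>CM_fg \<Lambda> M\<close>: finitely generated over \<open>\<Lambda>\<close> and free over \<open>R\<close>;
\<open>CM_fr \<Lambda> M\<close>: free of finite rank over \<open>R\<close>.\<close>

definition CM_fg :: "('r::comm_ring_1, 'a) module \<Rightarrow> ('a, 'm) module \<Rightarrow> bool" where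
  "CM_fg \<Lambda> M \<longleftrightarrow> left_module \<Lambda> M \<and> finitely_generated \<Lambda> M \<and>
     (\<exists>B. is_basis (restrict_scalars \<Lambda> M) B)"

definition CM_fr :: "('r::comm_ring_1, 'a) module \<Rightarrow> ('a, 'm) module \<Rightarrow> bool" where
  "CM_fr \<Lambda> M \<longleftrightarrow> left_module \<Lambda> M \<and> (\<exists>B. finite B \<and> is_basis (restrict_scalars \<Lambda> M) B)"


section \<open>The Grothendieck group and its real extension\<close>

text \<open>A fixed type that is large enough to contain, up to isomorphism, every module that is free
of finite rank over \<open>R\<close>; the carrier may be any subset of it, with any operations.\<close>

type_synonym univ = "nat \<Rightarrow> complex fps"

abbreviation K_gens :: "(complex fps, 'a) module \<Rightarrow> (('a, univ) module \<Rightarrow>\<^sub>0 int) monoid" where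
  "K_gens \<Lambda> \<equiv> free_Abelian_group {M :: ('a, univ) module. CM_fr \<Lambda> M}"

definition K_rels :: "(complex fps, 'a) module \<Rightarrow> (('a, univ) module \<Rightarrow>\<^sub>0 int) set" where
  "K_rels \<Lambda> = generate (K_gens \<Lambda>)
     {frag_of M - frag_of L - frag_of N | L M N.
        CM_fr \<Lambda> L \<and> CM_fr \<Lambda> M \<and> CM_fr \<Lambda> N \<and> short_exact \<Lambda> L M N}"

definition K_CM :: "(complex fps, 'a) module \<Rightarrow> (('a, univ) module \<Rightarrow>\<^sub>0 int) set monoid" where
  "K_CM \<Lambda> = K_gens \<Lambda> Mod K_rels \<Lambda>"

definition K_class ::
    "(complex fps, 'a) module \<Rightarrow> ('a, 'm) module \<Rightarrow> (('a, univ) module \<Rightarrow>\<^sub>0 int) set" where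
  "K_class \<Lambda> X = K_rels \<Lambda> #>\<^bsub>K_gens \<Lambda>\<^esub>
     frag_of (SOME N :: ('a, univ) module. CM_fr \<Lambda> N \<and> isomorphic_modules \<Lambda> X N)"

text \<open>For an abelian group \<open>G\<close> (written multiplicatively, as all \<^typ>\<open>'k monoid\<close> records):
the tensor product \<open>G \<otimes> \<real>\<close> over the integers, on generators \<open>(a, r)\<close>.\<close>

abbreviation tensor_gens :: "'k monoid \<Rightarrow> ('k \<times> real \<Rightarrow>\<^sub>0 int) monoid" where
  "tensor_gens G \<equiv> free_Abelian_group (carrier G \<times> UNIV)"

definition tensor_rels :: "'k monoid \<Rightarrow> ('k \<times> real \<Rightarrow>\<^sub>0 int) set" where
  "tensor_rels G = generate (tensor_gens G)
     ({frag_of (a \<otimes>\<^bsub>G\<^esub> b, r) - frag_of (a, r) - frag_of (b, r) | a b r.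
         a \<in> carrier G \<and> b \<in> carrier G} \<union>
      {frag_of (a, r + s) - frag_of (a, r) - frag_of (a, s) | a r s. a \<in> carrier G})"

definition real_tensor :: "'k monoid \<Rightarrow> ('k \<times> real \<Rightarrow>\<^sub>0 int) set monoid" where
  "real_tensor G = tensor_gens G Mod tensor_rels G"

definition tensor :: "'k monoid \<Rightarrow> 'k \<Rightarrow> real \<Rightarrow> ('k \<times> real \<Rightarrow>\<^sub>0 int) set" where
  "tensor G a r = tensor_rels G #>\<^bsub>tensor_gens G\<^esub> frag_of (a, r)"

text \<open>Additive maps \<open>\<phi>\<close> that are \<open>\<real>\<close>-linear for \<open>s (a \<otimes> r) = a \<otimes> s r\<close>; it suffices
to require this on the pure tensors, which generate.\<close>

definition real_functional :: "'k monoid \<Rightarrow> (('k \<times> real \<Rightarrow>\<^sub>0 int) set \<Rightarrow> real) \<Rightarrow> bool" where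
  "real_functional G \<phi> \<longleftrightarrow>
     (\<forall>x\<in>carrier (real_tensor G). \<forall>y\<in>carrier (real_tensor G).
        \<phi> (x \<otimes>\<^bsub>real_tensor G\<^esub> y) = \<phi> x + \<phi> y) \<and>
     (\<forall>a\<in>carrier G. \<forall>r s. \<phi> (tensor G a (s * r)) = s * \<phi> (tensor G a r))"

text \<open>The coarsest topology making all linear functionals continuous. If \<open>G\<close> has finite rank, this
is the Euclidean topology of the finite-dimensional real vector space \<open>G \<otimes> \<real>\<close>.\<close>

definition real_tensor_topology :: "'k monoid \<Rightarrow> ('k \<times> real \<Rightarrow>\<^sub>0 int) set topology" where
  "real_tensor_topology G = topology_generated_by
     {{x \<in> carrier (real_tensor G). \<phi> x \<in> U} | \<phi> U. real_functional G \<phi> \<and> open U}"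

definition nonneg_span :: "'k monoid \<Rightarrow> 'k set \<Rightarrow> ('k \<times> real \<Rightarrow>\<^sub>0 int) set set" where
  "nonneg_span G S = {finprod (real_tensor G) (\<lambda>a. tensor G a (c a)) F | F c.
     finite F \<and> F \<subseteq> S \<and> (\<forall>a\<in>F. 0 \<le> c a)}"

definition rational_polyhedral_cone :: "'k monoid \<Rightarrow> ('k \<times> real \<Rightarrow>\<^sub>0 int) set set \<Rightarrow> bool" where
  "rational_polyhedral_cone G \<sigma> \<longleftrightarrow> (\<exists>F. finite F \<and> F \<subseteq> carrier G \<and> \<sigma> = nonneg_span G F)"

definition integral_points ::
    "'k monoid \<Rightarrow> ('k \<times> real \<Rightarrow>\<^sub>0 int) set set \<Rightarrow> 'k set" where
  "integral_points G \<sigma> = {a \<in> carrier G. tensor G a 1 \<in> \<sigma>}"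


section \<open>The algebra \<open>C(k,n)\<close>\<close>

text \<open>A path is a pair \<open>(u, p)\<close> of a start vertex and the list of its arrows in the order of
traversal. As modules are left modules, a product \<open>f g\<close> traverses \<open>g\<close> first.\<close>

definition path_algebra ::
    "('v, 'e) pre_digraph \<Rightarrow> ('r::comm_ring_1, 'v \<times> 'e list \<Rightarrow> 'r) module" where
  "path_algebra Q = \<lparr>
     carrier = {f. finite {w. f w \<noteq> 0} \<and>
       (\<forall>u p. f (u, p) \<noteq> 0 \<longrightarrow> (\<exists>v. pre_digraph.awalk Q u p v))},
     monoid.mult = (\<lambda>f g (u, p). \<Sum>i\<le>length p.
       f (pre_digraph.awlast Q u (take i p), drop i p) * g (u, take i p)),
     one = (\<lambda>(u, p). if u \<in> verts Q \<and> p = [] then 1 else 0),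
     ring.zero = (\<lambda>_. 0),
     add = (\<lambda>f g w. f w + g w),
     smult = (\<lambda>r f w. r * f w)\<rparr>"

definition path_elt :: "'v \<times> 'e list \<Rightarrow> ('v \<times> 'e list \<Rightarrow> 'r::comm_ring_1)" where
  "path_elt w = (\<lambda>w'. if w' = w then 1 else 0)"

text \<open>The vertex set \<open>\<int>/n\<close> is represented by \<open>{1..n}\<close>, so the vertex \<open>* = 0\<close> is \<open>n\<close>.\<close>

definition vtx :: "int \<Rightarrow> int \<Rightarrow> int" where
  "vtx n i = (i - 1) mod n + 1"

datatype arrow = ArrX int | ArrY int

definition cyclic_quiver :: "int \<Rightarrow> (int, arrow) pre_digraph" where
  "cyclic_quiver n = \<lparr>verts = {1..n}, arcs = ArrX ` {1..n} \<union> ArrY ` {1..n},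
     tail = (\<lambda>a. case a of ArrX i \<Rightarrow> vtx n (i - 1) | ArrY i \<Rightarrow> i),
     head = (\<lambda>a. case a of ArrX i \<Rightarrow> i | ArrY i \<Rightarrow> vtx n (i - 1))\<rparr>"

type_synonym path_elts = "int \<times> arrow list \<Rightarrow> complex fps"

abbreviation RQ :: "int \<Rightarrow> (complex fps, path_elts) module" where
  "RQ n \<equiv> path_algebra (cyclic_quiver n)"

text \<open>The relations \<open>xy = t\<close>, \<open>yx = t\<close> and \<open>x\<^sup>k = y\<^sup>n\<^sup>-\<^sup>k\<close> starting at each vertex \<open>i\<close>.\<close>

definition C_relations :: "int \<Rightarrow> int \<Rightarrow> path_elts set" where
  "C_relations k n = (\<Union>i\<in>{1..n}.
     {path_elt (i, [ArrY i, ArrX i]) \<ominus>\<^bsub>RQ n\<^esub> (fps_X \<odot>\<^bsub>RQ n\<^esub> path_elt (i, [])),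
      path_elt (i, [ArrX (vtx n (i + 1)), ArrY (vtx n (i + 1))])
        \<ominus>\<^bsub>RQ n\<^esub> (fps_X \<odot>\<^bsub>RQ n\<^esub> path_elt (i, [])),
      path_elt (i, map (\<lambda>l. ArrX (vtx n l)) [i + 1..i + k])
        \<ominus>\<^bsub>RQ n\<^esub> path_elt (i, map (\<lambda>l. ArrY (vtx n l)) (rev [i - (n - k) + 1..i]))})"

abbreviation C_ideal :: "int \<Rightarrow> int \<Rightarrow> path_elts set" where
  "C_ideal k n \<equiv> genideal (RQ n) (C_relations k n)"

definition Calg :: "int \<Rightarrow> int \<Rightarrow> (complex fps, path_elts set) module" where
  "Calg k n = quotient_by (RQ n) (C_ideal k n)"

definition e_star :: "int \<Rightarrow> int \<Rightarrow> path_elts set" where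
  "e_star k n = C_ideal k n +>\<^bsub>RQ n\<^esub> path_elt (n, [])"

text \<open>The rank one module \<open>M\<^sub>J\<close>, given by the action of the path algebra; a class in \<open>C\<close>
acts through any representative, since the relations act by zero when \<open>J\<close> is a \<open>k\<close>-subset.\<close>

definition arrow_weight :: "int set \<Rightarrow> arrow \<Rightarrow> complex fps" where
  "arrow_weight J a = (case a of ArrX i \<Rightarrow> if i \<in> J then 1 else fps_X
                               | ArrY i \<Rightarrow> if i \<in> J then fps_X else 1)"

definition path_action ::
    "int \<Rightarrow> int set \<Rightarrow> path_elts \<Rightarrow> (int \<Rightarrow> complex fps) \<Rightarrow> (int \<Rightarrow> complex fps)" where
  "path_action n J f m = (\<lambda>v\<in>{1..n}.
     \<Sum>(u, p) \<in> {(u, p). f (u, p) \<noteq> 0 \<and> pre_digraph.awalk (cyclic_quiver n) u p v}.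
       f (u, p) * prod_list (map (arrow_weight J) p) * m u)"

definition rank_one_module ::
    "int \<Rightarrow> int set \<Rightarrow> (path_elts set, int \<Rightarrow> complex fps) module" where
  "rank_one_module n J = \<lparr>carrier = {1..n} \<rightarrow>\<^sub>E UNIV,
     monoid.mult = undefined, one = undefined,
     ring.zero = (\<lambda>i\<in>{1..n}. 0), add = (\<lambda>m m'. \<lambda>i\<in>{1..n}. m i + m' i),
     smult = (\<lambda>X. path_action n J (SOME f. f \<in> X))\<rparr>"


section \<open>Invariants of modules\<close>

text \<open>\<open>eM = e M\<close> and \<open>e\<Lambda> = e \<Lambda>\<close> as \<open>R\<close>-modules, for an idempotent \<open>e\<close> of \<open>\<Lambda>\<close>.\<close>

definition eM :: "('r, 'a) module \<Rightarrow> 'a \<Rightarrow> ('a, 'm) module \<Rightarrow> ('r, 'm) module" where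
  "eM \<Lambda> e M = (restrict_scalars \<Lambda> M)\<lparr>carrier := (\<lambda>m. e \<odot>\<^bsub>M\<^esub> m) ` carrier M\<rparr>"

definition e\<Lambda> :: "('r, 'a) module \<Rightarrow> 'a \<Rightarrow> ('r, 'a) module" where
  "e\<Lambda> \<Lambda> e = \<Lambda>\<lparr>carrier := (\<lambda>c. e \<otimes>\<^bsub>\<Lambda>\<^esub> c) ` carrier \<Lambda>\<rparr>"

definition J_module ::
    "('r::comm_ring_1, 'a) module \<Rightarrow> 'a \<Rightarrow> ('a, 'm) module \<Rightarrow> ('a, 'a \<Rightarrow> 'm) module" where
  "J_module \<Lambda> e M = \<lparr>carrier = Hom class_ring (e\<Lambda> \<Lambda> e) (eM \<Lambda> e M),
     monoid.mult = undefined, one = undefined,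
     ring.zero = (\<lambda>c\<in>carrier (e\<Lambda> \<Lambda> e). \<zero>\<^bsub>M\<^esub>),
     add = (\<lambda>f g. \<lambda>c\<in>carrier (e\<Lambda> \<Lambda> e). f c \<oplus>\<^bsub>M\<^esub> g c),
     smult = (\<lambda>a f. \<lambda>c\<in>carrier (e\<Lambda> \<Lambda> e). f (c \<otimes>\<^bsub>\<Lambda>\<^esub> a))\<rparr>"

definition J_embedding :: "('r, 'a) module \<Rightarrow> 'a \<Rightarrow> ('a, 'm) module \<Rightarrow> 'm \<Rightarrow> 'a \<Rightarrow> 'm" where
  "J_embedding \<Lambda> e M = (\<lambda>m\<in>carrier M. \<lambda>c\<in>carrier (e\<Lambda> \<Lambda> e). c \<odot>\<^bsub>M\<^esub> m)"

definition \<kappa> ::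
    "(complex fps, 'a) module \<Rightarrow> 'a \<Rightarrow> ('a, 'm) module \<Rightarrow> ('a, 'n) module \<Rightarrow> nat" where
  "\<kappa> \<Lambda> e N M = vectorspace.dim class_ring (complex_scalars
     (quotient_by (Hom_module \<Lambda> N (J_module \<Lambda> e M))
       ((\<lambda>f. compose (carrier N) (J_embedding \<Lambda> e M) f) ` Hom \<Lambda> N M)))"

text \<open>The rank of \<open>e\<^sub>iM\<close> does not depend on \<open>i\<close>; we take \<open>i = *\<close>.\<close>

definition rk_C :: "int \<Rightarrow> int \<Rightarrow> (path_elts set, 'm) module \<Rightarrow> nat" where
  "rk_C k n M = free_rank (eM (Calg k n) (e_star k n) M)"


section \<open>The rectangles cluster tilting object\<close>

definition \<Gamma> :: "int \<Rightarrow> int \<Rightarrow> (int \<times> int) set" where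
  "\<Gamma> k n = {1..k} \<times> {1..n - k}"

definition T_ij :: "int \<Rightarrow> int \<Rightarrow> int \<times> int \<Rightarrow> (path_elts set, int \<Rightarrow> complex fps) module" where
  "T_ij k n = (\<lambda>(i, j). rank_one_module n ({1..k - i} \<union> {k - i + j + 1..k + j}))"

definition T_empty :: "int \<Rightarrow> int \<Rightarrow> (path_elts set, int \<Rightarrow> complex fps) module" where
  "T_empty k n = rank_one_module n {1..k}"

text \<open>The summands are indexed by \<open>None\<close> for \<open>T\<^sub>\<emptyset>\<close> and \<open>Some (i, j)\<close> for \<open>T\<^sub>i\<^sub>j\<close>.\<close>

type_synonym T_elts = "(int \<times> int) option \<Rightarrow> int \<Rightarrow> complex fps"

definition T_square :: "int \<Rightarrow> int \<Rightarrow> (path_elts set, T_elts) module" where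
  "T_square k n = direct_sum_family (insert None (Some ` \<Gamma> k n))
     (case_option (T_empty k n) (T_ij k n))"

definition GV_class ::
    "int \<Rightarrow> int \<Rightarrow> (path_elts set, 't) module \<Rightarrow> (path_elts set, 'm) module \<Rightarrow>
      (('t \<Rightarrow> 't, univ) module \<Rightarrow>\<^sub>0 int) set" where
  "GV_class k n T M = K_class (End_op (Calg k n) T) (Hom_from (Calg k n) T M)"

definition K_GV ::
    "int \<Rightarrow> int \<Rightarrow> (path_elts set, 't) module \<Rightarrow> (('t \<Rightarrow> 't, univ) module \<Rightarrow>\<^sub>0 int) set monoid" where
  "K_GV k n T = K_CM (End_op (Calg k n) T)"

definition Mon_GV ::
    "int \<Rightarrow> int \<Rightarrow> (path_elts set, 't) module \<Rightarrow> (('t \<Rightarrow> 't, univ) module \<Rightarrow>\<^sub>0 int) set set" where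
  "Mon_GV k n T = {GV_class k n T M | M :: (path_elts set, univ) module. CM_fg (Calg k n) M}"

definition Cone_GV ::
    "int \<Rightarrow> int \<Rightarrow> (path_elts set, 't) module \<Rightarrow>
      ((('t \<Rightarrow> 't, univ) module \<Rightarrow>\<^sub>0 int) set \<times> real \<Rightarrow>\<^sub>0 int) set set" where
  "Cone_GV k n T =
     real_tensor_topology (K_GV k n T) closure_of nonneg_span (K_GV k n T) (Mon_GV k n T)"

definition \<kappa>_vector :: "int \<Rightarrow> int \<Rightarrow> (path_elts set, 'm) module \<Rightarrow> (int \<times> int \<Rightarrow> int)" where
  "\<kappa>_vector k n M = (\<lambda>ij\<in>\<Gamma> k n. int (\<kappa> (Calg k n) (e_star k n) (T_ij k n ij) M))"

text \<open>The lattice \<open>\<int> \<oplus> \<int>\<^sup>\<Gamma>\<close>, whose second components are extensional functions on \<open>\<Gamma>\<close>.\<close>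

definition GT_lattice :: "int \<Rightarrow> int \<Rightarrow> (int \<times> (int \<times> int \<Rightarrow> int)) monoid" where
  "GT_lattice k n = integer_group \<times>\<times> product_group (\<Gamma> k n) (\<lambda>_. integer_group)"

definition Mon_GT :: "int \<Rightarrow> int \<Rightarrow> (int \<times> (int \<times> int \<Rightarrow> int)) set" where
  "Mon_GT k n = {(r, v). (r, v) \<in> carrier (GT_lattice k n) \<and>
     (let v' = (\<lambda>i j. if i \<le> 0 \<or> j \<le> 0 then 0 else v (i, j)) in
        v' 1 1 \<ge> 0 \<and>
        v' k (n - k) - v' (k - 1) (n - k - 1) \<le> r \<and>
        (\<forall>i\<in>{2..k}. \<forall>j\<in>{1..n - k}.
           v' i j - v' (i - 1) (j - 1) \<ge> v' (i - 1) j - v' (i - 2) (j - 1)) \<and>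
        (\<forall>i\<in>{1..k}. \<forall>j\<in>{2..n - k}.
           v' i j - v' (i - 1) (j - 1) \<ge> v' i (j - 1) - v' (i - 1) (j - 2)))}"

end

theory Submission
  imports Defs "HOL-Library.Function_Algebras"
begin

text \<open>Let \<open>V = e\<^sub>*M\<close> and let \<open>N\<^sub>v \<subseteq> V\<close> be the image of \<open>e\<^sub>vM\<close> under \<open>y\<^sup>v\<close>. Then \<open>\<kappa>(T\<^sub>i\<^sub>j, M)\<close> is the
codimension of \<open>W = {w. t\<^sup>a w \<in> N\<^sub>v}\<close> in \<open>V\<close> for \<open>a = k - i\<close> and \<open>v = k - i + j\<close>, and the difference
along a diagonal is the codimension of \<open>W + tV\<close>, which is at most the rank and monotone in \<open>i\<close> and
\<open>j\<close>: these are the Gelfand-Tsetlin inequalities. Conversely, the level sets of the differences of a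
pattern are up-sets of boxes, hence \<open>k\<close>-subsets, and the sum of the corresponding rank one modules
realizes the pattern. In the coordinates given by rank and differences the monoid consists of the
lattice points of the cone over an order polytope, which is spanned by its up-sets.\<close>

section \<open>Path algebras and their quotients\<close>

text \<open>The exponents come from the shape of the rectangles. A homomorphism from
  \<open>M_J\<close> to a torsion-free module is determined by the image w of the generator at the
  vertex *, and w is admissible iff t^b(u) w lies in \<open>N_u\<close> for all u, where b(u) counts
  the elements of J in [1,u]. For J = \<open>K_ij\<close> the function b rises up to u = a, rests up
  to u = v, rises up to u = k + j and then stays at k. As t N_u lies in N_(u+1), the chain decreases
  and t^k V lies in N_n, the condition at the corner u = v implies all others and gives
  \<open>W\<close>. Homomorphisms into \<open>J M\<close> carry no condition, hence the codimension
  in \<open>V\<close>. The diagonal step from (i,j) to (i-1,j-1) fixes v and raises a by one, so it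
  replaces \<open>W\<close> by its preimage under t.

  The isomorphism \<open>wt\<close> is known on the classes [T,M] and injective on the group; to
  combine the two, Hom(T,M) has to be shown free of finite rank, with a copy in the fixed type
  \<open>univ\<close>. The cone lives in a tensor product given by generators and relations, and its
  points are handled through the real functionals that extend the integer coordinates.\<close>

locale finite_quiver = wf_digraph Q for Q :: "('v, 'e) pre_digraph" +
  assumes finite_verts: "finite (verts Q)"
begin

abbreviation PA :: "('r::comm_ring_1, 'v \<times> 'e list \<Rightarrow> 'r) module" where
  "PA \<equiv> path_algebra Q"

lemma awlast_append: "awlast (awlast u p) q = awlast u (p @ q)"
  by (cases q) (auto simp: awalk_verts_conv)

lemma PA_mult_apply:
  "(f \<otimes>\<^bsub>PA\<^esub> g) (u, p) = (\<Sum>i\<le>length p. f (awlast u (take i p), drop i p) * g (u, take i p))"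
  by (simp add: path_algebra_def)

lemma PA_simps:
  "f \<oplus>\<^bsub>PA\<^esub> g = (\<lambda>w. f w + g w)" "\<zero>\<^bsub>PA\<^esub> = (\<lambda>_. 0)" "r \<odot>\<^bsub>PA\<^esub> f = (\<lambda>w. r * f w)"
  by (simp_all add: path_algebra_def)

lemma PA_one: "\<one>\<^bsub>PA\<^esub> = (\<lambda>(u, p). if u \<in> verts Q \<and> p = [] then 1 else 0)"
  by (simp add: path_algebra_def)

lemma PA_carrier:
  "f \<in> carrier PA \<longleftrightarrow> finite {w. f w \<noteq> 0} \<and> (\<forall>u p. f (u, p) \<noteq> 0 \<longrightarrow> (\<exists>v. awalk u p v))"
  by (simp add: path_algebra_def)

lemma PA_add_closed: "\<lbrakk>f \<in> carrier PA; g \<in> carrier PA\<rbrakk> \<Longrightarrow> f \<oplus>\<^bsub>PA\<^esub> g \<in> carrier PA"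
  unfolding PA_carrier PA_simps
  by (auto intro: finite_subset[of _ "{w. f w \<noteq> 0} \<union> {w. g w \<noteq> 0}"]) (metis add.right_neutral)

lemma PA_smult_closed: "f \<in> carrier PA \<Longrightarrow> r \<odot>\<^bsub>PA\<^esub> f \<in> carrier PA"
  unfolding PA_carrier PA_simps
  by (auto intro: finite_subset[of _ "{w. f w \<noteq> 0}"]) (metis mult_zero_right)

lemma PA_mult_closed:
  assumes f: "f \<in> carrier PA" and g: "g \<in> carrier PA"
  shows "f \<otimes>\<^bsub>PA\<^esub> g \<in> carrier PA"
proof -
  have *: "\<exists>i\<le>length p. f (awlast u (take i p), drop i p) \<noteq> 0 \<and> g (u, take i p) \<noteq> 0"
    if "(f \<otimes>\<^bsub>PA\<^esub> g) (u, p) \<noteq> 0" for u p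
    using sum.not_neutral_contains_not_neutral[OF that[unfolded PA_mult_apply]]
    by (metis atMost_iff mult_eq_0_iff mult_zero_left mult_zero_right)
  let ?S = "(\<lambda>((v, q), (u, p)). (u, p @ q)) ` ({w. f w \<noteq> 0} \<times> {w. g w \<noteq> 0})"
  have "{w. (f \<otimes>\<^bsub>PA\<^esub> g) w \<noteq> 0} \<subseteq> ?S"
  proof
    fix w assume w: "w \<in> {w. (f \<otimes>\<^bsub>PA\<^esub> g) w \<noteq> 0}"
    obtain u p where up: "w = (u, p)" by (cases w)
    with w * obtain i where "f (awlast u (take i p), drop i p) \<noteq> 0" "g (u, take i p) \<noteq> 0"
      by blast
    then show "w \<in> ?S"
      by (intro image_eqI[of _ _ "((awlast u (take i p), drop i p), (u, take i p))"])
        (auto simp: up)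
  qed
  moreover have "finite ?S" using f g by (auto simp: PA_carrier)
  ultimately have fin: "finite {w. (f \<otimes>\<^bsub>PA\<^esub> g) w \<noteq> 0}" by (rule finite_subset)
  have "\<exists>v. awalk u p v" if nz: "(f \<otimes>\<^bsub>PA\<^esub> g) (u, p) \<noteq> 0" for u p
  proof -
    obtain i where i: "f (awlast u (take i p), drop i p) \<noteq> 0" "g (u, take i p) \<noteq> 0"
      using *[OF nz] by blast
    obtain v' where v': "awalk u (take i p) v'" using g i(2) by (auto simp: PA_carrier)
    obtain v where v: "awalk (awlast u (take i p)) (drop i p) v"
      using f i(1) by (auto simp: PA_carrier)
    have "awalk u (take i p @ drop i p) v"
      using v v' awlast_if_cas[of u "take i p" v'] by (intro awalk_appendI[of u _ v']) (auto simp: awalk_def)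
    then show ?thesis by auto
  qed
  with fin show ?thesis unfolding PA_carrier by blast
qed

text \<open>Both sides run over the ways to cut \<open>p\<close> into three consecutive pieces. The
  left side records the cuts by the lengths of the first two pieces, the right side starts with the
  position of the second cut, so a triangular sum is reindexed.\<close>

lemma PA_mult_assoc:
  fixes f g h :: "'v \<times> 'e list \<Rightarrow> 'r::comm_ring_1"
  shows "(f \<otimes>\<^bsub>PA\<^esub> g) \<otimes>\<^bsub>PA\<^esub> h = f \<otimes>\<^bsub>PA\<^esub> (g \<otimes>\<^bsub>PA\<^esub> h)"
proof
  fix w :: "'v \<times> 'e list" obtain u p where w: "w = (u, p)" by (cases w)
  let ?n = "length p"
  define G where "G i j = f (awlast u (take (i + j) p), drop (i + j) p) *
    g (awlast u (take i p), drop i (take (i + j) p)) * h (u, take i p)" for i j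
  have *: "take i p @ drop i (take (i + j) p) = take (i + j) p" for i j
    using append_take_drop_id[of i "take (i + j) p"] by simp
  have "((f \<otimes>\<^bsub>PA\<^esub> g) \<otimes>\<^bsub>PA\<^esub> h) (u, p) = (\<Sum>i\<le>?n. \<Sum>j\<le>?n - i. G i j)"
    unfolding PA_mult_apply sum_distrib_right
    by (intro sum.cong)
      (auto simp: G_def awlast_append take_drop add.commute *)
  also have "\<dots> = (\<Sum>(i, j)\<in>(SIGMA i:{..?n}. {..?n - i}). G i j)"
    by (simp add: sum.Sigma)
  also have "(SIGMA i:{..?n}. {..?n - i}) = {(i, j). i + j \<le> ?n}" by auto
  also have "(\<Sum>(i, j)\<in>{(i, j). i + j \<le> ?n}. G i j) = (\<Sum>m\<le>?n. \<Sum>i\<le>m. G i (m - i))"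
    by (rule sum.triangle_reindex_eq)
  also have "\<dots> = (f \<otimes>\<^bsub>PA\<^esub> (g \<otimes>\<^bsub>PA\<^esub> h)) (u, p)"
    unfolding PA_mult_apply sum_distrib_left
    by (intro sum.cong) (auto simp: G_def min_absorb1 min_absorb2 mult.assoc)
  finally show "((f \<otimes>\<^bsub>PA\<^esub> g) \<otimes>\<^bsub>PA\<^esub> h) w = (f \<otimes>\<^bsub>PA\<^esub> (g \<otimes>\<^bsub>PA\<^esub> h)) w" by (simp add: w)
qed

lemma PA_one_closed: "\<one>\<^bsub>PA\<^esub> \<in> carrier PA"
  unfolding PA_carrier PA_one
  by (auto intro: finite_subset[of _ "verts Q \<times> {[]}"] simp: finite_verts awalk_Nil_iff split: if_splits)

lemma PA_l_one:
  assumes g: "g \<in> carrier PA"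
  shows "\<one>\<^bsub>PA\<^esub> \<otimes>\<^bsub>PA\<^esub> g = g"
proof
  fix w :: "'v \<times> 'e list" obtain u p where w: "w = (u, p)" by (cases w)
  have "(\<one>\<^bsub>PA\<^esub> \<otimes>\<^bsub>PA\<^esub> g) (u, p) = (\<Sum>i\<in>{length p}. \<one>\<^bsub>PA\<^esub> (awlast u (take i p), drop i p) * g (u, take i p))"
    unfolding PA_mult_apply by (intro sum.mono_neutral_right) (auto simp: PA_one)
  also have "\<dots> = g (u, p)"
    using g by (auto simp: PA_one PA_carrier)
  finally show "(\<one>\<^bsub>PA\<^esub> \<otimes>\<^bsub>PA\<^esub> g) w = g w" by (simp add: w)
qed

lemma PA_r_one:
  assumes g: "g \<in> carrier PA"
  shows "g \<otimes>\<^bsub>PA\<^esub> \<one>\<^bsub>PA\<^esub> = g"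
proof
  fix w :: "'v \<times> 'e list" obtain u p where w: "w = (u, p)" by (cases w)
  have "(g \<otimes>\<^bsub>PA\<^esub> \<one>\<^bsub>PA\<^esub>) (u, p) = (\<Sum>i\<in>{0}. g (awlast u (take i p), drop i p) * \<one>\<^bsub>PA\<^esub> (u, take i p))"
    unfolding PA_mult_apply by (intro sum.mono_neutral_right) (auto simp: PA_one)
  also have "\<dots> = g (u, p)"
    using g by (auto simp: PA_one PA_carrier)
  finally show "(g \<otimes>\<^bsub>PA\<^esub> \<one>\<^bsub>PA\<^esub>) w = g w" by (simp add: w)
qed

lemma PA_smult_mult:
  "(r \<odot>\<^bsub>PA\<^esub> f) \<otimes>\<^bsub>PA\<^esub> g = r \<odot>\<^bsub>PA\<^esub> (f \<otimes>\<^bsub>PA\<^esub> g)" "f \<otimes>\<^bsub>PA\<^esub> (r \<odot>\<^bsub>PA\<^esub> g) = r \<odot>\<^bsub>PA\<^esub> (f \<otimes>\<^bsub>PA\<^esub> g)"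
  by (auto simp: PA_simps PA_mult_apply fun_eq_iff sum_distrib_left algebra_simps)

lemma PA_ring: "ring (PA :: ('r::comm_ring_1, _) module)"
proof (rule ringI)
  show "abelian_group (PA :: ('r, _) module)"
  proof (rule abelian_groupI)
    fix f :: "'v \<times> 'e list \<Rightarrow> 'r" assume "f \<in> carrier PA"
    then have "(-1) \<odot>\<^bsub>PA\<^esub> f \<in> carrier PA" by (rule PA_smult_closed)
    then show "\<exists>g\<in>carrier PA. g \<oplus>\<^bsub>PA\<^esub> f = \<zero>\<^bsub>PA\<^esub>"
      by (intro bexI[of _ "(-1) \<odot>\<^bsub>PA\<^esub> f"]) (auto simp: PA_simps)
  next
    show "\<zero>\<^bsub>PA\<^esub> \<in> carrier (PA :: ('r, _) module)" by (simp add: PA_carrier PA_simps)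
  qed (assumption | rule PA_add_closed | simp add: PA_simps add_ac)+
  show "monoid (PA :: ('r, _) module)"
    by (intro monoidI PA_mult_closed PA_one_closed PA_mult_assoc PA_l_one PA_r_one)
qed (auto simp: PA_simps PA_mult_apply fun_eq_iff algebra_simps sum.distrib)

lemma path_elt_closed: "awalk u p v \<Longrightarrow> path_elt (u, p) \<in> carrier PA"
  by (auto simp: PA_carrier path_elt_def)

text \<open>The right factor is traversed first. In the convolution sum only the cut after
  \<open>length p\<close> arrows can contribute, and it does so exactly when the second path starts
  where the first one ends.\<close>

lemma path_elt_mult:
  "path_elt (v, q) \<otimes>\<^bsub>PA\<^esub> path_elt (u, p) =
    (if awlast u p = v then path_elt (u, p @ q) else (\<zero>\<^bsub>PA\<^esub> :: _ \<Rightarrow> 'r::comm_ring_1))"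
proof
  fix w :: "'v \<times> 'e list" obtain u' r where w: "w = (u', r)" by (cases w)
  let ?s = "path_elt (v, q) \<otimes>\<^bsub>PA\<^esub> path_elt (u, p) :: _ \<Rightarrow> 'r"
  show "?s w = (if awlast u p = v then path_elt (u, p @ q) else \<zero>\<^bsub>PA\<^esub>) w"
  proof (cases "u' = u \<and> r = p @ q")
    case True
    have "?s w = (\<Sum>i\<in>{length p}. path_elt (v, q) (awlast u' (take i r), drop i r) * path_elt (u, p) (u', take i r))"
      unfolding w PA_mult_apply
    proof (intro sum.mono_neutral_right ballI)
      fix i assume i: "i \<in> {..length r} - {length p}"
      then have "take i r \<noteq> p" by auto
      then show "path_elt (v, q) (awlast u' (take i r), drop i r) * path_elt (u, p) (u', take i r) = (0 :: 'r)"
        by (simp add: path_elt_def)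
    qed (use True in auto)
    then show ?thesis using True by (simp add: w path_elt_def PA_simps)
  next
    case False
    have "?s w = 0"
      unfolding w PA_mult_apply using False
      by (intro sum.neutral) (auto simp: path_elt_def)
    then show ?thesis using False by (auto simp: w path_elt_def PA_simps)
  qed
qed

text \<open>Peels one path at a time off the finite support, so that additive statements reduce to
  scalar multiples of single paths.\<close>

lemma PA_induct [consumes 1, case_names zero path add]:
  fixes f :: "'v \<times> 'e list \<Rightarrow> 'r::comm_ring_1"
  assumes "f \<in> carrier PA"
    and zero: "P \<zero>\<^bsub>PA\<^esub>"
    and path: "\<And>r u p v. awalk u p v \<Longrightarrow> P (r \<odot>\<^bsub>PA\<^esub> path_elt (u, p))"
    and add: "\<And>f g. \<lbrakk>f \<in> carrier PA; g \<in> carrier PA; P f; P g\<rbrakk> \<Longrightarrow> P (f \<oplus>\<^bsub>PA\<^esub> g)"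
  shows "P f"
  using assms(1)
proof (induction "card {w. f w \<noteq> 0}" arbitrary: f)
  case 0
  then have "f = \<zero>\<^bsub>PA\<^esub>" by (auto simp: PA_carrier PA_simps)
  then show ?case using zero by simp
next
  case (Suc m)
  then have "{w. f w \<noteq> 0} \<noteq> {}" by fastforce
  then obtain u p where up: "f (u, p) \<noteq> 0" by auto
  then obtain v where v: "awalk u p v" using Suc.prems by (auto simp: PA_carrier)
  let ?g = "f((u, p) := 0)"
  have g: "{w. ?g w \<noteq> 0} = {w. f w \<noteq> 0} - {(u, p)}" by auto
  have "?g \<in> carrier PA" using Suc.prems unfolding PA_carrier g by auto
  moreover have "m = card {w. ?g w \<noteq> 0}"
    using Suc.hyps(2) up Suc.prems unfolding g by (simp add: PA_carrier)
  ultimately have "P ?g" using Suc.hyps(1) by blast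
  moreover have "f = (f (u, p) \<odot>\<^bsub>PA\<^esub> path_elt (u, p)) \<oplus>\<^bsub>PA\<^esub> ?g"
    by (auto simp: PA_simps path_elt_def)
  ultimately show ?case
    using add[of "f (u, p) \<odot>\<^bsub>PA\<^esub> path_elt (u, p)" ?g] path[OF v] \<open>?g \<in> carrier PA\<close>
      PA_smult_closed[OF path_elt_closed[OF v]] by metis
qed

end

text \<open>The quotient enters as a parameter with an equation, so that after interpretation all
  facts speak of the constant \<open>Calg k n\<close>.\<close>

locale quiver_algebra = finite_quiver Q for Q :: "('v, 'e) pre_digraph" +
  fixes I :: "('v \<times> 'e list \<Rightarrow> 'r::comm_ring_1) set" and \<Lambda>
  assumes ideal: "ideal I (path_algebra Q)"
    and \<Lambda>: "\<Lambda> = quotient_by (path_algebra Q) I"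
begin

sublocale PA: ring "path_algebra Q :: ('r, _) module" by (rule PA_ring)

definition cls :: "('v \<times> 'e list \<Rightarrow> 'r) \<Rightarrow> ('v \<times> 'e list \<Rightarrow> 'r) set" where
  "cls f = I +>\<^bsub>PA\<^esub> f"

lemma \<Lambda>_carrier: "carrier \<Lambda> = cls ` carrier PA"
  by (auto simp: \<Lambda> quotient_by_def FactRing_def A_RCOSETS_def' cls_def)

lemma cls_closed [simp, intro]: "f \<in> carrier PA \<Longrightarrow> cls f \<in> carrier \<Lambda>"
  by (simp add: \<Lambda>_carrier)

lemma \<Lambda>_ring: "ring \<Lambda>"
proof -
  interpret q: ring "PA Quot I" by (rule ideal.quotient_is_ring[OF ideal])
  \<comment> \<open>The two records differ in type, since an algebra also carries
    \<open>smult\<close>; the ring laws of the quotient are therefore transported field by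
    field.\<close>
  have eq: "carrier \<Lambda> = carrier (PA Quot I)" "monoid.mult \<Lambda> = monoid.mult (PA Quot I)"
    "\<one>\<^bsub>\<Lambda>\<^esub> = \<one>\<^bsub>PA Quot I\<^esub>" "\<zero>\<^bsub>\<Lambda>\<^esub> = \<zero>\<^bsub>PA Quot I\<^esub>" "add \<Lambda> = add (PA Quot I)"
    by (simp_all add: \<Lambda> quotient_by_def)
  show ?thesis
  proof (rule ringI)
    show "abelian_group \<Lambda>"
      by (rule abelian_groupI; unfold eq) (auto simp: q.a_ac intro: q.a_inv_closed q.l_neg)
    show "monoid \<Lambda>"
      by (rule monoidI; unfold eq) (auto simp: q.m_assoc)
  qed (unfold eq, auto simp: q.l_distr q.r_distr)
qed

sublocale \<Lambda>: ring \<Lambda> by (rule \<Lambda>_ring)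

lemma cls_hom:
  "\<lbrakk>f \<in> carrier PA; g \<in> carrier PA\<rbrakk> \<Longrightarrow> cls (f \<oplus>\<^bsub>PA\<^esub> g) = cls f \<oplus>\<^bsub>\<Lambda>\<^esub> cls g"
  "\<lbrakk>f \<in> carrier PA; g \<in> carrier PA\<rbrakk> \<Longrightarrow> cls (f \<otimes>\<^bsub>PA\<^esub> g) = cls f \<otimes>\<^bsub>\<Lambda>\<^esub> cls g"
  "cls \<one>\<^bsub>PA\<^esub> = \<one>\<^bsub>\<Lambda>\<^esub>"
  "cls \<zero>\<^bsub>PA\<^esub> = \<zero>\<^bsub>\<Lambda>\<^esub>"
proof -
  have h: "cls \<in> Ring.ring_hom PA (PA Quot I)"
    using ideal.rcos_ring_hom[OF ideal] by (simp add: cls_def[abs_def])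
  show "\<lbrakk>f \<in> carrier PA; g \<in> carrier PA\<rbrakk> \<Longrightarrow> cls (f \<oplus>\<^bsub>PA\<^esub> g) = cls f \<oplus>\<^bsub>\<Lambda>\<^esub> cls g"
    "\<lbrakk>f \<in> carrier PA; g \<in> carrier PA\<rbrakk> \<Longrightarrow> cls (f \<otimes>\<^bsub>PA\<^esub> g) = cls f \<otimes>\<^bsub>\<Lambda>\<^esub> cls g"
    "cls \<one>\<^bsub>PA\<^esub> = \<one>\<^bsub>\<Lambda>\<^esub>"
    using ring_hom_add[OF h] ring_hom_mult[OF h] ring_hom_one[OF h]
    by (auto simp: \<Lambda> quotient_by_def)
  show "cls \<zero>\<^bsub>PA\<^esub> = \<zero>\<^bsub>\<Lambda>\<^esub>"
    using ideal.axioms(1)[OF ideal, THEN additive_subgroup.a_subset]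
    by (simp add: cls_def \<Lambda> quotient_by_def FactRing_def)
qed

lemma cls_eqI:
  "\<lbrakk>f \<in> carrier PA; g \<in> carrier PA; f \<ominus>\<^bsub>PA\<^esub> g \<in> I\<rbrakk> \<Longrightarrow> cls f = cls g"
  unfolding cls_def by (rule PA.quotient_eq_iff_same_a_r_cos[OF ideal, THEN iffD1])

interpretation I: ideal I "path_algebra Q" by (rule ideal)

lemma I_abelian_subgroup: "abelian_subgroup I (path_algebra Q)"
  by (rule abelian_subgroupI3[OF I.additive_subgroup_axioms PA.abelian_group_axioms])

interpretation I: abelian_subgroup I "path_algebra Q" by (rule I_abelian_subgroup)

lemma mem_cls: "\<lbrakk>f \<in> carrier PA; g \<in> cls f\<rbrakk> \<Longrightarrow> g \<in> carrier PA \<and> cls g = cls f"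
  unfolding cls_def using I.a_repr_independence' I.a_elemrcos_carrier by blast

lemma cls_self: "f \<in> carrier PA \<Longrightarrow> f \<in> cls f"
  unfolding cls_def by (rule I.a_rcos_self)

text \<open>In \<open>quotient_by\<close> the scalar action is a union over all representatives. Its
  members agree, because scaling by \<open>r\<close> is multiplication by the class of
  \<open>r\<close> times the unit, and this depends on the class alone.\<close>

lemma smult_cls:
  assumes f: "f \<in> carrier PA"
  shows "r \<odot>\<^bsub>\<Lambda>\<^esub> cls f = cls (r \<odot>\<^bsub>PA\<^esub> f)"
proof -
  have "r \<odot>\<^bsub>\<Lambda>\<^esub> cls f = (\<Union>x\<in>cls f. cls (r \<odot>\<^bsub>PA\<^esub> x))"
    by (simp add: \<Lambda> quotient_by_def cls_def)
  also have "\<dots> = (\<Union>x\<in>cls f. cls (r \<odot>\<^bsub>PA\<^esub> f))"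
  proof (rule SUP_cong[OF refl])
    fix x assume that: "x \<in> cls f"
    have x: "x \<in> carrier PA" "cls x = cls f" using mem_cls[OF f that] by auto
    have *: "cls (r \<odot>\<^bsub>PA\<^esub> y) = cls (r \<odot>\<^bsub>PA\<^esub> \<one>\<^bsub>PA\<^esub>) \<otimes>\<^bsub>\<Lambda>\<^esub> cls y" if y: "y \<in> carrier PA" for y
      using cls_hom(2)[OF PA_smult_closed[OF PA_one_closed] y, of r]
      by (simp only: PA_smult_mult PA_l_one[OF y])
    show "cls (r \<odot>\<^bsub>PA\<^esub> x) = cls (r \<odot>\<^bsub>PA\<^esub> f)" unfolding *[OF x(1)] *[OF f] x(2) ..
  qed
  also have "\<dots> = cls (r \<odot>\<^bsub>PA\<^esub> f)" using cls_self[OF f] by blast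
  finally show ?thesis .
qed

text \<open>The structure map from the ground ring into the centre. A module record only sees the
  action of \<open>\<Lambda>\<close>, so scalars act on modules through these elements.\<close>

definition \<rho> :: "'r \<Rightarrow> ('v \<times> 'e list \<Rightarrow> 'r) set" where
  "\<rho> r = r \<odot>\<^bsub>\<Lambda>\<^esub> \<one>\<^bsub>\<Lambda>\<^esub>"

lemma \<rho>_cls: "\<rho> r = cls (r \<odot>\<^bsub>PA\<^esub> \<one>\<^bsub>PA\<^esub>)"
  unfolding \<rho>_def cls_hom(3)[symmetric] by (rule smult_cls[OF PA_one_closed])

lemma \<rho>_closed [simp, intro]: "\<rho> r \<in> carrier \<Lambda>"
  unfolding \<rho>_cls by (intro cls_closed PA_smult_closed PA_one_closed)

lemma \<rho>_mult_cls: "f \<in> carrier PA \<Longrightarrow> \<rho> r \<otimes>\<^bsub>\<Lambda>\<^esub> cls f = cls (r \<odot>\<^bsub>PA\<^esub> f)"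
  using cls_hom(2)[OF PA_smult_closed[OF PA_one_closed], of f r]
  by (simp only: \<rho>_cls PA_smult_mult PA_l_one)

lemma cls_mult_\<rho>: "f \<in> carrier PA \<Longrightarrow> cls f \<otimes>\<^bsub>\<Lambda>\<^esub> \<rho> r = cls (r \<odot>\<^bsub>PA\<^esub> f)"
  using cls_hom(2)[OF _ PA_smult_closed[OF PA_one_closed], of f r]
  by (simp only: \<rho>_cls PA_smult_mult PA_r_one)

lemma smult_\<rho>: "c \<in> carrier \<Lambda> \<Longrightarrow> r \<odot>\<^bsub>\<Lambda>\<^esub> c = \<rho> r \<otimes>\<^bsub>\<Lambda>\<^esub> c"
  by (auto simp: \<Lambda>_carrier smult_cls \<rho>_mult_cls)

lemma \<rho>_central: "c \<in> carrier \<Lambda> \<Longrightarrow> \<rho> r \<otimes>\<^bsub>\<Lambda>\<^esub> c = c \<otimes>\<^bsub>\<Lambda>\<^esub> \<rho> r"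
  by (auto simp: \<Lambda>_carrier \<rho>_mult_cls cls_mult_\<rho>)

lemma \<rho>_add: "\<rho> (r + s) = \<rho> r \<oplus>\<^bsub>\<Lambda>\<^esub> \<rho> s"
proof -
  have "(r + s) \<odot>\<^bsub>PA\<^esub> \<one>\<^bsub>PA\<^esub> = r \<odot>\<^bsub>PA\<^esub> \<one>\<^bsub>PA\<^esub> \<oplus>\<^bsub>PA\<^esub> s \<odot>\<^bsub>PA\<^esub> \<one>\<^bsub>PA\<^esub>"
    unfolding PA_simps by (simp add: algebra_simps)
  then show ?thesis
    unfolding \<rho>_cls by (simp only: cls_hom(1) PA_smult_closed PA_one_closed)
qed

lemma \<rho>_mult: "\<rho> (r * s) = \<rho> r \<otimes>\<^bsub>\<Lambda>\<^esub> \<rho> s"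
proof -
  have "(r * s) \<odot>\<^bsub>PA\<^esub> \<one>\<^bsub>PA\<^esub> = r \<odot>\<^bsub>PA\<^esub> (s \<odot>\<^bsub>PA\<^esub> \<one>\<^bsub>PA\<^esub>)"
    unfolding PA_simps by (simp add: algebra_simps)
  then show ?thesis
    using \<rho>_mult_cls[OF PA_smult_closed[OF PA_one_closed], of r s] by (simp only: \<rho>_cls)
qed

lemma \<rho>_one [simp]: "\<rho> 1 = \<one>\<^bsub>\<Lambda>\<^esub>"
proof -
  have "1 \<odot>\<^bsub>PA\<^esub> \<one>\<^bsub>PA\<^esub> = (\<one>\<^bsub>PA\<^esub> :: _ \<Rightarrow> 'r)" unfolding PA_simps by simp
  then show ?thesis by (simp only: \<rho>_cls cls_hom(3))
qed

end

section \<open>The algebra \<open>C(k,n)\<close>\<close>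

locale cyclic =
  fixes n :: int
  assumes n_pos: "0 < n"
begin

lemma vtx_range [simp]: "vtx n i \<in> {1..n}" "1 \<le> vtx n i" "vtx n i \<le> n"
  using n_pos by (auto simp: vtx_def add1_zle_eq)

lemma vtx_id [simp]: "1 \<le> i \<Longrightarrow> i \<le> n \<Longrightarrow> vtx n i = i"
  by (simp add: vtx_def)

lemma vtx_vtx [simp]: "vtx n (vtx n i + j) = vtx n (i + j)" "vtx n (vtx n i - j) = vtx n (i - j)"
  "vtx n (vtx n i) = vtx n i"
proof -
  have "(vtx n i + j - 1) mod n = (i + j - 1) mod n" for j
    using mod_add_left_eq[of "i - 1" n j] by (simp add: vtx_def algebra_simps)
  from this[of j] this[of "-j"] this[of 0] show "vtx n (vtx n i + j) = vtx n (i + j)"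
    "vtx n (vtx n i - j) = vtx n (i - j)" "vtx n (vtx n i) = vtx n i"
    by (simp_all add: vtx_def[of n "_ + _"] vtx_def[of n "_ - _"] vtx_def[of n i] algebra_simps)
qed

lemma vtx_zero: "vtx n 0 = n"
  using n_pos by (simp add: vtx_def zmod_minus1)

lemma vtx_shift_eq: "vtx n (i + c) = vtx n (j + c) \<longleftrightarrow> vtx n i = vtx n j"
  by (metis add_diff_cancel_right' vtx_vtx(1,2))

lemma vtx_eq_iff: "\<lbrakk>u \<in> {1..n}; v \<in> {1..n}\<rbrakk> \<Longrightarrow> vtx n (u + c) = v \<longleftrightarrow> u = vtx n (v - c)"
  by (metis add_diff_cancel_right' atLeastAtMost_iff diff_add_cancel vtx_id vtx_vtx(1,2))

sublocale finite_quiver "cyclic_quiver n"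
  by unfold_locales (auto simp: cyclic_quiver_def)

lemma quiver_simps:
  "verts (cyclic_quiver n) = {1..n}" "arcs (cyclic_quiver n) = ArrX ` {1..n} \<union> ArrY ` {1..n}"
  "tail (cyclic_quiver n) (ArrX i) = vtx n (i - 1)" "head (cyclic_quiver n) (ArrX i) = i"
  "tail (cyclic_quiver n) (ArrY i) = i" "head (cyclic_quiver n) (ArrY i) = vtx n (i - 1)"
  by (simp_all add: cyclic_quiver_def)

lemma awalk_Nil: "awalk u [] v \<longleftrightarrow> u = v \<and> u \<in> {1..n}"
  by (auto simp: awalk_Nil_iff quiver_simps)

lemma awalk_snoc: "awalk u (p @ [a]) v \<longleftrightarrow>
    (\<exists>w. awalk u p w \<and> a \<in> arcs (cyclic_quiver n) \<and> tail (cyclic_quiver n) a = w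
      \<and> head (cyclic_quiver n) a = v)"
  by (auto simp: awalk_append_iff awalk_Cons_iff awalk_Nil_iff)

text \<open>Labels stay unreduced integers until \<open>vtx\<close> is applied, so a path may wind
  around the cycle while its labels still form an interval, in which elements of a subset can be
  counted.\<close>

definition xpath :: "int \<Rightarrow> nat \<Rightarrow> int \<times> arrow list" where
  "xpath i m = (vtx n i, map (\<lambda>l. ArrX (vtx n l)) [i + 1..i + int m])"

definition ypath :: "int \<Rightarrow> nat \<Rightarrow> int \<times> arrow list" where
  "ypath i m = (vtx n i, map (\<lambda>l. ArrY (vtx n l)) (rev [i - int m + 1..i]))"

lemma xpath_0: "xpath i 0 = (vtx n i, [])" and ypath_0: "ypath i 0 = (vtx n i, [])"
  by (simp_all add: xpath_def ypath_def)

lemma xpath_Suc: "xpath i (Suc m) = (vtx n i, snd (xpath i m) @ [ArrX (vtx n (i + int m + 1))])"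
  using upto_rec2[of "i + 1" "i + int (Suc m)"] by (simp add: xpath_def algebra_simps)

lemma ypath_Suc: "ypath i (Suc m) = (vtx n i, snd (ypath i m) @ [ArrY (vtx n (i - int m))])"
  using upto_rec1[of "i - int m" i] by (simp add: ypath_def algebra_simps)

lemma awalk_xpath: "awalk (vtx n i) (snd (xpath i m)) (vtx n (i + int m))"
proof (induction m)
  case (Suc m)
  then have "awalk (vtx n i) (snd (xpath i m) @ [ArrX (vtx n (i + int m + 1))]) (vtx n (i + int m + 1))"
    unfolding awalk_snoc by (simp add: quiver_simps)
  then show ?case by (simp only: xpath_Suc snd_conv) (simp add: algebra_simps)
qed (simp add: xpath_0 awalk_Nil_iff quiver_simps)

lemma awalk_ypath: "awalk (vtx n i) (snd (ypath i m)) (vtx n (i - int m))"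
proof (induction m)
  case (Suc m)
  then have "awalk (vtx n i) (snd (ypath i m) @ [ArrY (vtx n (i - int m))]) (vtx n (i - int m - 1))"
    unfolding awalk_snoc by (simp add: quiver_simps)
  then show ?case by (simp only: ypath_Suc snd_conv) (simp add: algebra_simps)
qed (simp add: ypath_0 awalk_Nil_iff quiver_simps)

lemma awalk_awlast: "awalk u p v \<Longrightarrow> awlast u p = v"
  by (auto simp: awalk_def awlast_if_cas)

lemma xpath_fst: "xpath i m = (vtx n i, snd (xpath i m))" and
  ypath_fst: "ypath i m = (vtx n i, snd (ypath i m))"
  by (simp_all add: xpath_def ypath_def)

text \<open>The sum of all arrows \<open>x_i\<close>. Its products with the idempotents recover the
  single arrows and its powers give the long paths, so the relations of the quiver become identities
  between two elements of the algebra.\<close>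

definition x_elt :: path_elts where
  "x_elt = (\<lambda>(u, p). if u \<in> {1..n} \<and> p = [ArrX (vtx n (u + 1))] then 1 else 0)"

definition y_elt :: path_elts where
  "y_elt = (\<lambda>(u, p). if u \<in> {1..n} \<and> p = [ArrY u] then 1 else 0)"

lemma x_elt_closed: "x_elt \<in> carrier (RQ n)" and y_elt_closed: "y_elt \<in> carrier (RQ n)"
proof -
  have "awalk u [ArrX (vtx n (u + 1))] (vtx n (u + 1))" "awalk u [ArrY u] (vtx n (u - 1))"
    if "u \<in> {1..n}" for u
    using that awalk_snoc[of u "[]"] by (auto simp: awalk_Nil quiver_simps)
  moreover have "{w. x_elt w \<noteq> 0} \<subseteq> (\<lambda>u. (u, [ArrX (vtx n (u + 1))])) ` {1..n}"
    "{w. y_elt w \<noteq> 0} \<subseteq> (\<lambda>u. (u, [ArrY u])) ` {1..n}"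
    by (auto simp: x_elt_def y_elt_def split: if_splits)
  then have "finite {w. x_elt w \<noteq> 0}" "finite {w. y_elt w \<noteq> 0}"
    by (auto intro: finite_subset)
  ultimately show "x_elt \<in> carrier (RQ n)" "y_elt \<in> carrier (RQ n)"
    unfolding PA_carrier by (auto simp: x_elt_def y_elt_def split: if_splits) 
qed

text \<open>Stated for any element with a single arrow leaving the end of \<open>p\<close>, so as to
  cover \<open>x_elt\<close> and \<open>y_elt\<close> together.\<close>

lemma elt_mult_path:
  assumes f: "\<And>q. f (awlast u p, q) = (if q = [a] then 1 else 0)"
  shows "f \<otimes>\<^bsub>RQ n\<^esub> path_elt (u, p) = path_elt (u, p @ [a])"
proof
  fix w :: "int \<times> arrow list" obtain u' r where w: "w = (u', r)" by (cases w)
  show "(f \<otimes>\<^bsub>RQ n\<^esub> path_elt (u, p)) w = path_elt (u, p @ [a]) w"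
  proof (cases "u' = u \<and> r = p @ [a]")
    case True
    have "(f \<otimes>\<^bsub>RQ n\<^esub> path_elt (u, p)) w = (\<Sum>i\<in>{length p}. f (awlast u' (take i r), drop i r) * path_elt (u, p) (u', take i r))"
      unfolding w PA_mult_apply
    proof (intro sum.mono_neutral_right ballI)
      fix i assume i: "i \<in> {..length r} - {length p}"
      then have "take i r \<noteq> p" by auto
      then show "f (awlast u' (take i r), drop i r) * path_elt (u, p) (u', take i r) = 0"
        by (simp add: path_elt_def)
    qed (use True in auto)
    then show ?thesis using True f by (simp add: w path_elt_def)
  next
    case False
    have "(f \<otimes>\<^bsub>RQ n\<^esub> path_elt (u, p)) w = 0"
      unfolding w PA_mult_apply
    proof (intro sum.neutral ballI)
      fix i assume "i \<in> {..length r}"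
      show "f (awlast u' (take i r), drop i r) * path_elt (u, p) (u', take i r) = 0"
      proof (cases "u' = u \<and> take i r = p")
        case True
        then have "drop i r \<noteq> [a]" using False by (metis append_take_drop_id)
        then show ?thesis using True f by simp
      qed (auto simp: path_elt_def)
    qed
    then show ?thesis using False by (auto simp: w path_elt_def)
  qed
qed

lemma x_elt_mult: "awalk u p v \<Longrightarrow> x_elt \<otimes>\<^bsub>RQ n\<^esub> path_elt (u, p) = path_elt (u, p @ [ArrX (vtx n (v + 1))])"
  by (intro elt_mult_path)
    (auto simp: x_elt_def awalk_awlast quiver_simps dest: awalk_last_in_verts)

lemma y_elt_mult: "awalk u p v \<Longrightarrow> y_elt \<otimes>\<^bsub>RQ n\<^esub> path_elt (u, p) = path_elt (u, p @ [ArrY v])"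
  by (intro elt_mult_path)
    (auto simp: y_elt_def awalk_awlast quiver_simps dest: awalk_last_in_verts)

end

locale C_algebra =
  fixes k n :: int
  assumes k_pos: "0 < k" and k_less: "k < n"
begin

sublocale cyclic n
  using k_pos k_less by unfold_locales simp

lemma C_relations_eq: "C_relations k n = (\<Union>i\<in>{1..n}.
     {path_elt (i, [ArrY i, ArrX i]) \<ominus>\<^bsub>RQ n\<^esub> (fps_X \<odot>\<^bsub>RQ n\<^esub> path_elt (i, [])),
      path_elt (i, [ArrX (vtx n (i + 1)), ArrY (vtx n (i + 1))])
        \<ominus>\<^bsub>RQ n\<^esub> (fps_X \<odot>\<^bsub>RQ n\<^esub> path_elt (i, [])),
      path_elt (xpath i (nat k)) \<ominus>\<^bsub>RQ n\<^esub> path_elt (ypath i (nat (n - k)))})"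
  unfolding C_relations_def xpath_def ypath_def using k_pos k_less
  by (intro SUP_cong refl) (simp only: vtx_id atLeastAtMost_iff int_nat_eq, simp)

lemma awalk_relations:
  assumes "i \<in> {1..n}"
  shows "awalk i [ArrY i, ArrX i] i" "awalk i [] i"
    "awalk i [ArrX (vtx n (i + 1)), ArrY (vtx n (i + 1))] i"
  using assms awalk_snoc[of i "[ArrY i]" "ArrX i"] awalk_snoc[of i "[]" "ArrY i"]
    awalk_snoc[of i "[ArrX (vtx n (i + 1))]" "ArrY (vtx n (i + 1))"]
    awalk_snoc[of i "[]" "ArrX (vtx n (i + 1))"]
  by (auto simp: awalk_Nil quiver_simps)

lemma path_elt_xpath_closed: "path_elt (xpath i m) \<in> carrier (RQ n)"
  and path_elt_ypath_closed: "path_elt (ypath i m) \<in> carrier (RQ n)"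
  by (metis awalk_xpath path_elt_closed xpath_fst) (metis awalk_ypath path_elt_closed ypath_fst)

interpretation RQ: ring "RQ n" by (rule PA_ring)

lemma C_relations_closed: "C_relations k n \<subseteq> carrier (RQ n)"
  unfolding C_relations_eq
  by (auto intro!: RQ.minus_closed PA_smult_closed path_elt_xpath_closed path_elt_ypath_closed
      path_elt_closed[OF awalk_relations(1)] path_elt_closed[OF awalk_relations(2)]
      path_elt_closed[OF awalk_relations(3)])

sublocale C: quiver_algebra "cyclic_quiver n" "C_ideal k n" "Calg k n"
  by (intro quiver_algebra.intro finite_quiver_axioms quiver_algebra_axioms.intro
      RQ.genideal_ideal C_relations_closed Calg_def)

abbreviation C :: "(complex fps, path_elts set) module" where "C \<equiv> Calg k n"

definition E :: "int \<Rightarrow> path_elts set" where "E i = C.cls (path_elt (vtx n i, []))"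

definition x :: "path_elts set" where "x = C.cls x_elt"

definition y :: "path_elts set" where "y = C.cls y_elt"

lemma C_rel:
  assumes "f \<ominus>\<^bsub>RQ n\<^esub> g \<in> C_relations k n" "f \<in> carrier (RQ n)" "g \<in> carrier (RQ n)"
  shows "C.cls f = C.cls g"
  using assms RQ.genideal_self[OF C_relations_closed] by (intro C.cls_eqI) auto

lemma nil_closed: "path_elt (vtx n i, []) \<in> carrier (RQ n)"
  by (rule path_elt_closed[of _ _ "vtx n i"]) (simp add: awalk_Nil)

lemma E_closed [simp, intro]: "E i \<in> carrier C" and x_closed [simp, intro]: "x \<in> carrier C"
  and y_closed [simp, intro]: "y \<in> carrier C"
  unfolding E_def x_def y_def by (auto intro: nil_closed x_elt_closed y_elt_closed)

lemma E_vtx: "E (vtx n i) = E i"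
  by (simp add: E_def)

lemma e_star_E: "e_star k n = E n"
  using n_pos by (simp add: e_star_def E_def C.cls_def)

lemma x_cls: "awalk u p v \<Longrightarrow> x \<otimes>\<^bsub>C\<^esub> C.cls (path_elt (u, p)) = C.cls (path_elt (u, p @ [ArrX (vtx n (v + 1))]))"
  unfolding x_def by (simp only: C.cls_hom(2)[symmetric] x_elt_closed path_elt_closed x_elt_mult)

lemma y_cls: "awalk u p v \<Longrightarrow> y \<otimes>\<^bsub>C\<^esub> C.cls (path_elt (u, p)) = C.cls (path_elt (u, p @ [ArrY v]))"
  unfolding y_def by (simp only: C.cls_hom(2)[symmetric] y_elt_closed path_elt_closed y_elt_mult)

lemma E_cls:
  assumes w: "awalk u p v"
  shows "E i \<otimes>\<^bsub>C\<^esub> C.cls (path_elt (u, p)) = (if v = vtx n i then C.cls (path_elt (u, p)) else \<zero>\<^bsub>C\<^esub>)"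
proof -
  have "E i \<otimes>\<^bsub>C\<^esub> C.cls (path_elt (u, p)) = C.cls (path_elt (vtx n i, []) \<otimes>\<^bsub>RQ n\<^esub> path_elt (u, p))"
    unfolding E_def by (rule C.cls_hom(2)[symmetric, OF nil_closed path_elt_closed[OF w]])
  then show ?thesis
    by (simp add: path_elt_mult awalk_awlast[OF w] C.cls_hom(4))
qed

lemma x_pow_E: "x [^]\<^bsub>C\<^esub> m \<otimes>\<^bsub>C\<^esub> E i = C.cls (path_elt (xpath i m))"
proof (induction m)
  case (Suc m)
  have "x [^]\<^bsub>C\<^esub> Suc m \<otimes>\<^bsub>C\<^esub> E i = x \<otimes>\<^bsub>C\<^esub> (x [^]\<^bsub>C\<^esub> m \<otimes>\<^bsub>C\<^esub> E i)"
    unfolding C.\<Lambda>.nat_pow_Suc2[OF x_closed] by (rule C.\<Lambda>.m_assoc) auto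
  also have "\<dots> = x \<otimes>\<^bsub>C\<^esub> C.cls (path_elt (vtx n i, snd (xpath i m)))"
    using Suc xpath_fst by metis
  also have "\<dots> = C.cls (path_elt (xpath i (Suc m)))"
    unfolding x_cls[OF awalk_xpath] xpath_Suc by simp
  finally show ?case .
qed (simp add: E_def xpath_0 nil_closed)

lemma y_pow_E: "y [^]\<^bsub>C\<^esub> m \<otimes>\<^bsub>C\<^esub> E i = C.cls (path_elt (ypath i m))"
proof (induction m)
  case (Suc m)
  have "y [^]\<^bsub>C\<^esub> Suc m \<otimes>\<^bsub>C\<^esub> E i = y \<otimes>\<^bsub>C\<^esub> (y [^]\<^bsub>C\<^esub> m \<otimes>\<^bsub>C\<^esub> E i)"
    unfolding C.\<Lambda>.nat_pow_Suc2[OF y_closed] by (rule C.\<Lambda>.m_assoc) auto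
  also have "\<dots> = y \<otimes>\<^bsub>C\<^esub> C.cls (path_elt (vtx n i, snd (ypath i m)))"
    using Suc ypath_fst by metis
  also have "\<dots> = C.cls (path_elt (ypath i (Suc m)))"
    unfolding y_cls[OF awalk_ypath] ypath_Suc by simp
  finally show ?case .
qed (simp add: E_def ypath_0 nil_closed)

lemma sum_E: "(\<Oplus>\<^bsub>C\<^esub>i\<in>{1..n}. E i) = \<one>\<^bsub>C\<^esub>"
proof -
  define D :: "int set \<Rightarrow> path_elts" where "D F = (\<lambda>(u, p). if u \<in> F \<and> p = [] then 1 else 0)" for F
  have "(\<Oplus>\<^bsub>C\<^esub>i\<in>F. E i) = C.cls (D F) \<and> D F \<in> carrier (RQ n)" if "finite F" "F \<subseteq> {1..n}" for F
    using that
  proof (induction F)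
    case empty
    have "D {} = \<zero>\<^bsub>RQ n\<^esub>" by (auto simp: D_def PA_simps)
    then show ?case by (simp add: C.cls_hom(4))
  next
    case (insert i F)
    have i: "path_elt (i, []) \<in> carrier (RQ n)" using nil_closed[of i] insert.prems by simp
    have "D (insert i F) = path_elt (i, []) \<oplus>\<^bsub>RQ n\<^esub> D F"
      using insert.hyps by (auto simp: D_def PA_simps path_elt_def fun_eq_iff)
    moreover have "(\<Oplus>\<^bsub>C\<^esub>i\<in>insert i F. E i) = E i \<oplus>\<^bsub>C\<^esub> (\<Oplus>\<^bsub>C\<^esub>i\<in>F. E i)"
      using insert.hyps by (intro C.\<Lambda>.finsum_insert) auto
    moreover have "E i = C.cls (path_elt (i, []))" using insert.prems by (simp add: E_def)
    ultimately show ?case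
      using insert i by (simp add: C.cls_hom(1) PA_add_closed)
  qed
  moreover have "D {1..n} = \<one>\<^bsub>RQ n\<^esub>"
    by (simp add: D_def PA_one quiver_simps)
  ultimately show ?thesis by (simp add: C.cls_hom(3))
qed

text \<open>The idempotents sum to the unit. Identities in the algebra can therefore be checked one
  starting vertex at a time, where both sides are classes of paths.\<close>

lemma C_ext:
  assumes "c \<in> carrier C" "d \<in> carrier C" "\<And>i. c \<otimes>\<^bsub>C\<^esub> E i = d \<otimes>\<^bsub>C\<^esub> E i"
  shows "c = d"
proof -
  have *: "a = (\<Oplus>\<^bsub>C\<^esub>i\<in>{1..n}. a \<otimes>\<^bsub>C\<^esub> E i)" if "a \<in> carrier C" for a
    using C.\<Lambda>.finsum_rdistr[of "{1..n}" a E] that by (simp add: sum_E)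
  have "c = (\<Oplus>\<^bsub>C\<^esub>i\<in>{1..n}. c \<otimes>\<^bsub>C\<^esub> E i)" by (rule *[OF assms(1)])
  also have "\<dots> = (\<Oplus>\<^bsub>C\<^esub>i\<in>{1..n}. d \<otimes>\<^bsub>C\<^esub> E i)" by (simp only: assms(3))
  also have "\<dots> = d" by (rule *[OF assms(2), symmetric])
  finally show ?thesis .
qed

lemma E_E: "E i \<otimes>\<^bsub>C\<^esub> E j = (if vtx n i = vtx n j then E j else \<zero>\<^bsub>C\<^esub>)"
  unfolding E_def[of j] by (subst E_cls[of _ _ "vtx n j"]) (auto simp: awalk_Nil_iff quiver_simps)

lemma x_E1: "x \<otimes>\<^bsub>C\<^esub> E i = C.cls (path_elt (xpath i 1))"
  and y_E1: "y \<otimes>\<^bsub>C\<^esub> E i = C.cls (path_elt (ypath i 1))"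
  using x_pow_E[of 1 i] y_pow_E[of 1 i] by simp_all

lemma x_E: "x \<otimes>\<^bsub>C\<^esub> E i = E (i + 1) \<otimes>\<^bsub>C\<^esub> x"
proof (rule C_ext)
  fix j
  have "(E (i + 1) \<otimes>\<^bsub>C\<^esub> x) \<otimes>\<^bsub>C\<^esub> E j = E (i + 1) \<otimes>\<^bsub>C\<^esub> C.cls (path_elt (vtx n j, snd (xpath j 1)))"
    unfolding xpath_fst[symmetric] x_E1[symmetric] by (simp add: C.\<Lambda>.m_assoc)
  also have "\<dots> = (if vtx n i = vtx n j then C.cls (path_elt (vtx n j, snd (xpath j 1))) else \<zero>\<^bsub>C\<^esub>)"
    unfolding E_cls[OF awalk_xpath] using vtx_shift_eq[of j 1 i] by (simp add: eq_commute)
  also have "\<dots> = (if vtx n i = vtx n j then x \<otimes>\<^bsub>C\<^esub> E j else \<zero>\<^bsub>C\<^esub>)"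
    unfolding x_E1 xpath_fst[symmetric] ..
  finally show "(x \<otimes>\<^bsub>C\<^esub> E i) \<otimes>\<^bsub>C\<^esub> E j = (E (i + 1) \<otimes>\<^bsub>C\<^esub> x) \<otimes>\<^bsub>C\<^esub> E j"
    by (simp add: C.\<Lambda>.m_assoc E_E)
qed auto

lemma y_E: "y \<otimes>\<^bsub>C\<^esub> E i = E (i - 1) \<otimes>\<^bsub>C\<^esub> y"
proof (rule C_ext)
  fix j
  have "(E (i - 1) \<otimes>\<^bsub>C\<^esub> y) \<otimes>\<^bsub>C\<^esub> E j = E (i - 1) \<otimes>\<^bsub>C\<^esub> C.cls (path_elt (vtx n j, snd (ypath j 1)))"
    unfolding ypath_fst[symmetric] y_E1[symmetric] by (simp add: C.\<Lambda>.m_assoc)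
  also have "\<dots> = (if vtx n i = vtx n j then C.cls (path_elt (vtx n j, snd (ypath j 1))) else \<zero>\<^bsub>C\<^esub>)"
    unfolding E_cls[OF awalk_ypath] using vtx_shift_eq[of j "-1" i] by (simp add: eq_commute)
  also have "\<dots> = (if vtx n i = vtx n j then y \<otimes>\<^bsub>C\<^esub> E j else \<zero>\<^bsub>C\<^esub>)"
    unfolding y_E1 ypath_fst[symmetric] ..
  finally show "(y \<otimes>\<^bsub>C\<^esub> E i) \<otimes>\<^bsub>C\<^esub> E j = (E (i - 1) \<otimes>\<^bsub>C\<^esub> y) \<otimes>\<^bsub>C\<^esub> E j"
    by (simp add: C.\<Lambda>.m_assoc E_E)
qed auto

lemma X_path: "C.cls (fps_X \<odot>\<^bsub>RQ n\<^esub> path_elt (vtx n i, [])) = C.\<rho> fps_X \<otimes>\<^bsub>C\<^esub> E i"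
  unfolding E_def by (rule C.\<rho>_mult_cls[OF nil_closed, symmetric])

lemma x_y: "x \<otimes>\<^bsub>C\<^esub> y = C.\<rho> fps_X"
proof (rule C_ext)
  fix i let ?i = "vtx n i"
  have "(x \<otimes>\<^bsub>C\<^esub> y) \<otimes>\<^bsub>C\<^esub> E i = x \<otimes>\<^bsub>C\<^esub> C.cls (path_elt (?i, snd (ypath i 1)))"
    unfolding ypath_fst[symmetric] y_E1[symmetric] by (simp add: C.\<Lambda>.m_assoc)
  also have "\<dots> = C.cls (path_elt (?i, [ArrY ?i, ArrX ?i]))"
    unfolding x_cls[OF awalk_ypath] by (simp add: ypath_Suc ypath_0)
  also have "\<dots> = C.cls (fps_X \<odot>\<^bsub>RQ n\<^esub> path_elt (?i, []))"
    by (rule C_rel) (auto simp: C_relations_def intro!: bexI[of _ ?i] PA_smult_closed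
        path_elt_closed[OF awalk_relations(1)] nil_closed)
  finally show "(x \<otimes>\<^bsub>C\<^esub> y) \<otimes>\<^bsub>C\<^esub> E i = C.\<rho> fps_X \<otimes>\<^bsub>C\<^esub> E i" by (simp only: X_path)
qed auto

lemma y_x: "y \<otimes>\<^bsub>C\<^esub> x = C.\<rho> fps_X"
proof (rule C_ext)
  fix i let ?i = "vtx n i"
  have "(y \<otimes>\<^bsub>C\<^esub> x) \<otimes>\<^bsub>C\<^esub> E i = y \<otimes>\<^bsub>C\<^esub> C.cls (path_elt (?i, snd (xpath i 1)))"
    unfolding xpath_fst[symmetric] x_E1[symmetric] by (simp add: C.\<Lambda>.m_assoc)
  also have "\<dots> = C.cls (path_elt (?i, [ArrX (vtx n (?i + 1)), ArrY (vtx n (?i + 1))]))"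
    unfolding y_cls[OF awalk_xpath] by (simp add: xpath_Suc xpath_0)
  also have "\<dots> = C.cls (fps_X \<odot>\<^bsub>RQ n\<^esub> path_elt (?i, []))"
    by (rule C_rel) (auto simp: C_relations_def simp del: vtx_vtx intro!: bexI[of _ ?i] PA_smult_closed
        path_elt_closed[OF awalk_relations(3)] nil_closed)
  finally show "(y \<otimes>\<^bsub>C\<^esub> x) \<otimes>\<^bsub>C\<^esub> E i = C.\<rho> fps_X \<otimes>\<^bsub>C\<^esub> E i" by (simp only: X_path)
qed auto

lemma x_pow_y_pow: "x [^]\<^bsub>C\<^esub> nat k = y [^]\<^bsub>C\<^esub> nat (n - k)"
proof (rule C_ext)
  fix i
  have E: "E i = E (vtx n i)" by (simp add: E_vtx)
  show "x [^]\<^bsub>C\<^esub> nat k \<otimes>\<^bsub>C\<^esub> E i = y [^]\<^bsub>C\<^esub> nat (n - k) \<otimes>\<^bsub>C\<^esub> E i"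
    unfolding E x_pow_E y_pow_E
    by (rule C_rel[OF _ path_elt_xpath_closed path_elt_ypath_closed])
      (auto simp: C_relations_eq intro!: bexI[of _ "vtx n i"])
qed auto

text \<open>Every path is a product of an idempotent and copies of \<open>x\<close> and
  \<open>y\<close>. This reduces \<open>C\<close>-linearity of a map, or stability of a submodule,
  to four kinds of generators.\<close>

lemma C_induct [consumes 1, case_names scalar E x y add mult]:
  assumes "c \<in> carrier C"
    and scalar: "\<And>r. P (C.\<rho> r)" and E: "\<And>i. P (E i)" and x: "P x" and y: "P y"
    and add: "\<And>a b. \<lbrakk>a \<in> carrier C; b \<in> carrier C; P a; P b\<rbrakk> \<Longrightarrow> P (a \<oplus>\<^bsub>C\<^esub> b)"
    and mult: "\<And>a b. \<lbrakk>a \<in> carrier C; b \<in> carrier C; P a; P b\<rbrakk> \<Longrightarrow> P (a \<otimes>\<^bsub>C\<^esub> b)"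
  shows "P c"
proof -
  have path: "P (C.cls (path_elt (u, p)))" if "awalk u p v" for u p v
    using that
  proof (induction p arbitrary: v rule: rev_induct)
    case Nil
    then show ?case using E[of u] by (simp add: E_def awalk_Nil_iff quiver_simps)
  next
    case (snoc a p)
    then obtain w where w: "awalk u p w" "a \<in> arcs (cyclic_quiver n)" "tail (cyclic_quiver n) a = w"
      unfolding awalk_snoc by blast
    have c: "C.cls (path_elt (u, p)) \<in> carrier C" "P (C.cls (path_elt (u, p)))"
      using w(1) snoc.IH by (auto intro: path_elt_closed)
    from w(2,3) consider "a = ArrX (vtx n (w + 1))" | "a = ArrY w"
      by (auto simp: quiver_simps)
    then show ?case
    proof cases
      case 1
      then show ?thesis using mult[OF x_closed c(1) x c(2)] x_cls[OF w(1)] by simp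
    next
      case 2
      then show ?thesis using mult[OF y_closed c(1) y c(2)] y_cls[OF w(1)] by simp
    qed
  qed
  obtain f where f: "f \<in> carrier (RQ n)" "c = C.cls f" using assms(1) by (auto simp: C.\<Lambda>_carrier)
  have "P (C.cls f)" using f(1)
  proof (induction f rule: PA_induct)
    case zero
    have "C.\<rho> 0 = C.cls \<zero>\<^bsub>RQ n\<^esub>" unfolding C.\<rho>_cls by (simp add: PA_simps)
    then show ?case using scalar[of 0] by simp
  next
    case (path r u p v)
    have "C.cls (path_elt (u, p)) \<in> carrier C" using path by (auto intro: path_elt_closed)
    then have "P (C.\<rho> r \<otimes>\<^bsub>C\<^esub> C.cls (path_elt (u, p)))"
      using mult[of "C.\<rho> r" "C.cls (path_elt (u, p))"] scalar \<open>\<And>v p u. awalk u p v \<Longrightarrow> P (C.cls (path_elt (u, p)))\<close>[OF path] by simp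
    then show ?case by (simp only: C.\<rho>_mult_cls[OF path_elt_closed[OF path]])
  next
    case (add f g)
    then show ?case using assms(6)[of "C.cls f" "C.cls g"] by (simp add: C.cls_hom(1))
  qed
  then show ?thesis using f(2) by simp
qed

end

section \<open>The rank one modules\<close>

definition path_weight :: "int set \<Rightarrow> arrow list \<Rightarrow> complex fps" where
  "path_weight J p = prod_list (map (arrow_weight J) p)"

lemma path_weight_append: "path_weight J (p @ q) = path_weight J p * path_weight J q"
  by (simp add: path_weight_def)

context cyclic
begin

text \<open>The definition sums over the support of \<open>f\<close>, which changes under addition.
  Over a fixed finite superset the action is visibly linear, term by term.\<close>

lemma path_action_sum:
  assumes S: "finite S" "{w. f w \<noteq> 0} \<subseteq> S" and v: "v \<in> {1..n}"
  shows "path_action n J f m v =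
    (\<Sum>(u, p)\<in>S. if awalk u p v then f (u, p) * path_weight J p * m u else 0)"
proof -
  have "(\<Sum>(u, p)\<in>S. if awalk u p v then f (u, p) * path_weight J p * m u else 0)
      = (\<Sum>(u, p)\<in>{(u, p). f (u, p) \<noteq> 0 \<and> awalk u p v}. f (u, p) * path_weight J p * m u)"
    using S by (intro sum.mono_neutral_cong_right) (auto split: if_splits)
  then show ?thesis using v by (simp add: path_action_def path_weight_def)
qed

lemma path_action_extensional: "path_action n J f m \<in> {1..n} \<rightarrow>\<^sub>E UNIV"
  by (simp add: path_action_def)

lemma path_action_eqI:
  assumes "\<And>v. v \<in> {1..n} \<Longrightarrow> path_action n J f m v = g v"
  shows "path_action n J f m = (\<lambda>v\<in>{1..n}. g v)"
  using assms path_action_extensional[of J f m]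
  by (intro ext) (auto simp: PiE_def extensional_def)

lemma path_action_add:
  assumes f: "f \<in> carrier (RQ n)" and g: "g \<in> carrier (RQ n)"
  shows "path_action n J (f \<oplus>\<^bsub>RQ n\<^esub> g) m
    = (\<lambda>v\<in>{1..n}. path_action n J f m v + path_action n J g m v)"
proof (rule path_action_eqI)
  fix v assume v: "v \<in> {1..n}"
  let ?S = "{w. f w \<noteq> 0} \<union> {w. g w \<noteq> 0}"
  have S: "finite ?S" using f g by (simp add: PA_carrier)
  show "path_action n J (f \<oplus>\<^bsub>RQ n\<^esub> g) m v = path_action n J f m v + path_action n J g m v"
  proof -
    have "{w. f w \<noteq> 0} \<subseteq> ?S" "{w. g w \<noteq> 0} \<subseteq> ?S" "{w. (f \<oplus>\<^bsub>RQ n\<^esub> g) w \<noteq> 0} \<subseteq> ?S"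
      by (auto simp: PA_simps)
    note sums = path_action_sum[OF S this(1) v] path_action_sum[OF S this(2) v]
      path_action_sum[OF S this(3) v]
    show ?thesis
      unfolding sums sum.distrib[symmetric]
      by (intro sum.cong refl) (auto simp: PA_simps algebra_simps)
  qed
qed

lemma path_action_add_right:
  assumes f: "f \<in> carrier (RQ n)"
  shows "path_action n J f (\<lambda>i\<in>{1..n}. m i + m' i)
    = (\<lambda>v\<in>{1..n}. path_action n J f m v + path_action n J f m' v)"
proof (rule path_action_eqI)
  fix v assume v: "v \<in> {1..n}"
  have S: "finite {w. f w \<noteq> 0}" using f by (simp add: PA_carrier)
  have u: "1 \<le> u \<and> u \<le> n" if "awalk u p v" for u p
    using that by (auto simp: awalk_def quiver_simps)
  show "path_action n J f (\<lambda>i\<in>{1..n}. m i + m' i) v = path_action n J f m v + path_action n J f m' v"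
    unfolding path_action_sum[OF S order_refl v] sum.distrib[symmetric]
    by (intro sum.cong) (auto simp: algebra_simps dest!: u)
qed

lemma path_action_smult:
  assumes f: "f \<in> carrier (RQ n)"
  shows "path_action n J (r \<odot>\<^bsub>RQ n\<^esub> f) m = (\<lambda>v\<in>{1..n}. r * path_action n J f m v)"
proof (rule path_action_eqI)
  fix v assume v: "v \<in> {1..n}"
  let ?S = "{w. f w \<noteq> 0}"
  have S: "finite ?S" using f by (simp add: PA_carrier)
  show "path_action n J (r \<odot>\<^bsub>RQ n\<^esub> f) m v = r * path_action n J f m v"
  proof -
    have "{w. f w \<noteq> 0} \<subseteq> ?S" "{w. (r \<odot>\<^bsub>RQ n\<^esub> f) w \<noteq> 0} \<subseteq> ?S"
      by (auto simp: PA_simps)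
    note sums = path_action_sum[OF S this(1) v] path_action_sum[OF S this(2) v]
    show ?thesis
      unfolding sums sum_distrib_left by (intro sum.cong refl) (auto simp: PA_simps algebra_simps)
  qed
qed

lemma path_action_smult_right:
  assumes f: "f \<in> carrier (RQ n)"
  shows "path_action n J f (\<lambda>i\<in>{1..n}. r * m i) = (\<lambda>v\<in>{1..n}. r * path_action n J f m v)"
proof (rule path_action_eqI)
  fix v assume v: "v \<in> {1..n}"
  have S: "finite {w. f w \<noteq> 0}" using f by (simp add: PA_carrier)
  have u: "1 \<le> u \<and> u \<le> n" if "awalk u p v" for u p
    using that by (auto simp: awalk_def quiver_simps)
  show "path_action n J f (\<lambda>i\<in>{1..n}. r * m i) v = r * path_action n J f m v"
    unfolding path_action_sum[OF S order_refl v] sum_distrib_left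
    by (intro sum.cong) (auto simp: algebra_simps dest!: u)
qed

lemma path_action_zero: "path_action n J \<zero>\<^bsub>RQ n\<^esub> m = (\<lambda>v\<in>{1..n}. 0)"
  by (rule path_action_eqI) (subst path_action_sum[of "{}"], auto simp: PA_simps)

lemma path_action_path:
  assumes w: "awalk u p v"
  shows "path_action n J (path_elt (u, p)) m = (\<lambda>v'\<in>{1..n}. if v' = v then path_weight J p * m u else 0)"
proof (rule path_action_eqI)
  fix v' assume v: "v' \<in> {1..n}"
  have "awalk u p v' \<longleftrightarrow> v' = v" using w awalk_awlast by blast
  then show "path_action n J (path_elt (u, p)) m v' = (if v' = v then path_weight J p * m u else 0)"
    using v by (subst path_action_sum[of "{(u, p)}"]) (auto simp: path_elt_def split: if_splits)
qed

text \<open>By linearity in both factors it suffices to compose two paths. If they do not meet, both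
  sides vanish; otherwise weights multiply under concatenation.\<close>

lemma path_action_mult:
  assumes "f \<in> carrier (RQ n)" and g: "g \<in> carrier (RQ n)"
  shows "path_action n J (f \<otimes>\<^bsub>RQ n\<^esub> g) m = path_action n J f (path_action n J g m)"
proof -
  interpret RQ: ring "RQ n" by (rule PA_ring)
  have zero_right: "path_action n J f (\<lambda>v\<in>{1..n}. 0) = (\<lambda>v\<in>{1..n}. 0)" if "f \<in> carrier (RQ n)" for f
    using path_action_smult_right[OF that, of J 0] by simp
  show ?thesis
    using assms(1)
  proof (induction f rule: PA_induct)
    case zero
    then show ?case using g by (simp add: path_action_zero)
  next
    case (add f1 f2)
    then show ?case using g by (simp add: RQ.l_distr path_action_add)
  next
    case (path r u p v)
    have cl: "path_elt (u, p) \<in> carrier (RQ n)" by (rule path_elt_closed[OF path])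
    have "path_action n J (path_elt (u, p) \<otimes>\<^bsub>RQ n\<^esub> g) m
        = path_action n J (path_elt (u, p)) (path_action n J g m)"
      using g
    proof (induction g rule: PA_induct)
      case zero
      show ?case by (simp only: RQ.r_null cl path_action_zero zero_right)
    next
      case (add g1 g2)
      then show ?case using cl
        by (simp only: RQ.r_distr path_action_add path_action_add_right PA_mult_closed)
    next
      case (path s u' q w)
      have cl': "path_elt (u', q) \<in> carrier (RQ n)" by (rule path_elt_closed[OF path])
      have w: "w \<in> {1..n}" using awalk_last_in_verts[OF path] by (simp add: quiver_simps)
      have u: "u \<in> {1..n}" using \<open>awalk u p v\<close> by (auto simp: awalk_def quiver_simps)
      have eq: "path_action n J (path_elt (u, p)) (path_action n J (path_elt (u', q)) m)
          = (\<lambda>v'\<in>{1..n}. if v' = v \<and> u = w then path_weight J (q @ p) * m u' else 0)"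
        unfolding path_action_path[OF path] path_action_path[OF \<open>awalk u p v\<close>]
        using u by (intro ext) (auto simp: path_weight_append restrict_def)
      have "path_action n J (path_elt (u, p) \<otimes>\<^bsub>RQ n\<^esub> path_elt (u', q)) m
          = path_action n J (path_elt (u, p)) (path_action n J (path_elt (u', q)) m)"
      proof (cases "w = u")
        case True
        have "awalk u' (q @ p) v" using path \<open>awalk u p v\<close> True by auto
        from path_action_path[OF this] show ?thesis
          unfolding eq using True by (simp add: path_elt_mult awalk_awlast[OF path])
      next
        case False
        then have "path_elt (u, p) \<otimes>\<^bsub>RQ n\<^esub> path_elt (u', q) = (\<zero>\<^bsub>RQ n\<^esub> :: path_elts)"
          by (simp add: path_elt_mult awalk_awlast[OF path])
        then show ?thesis
          unfolding eq using False by (simp only: path_action_zero) auto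
      qed
      then show ?case
        using cl cl' by (simp only: PA_smult_mult path_action_smult path_action_smult_right PA_mult_closed)
    qed
    then show ?case
      using cl g by (simp only: PA_smult_mult path_action_smult PA_mult_closed)
  qed
qed

lemma path_weight_xpath: "path_weight J (snd (xpath i m)) = fps_X ^ card {l \<in> {i + 1..i + int m}. vtx n l \<notin> J}"
proof (induction m)
  case (Suc m)
  let ?A = "{l \<in> {i + 1..i + int m}. vtx n l \<notin> J}" and ?a = "i + int m + 1"
  have "{l \<in> {i + 1..i + int (Suc m)}. vtx n l \<notin> J} = (if vtx n ?a \<in> J then {} else {?a}) \<union> ?A"
  proof -
    have "{i + 1..i + int (Suc m)} = insert (i + int m + 1) {i + 1..i + int m}" by auto
    then show ?thesis by auto
  qed
  moreover have "card ((if vtx n ?a \<in> J then {} else {?a}) \<union> ?A)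
      = (if vtx n ?a \<in> J then 0 else 1) + card ?A"
    by (subst card_Un_disjoint) (auto intro: finite_subset[of _ "{i + 1..i + int m}"])
  ultimately show ?case
    unfolding xpath_Suc snd_conv path_weight_append Suc
    by (simp add: power_add) (simp add: path_weight_def arrow_weight_def)
qed (simp add: xpath_0 path_weight_def)

lemma path_weight_ypath: "path_weight J (snd (ypath i m)) = fps_X ^ card {l \<in> {i - int m + 1..i}. vtx n l \<in> J}"
proof (induction m)
  case (Suc m)
  let ?A = "{l \<in> {i - int m + 1..i}. vtx n l \<in> J}" and ?a = "i - int m"
  have "{l \<in> {i - int (Suc m) + 1..i}. vtx n l \<in> J} = (if vtx n ?a \<in> J then {?a} else {}) \<union> ?A"
  proof -
    have "{i - int (Suc m) + 1..i} = insert (i - int m) {i - int m + 1..i}" by auto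
    then show ?thesis by auto
  qed
  moreover have "card ((if vtx n ?a \<in> J then {?a} else {}) \<union> ?A)
      = (if vtx n ?a \<in> J then 1 else 0) + card ?A"
    by (subst card_Un_disjoint) (auto intro: finite_subset[of _ "{i - int m + 1..i}"])
  ultimately show ?case
    unfolding ypath_Suc snd_conv path_weight_append Suc
    by (simp add: power_add) (simp add: path_weight_def arrow_weight_def)
qed (simp add: ypath_0 path_weight_def)

lemma vtx_bij: "bij_betw (vtx n) {a + 1..a + n} {1..n}"
proof -
  have "vtx n ` {a + 1..a + n} = {1..n}"
  proof (intro equalityI subsetI)
    fix v assume v: "v \<in> {1..n}"
    define l where "l = a + 1 + (v - a - 1) mod n"
    have "vtx n l = vtx n v"
      using mod_add_right_eq[of a "v - a - 1" n] by (simp add: l_def vtx_def algebra_simps)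
    moreover have "l \<in> {a + 1..a + n}"
      using zless_imp_add1_zle[OF pos_mod_bound[OF n_pos]] n_pos by (simp add: l_def add.commute)
    ultimately show "v \<in> vtx n ` {a + 1..a + n}" using v by (metis atLeastAtMost_iff imageI vtx_id)
  qed auto
  moreover have "inj_on (vtx n) {a + 1..a + n}"
    using calculation n_pos by (intro eq_card_imp_inj_on) auto
  ultimately show ?thesis by (simp add: bij_betw_def)
qed

text \<open>A window of n consecutive integers contains every residue exactly once, wherever it
  starts.\<close>

lemma card_vtx_window:
  assumes "J \<subseteq> {1..n}"
  shows "card {l \<in> {a + 1..a + n}. vtx n l \<in> J} = card J"
proof (rule bij_betw_same_card)
  have "vtx n ` {l \<in> {a + 1..a + n}. vtx n l \<in> J} = J \<inter> vtx n ` {a + 1..a + n}" by auto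
  then have "vtx n ` {l \<in> {a + 1..a + n}. vtx n l \<in> J} = J"
    using vtx_bij[of a] assms by (auto simp: bij_betw_def)
  then show "bij_betw (vtx n) {l \<in> {a + 1..a + n}. vtx n l \<in> J} J"
    using vtx_bij[of a] unfolding bij_betw_def by (auto intro: inj_on_subset)
qed

lemma sum_vtx_delta: "(\<Sum>u\<in>{1..n}. if u = vtx n i then g u else 0) = (g (vtx n i) :: complex fps)"
  using sum.delta[of "{1..n}" "vtx n i" g] vtx_range(1)[of i]
  by (simp only: finite_atLeastAtMost_int if_True)

lemma vtx_pred_succ: "v \<in> {1..n} \<Longrightarrow> vtx n (vtx n (v - 1) + 1) = v"
  by (simp only: vtx_vtx diff_add_cancel) simp

lemma path_action_x_elt:
  "path_action n J x_elt m = (\<lambda>v\<in>{1..n}. (if v \<in> J then 1 else fps_X) * m (vtx n (v - 1)))"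
proof (rule path_action_eqI)
  fix v assume v: "v \<in> {1..n}"
  let ?a = "\<lambda>u. (u, [ArrX (vtx n (u + 1))])" and ?u = "vtx n (v - 1)"
  have inj: "inj_on ?a {1..n}" by (auto simp: inj_on_def)
  have w: "awalk u [ArrX (vtx n (u + 1))] v \<longleftrightarrow> u = vtx n (v - 1)" if "u \<in> {1..n}" for u
  proof -
    have "awalk u [ArrX (vtx n (u + 1))] v \<longleftrightarrow> vtx n (u + 1) = v"
      using that by (auto simp: awalk_Cons_iff awalk_Nil_iff quiver_simps)
    then show ?thesis using vtx_eq_iff[OF that v, of 1] by simp
  qed
  have sub: "{w. x_elt w \<noteq> 0} \<subseteq> ?a ` {1..n}"
    by (auto simp: x_elt_def split: if_splits)
  have A: "path_action n J x_elt m v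
      = (\<Sum>u\<in>{1..n}. if u = ?u then path_weight J (snd (?a u)) * m u else 0)"
    unfolding path_action_sum[OF finite_imageI[OF finite_atLeastAtMost_int] sub v] sum.reindex[OF inj] o_def
  proof (intro sum.cong refl)
    fix u assume u: "u \<in> {1..n}"
    have "x_elt (?a u) = 1" using u by (simp add: x_elt_def)
    then show "(case ?a u of (u, p) \<Rightarrow> if awalk u p v then x_elt (u, p) * path_weight J p * m u else 0)
      = (if u = ?u then path_weight J (snd (?a u)) * m u else 0)"
      by (simp only: prod.case w[OF u] mult_1_left snd_conv)
  qed
  have B: "(\<Sum>u\<in>{1..n}. if u = ?u then path_weight J (snd (?a u)) * m u else 0) = (if v \<in> J then 1 else fps_X) * m (vtx n (v - 1))"
    unfolding sum_vtx_delta snd_conv vtx_pred_succ[OF v]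
    by (simp add: path_weight_def arrow_weight_def)
  show "path_action n J x_elt m v = (if v \<in> J then 1 else fps_X) * m (vtx n (v - 1))" by (rule trans[OF A B])
qed

lemma path_action_y_elt:
  "path_action n J y_elt m = (\<lambda>v\<in>{1..n}. (if vtx n (v + 1) \<in> J then fps_X else 1) * m (vtx n (v + 1)))"
proof (rule path_action_eqI)
  fix v assume v: "v \<in> {1..n}"
  let ?a = "\<lambda>u. (u, [ArrY u])" and ?u = "vtx n (v + 1)"
  have inj: "inj_on ?a {1..n}" by (auto simp: inj_on_def)
  have w: "awalk u [ArrY u] v \<longleftrightarrow> u = vtx n (v + 1)" if "u \<in> {1..n}" for u
  proof -
    have "awalk u [ArrY u] v \<longleftrightarrow> vtx n (u - 1) = v"
      using that by (auto simp: awalk_Cons_iff awalk_Nil_iff quiver_simps)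
    then show ?thesis using vtx_eq_iff[OF that v, of "-1"] by simp
  qed
  have sub: "{w. y_elt w \<noteq> 0} \<subseteq> ?a ` {1..n}"
    by (auto simp: y_elt_def split: if_splits)
  have A: "path_action n J y_elt m v
      = (\<Sum>u\<in>{1..n}. if u = ?u then path_weight J (snd (?a u)) * m u else 0)"
    unfolding path_action_sum[OF finite_imageI[OF finite_atLeastAtMost_int] sub v] sum.reindex[OF inj] o_def
  proof (intro sum.cong refl)
    fix u assume u: "u \<in> {1..n}"
    have "y_elt (?a u) = 1" using u by (simp add: y_elt_def)
    then show "(case ?a u of (u, p) \<Rightarrow> if awalk u p v then y_elt (u, p) * path_weight J p * m u else 0)
      = (if u = ?u then path_weight J (snd (?a u)) * m u else 0)"
      by (simp only: prod.case w[OF u] mult_1_left snd_conv)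
  qed
  have B: "(\<Sum>u\<in>{1..n}. if u = ?u then path_weight J (snd (?a u)) * m u else 0) = (if vtx n (v + 1) \<in> J then fps_X else 1) * m (vtx n (v + 1))"
    unfolding sum_vtx_delta snd_conv by (simp add: path_weight_def arrow_weight_def)
  show "path_action n J y_elt m v = (if vtx n (v + 1) \<in> J then fps_X else 1) * m (vtx n (v + 1))" by (rule trans[OF A B])
qed

end

locale rank_one = C_algebra k n for k n :: int +
  fixes J :: "int set"
  assumes J_sub: "J \<subseteq> {1..n}" and J_card: "int (card J) = k"
begin

abbreviation T :: "(path_elts set, int \<Rightarrow> complex fps) module" where "T \<equiv> rank_one_module n J"

lemma T_simps:
  "carrier T = {1..n} \<rightarrow>\<^sub>E UNIV" "\<zero>\<^bsub>T\<^esub> = (\<lambda>i\<in>{1..n}. 0)"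
  "m \<oplus>\<^bsub>T\<^esub> m' = (\<lambda>i\<in>{1..n}. m i + m' i)"
  by (simp_all add: rank_one_module_def)

lemma T_ext: "\<lbrakk>m \<in> carrier T; m' \<in> carrier T; \<And>v. v \<in> {1..n} \<Longrightarrow> m v = m' v\<rbrakk> \<Longrightarrow> m = m'"
  unfolding T_simps by (rule PiE_ext)

text \<open>The annihilator in the path algebra. Once it is known to be an ideal containing the
  relations, it contains \<open>C_ideal k n\<close>, and the action of a class through an arbitrary
  representative is well defined.\<close>

definition ann :: "path_elts set" where
  "ann = {f \<in> carrier (RQ n). \<forall>m. path_action n J f m = (\<lambda>v\<in>{1..n}. 0)}"

lemma ann_minus:
  assumes f: "f \<in> carrier (RQ n)" and g: "g \<in> carrier (RQ n)"
    and eq: "\<And>m. path_action n J f m = path_action n J g m"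
  shows "f \<ominus>\<^bsub>RQ n\<^esub> g \<in> ann"
proof -
  have "path_action n J (f \<ominus>\<^bsub>RQ n\<^esub> g) m = (\<lambda>v\<in>{1..n}. 0)" for m
  proof (rule path_action_eqI)
    fix v assume v: "v \<in> {1..n}"
    have "f = (f \<ominus>\<^bsub>RQ n\<^esub> g) \<oplus>\<^bsub>RQ n\<^esub> g"
      using f g by (simp add: C.PA.minus_eq C.PA.a_assoc C.PA.l_neg)
    then have "path_action n J f m = path_action n J ((f \<ominus>\<^bsub>RQ n\<^esub> g) \<oplus>\<^bsub>RQ n\<^esub> g) m" by simp
    from fun_cong[OF this, of v] show "path_action n J (f \<ominus>\<^bsub>RQ n\<^esub> g) m v = 0"
      using f g v by (simp add: path_action_add eq)
  qed
  then show ?thesis using f g by (simp add: ann_def)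
qed

lemma ann_ideal: "ideal ann (RQ n)"
proof (rule idealI[OF PA_ring])
  show "subgroup ann (add_monoid (RQ n))"
  proof
    show "ann \<subseteq> carrier (add_monoid (RQ n))" by (auto simp: ann_def)
    show "\<one>\<^bsub>add_monoid (RQ n)\<^esub> \<in> ann" by (auto simp: ann_def path_action_zero)
    fix f assume f: "f \<in> ann"
    show "inv\<^bsub>add_monoid (RQ n)\<^esub> f \<in> ann"
      using ann_minus[of "\<zero>\<^bsub>RQ n\<^esub>" f] f
      by (simp add: ann_def path_action_zero C.PA.minus_eq a_inv_def)
    fix g assume "g \<in> ann"
    then show "f \<otimes>\<^bsub>add_monoid (RQ n)\<^esub> g \<in> ann" using f by (auto simp: ann_def path_action_add)
  qed
next
  fix f g assume f: "f \<in> ann" and g: "g \<in> carrier (RQ n)"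
  have "path_action n J g (\<lambda>v\<in>{1..n}. 0) = (\<lambda>v\<in>{1..n}. 0)"
    using path_action_smult_right[OF g, of J 0] by simp
  then show "g \<otimes>\<^bsub>RQ n\<^esub> f \<in> ann" "f \<otimes>\<^bsub>RQ n\<^esub> g \<in> ann"
    using f g by (auto simp: ann_def path_action_mult)
qed

text \<open>This is where \<open>J\<close> must have k elements. The x-path collects k minus the
  number of its labels in \<open>J\<close>, the y-path the number of its labels in \<open>J\<close>;
  together the two label windows form one full period, which meets \<open>J\<close> in k
  elements.\<close>

lemma xy_weight: "path_weight J (snd (xpath i (nat k))) = path_weight J (snd (ypath i (nat (n - k))))"
proof -
  let ?a = "i - (n - k)" let ?W1 = "{i + 1..i + k}" and ?W2 = "{?a + 1..i}"
  have fin: "finite {l \<in> {c..d}. P l}" for c d :: int and P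
    by (rule finite_subset[of _ "{c..d}"]) auto
  have "card {l \<in> ?W1. vtx n l \<notin> J} + card {l \<in> ?W1. vtx n l \<in> J} = card ({l \<in> ?W1. vtx n l \<notin> J} \<union> {l \<in> ?W1. vtx n l \<in> J})"
    using fin by (intro card_Un_disjoint[symmetric]) auto
  also have "{l \<in> ?W1. vtx n l \<notin> J} \<union> {l \<in> ?W1. vtx n l \<in> J} = ?W1" by auto
  finally have 1: "card {l \<in> ?W1. vtx n l \<notin> J} + card {l \<in> ?W1. vtx n l \<in> J} = nat k" by simp
  have W: "?W2 \<inter> ?W1 = {}" "?W2 \<union> ?W1 = {?a + 1..?a + n}" using k_pos k_less by auto
  have "card {l \<in> ?W2. vtx n l \<in> J} + card {l \<in> ?W1. vtx n l \<in> J} = card ({l \<in> ?W2. vtx n l \<in> J} \<union> {l \<in> ?W1. vtx n l \<in> J})"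
    using W(1) by (intro card_Un_disjoint[symmetric] fin) blast
  also have "{l \<in> ?W2. vtx n l \<in> J} \<union> {l \<in> ?W1. vtx n l \<in> J} = {l \<in> ?W2 \<union> ?W1. vtx n l \<in> J}"
    by blast
  also have "\<dots> = {l \<in> {?a + 1..?a + n}. vtx n l \<in> J}" unfolding W(2) ..
  also have "card \<dots> = nat k" using J_card card_vtx_window[OF J_sub, of ?a] by simp
  finally show ?thesis
    using 1 k_pos k_less by (simp add: path_weight_xpath path_weight_ypath)
qed

lemma path_action_xpath: "path_action n J (path_elt (xpath i l)) m =
    (\<lambda>v'\<in>{1..n}. if v' = vtx n (i + int l) then path_weight J (snd (xpath i l)) * m (vtx n i) else 0)"
  and path_action_ypath: "path_action n J (path_elt (ypath i l)) m =
    (\<lambda>v'\<in>{1..n}. if v' = vtx n (i - int l) then path_weight J (snd (ypath i l)) * m (vtx n i) else 0)"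
  using path_action_path[OF awalk_xpath, of J i l m] path_action_path[OF awalk_ypath, of J i l m]
  by (simp_all only: xpath_fst[symmetric] ypath_fst[symmetric])

lemma C_ideal_ann: "C_ideal k n \<subseteq> ann"
proof (rule C.PA.genideal_minimal[OF ann_ideal])
  have w: "path_weight J [] = 1" "path_weight J [ArrY i, ArrX i] = fps_X" "path_weight J [ArrX i, ArrY i] = fps_X" for i
    by (simp_all add: path_weight_def arrow_weight_def)
  \<comment> \<open>Both sides of the last relation end at the same vertex because k and -(n - k)
    agree modulo n.\<close>
  have end_eq: "vtx n (i + int (nat k)) = vtx n (i - int (nat (n - k)))" for i
    using k_pos k_less minus_mod_self2[of "i + k - 1" n] by (simp add: vtx_def algebra_simps)
  show "C_relations k n \<subseteq> ann"
  proof
    fix f assume "f \<in> C_relations k n"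
    then obtain i where i: "i \<in> {1..n}" and "f \<in> {path_elt (i, [ArrY i, ArrX i]) \<ominus>\<^bsub>RQ n\<^esub> (fps_X \<odot>\<^bsub>RQ n\<^esub> path_elt (i, [])),
      path_elt (i, [ArrX (vtx n (i + 1)), ArrY (vtx n (i + 1))])
        \<ominus>\<^bsub>RQ n\<^esub> (fps_X \<odot>\<^bsub>RQ n\<^esub> path_elt (i, [])),
      path_elt (xpath i (nat k)) \<ominus>\<^bsub>RQ n\<^esub> path_elt (ypath i (nat (n - k)))}"
      unfolding C_relations_eq by blast
    then consider "f = path_elt (i, [ArrY i, ArrX i]) \<ominus>\<^bsub>RQ n\<^esub> (fps_X \<odot>\<^bsub>RQ n\<^esub> path_elt (i, []))"
      | "f = path_elt (i, [ArrX (vtx n (i + 1)), ArrY (vtx n (i + 1))]) \<ominus>\<^bsub>RQ n\<^esub> (fps_X \<odot>\<^bsub>RQ n\<^esub> path_elt (i, []))"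
      | "f = path_elt (xpath i (nat k)) \<ominus>\<^bsub>RQ n\<^esub> path_elt (ypath i (nat (n - k)))" by blast
    then show "f \<in> ann"
    proof cases
      case 1
      show ?thesis unfolding 1
      proof (intro ann_minus PA_smult_closed path_elt_closed[OF awalk_relations(1)[OF i]]
          path_elt_closed[OF awalk_relations(2)[OF i]])
        show "path_action n J (path_elt (i, [ArrY i, ArrX i])) m = path_action n J (fps_X \<odot>\<^bsub>RQ n\<^esub> path_elt (i, [])) m" for m
          unfolding path_action_smult[OF path_elt_closed[OF awalk_relations(2)[OF i]]]
            path_action_path[OF awalk_relations(1)[OF i]] path_action_path[OF awalk_relations(2)[OF i]] w
          by (intro restrict_ext) simp
      qed
    next
      case 2
      show ?thesis unfolding 2
      proof (intro ann_minus PA_smult_closed path_elt_closed[OF awalk_relations(3)[OF i]]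
          path_elt_closed[OF awalk_relations(2)[OF i]])
        show "path_action n J (path_elt (i, [ArrX (vtx n (i + 1)), ArrY (vtx n (i + 1))])) m = path_action n J (fps_X \<odot>\<^bsub>RQ n\<^esub> path_elt (i, [])) m" for m
          unfolding path_action_smult[OF path_elt_closed[OF awalk_relations(2)[OF i]]]
            path_action_path[OF awalk_relations(3)[OF i]] path_action_path[OF awalk_relations(2)[OF i]] w
          by (intro restrict_ext) simp
      qed
    next
      case 3
      have eq: "path_action n J (path_elt (xpath i (nat k))) m = path_action n J (path_elt (ypath i (nat (n - k)))) m" for m
        unfolding path_action_xpath path_action_ypath xy_weight end_eq ..
      show ?thesis unfolding 3
        by (rule ann_minus[OF path_elt_xpath_closed path_elt_ypath_closed eq])
    qed
  qed
qed

text \<open>\<open>SOME\<close> may return any representative; it differs from \<open>f\<close> by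
  an element of the ideal, which acts by zero.\<close>

lemma T_smult: 
  assumes f: "f \<in> carrier (RQ n)"
  shows "C.cls f \<odot>\<^bsub>T\<^esub> m = path_action n J f m"
proof -
  define g where "g = (SOME g. g \<in> C.cls f)"
  have "g \<in> C.cls f" unfolding g_def using C.cls_self[OF f] by (rule someI[where P = "\<lambda>g. g \<in> C.cls f"])
  then obtain h where h: "h \<in> C_ideal k n" "g = h \<oplus>\<^bsub>RQ n\<^esub> f"
    by (auto simp: C.cls_def a_r_coset_def')
  then have "h \<in> ann" using C_ideal_ann by blast
  then have "path_action n J g m = path_action n J f m"
    using f path_action_extensional[of J f m]
    by (auto simp: h(2) ann_def path_action_add PiE_def extensional_def)
  then show ?thesis by (simp add: rank_one_module_def g_def)
qed

lemma T_closed: "c \<in> carrier C \<Longrightarrow> c \<odot>\<^bsub>T\<^esub> m \<in> carrier T"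
proof -
  assume "c \<in> carrier C"
  then obtain f where f: "f \<in> carrier (RQ n)" "c = C.cls f" by (auto simp: C.\<Lambda>_carrier)
  show ?thesis unfolding f(2) T_smult[OF f(1)] T_simps(1) by (rule path_action_extensional)
qed

lemma T_\<rho>: "m \<in> carrier T \<Longrightarrow> C.\<rho> r \<odot>\<^bsub>T\<^esub> m = (\<lambda>v\<in>{1..n}. r * m v)"
proof -
  assume m: "m \<in> carrier T"
  have "path_action n J \<one>\<^bsub>RQ n\<^esub> m v = m v" if v: "v \<in> {1..n}" for v
  proof -
    have inj: "inj_on (\<lambda>u. (u, [])) {1..n}" by (auto simp: inj_on_def)
    have sub: "{w. \<one>\<^bsub>RQ n\<^esub> w \<noteq> (0 :: complex fps)} \<subseteq> (\<lambda>u. (u, [])) ` {1..n}"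
      by (auto simp: PA_one quiver_simps split: if_splits)
    have A: "path_action n J \<one>\<^bsub>RQ n\<^esub> m v = (\<Sum>u\<in>{1..n}. if u = vtx n v then m u else 0)"
      unfolding path_action_sum[OF finite_imageI[OF finite_atLeastAtMost_int] sub v] sum.reindex[OF inj] o_def
    proof (intro sum.cong refl)
      fix u assume u: "u \<in> {1..n}"
      have "\<one>\<^bsub>RQ n\<^esub> (u, []) = (1 :: complex fps)" using u by (simp add: PA_one quiver_simps)
      moreover have "awalk u [] v \<longleftrightarrow> u = vtx n v" using u v by (auto simp: awalk_Nil_iff quiver_simps)
      ultimately show "(case (u, []) of (u, p) \<Rightarrow> if awalk u p v then \<one>\<^bsub>RQ n\<^esub> (u, p) * path_weight J p * m u else 0)
          = (if u = vtx n v then m u else 0)"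
        by (simp only: prod.case path_weight_def list.map prod_list.Nil mult_1_left mult_1_right)
    qed
    show ?thesis using v unfolding A sum_vtx_delta by simp
  qed
  then show ?thesis
    unfolding C.\<rho>_cls T_smult[OF PA_smult_closed[OF PA_one_closed]] path_action_smult[OF PA_one_closed]
    by (intro restrict_ext) simp
qed

lemma T_E: "E i \<odot>\<^bsub>T\<^esub> m = (\<lambda>v\<in>{1..n}. if v = vtx n i then m v else 0)"
proof -
  have w: "awalk (vtx n i) [] (vtx n i)" by (simp add: awalk_Nil_iff quiver_simps)
  show ?thesis
    unfolding E_def T_smult[OF nil_closed] path_action_path[OF w]
    by (intro restrict_ext) (simp add: path_weight_def)
qed

lemma T_x: "x \<odot>\<^bsub>T\<^esub> m = (\<lambda>v\<in>{1..n}. (if v \<in> J then 1 else fps_X) * m (vtx n (v - 1)))"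
  unfolding x_def T_smult[OF x_elt_closed] path_action_x_elt ..

lemma T_y: "y \<odot>\<^bsub>T\<^esub> m = (\<lambda>v\<in>{1..n}. (if vtx n (v + 1) \<in> J then fps_X else 1) * m (vtx n (v + 1)))"
  unfolding y_def T_smult[OF y_elt_closed] path_action_y_elt ..

text \<open>The path from \<open>v\<close> down to the vertex * runs through y_v, ..., y_1 and picks
  up a factor t for each label in \<open>J\<close>. These exponents govern the homomorphisms out of
  \<open>M_J\<close>.\<close>

lemma T_y_pow_E:
  assumes "v \<le> nat n"
  shows "(y [^]\<^bsub>C\<^esub> v \<otimes>\<^bsub>C\<^esub> E (int v)) \<odot>\<^bsub>T\<^esub> m
    = (\<lambda>u\<in>{1..n}. if u = n then fps_X ^ card (J \<inter> {1..int v}) * m (vtx n (int v)) else 0)"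
proof -
  have "{l \<in> {int v - int v + 1..int v}. vtx n l \<in> J} = J \<inter> {1..int v}"
    using assms by auto
  moreover have "vtx n (int v - int v) = n" by (simp add: vtx_zero)
  ultimately show ?thesis
    unfolding y_pow_E T_smult[OF path_elt_ypath_closed] path_action_ypath path_weight_ypath
    by (simp only:)
qed

lemma T_left_module: "left_module C T"
proof (intro left_module.intro left_module_axioms.intro)
  show "ring C" by (rule C.\<Lambda>_ring)
  show "abelian_group T"
  proof (rule abelian_groupI)
    fix m assume m: "m \<in> carrier T"
    then show "\<exists>m'\<in>carrier T. m' \<oplus>\<^bsub>T\<^esub> m = \<zero>\<^bsub>T\<^esub>"
      by (intro bexI[of _ "\<lambda>v\<in>{1..n}. - m v"]) (auto simp: T_simps)
    show "\<zero>\<^bsub>T\<^esub> \<oplus>\<^bsub>T\<^esub> m = m"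
      using m by (intro T_ext) (auto simp: T_simps)
  qed (auto simp: T_simps algebra_simps)
next
  fix a m assume a: "a \<in> carrier C" and m: "m \<in> carrier T"
  show "a \<odot>\<^bsub>T\<^esub> m \<in> carrier T" using a by (rule T_closed)
  obtain f where f: "f \<in> carrier (RQ n)" "a = C.cls f" using a by (auto simp: C.\<Lambda>_carrier)
  have act: "a \<odot>\<^bsub>T\<^esub> m = path_action n J f m" for m using T_smult[OF f(1)] f(2) by simp
  fix m' assume "m' \<in> carrier T"
  show "a \<odot>\<^bsub>T\<^esub> (m \<oplus>\<^bsub>T\<^esub> m') = a \<odot>\<^bsub>T\<^esub> m \<oplus>\<^bsub>T\<^esub> a \<odot>\<^bsub>T\<^esub> m'"
    unfolding act T_simps(3) by (rule path_action_add_right[OF f(1)])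
next
  fix a b m assume a: "a \<in> carrier C" and b: "b \<in> carrier C"
  obtain f g where fg: "f \<in> carrier (RQ n)" "a = C.cls f" "g \<in> carrier (RQ n)" "b = C.cls g"
    using a b by (auto simp: C.\<Lambda>_carrier)
  have act: "a \<odot>\<^bsub>T\<^esub> m = path_action n J f m" "b \<odot>\<^bsub>T\<^esub> m = path_action n J g m" for m
    using T_smult[OF fg(1)] T_smult[OF fg(3)] fg(2,4) by simp_all
  have sum: "(a \<oplus>\<^bsub>C\<^esub> b) \<odot>\<^bsub>T\<^esub> m = path_action n J (f \<oplus>\<^bsub>RQ n\<^esub> g) m"
    using T_smult[OF PA_add_closed[OF fg(1,3)], of m] by (simp only: C.cls_hom(1)[OF fg(1,3)] fg(2,4))
  show "(a \<oplus>\<^bsub>C\<^esub> b) \<odot>\<^bsub>T\<^esub> m = a \<odot>\<^bsub>T\<^esub> m \<oplus>\<^bsub>T\<^esub> b \<odot>\<^bsub>T\<^esub> m"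
    unfolding sum act T_simps(3) by (rule path_action_add[OF fg(1,3)])
  have prod: "(a \<otimes>\<^bsub>C\<^esub> b) \<odot>\<^bsub>T\<^esub> m = path_action n J (f \<otimes>\<^bsub>RQ n\<^esub> g) m"
    using T_smult[OF PA_mult_closed[OF fg(1,3)], of m] by (simp only: C.cls_hom(2)[OF fg(1,3)] fg(2,4))
  show "(a \<otimes>\<^bsub>C\<^esub> b) \<odot>\<^bsub>T\<^esub> m = a \<odot>\<^bsub>T\<^esub> (b \<odot>\<^bsub>T\<^esub> m)"
    unfolding prod act by (rule path_action_mult[OF fg(1,3)])
next
  fix m assume m: "m \<in> carrier T"
  show "\<one>\<^bsub>C\<^esub> \<odot>\<^bsub>T\<^esub> m = m"
    using T_\<rho>[OF m, of 1] m by (intro T_ext) (auto simp: T_simps)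
qed

end

section \<open>Codimension\<close>

locale codim_space = vector_space scale
  for scale :: "'a::field \<Rightarrow> 'b::ab_group_add \<Rightarrow> 'b" (infixr \<open>*s\<close> 75)
begin

text \<open>\<open>B\<close> represents a basis of \<open>U\<close> modulo \<open>W\<close>. The
  spaces in the application are in general infinite dimensional, so the quotient is measured by such
  finite sets and not by comparing dimensions of \<open>U\<close> and \<open>W\<close>.\<close>

definition basis_mod :: "'b set \<Rightarrow> 'b set \<Rightarrow> 'b set \<Rightarrow> bool" where
  "basis_mod U W B \<longleftrightarrow> finite B \<and> B \<subseteq> U \<and> (\<forall>u\<in>U. \<exists>b\<in>span B. u - b \<in> W) \<and>
     (\<forall>c. (\<Sum>b\<in>B. c b *s b) \<in> W \<longrightarrow> (\<forall>b\<in>B. c b = 0))"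

text \<open>A relation and not a function, so that it also asserts that the codimension is
  finite.\<close>

definition codim :: "'b set \<Rightarrow> 'b set \<Rightarrow> nat \<Rightarrow> bool" where
  "codim U W d \<longleftrightarrow> (\<exists>B. basis_mod U W B \<and> card B = d)"

lemma basis_mod_span:
  "\<lbrakk>basis_mod U W B; u \<in> U\<rbrakk> \<Longrightarrow> \<exists>b\<in>span B. u - b \<in> W"
  by (simp add: basis_mod_def)

lemma basis_mod_indep:
  "\<lbrakk>basis_mod U W B; (\<Sum>b\<in>B. c b *s b) \<in> W; b \<in> B\<rbrakk> \<Longrightarrow> c b = 0"
  by (simp add: basis_mod_def)

text \<open>Each element of \<open>B'\<close> is congruent modulo \<open>W'\<close> to some
  \<open>p b\<close> in the span of \<open>B\<close>. A relation among the \<open>p b\<close> is a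
  relation among the elements of \<open>B'\<close> modulo \<open>W'\<close>, so the
  \<open>p b\<close> are distinct and independent, and the exchange bound applies.\<close>

lemma basis_mod_card_mono:
  assumes B: "basis_mod U W B" and B': "basis_mod U W' B'" and "W \<subseteq> W'" and W': "subspace W'"
  shows "card B' \<le> card B"
proof -
  have "\<forall>b\<in>B'. \<exists>p. p \<in> span B \<and> b - p \<in> W'"
  proof
    fix b assume "b \<in> B'"
    then have "b \<in> U" using B' by (auto simp: basis_mod_def)
    from basis_mod_span[OF B this] show "\<exists>p. p \<in> span B \<and> b - p \<in> W'"
      using \<open>W \<subseteq> W'\<close> by blast
  qed
  then obtain p where p: "\<And>b. b \<in> B' \<Longrightarrow> p b \<in> span B" "\<And>b. b \<in> B' \<Longrightarrow> b - p b \<in> W'"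
    by metis
  have fin: "finite B'" "finite B"
    using B B' unfolding basis_mod_def by auto
  have ind: "\<forall>b\<in>B'. c b = 0" if "(\<Sum>b\<in>B'. c b *s p b) = 0" for c
  proof -
    have "(\<Sum>b\<in>B'. c b *s (b - p b)) \<in> W'"
      using p(2) W' by (intro subspace_sum subspace_scale) auto
    also have "(\<Sum>b\<in>B'. c b *s (b - p b)) = (\<Sum>b\<in>B'. c b *s b)"
      using that by (simp add: scale_right_diff_distrib sum_subtractf)
    finally show ?thesis
      by (intro ballI basis_mod_indep[OF B'])
  qed
  have inj: "inj_on p B'"
  proof
    fix a b assume ab: "a \<in> B'" "b \<in> B'" "p a = p b"
    show "a = b"
    proof (rule ccontr)
      assume ne: "a \<noteq> b"
      define c where "c = (\<lambda>x. if x = a then 1 else if x = b then -1 else (0::'a))"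
      have "(\<Sum>x\<in>B'. c x *s p x) = (\<Sum>x\<in>{a, b}. c x *s p x)"
        using ab fin by (intro sum.mono_neutral_right) (auto simp: c_def)
      also have "\<dots> = 0" using ne ab(3) by (simp add: c_def)
      finally have "c a = 0" using ind ab(1) by blast
      then show False by (simp add: c_def)
    qed
  qed
  have "independent (p ` B')"
  proof
    assume "dependent (p ` B')"
    then obtain u where u: "\<exists>v\<in>p ` B'. u v \<noteq> 0" "(\<Sum>v\<in>p ` B'. u v *s v) = 0"
      using fin by (auto simp: dependent_finite)
    then have "(\<Sum>b\<in>B'. u (p b) *s p b) = 0"
      by (simp add: sum.reindex[OF inj])
    then have "\<forall>b\<in>B'. u (p b) = 0" by (rule ind[of "u \<circ> p", simplified])
    then show False using u(1) by blast
  qed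
  then have "card (p ` B') \<le> card B"
    using independent_span_bound[OF fin(2)] p(1) by auto
  then show ?thesis using card_image[OF inj] by simp
qed

lemma codim_mono:
  "\<lbrakk>codim U W d; codim U W' d'; W \<subseteq> W'; subspace W'\<rbrakk> \<Longrightarrow> d' \<le> d"
  unfolding codim_def using basis_mod_card_mono by blast

lemma codim_unique: "\<lbrakk>codim U W d; codim U W d'; subspace W\<rbrakk> \<Longrightarrow> d' = d"
  using codim_mono by (metis order_antisym order_refl)

lemma codim_self: "subspace U \<Longrightarrow> U \<subseteq> W \<Longrightarrow> codim U W 0"
  unfolding codim_def basis_mod_def by (intro exI[of _ "{}"]) (auto simp: span_empty)

text \<open>A generating set modulo \<open>W\<close> of least cardinality is independent modulo
  \<open>W\<close>: a nontrivial relation would allow one generator to be traded for the combination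
  \<open>s\<close> of the others.\<close>

lemma codim_exists:
  assumes "finite S" "S \<subseteq> U" "\<And>u. u \<in> U \<Longrightarrow> \<exists>b\<in>span S. u - b \<in> W" and W: "subspace W"
  shows "\<exists>d. codim U W d"
proof -
  define P where "P = (\<lambda>S. finite S \<and> S \<subseteq> U \<and> (\<forall>u\<in>U. \<exists>b\<in>span S. u - b \<in> W))"
  have "P S" using assms unfolding P_def by blast
  then obtain B where B: "P B" and min: "\<And>C. P C \<Longrightarrow> card B \<le> card C"
    using ex_has_least_nat[of P S card] by blast
  have "\<forall>b\<in>B. c b = 0" if c: "(\<Sum>b\<in>B. c b *s b) \<in> W" for c
  proof (rule ccontr)
    assume "\<not> ?thesis"
    then obtain b where b: "b \<in> B" "c b \<noteq> 0" by blast
    have fB: "finite B" using B by (simp add: P_def)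
    define s where "s = - (inverse (c b) *s (\<Sum>x\<in>B - {b}. c x *s x))"
    have s: "s \<in> span (B - {b})"
      unfolding s_def by (intro span_neg span_scale span_sum) (auto intro: span_base)
    have bs: "b - s \<in> W"
    proof -
      have "inverse (c b) *s (\<Sum>x\<in>B. c x *s x) \<in> W" using c W by (rule subspace_scale[rotated])
      also have "inverse (c b) *s (\<Sum>x\<in>B. c x *s x) = b - s"
        using b fB by (simp add: s_def sum.remove scale_right_distrib)
      finally show ?thesis .
    qed
    have "P (B - {b})"
      unfolding P_def
    proof (intro conjI ballI)
      fix u assume "u \<in> U"
      then obtain v where v: "v \<in> span B" "u - v \<in> W" using B unfolding P_def by blast
      then obtain a where a: "v - a *s b \<in> span (B - {b})"
        using span_breakdown[OF b(1)] by blast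
      have "v - a *s b + a *s s \<in> span (B - {b})"
        using a s by (intro span_add span_scale)
      moreover have "u - (v - a *s b + a *s s) = (u - v) + a *s (b - s)"
        by (simp add: algebra_simps scale_right_diff_distrib)
      moreover have "(u - v) + a *s (b - s) \<in> W"
        using v(2) bs W by (intro subspace_add subspace_scale)
      ultimately show "\<exists>b'\<in>span (B - {b}). u - b' \<in> W" by metis
    qed (use B in \<open>auto simp: P_def\<close>)
    from min[OF this] have "card B \<le> card (B - {b})" .
    moreover have "card (B - {b}) < card B" using b(1) fB by (rule card_Diff1_less[rotated])
    ultimately show False by simp
  qed
  then have "basis_mod U W B" using B unfolding P_def basis_mod_def by blast
  then show ?thesis unfolding codim_def by blast
qed

text \<open>This is exactness of \<open>0 \<rightarrow> U/T\<^sup>-\<^sup>1W \<rightarrow> U/W \<rightarrow> U/(W + TU) \<rightarrow> 0\<close>, on bases.\<close>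

lemma codim_exact:
  assumes T: "\<And>x y. T (x + y) = T x + T y" "\<And>c x. T (c *s x) = c *s T x" "inj T" "T ` U \<subseteq> U"
    and U: "subspace U" and W: "subspace W"
    and d1: "codim U {w + T u |w u. w \<in> W \<and> u \<in> U} d1" and d2: "codim U {u. T u \<in> W} d2"
  shows "codim U W (d1 + d2)"
proof -
  obtain B C where B: "basis_mod U {w + T u |w u. w \<in> W \<and> u \<in> U} B" "card B = d1"
    and C: "basis_mod U {u. T u \<in> W} C" "card C = d2"
    using d1 d2 unfolding codim_def by blast
  interpret T: Vector_Spaces.linear scale scale T
    using T by unfold_locales auto
  have fin: "finite B" "finite C" and sub: "B \<subseteq> U" "C \<subseteq> U"
    using B C unfolding basis_mod_def by auto
  have sum_image: "(\<Sum>x\<in>T ` C. c x *s x) = T (\<Sum>x\<in>C. c (T x) *s x)" for c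
    by (subst sum.reindex) (auto simp: T.sum T.scale inj_on_subset[OF T(3)])
  have span_C: "\<exists>b\<in>span (T ` C). T u - b \<in> W" if u: "u \<in> U" for u
  proof -
    obtain b where b: "b \<in> span C" "T (u - b) \<in> W"
      using basis_mod_span[OF C(1) u] by auto
    have "T b \<in> span (T ` C)"
      using b(1) by (simp add: T.span_image)
    then show ?thesis using b(2) T.diff by metis
  qed
  have in_U: "(\<Sum>x\<in>C. c x *s x) \<in> U" for c
    using sub U by (intro subspace_sum subspace_scale) auto
  \<comment> \<open>Images under \<open>T\<close> vanish modulo W + TU, whereas the elements of
    \<open>B\<close> do not.\<close>
  have disj: "B \<inter> T ` C = {}"
  proof (rule ccontr)
    assume "B \<inter> T ` C \<noteq> {}"
    then obtain b where b: "T b \<in> B" "b \<in> C" by blast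
    define c where "c = (\<lambda>x. if x = T b then 1 else (0::'a))"
    have "(\<Sum>x\<in>B. c x *s x) = (\<Sum>x\<in>{T b}. c x *s x)"
      using b fin by (intro sum.mono_neutral_right) (auto simp: c_def)
    also have "\<dots> = 0 + T b" by (simp add: c_def)
    finally have "(\<Sum>x\<in>B. c x *s x) \<in> {w + T u |w u. w \<in> W \<and> u \<in> U}"
      using subspace_0[OF W] b sub by blast
    then have "c (T b) = 0" using basis_mod_indep[OF B(1)] b by blast
    then show False by (simp add: c_def)
  qed
  \<comment> \<open>A basis modulo W + TU, together with the image of a basis modulo the preimage of
    \<open>W\<close>. Injectivity of \<open>T\<close> keeps the number of elements of
    \<open>C\<close>.\<close>
  have "basis_mod U W (B \<union> T ` C)"
    unfolding basis_mod_def
  proof (intro conjI ballI allI impI)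
    show "finite (B \<union> T ` C)" "B \<union> T ` C \<subseteq> U" using fin sub T(4) by auto
  next
    fix u assume "u \<in> U"
    then obtain b where "b \<in> span B" "u - b \<in> {w + T u |w u. w \<in> W \<and> u \<in> U}"
      using basis_mod_span[OF B(1)] by blast
    then obtain w v where b: "b \<in> span B" "u - b = w + T v" "w \<in> W" "v \<in> U" by blast
    obtain b' where b': "b' \<in> span (T ` C)" "T v - b' \<in> W" using span_C[OF b(4)] by blast
    have "b + b' \<in> span (B \<union> T ` C)"
      using b(1) b'(1) by (intro span_add) (meson Un_upper1 Un_upper2 span_mono subsetD)+
    moreover have "u - (b + b') = w + (T v - b')" using b(2) by (simp add: algebra_simps)
    ultimately show "\<exists>b\<in>span (B \<union> T ` C). u - b \<in> W"
      using b(3) b'(2) subspace_add[OF W] by metis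
  next
    fix c x assume c: "(\<Sum>b\<in>B \<union> T ` C. c b *s b) \<in> W" and x: "x \<in> B \<union> T ` C"
    have eq: "(\<Sum>b\<in>B \<union> T ` C. c b *s b) = (\<Sum>b\<in>B. c b *s b) + T (\<Sum>x\<in>C. c (T x) *s x)"
      using fin disj by (simp add: sum.union_disjoint sum_image)
    have "(\<Sum>b\<in>B. c b *s b) = (\<Sum>b\<in>B \<union> T ` C. c b *s b) + T (- (\<Sum>x\<in>C. c (T x) *s x))"
      by (simp add: eq T.neg)
    moreover have "- (\<Sum>x\<in>C. c (T x) *s x) \<in> U" by (intro subspace_neg[OF U] in_U)
    ultimately have "(\<Sum>b\<in>B. c b *s b) \<in> {w + T u |w u. w \<in> W \<and> u \<in> U}"
      using c by blast
    then have cB: "\<forall>b\<in>B. c b = 0" using basis_mod_indep[OF B(1)] by blast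
    then have "T (\<Sum>x\<in>C. c (T x) *s x) \<in> W" using c eq by simp
    then have "\<forall>x\<in>C. c (T x) = 0"
      using basis_mod_indep[OF C(1), of "c \<circ> T"] by simp
    then show "c x = 0" using x cB by blast
  qed
  moreover have "card (B \<union> T ` C) = d1 + d2"
    using fin disj B(2) C(2) card_image[OF inj_on_subset[OF T(3)], of C]
    by (simp add: card_Un_disjoint)
  ultimately show ?thesis unfolding codim_def by blast
qed

end

section \<open>Complex codimension of submodules of a free module over the power series ring\<close>

definition rscale :: "complex fps \<Rightarrow> ('i \<Rightarrow> complex fps) \<Rightarrow> 'i \<Rightarrow> complex fps" where
  "rscale r f = (\<lambda>i. r * f i)"

definition cscale :: "complex \<Rightarrow> ('i \<Rightarrow> complex fps) \<Rightarrow> 'i \<Rightarrow> complex fps" where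
  "cscale z = rscale (fps_const z)"

interpretation cx: codim_space cscale
  by unfold_locales
    (auto simp: cscale_def rscale_def plus_fun_def algebra_simps fps_const_add[symmetric]
      fps_const_mult[symmetric] simp del: fps_const_add fps_const_mult)

text \<open>The free module \<open>R^S\<close>, kept inside a full function type so that its
  addition is the pointwise one of the type class.\<close>

definition supported_on :: "'i set \<Rightarrow> ('i \<Rightarrow> complex fps) set" where
  "supported_on S = {f. \<forall>i. i \<notin> S \<longrightarrow> f i = 0}"

definition unit_fun :: "'i \<Rightarrow> 'i \<Rightarrow> complex fps" where
  "unit_fun i = (\<lambda>j. if j = i then 1 else 0)"

definition R_submodule :: "('i \<Rightarrow> complex fps) set \<Rightarrow> bool" where
  "R_submodule U \<longleftrightarrow> 0 \<in> U \<and> (\<forall>x\<in>U. \<forall>y\<in>U. x + y \<in> U) \<and> (\<forall>r. \<forall>x\<in>U. rscale r x \<in> U)"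

lemma R_submodule_subspace: "R_submodule U \<Longrightarrow> cx.subspace U"
  unfolding R_submodule_def cx.subspace_def cscale_def by auto

lemma R_submodule_supported_on: "R_submodule (supported_on S)"
  by (auto simp: R_submodule_def supported_on_def rscale_def)

lemma rscale_rscale: "rscale r (rscale s f) = rscale (r * s) f"
  by (simp add: rscale_def mult.assoc)

lemma rscale_zero [simp]: "rscale r 0 = 0"
  by (simp add: rscale_def zero_fun_def)

lemma rscale_add: "rscale r (f + g) = rscale r f + rscale r g"
  by (simp add: rscale_def plus_fun_def algebra_simps)

lemma rscale_one [simp]: "rscale 1 f = f"
  by (simp add: rscale_def)

lemma inj_rscale_X: "inj (rscale fps_X)"
  by (auto simp: inj_on_def rscale_def fun_eq_iff)

lemma rscale_X_cscale: "rscale r (cscale c x) = cscale c (rscale r x)"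
  by (simp add: cscale_def rscale_rscale mult.commute)

lemma sum_apply: "(\<Sum>i\<in>S. f i) x = (\<Sum>i\<in>S. f i x)"
  by (induction S rule: infinite_finite_induct) auto

lemma fps_split: "\<exists>g. f = fps_const (fps_nth f 0) + fps_X * (g :: complex fps)"
proof
  show "f = fps_const (fps_nth f 0) + fps_X * fps_shift 1 f"
    by (rule fps_ext) simp
qed

lemma sum_unit_fun:
  "finite S \<Longrightarrow> (\<Sum>i\<in>S. g i * unit_fun i j) = (if j \<in> S then g j else 0)"
  by (simp add: unit_fun_def if_distrib cong: if_cong)

lemma supported_on_split:
  assumes "finite S" "f \<in> supported_on S"
  shows "f = (\<Sum>i\<in>S. rscale (f i) (unit_fun i))"
  using assms by (auto simp: fun_eq_iff supported_on_def rscale_def sum_apply sum_unit_fun)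

text \<open>Modulo t only the constant terms of the coordinates in \<open>S\<close> survive, so the
  unit functions are a basis of the quotient.\<close>

lemma codim_shift:
  assumes "finite S"
  shows "cx.codim (supported_on S) (rscale fps_X ` supported_on S) (card S)"
proof -
  have inj: "inj_on unit_fun S"
    by (auto simp: inj_on_def unit_fun_def fun_eq_iff)
  have "cx.basis_mod (supported_on S) (rscale fps_X ` supported_on S) (unit_fun ` S)"
    unfolding cx.basis_mod_def
  proof (intro conjI ballI allI impI)
    show "finite (unit_fun ` S)" "unit_fun ` S \<subseteq> supported_on S"
      using assms by (auto simp: unit_fun_def supported_on_def)
  next
    fix f :: "'a \<Rightarrow> complex fps" assume f: "f \<in> supported_on S"
    have "\<forall>i. \<exists>g. f i = fps_const (fps_nth (f i) 0) + fps_X * g"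
      by (intro allI fps_split)
    then obtain g where g: "\<And>i. f i = fps_const (fps_nth (f i) 0) + fps_X * g i"
      by metis
    let ?b = "\<Sum>i\<in>S. cscale (fps_nth (f i) 0) (unit_fun i)"
    have "?b \<in> cx.span (unit_fun ` S)"
      by (intro cx.span_sum cx.span_scale) (auto intro: cx.span_base)
    moreover have "f - ?b = rscale fps_X (\<lambda>i. if i \<in> S then g i else 0)"
    proof
      fix i
      have "?b i = (if i \<in> S then fps_const (fps_nth (f i) 0) else 0)"
        using assms by (simp add: sum_apply cscale_def rscale_def sum_unit_fun)
      then show "(f - ?b) i = rscale fps_X (\<lambda>i. if i \<in> S then g i else 0) i"
        using f g[of i] by (auto simp: rscale_def supported_on_def algebra_simps)
    qed
    moreover have "(\<lambda>i. if i \<in> S then g i else 0) \<in> supported_on S"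
      by (simp add: supported_on_def)
    ultimately show "\<exists>b\<in>cx.span (unit_fun ` S). f - b \<in> rscale fps_X ` supported_on S" by blast
  next
    fix c b assume c: "(\<Sum>b\<in>unit_fun ` S. cscale (c b) b) \<in> rscale fps_X ` supported_on S"
      and b: "b \<in> unit_fun ` S"
    then obtain i where i: "i \<in> S" "b = unit_fun i" by blast
    from c obtain g where "(\<Sum>j\<in>S. cscale (c (unit_fun j)) (unit_fun j)) = rscale fps_X g"
      by (auto simp: sum.reindex[OF inj])
    then have "(\<Sum>j\<in>S. cscale (c (unit_fun j)) (unit_fun j)) i = fps_X * g i"
      by (simp add: rscale_def)
    moreover have "(\<Sum>j\<in>S. cscale (c (unit_fun j)) (unit_fun j)) i = fps_const (c b)"
      using assms i by (simp add: sum_apply cscale_def rscale_def sum_unit_fun)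
    ultimately have "fps_nth (fps_const (c b)) 0 = fps_nth (fps_X * g i) 0" by simp
    then show "c b = 0" by simp
  qed
  then show ?thesis
    unfolding cx.codim_def using card_image[OF inj] by blast
qed

text \<open>Induction on \<open>m\<close> through \<open>codim_exact\<close>: the preimage of
  \<open>W\<close> under t contains a multiple of the whole module by one power of t less, and the
  quotient by W + tU is a quotient of the finite-dimensional U/tU.\<close>

lemma codim_finite:
  assumes "finite S" "R_submodule W" "rscale (fps_X ^ m) ` supported_on S \<subseteq> W"
  shows "\<exists>d. cx.codim (supported_on S) W d"
  using assms
proof (induction m arbitrary: W)
  case 0
  then have "supported_on S \<subseteq> W" by auto
  then show ?case
    using cx.codim_self R_submodule_subspace[OF R_submodule_supported_on] by blast
next
  case (Suc m)
  let ?U = "supported_on S"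
  have Usub: "cx.subspace ?U" by (intro R_submodule_subspace R_submodule_supported_on)
  have Wsub: "cx.subspace W" using Suc.prems(2) by (rule R_submodule_subspace)
  have "R_submodule {u. rscale fps_X u \<in> W}"
    using Suc.prems(2) unfolding R_submodule_def
    by (auto simp: rscale_add rscale_rscale) (metis mult.commute rscale_rscale)
  moreover have "rscale (fps_X ^ m) ` ?U \<subseteq> {u. rscale fps_X u \<in> W}"
    using Suc.prems(3) by (auto simp: rscale_rscale)
  ultimately obtain d2 where d2: "cx.codim ?U {u. rscale fps_X u \<in> W} d2"
    using Suc.IH[OF Suc.prems(1)] by blast
  define W1 where "W1 = {w + rscale fps_X u |w u. w \<in> W \<and> u \<in> ?U}"
  have W1: "cx.subspace W1"
    unfolding cx.subspace_def
  proof (intro conjI ballI allI)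
    show "0 \<in> W1"
      unfolding W1_def using Usub Wsub
      by (force simp: cx.subspace_0 rscale_def intro!: exI[of _ 0])
  next
    fix x y assume "x \<in> W1" "y \<in> W1"
    then obtain w u w' u' where "x = w + rscale fps_X u" "y = w' + rscale fps_X u'"
      "w \<in> W" "w' \<in> W" "u \<in> ?U" "u' \<in> ?U" unfolding W1_def by blast
    then have "x + y = (w + w') + rscale fps_X (u + u')" "w + w' \<in> W" "u + u' \<in> ?U"
      by (auto intro: cx.subspace_add[OF Usub] cx.subspace_add[OF Wsub]
        simp: rscale_add algebra_simps)
    then show "x + y \<in> W1" unfolding W1_def by blast
  next
    fix c x assume "x \<in> W1"
    then obtain w u where "x = w + rscale fps_X u" "w \<in> W" "u \<in> ?U" unfolding W1_def by blast
    then have "cscale c x = cscale c w + rscale fps_X (cscale c u)" "cscale c w \<in> W"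
      "cscale c u \<in> ?U"
      by (auto intro: cx.subspace_scale[OF Usub] cx.subspace_scale[OF Wsub]
        simp: rscale_X_cscale cx.scale_right_distrib)
    then show "cscale c x \<in> W1" unfolding W1_def by blast
  qed
  obtain B where B: "cx.basis_mod ?U (rscale fps_X ` ?U) B"
    using codim_shift[OF Suc.prems(1)] unfolding cx.codim_def by blast
  have "\<exists>d. cx.codim ?U W1 d"
  proof (rule cx.codim_exists[OF _ _ _ W1])
    show "finite B" "B \<subseteq> ?U" using B unfolding cx.basis_mod_def by auto
    fix u assume "u \<in> ?U"
    then obtain b where b: "b \<in> cx.span B" "u - b \<in> rscale fps_X ` ?U"
      using B unfolding cx.basis_mod_def by blast
    then obtain u' where "u' \<in> ?U" "u - b = 0 + rscale fps_X u'" by auto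
    then have "u - b \<in> W1" unfolding W1_def using cx.subspace_0[OF Wsub] by blast
    then show "\<exists>b\<in>cx.span B. u - b \<in> W1" using b by blast
  qed
  then obtain d1 where "cx.codim ?U W1 d1" by blast
  from cx.codim_exact[OF _ _ inj_rscale_X _ Usub Wsub this[unfolded W1_def] d2]
  have "cx.codim ?U W (d1 + d2)"
    using R_submodule_supported_on[of S]
    by (auto simp: rscale_add rscale_X_cscale R_submodule_def)
  then show ?case by blast
qed

lemma (in codim_space) basis_mod_diff_notin:
  assumes B: "basis_mod U W B" and ab: "a \<in> B" "b \<in> B" "a \<noteq> b"
  shows "a - b \<notin> W"
proof
  assume "a - b \<in> W"
  define c where "c = (\<lambda>x. if x = a then 1 else if x = b then -1 else (0::'a))"
  have "finite B" using B by (simp add: basis_mod_def)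
  then have "(\<Sum>x\<in>B. c x *s x) = (\<Sum>x\<in>{a, b}. c x *s x)"
    using ab by (intro sum.mono_neutral_right) (auto simp: c_def)
  also have "\<dots> = a - b" using ab(3) by (simp add: c_def)
  finally have "c a = 0" using \<open>a - b \<in> W\<close> by (intro basis_mod_indep[OF B _ ab(1)]) simp
  then show False by (simp add: c_def)
qed

text \<open>The bridge between the record-based dimension in the definition of
  \<open>\<kappa>\<close> and the relation \<open>codim\<close>: a linear bijection \<open>L\<close>
  onto a function space carries the quotient of \<open>P\<close> by \<open>I\<close> to
  \<open>U\<close> modulo \<open>W\<close>.\<close>

lemma dim_quotient_by:
  fixes P :: "(complex fps, 'p) module" and L :: "'p \<Rightarrow> 'i \<Rightarrow> complex fps"
  assumes bij: "bij_betw L (carrier P) U"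
    and add: "\<And>p q. \<lbrakk>p \<in> carrier P; q \<in> carrier P\<rbrakk> \<Longrightarrow> p \<oplus>\<^bsub>P\<^esub> q \<in> carrier P"
      "\<And>p q. \<lbrakk>p \<in> carrier P; q \<in> carrier P\<rbrakk> \<Longrightarrow> L (p \<oplus>\<^bsub>P\<^esub> q) = L p + L q"
    and zero: "\<zero>\<^bsub>P\<^esub> \<in> carrier P" "L \<zero>\<^bsub>P\<^esub> = 0"
    and smult: "\<And>r p. p \<in> carrier P \<Longrightarrow> r \<odot>\<^bsub>P\<^esub> p \<in> carrier P"
      "\<And>r p. p \<in> carrier P \<Longrightarrow> L (r \<odot>\<^bsub>P\<^esub> p) = rscale r (L p)"
    and W: "cx.subspace W" and I: "I = {p \<in> carrier P. L p \<in> W}" and d: "cx.codim U W d"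
  shows "vectorspace.dim class_ring (complex_scalars (quotient_by P I)) = d"
proof -
  have inj: "p = q" if "L p = L q" "p \<in> carrier P" "q \<in> carrier P" for p q
    using bij that by (auto simp: bij_betw_def inj_on_def)
  have neg: "L ((-1) \<odot>\<^bsub>P\<^esub> p) = - L p" if "p \<in> carrier P" for p
    using smult(2)[OF that, of "-1"] by (simp add: rscale_def fun_eq_iff)
  \<comment> \<open>The group laws of \<open>P\<close> are pulled back along the injective map
    \<open>L\<close>.\<close>
  interpret P: abelian_group P
  proof (rule abelian_groupI)
    fix x assume "x \<in> carrier P"
    then show "\<exists>y\<in>carrier P. y \<oplus>\<^bsub>P\<^esub> x = \<zero>\<^bsub>P\<^esub>"
      by (intro bexI[of _ "(-1) \<odot>\<^bsub>P\<^esub> x"] inj) (auto simp: add zero smult(1) neg)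
  qed (auto intro!: inj simp: add zero algebra_simps)
  have smult_laws: "(r * s) \<odot>\<^bsub>P\<^esub> p = r \<odot>\<^bsub>P\<^esub> (s \<odot>\<^bsub>P\<^esub> p)" "1 \<odot>\<^bsub>P\<^esub> p = p"
    "(r + s) \<odot>\<^bsub>P\<^esub> p = r \<odot>\<^bsub>P\<^esub> p \<oplus>\<^bsub>P\<^esub> s \<odot>\<^bsub>P\<^esub> p"
    "r \<odot>\<^bsub>P\<^esub> (p \<oplus>\<^bsub>P\<^esub> q) = r \<odot>\<^bsub>P\<^esub> p \<oplus>\<^bsub>P\<^esub> r \<odot>\<^bsub>P\<^esub> q"
    if "p \<in> carrier P" "q \<in> carrier P" for r s p q
    using that by (auto intro!: inj simp: smult add)
      (auto simp: rscale_def fun_eq_iff algebra_simps)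
  define Q where "Q = complex_scalars (quotient_by P I)"
  define cos where "cos = (\<lambda>p. I +>\<^bsub>P\<^esub> p)"
  have mem_cos: "x \<in> cos p \<longleftrightarrow> x \<in> carrier P \<and> L x - L p \<in> W" if p: "p \<in> carrier P" for x p
  proof
    assume "x \<in> cos p"
    then show "x \<in> carrier P \<and> L x - L p \<in> W"
      using p by (auto simp: cos_def a_r_coset_def' I add)
  next
    assume x: "x \<in> carrier P \<and> L x - L p \<in> W"
    have "x = (x \<oplus>\<^bsub>P\<^esub> ((-1) \<odot>\<^bsub>P\<^esub> p)) \<oplus>\<^bsub>P\<^esub> p"
      using x p by (intro inj) (auto simp: add smult(1) neg)
    moreover have "x \<oplus>\<^bsub>P\<^esub> ((-1) \<odot>\<^bsub>P\<^esub> p) \<in> I"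
      using x p by (auto simp: I add smult(1) neg)
    ultimately show "x \<in> cos p" by (auto simp: cos_def a_r_coset_def')
  qed
  have cos_eq: "cos p = cos q \<longleftrightarrow> L p - L q \<in> W" if p: "p \<in> carrier P" and q: "q \<in> carrier P" for p q
  proof
    assume "cos p = cos q"
    moreover have "p \<in> cos p" using p W by (simp add: mem_cos cx.subspace_0)
    ultimately show "L p - L q \<in> W" using q by (simp add: mem_cos)
  next
    assume *: "L p - L q \<in> W"
    have "L x - L p \<in> W \<longleftrightarrow> L x - L q \<in> W" for x
      using cx.subspace_add[OF W, of "L x - L p" "L p - L q"] 
        cx.subspace_diff[OF W, of "L x - L q" "L p - L q"] * by auto
    then show "cos p = cos q" using p q by (auto simp: mem_cos)
  qed
  have carr: "carrier Q = cos ` carrier P"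
    by (auto simp: Q_def complex_scalars_def quotient_by_def FactRing_def A_RCOSETS_def' cos_def)
  have zeroQ: "\<zero>\<^bsub>Q\<^esub> = cos \<zero>\<^bsub>P\<^esub>"
    using zero by (auto simp: Q_def complex_scalars_def quotient_by_def FactRing_def mem_cos I)
  have addQ: "cos p \<oplus>\<^bsub>Q\<^esub> cos q = cos (p \<oplus>\<^bsub>P\<^esub> q)" if p: "p \<in> carrier P" and q: "q \<in> carrier P" for p q
  proof -
    have "cos p \<oplus>\<^bsub>Q\<^esub> cos q = (\<Union>h\<in>cos p. \<Union>k\<in>cos q. {h \<oplus>\<^bsub>P\<^esub> k})"
      by (simp add: Q_def complex_scalars_def quotient_by_def FactRing_def set_add_def')
    also have "\<dots> = cos (p \<oplus>\<^bsub>P\<^esub> q)"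
    proof (intro equalityI subsetI)
      fix x assume "x \<in> (\<Union>h\<in>cos p. \<Union>k\<in>cos q. {h \<oplus>\<^bsub>P\<^esub> k})"
      then obtain h k where hk: "h \<in> cos p" "k \<in> cos q" "x = h \<oplus>\<^bsub>P\<^esub> k" by blast
      then have "(L h - L p) + (L k - L q) \<in> W"
        using p q by (intro cx.subspace_add[OF W]) (auto simp: mem_cos)
      then show "x \<in> cos (p \<oplus>\<^bsub>P\<^esub> q)"
        using hk p q by (auto simp: mem_cos add add_diff_add)
    next
      fix x assume x: "x \<in> cos (p \<oplus>\<^bsub>P\<^esub> q)"
      define h where "h = x \<oplus>\<^bsub>P\<^esub> ((-1) \<odot>\<^bsub>P\<^esub> q)"
      have xc: "x \<in> carrier P" using x p q by (simp add: mem_cos add)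
      have "x = h \<oplus>\<^bsub>P\<^esub> q"
        unfolding h_def using xc q by (intro inj) (auto simp: add smult(1) neg)
      moreover have "h \<in> cos p"
        using x xc p q by (auto simp: h_def mem_cos add smult(1) neg algebra_simps)
      moreover have "q \<in> cos q" using q W by (simp add: mem_cos cx.subspace_0)
      ultimately show "x \<in> (\<Union>h\<in>cos p. \<Union>k\<in>cos q. {h \<oplus>\<^bsub>P\<^esub> k})" by blast
    qed
    finally show ?thesis .
  qed
  have smultQ: "z \<odot>\<^bsub>Q\<^esub> cos p = cos (fps_const z \<odot>\<^bsub>P\<^esub> p)" if p: "p \<in> carrier P" for z p
  proof -
    have "z \<odot>\<^bsub>Q\<^esub> cos p = (\<Union>x\<in>cos p. cos (fps_const z \<odot>\<^bsub>P\<^esub> x))"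
      by (simp add: Q_def complex_scalars_def quotient_by_def cos_def)
    moreover have "cos (fps_const z \<odot>\<^bsub>P\<^esub> x) = cos (fps_const z \<odot>\<^bsub>P\<^esub> p)" if x: "x \<in> cos p" for x
    proof -
      have "cscale z (L x - L p) \<in> W" using x p W by (simp add: mem_cos cx.subspace_scale)
      then show ?thesis
        using x p by (simp add: mem_cos cos_eq smult cx.scale_right_diff_distrib)
          (simp add: cscale_def)
    qed
    moreover have "p \<in> cos p" using p W by (simp add: mem_cos cx.subspace_0)
    ultimately show ?thesis by blast
  qed
  interpret Q: vectorspace class_ring Q
  proof (rule vs_criteria)
    show "field (class_ring :: complex ring)" by (rule class_field)
    show "\<forall>v\<in>carrier Q. \<exists>w\<in>carrier Q. v \<oplus>\<^bsub>Q\<^esub> w = \<zero>\<^bsub>Q\<^esub>"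
    proof
      fix v assume "v \<in> carrier Q"
      then obtain p where p: "p \<in> carrier P" "v = cos p" by (auto simp: carr)
      have "p \<oplus>\<^bsub>P\<^esub> ((-1) \<odot>\<^bsub>P\<^esub> p) = \<zero>\<^bsub>P\<^esub>" using p by (intro inj) (auto simp: add zero smult(1) neg)
      then show "\<exists>w\<in>carrier Q. v \<oplus>\<^bsub>Q\<^esub> w = \<zero>\<^bsub>Q\<^esub>"
        using p smult(1) by (intro bexI[of _ "cos ((-1) \<odot>\<^bsub>P\<^esub> p)"]) (auto simp: carr zeroQ addQ)
    qed
  qed (auto simp: carr zeroQ addQ smultQ zero add smult smult_laws P.a_ac
      fps_const_add[symmetric] fps_const_mult[symmetric] simp del: fps_const_add fps_const_mult)
  obtain B where B: "cx.basis_mod U W B" "card B = d" using d unfolding cx.codim_def by blast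
  have fB: "finite B" and BU: "B \<subseteq> U" using B by (auto simp: cx.basis_mod_def)
  define \<psi> where "\<psi> = inv_into (carrier P) L"
  have \<psi>: "\<psi> u \<in> carrier P" "L (\<psi> u) = u" if "u \<in> U" for u
    using bij that by (auto simp: \<psi>_def bij_betw_def inv_into_into f_inv_into_f)
  have L_in_U: "L p \<in> U" if "p \<in> carrier P" for p
    using bij that by (auto simp: bij_betw_def)
  have \<psi>L: "\<psi> (L p) = p" if "p \<in> carrier P" for p
    using that by (intro inj) (auto simp: \<psi> L_in_U)
  have U0: "0 \<in> U" using L_in_U[OF zero(1)] zero(2) by simp
  have U_add: "u + v \<in> U" if "u \<in> U" "v \<in> U" for u v
    using L_in_U[OF add(1), of "\<psi> u" "\<psi> v"] that by (simp add: add \<psi>)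
  have U_scale: "cscale z u \<in> U" if "u \<in> U" for z u
    using L_in_U[OF smult(1), of "\<psi> u" "fps_const z"] that by (simp add: smult \<psi> cscale_def)
  have U_sum: "(\<Sum>b\<in>F. cscale (c b) b) \<in> U" if "F \<subseteq> U" for F c
    using that by (induction F rule: infinite_finite_induct) (auto intro: U0 U_add U_scale)
  \<comment> \<open>The classes of the preimages of the elements of \<open>B\<close>. They stay
    distinct because two elements of a basis modulo \<open>W\<close> are never congruent.\<close>
  define \<beta> where "\<beta> = (\<lambda>b. cos (\<psi> b))"
  have \<beta>_inj: "inj_on \<beta> B"
  proof
    fix a b assume ab: "a \<in> B" "b \<in> B" "\<beta> a = \<beta> b"
    then have "a - b \<in> W" using BU by (auto simp: \<beta>_def cos_eq \<psi> subset_iff)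
    then show "a = b" using cx.basis_mod_diff_notin[OF B(1) ab(1,2)] by blast
  qed
  have \<beta>_carr: "\<beta> ` B \<subseteq> carrier Q" using BU \<psi> by (auto simp: \<beta>_def carr)
  have sum_\<beta>: "(\<Oplus>\<^bsub>Q\<^esub>b\<in>F. c b \<odot>\<^bsub>Q\<^esub> \<beta> b) = cos (\<psi> (\<Sum>b\<in>F. cscale (c b) b))"
    if "finite F" "F \<subseteq> B" for F c
    using that
  proof (induction F)
    case empty
    have "\<psi> 0 = \<zero>\<^bsub>P\<^esub>" using \<psi>L[OF zero(1)] zero(2) by simp
    then show ?case by (simp only: Q.finsum_empty zeroQ sum.empty)
  next
    case (insert b F)
    have bU: "b \<in> U" using insert BU by blast
    have FU: "F \<subseteq> U" using insert BU by blast
    have "(\<Oplus>\<^bsub>Q\<^esub>b\<in>insert b F. c b \<odot>\<^bsub>Q\<^esub> \<beta> b) = c b \<odot>\<^bsub>Q\<^esub> \<beta> b \<oplus>\<^bsub>Q\<^esub> (\<Oplus>\<^bsub>Q\<^esub>b\<in>F. c b \<odot>\<^bsub>Q\<^esub> \<beta> b)"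
      using insert \<beta>_carr by (intro Q.finsum_insert) (auto intro!: Q.smult_closed)
    also have "\<dots> = cos (fps_const (c b) \<odot>\<^bsub>P\<^esub> \<psi> b \<oplus>\<^bsub>P\<^esub> \<psi> (\<Sum>b\<in>F. cscale (c b) b))"
      using insert bU U_sum[OF FU] by (simp add: \<beta>_def smultQ addQ \<psi> smult(1))
    also have "fps_const (c b) \<odot>\<^bsub>P\<^esub> \<psi> b \<oplus>\<^bsub>P\<^esub> \<psi> (\<Sum>b\<in>F. cscale (c b) b)
        = \<psi> (cscale (c b) b + (\<Sum>b\<in>F. cscale (c b) b))"
      using bU U_sum[OF FU]
      by (intro inj) (auto simp: add smult \<psi> U_add U_scale cscale_def[symmetric])
    finally show ?case using insert(1,2) by (simp only: sum.insert[OF insert(1,2)])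
  qed
  have lincomb: "Q.lincomb a (\<beta> ` B) = cos (\<psi> (\<Sum>b\<in>B. cscale (a (\<beta> b)) b))" for a
  proof -
    have "Q.lincomb a (\<beta> ` B) = (\<Oplus>\<^bsub>Q\<^esub>b\<in>B. a (\<beta> b) \<odot>\<^bsub>Q\<^esub> \<beta> b)"
      unfolding Q.lincomb_def using \<beta>_carr by (intro Q.finsum_reindex[OF _ \<beta>_inj]) auto
    then show ?thesis using sum_\<beta>[OF fB order_refl, of "\<lambda>b. a (\<beta> b)"] by simp
  qed
  have "Q.basis (\<beta> ` B)"
    unfolding Q.basis_def
  proof (intro conjI)
    show "Q.lin_indpt (\<beta> ` B)"
    proof (rule Q.finite_lin_indpt2)
      fix a assume "Q.lincomb a (\<beta> ` B) = \<zero>\<^bsub>Q\<^esub>"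
      then have "(\<Sum>b\<in>B. cscale (a (\<beta> b)) b) \<in> W"
        using U_sum[OF BU] by (simp add: lincomb zeroQ cos_eq zero \<psi>)
      then show "\<forall>v\<in>\<beta> ` B. a v = \<zero>\<^bsub>class_ring\<^esub>"
        using cx.basis_mod_indep[OF B(1), of "a \<circ> \<beta>"] by simp
    qed (use fB \<beta>_carr in auto)
    show "Q.gen_set (\<beta> ` B)"
    proof
      show "Q.span (\<beta> ` B) \<subseteq> carrier Q" using \<beta>_carr by (rule Q.span_is_subset2)
      show "carrier Q \<subseteq> Q.span (\<beta> ` B)"
      proof
        fix v assume "v \<in> carrier Q"
        then obtain p where p: "p \<in> carrier P" "v = cos p" by (auto simp: carr)
        obtain b where b: "b \<in> cx.span B" "L p - b \<in> W"
          using cx.basis_mod_span[OF B(1) L_in_U[OF p(1)]] by blast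
        then obtain c where c: "b = (\<Sum>x\<in>B. cscale (c x) x)"
          using fB by (auto simp: cx.span_finite)
        define a where "a = (\<lambda>v. c (inv_into B \<beta> v))"
        have "Q.lincomb a (\<beta> ` B) = cos (\<psi> b)"
          unfolding lincomb c a_def using \<beta>_inj by (simp cong: sum.cong)
        also have "\<dots> = v" using p b U_sum[OF BU] c
          by (simp add: cos_eq \<psi>) (metis W cx.subspace_neg minus_diff_eq)
        finally show "v \<in> Q.span (\<beta> ` B)"
          using fB \<beta>_carr by (subst Q.finite_span) (auto intro!: exI[of _ a])
      qed
    qed
  qed (fact \<beta>_carr)
  then have "Q.dim = card (\<beta> ` B)" using fB by (intro Q.dim_basis) auto
  then show ?thesis using B(2) card_image[OF \<beta>_inj] by (simp add: Q_def)
qed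

section \<open>Modules as lattice chains\<close>

locale C_module = C_algebra k n + M: left_module "Calg k n" M
  for k n :: int and M :: "(path_elts set, 'm) module"
begin

abbreviation act :: "path_elts set \<Rightarrow> 'm \<Rightarrow> 'm" (infixr \<open>\<cdot>\<close> 75) where "c \<cdot> m \<equiv> c \<odot>\<^bsub>M\<^esub> m"

lemma scalar_act_\<rho>: "scalar_act C M r m = C.\<rho> r \<cdot> m"
  by (simp add: scalar_act_def C.\<rho>_def)

lemma act_zero [simp]: "c \<in> carrier C \<Longrightarrow> c \<cdot> \<zero>\<^bsub>M\<^esub> = \<zero>\<^bsub>M\<^esub>"
  using M.smult_r_distr[of c "\<zero>\<^bsub>M\<^esub>" "\<zero>\<^bsub>M\<^esub>"] M.smult_closed[of c "\<zero>\<^bsub>M\<^esub>"]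
    M.M.add.l_cancel_one'[of "c \<cdot> \<zero>\<^bsub>M\<^esub>" "c \<cdot> \<zero>\<^bsub>M\<^esub>"] by simp

lemma zero_act [simp]: "m \<in> carrier M \<Longrightarrow> \<zero>\<^bsub>C\<^esub> \<cdot> m = \<zero>\<^bsub>M\<^esub>"
  using M.smult_l_distr[of "\<zero>\<^bsub>C\<^esub>" "\<zero>\<^bsub>C\<^esub>" m] M.smult_closed[of "\<zero>\<^bsub>C\<^esub>" m]
    M.M.add.l_cancel_one'[of "\<zero>\<^bsub>C\<^esub> \<cdot> m" "\<zero>\<^bsub>C\<^esub> \<cdot> m"] by simp

lemma \<rho>_zero: "C.\<rho> 0 = \<zero>\<^bsub>C\<^esub>"
  using C.\<rho>_add[of 0 0] C.\<Lambda>.add.l_cancel_one'[of "C.\<rho> 0" "C.\<rho> 0"] by simp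

lemma \<rho>_act_zero [simp]: "m \<in> carrier M \<Longrightarrow> C.\<rho> 0 \<cdot> m = \<zero>\<^bsub>M\<^esub>"
  by (simp add: \<rho>_zero)

lemma \<rho>_act_mult: "m \<in> carrier M \<Longrightarrow> C.\<rho> (r * s) \<cdot> m = C.\<rho> r \<cdot> C.\<rho> s \<cdot> m"
  by (simp add: C.\<rho>_mult M.smult_assoc)

lemma \<rho>_act_commute: "\<lbrakk>c \<in> carrier C; m \<in> carrier M\<rbrakk> \<Longrightarrow> C.\<rho> r \<cdot> c \<cdot> m = c \<cdot> C.\<rho> r \<cdot> m"
  by (simp add: M.smult_assoc[symmetric] C.\<rho>_central)

lemma act_finsum:
  assumes c: "c \<in> carrier C" and "finite S" "f \<in> S \<rightarrow> carrier M"
  shows "c \<cdot> (\<Oplus>\<^bsub>M\<^esub>s\<in>S. f s) = (\<Oplus>\<^bsub>M\<^esub>s\<in>S. c \<cdot> f s)"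
  using assms(2,3)
proof (induction S)
  case (insert s S)
  then have "f s \<in> carrier M" "f \<in> S \<rightarrow> carrier M" by auto
  then show ?case
    using insert c by (simp add: M.smult_r_distr M.smult_closed Pi_iff)
qed (simp add: c)

definition V :: "'m set" where "V = {m \<in> carrier M. E n \<cdot> m = m}"

text \<open>\<open>E 0\<close> is the idempotent of the vertex *, and y^n acts as t^k. As v runs
  from 0 to n, these submodules therefore descend from \<open>V\<close> to t^k
  \<open>V\<close>.\<close>

definition N :: "nat \<Rightarrow> 'm set" where
  "N v = (\<lambda>m. (y [^]\<^bsub>C\<^esub> v \<otimes>\<^bsub>C\<^esub> E (int v)) \<cdot> m) ` carrier M"

lemma E_0: "E 0 = E n"
  unfolding E_def using n_pos by (simp add: vtx_zero)

lemma E_idem: "E i \<otimes>\<^bsub>C\<^esub> E i = E i"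
  by (simp add: E_E)

lemma y_pow_shift: "y [^]\<^bsub>C\<^esub> v \<otimes>\<^bsub>C\<^esub> E i = E (i - int v) \<otimes>\<^bsub>C\<^esub> y [^]\<^bsub>C\<^esub> v"
proof (induction v arbitrary: i)
  case (Suc v)
  have "y [^]\<^bsub>C\<^esub> Suc v \<otimes>\<^bsub>C\<^esub> E i = y [^]\<^bsub>C\<^esub> v \<otimes>\<^bsub>C\<^esub> (E (i - 1) \<otimes>\<^bsub>C\<^esub> y)"
    by (simp add: C.\<Lambda>.m_assoc y_E)
  also have "\<dots> = (E (i - 1 - int v) \<otimes>\<^bsub>C\<^esub> y [^]\<^bsub>C\<^esub> v) \<otimes>\<^bsub>C\<^esub> y"
    by (subst Suc[symmetric]) (simp add: C.\<Lambda>.m_assoc)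
  finally show ?case by (simp add: C.\<Lambda>.m_assoc algebra_simps)
qed simp

lemma y_pow_x_pow: "y [^]\<^bsub>C\<^esub> m \<otimes>\<^bsub>C\<^esub> x [^]\<^bsub>C\<^esub> m = C.\<rho> (fps_X ^ m)"
  and x_pow_y_pow': "x [^]\<^bsub>C\<^esub> m \<otimes>\<^bsub>C\<^esub> y [^]\<^bsub>C\<^esub> m = C.\<rho> (fps_X ^ m)"
proof (induction m)
  case (Suc m)
  have *: "a [^]\<^bsub>C\<^esub> Suc m \<otimes>\<^bsub>C\<^esub> b [^]\<^bsub>C\<^esub> Suc m = C.\<rho> (fps_X ^ Suc m)"
    if a: "a \<in> carrier C" and b: "b \<in> carrier C" and ab: "a \<otimes>\<^bsub>C\<^esub> b = C.\<rho> fps_X"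
      and IH: "a [^]\<^bsub>C\<^esub> m \<otimes>\<^bsub>C\<^esub> b [^]\<^bsub>C\<^esub> m = C.\<rho> (fps_X ^ m)" for a b
  proof -
    have am: "a [^]\<^bsub>C\<^esub> m \<in> carrier C" and bm: "b [^]\<^bsub>C\<^esub> m \<in> carrier C" using a b by auto
    have "a [^]\<^bsub>C\<^esub> Suc m \<otimes>\<^bsub>C\<^esub> b [^]\<^bsub>C\<^esub> Suc m
        = (a [^]\<^bsub>C\<^esub> m \<otimes>\<^bsub>C\<^esub> a) \<otimes>\<^bsub>C\<^esub> (b \<otimes>\<^bsub>C\<^esub> b [^]\<^bsub>C\<^esub> m)"
      unfolding C.\<Lambda>.nat_pow_Suc2[OF b] by simp
    also have "\<dots> = a [^]\<^bsub>C\<^esub> m \<otimes>\<^bsub>C\<^esub> ((a \<otimes>\<^bsub>C\<^esub> b) \<otimes>\<^bsub>C\<^esub> b [^]\<^bsub>C\<^esub> m)"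
      using a b am bm by (simp add: C.\<Lambda>.m_assoc)
    also have "\<dots> = (a [^]\<^bsub>C\<^esub> m \<otimes>\<^bsub>C\<^esub> b [^]\<^bsub>C\<^esub> m) \<otimes>\<^bsub>C\<^esub> C.\<rho> fps_X"
      unfolding ab C.\<rho>_central[OF bm] using am bm by (simp add: C.\<Lambda>.m_assoc)
    finally show ?thesis unfolding IH by (simp add: C.\<rho>_mult[symmetric] mult.commute)
  qed
  show "y [^]\<^bsub>C\<^esub> Suc m \<otimes>\<^bsub>C\<^esub> x [^]\<^bsub>C\<^esub> Suc m = C.\<rho> (fps_X ^ Suc m)"
    by (rule *[OF y_closed x_closed y_x Suc(1)])
  show "x [^]\<^bsub>C\<^esub> Suc m \<otimes>\<^bsub>C\<^esub> y [^]\<^bsub>C\<^esub> Suc m = C.\<rho> (fps_X ^ Suc m)"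
    by (rule *[OF x_closed y_closed x_y Suc(2)])
qed simp_all

text \<open>Once around the cycle: n - k of the steps form y^(n-k), which equals x^k, and this
  cancels against the remaining y^k.\<close>

lemma y_pow_n: "y [^]\<^bsub>C\<^esub> nat n = C.\<rho> (fps_X ^ nat k)"
proof -
  have "nat n = nat k + nat (n - k)" using k_pos k_less by simp
  then have "y [^]\<^bsub>C\<^esub> nat n = y [^]\<^bsub>C\<^esub> nat k \<otimes>\<^bsub>C\<^esub> y [^]\<^bsub>C\<^esub> nat (n - k)"
    by (simp add: C.\<Lambda>.nat_pow_mult)
  also have "\<dots> = C.\<rho> (fps_X ^ nat k)" by (simp only: x_pow_y_pow[symmetric] y_pow_x_pow)
  finally show ?thesis .
qed

lemma V_closed: "w \<in> V \<Longrightarrow> w \<in> carrier M"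
  by (simp add: V_def)

lemma E_act_V: "m \<in> carrier M \<Longrightarrow> E n \<cdot> m \<in> V"
  by (simp add: V_def M.smult_closed M.smult_assoc[symmetric] E_idem)

lemma V_image: "V = (\<lambda>m. E n \<cdot> m) ` carrier M"
proof (intro equalityI subsetI)
  fix w assume "w \<in> V"
  then show "w \<in> (\<lambda>m. E n \<cdot> m) ` carrier M" by (intro image_eqI[of _ _ w]) (auto simp: V_def)
qed (use E_act_V in blast)

lemma V_zero: "\<zero>\<^bsub>M\<^esub> \<in> V"
  and V_add: "\<lbrakk>w \<in> V; w' \<in> V\<rbrakk> \<Longrightarrow> w \<oplus>\<^bsub>M\<^esub> w' \<in> V"
  and V_\<rho>: "w \<in> V \<Longrightarrow> C.\<rho> r \<cdot> w \<in> V"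
  by (auto simp: V_def M.smult_r_distr M.smult_closed \<rho>_act_commute[symmetric])

lemma N_sub_V: "N v \<subseteq> V"
proof
  fix w assume "w \<in> N v"
  then obtain m where m: "m \<in> carrier M" "w = (y [^]\<^bsub>C\<^esub> v \<otimes>\<^bsub>C\<^esub> E (int v)) \<cdot> m" by (auto simp: N_def)
  have "w = E n \<cdot> ((y [^]\<^bsub>C\<^esub> v) \<cdot> m)"
    unfolding m(2) y_pow_shift using m(1) E_0 by (simp add: M.smult_assoc)
  then show "w \<in> V" using E_act_V[of "(y [^]\<^bsub>C\<^esub> v) \<cdot> m"] m(1) by (simp add: M.smult_closed)
qed

lemma N_0: "N 0 = V"
  unfolding N_def V_image by (simp add: E_0)

lemma N_add: "\<lbrakk>w \<in> N v; w' \<in> N v\<rbrakk> \<Longrightarrow> w \<oplus>\<^bsub>M\<^esub> w' \<in> N v"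
  unfolding N_def by (auto simp: M.smult_r_distr[symmetric])

lemma N_\<rho>: "w \<in> N v \<Longrightarrow> C.\<rho> r \<cdot> w \<in> N v"
  unfolding N_def by (auto simp: \<rho>_act_commute M.smult_closed)

lemma N_zero: "\<zero>\<^bsub>M\<^esub> \<in> N v"
  unfolding N_def by (rule image_eqI[of _ _ "\<zero>\<^bsub>M\<^esub>"]) auto

lemma N_Suc: "N (Suc v) \<subseteq> N v"
proof
  fix w assume "w \<in> N (Suc v)"
  then obtain m where m: "m \<in> carrier M" "w = (y [^]\<^bsub>C\<^esub> Suc v \<otimes>\<^bsub>C\<^esub> E (int (Suc v))) \<cdot> m" by (auto simp: N_def)
  have "y [^]\<^bsub>C\<^esub> Suc v \<otimes>\<^bsub>C\<^esub> E (int (Suc v)) = (y [^]\<^bsub>C\<^esub> v \<otimes>\<^bsub>C\<^esub> E (int v)) \<otimes>\<^bsub>C\<^esub> y"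
    by (simp add: C.\<Lambda>.m_assoc y_E)
  then have "w = (y [^]\<^bsub>C\<^esub> v \<otimes>\<^bsub>C\<^esub> E (int v)) \<cdot> (y \<cdot> m)" using m by (simp add: M.smult_assoc)
  then show "w \<in> N v" unfolding N_def using m M.smult_closed[of y m] by blast
qed

lemma N_mono: "u \<le> v \<Longrightarrow> N v \<subseteq> N u"
  by (induction rule: dec_induct) (use N_Suc in blast)+

text \<open>Writing t as y x moves the argument one vertex up: t y^v e_v = y^(v+1) e_(v+1)
  x.\<close>

lemma X_N: "w \<in> N v \<Longrightarrow> C.\<rho> fps_X \<cdot> w \<in> N (Suc v)"
proof -
  assume "w \<in> N v"
  then obtain m where m: "m \<in> carrier M" "w = (y [^]\<^bsub>C\<^esub> v \<otimes>\<^bsub>C\<^esub> E (int v)) \<cdot> m" by (auto simp: N_def)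
  have "C.\<rho> fps_X \<otimes>\<^bsub>C\<^esub> (y [^]\<^bsub>C\<^esub> v \<otimes>\<^bsub>C\<^esub> E (int v)) = y [^]\<^bsub>C\<^esub> v \<otimes>\<^bsub>C\<^esub> (C.\<rho> fps_X \<otimes>\<^bsub>C\<^esub> E (int v))"
    using C.\<rho>_central[of "y [^]\<^bsub>C\<^esub> v" fps_X] by (simp add: C.\<Lambda>.m_assoc[symmetric])
  also have "\<dots> = y [^]\<^bsub>C\<^esub> v \<otimes>\<^bsub>C\<^esub> (y \<otimes>\<^bsub>C\<^esub> (E (int v + 1) \<otimes>\<^bsub>C\<^esub> x))"
    by (simp add: y_x[symmetric] C.\<Lambda>.m_assoc x_E)
  also have "\<dots> = (y [^]\<^bsub>C\<^esub> Suc v \<otimes>\<^bsub>C\<^esub> E (int (Suc v))) \<otimes>\<^bsub>C\<^esub> x"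
    by (simp add: C.\<Lambda>.m_assoc add.commute)
  finally have "C.\<rho> fps_X \<cdot> w = (y [^]\<^bsub>C\<^esub> Suc v \<otimes>\<^bsub>C\<^esub> E (int (Suc v))) \<cdot> (x \<cdot> m)"
    using m by (simp add: M.smult_assoc[symmetric])
  then show ?thesis unfolding N_def using m M.smult_closed[of x m] by blast
qed

lemma X_pow_N: "w \<in> N v \<Longrightarrow> C.\<rho> (fps_X ^ a) \<cdot> w \<in> N (v + a)"
proof (induction a)
  case 0
  then show ?case using N_sub_V V_closed by (auto simp: M.smult_one subset_iff)
next
  case (Suc a)
  then have "w \<in> carrier M" using N_sub_V V_closed by blast
  then show ?case using X_N[OF Suc.IH[OF Suc.prems]] by (simp add: \<rho>_act_mult)
qed

lemma X_pow_V_n: "w \<in> V \<Longrightarrow> C.\<rho> (fps_X ^ nat k) \<cdot> w \<in> N (nat n)"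
  unfolding N_def using n_pos y_pow_n
  by (intro image_eqI[of _ _ w]) (auto simp: V_def M.smult_assoc)

definition W :: "nat \<Rightarrow> nat \<Rightarrow> 'm set" where
  "W a v = {w \<in> V. C.\<rho> (fps_X ^ a) \<cdot> w \<in> N v}"

lemma W_Suc: "W (Suc a) v = {w \<in> V. C.\<rho> fps_X \<cdot> w \<in> W a v}"
  by (auto simp: W_def V_\<rho> \<rho>_act_mult[symmetric] V_closed mult.commute)

text \<open>This inclusion and \<open>W_anti\<close> become the two families of Gelfand-Tsetlin
  inequalities: with a = k - i and v = k - i + j, lowering i raises both indices, and raising j
  raises \<open>v\<close> alone.\<close>

lemma W_diag: "W a v \<subseteq> W (Suc a) (Suc v)"
  using X_N by (auto simp: W_def \<rho>_act_mult V_closed)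

lemma W_anti: "W a (Suc v) \<subseteq> W a v"
  using N_Suc by (auto simp: W_def)

text \<open>The boundary case j = 0; \<open>W_k\<close> is the case i = 0. There the codimension is
  0, in agreement with the convention for patterns.\<close>

lemma W_self: "W a a = V"
  using X_pow_N[of _ 0 a] by (auto simp: W_def N_0)

lemma W_k: "v \<le> nat n \<Longrightarrow> W (nat k) v = V"
  using X_pow_V_n N_mono[of v "nat n"] by (auto simp: W_def)

lemma X_pow_W: "v \<le> nat n \<Longrightarrow> w \<in> V \<Longrightarrow> C.\<rho> (fps_X ^ nat k) \<cdot> w \<in> W a v"
  using X_pow_V_n[of w] N_mono[of v "nat n"] N_\<rho> by (auto simp: W_def V_\<rho>)

lemma W_sub_V: "W a v \<subseteq> V"
  by (auto simp: W_def)

lemma W_submodule: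
  "\<zero>\<^bsub>M\<^esub> \<in> W a v" "\<lbrakk>w \<in> W a v; w' \<in> W a v\<rbrakk> \<Longrightarrow> w \<oplus>\<^bsub>M\<^esub> w' \<in> W a v"
  "w \<in> W a v \<Longrightarrow> C.\<rho> r \<cdot> w \<in> W a v"
proof -
  show "\<zero>\<^bsub>M\<^esub> \<in> W a v" by (simp add: W_def V_zero N_zero)
  show "\<lbrakk>w \<in> W a v; w' \<in> W a v\<rbrakk> \<Longrightarrow> w \<oplus>\<^bsub>M\<^esub> w' \<in> W a v"
    by (simp add: W_def V_add M.smult_r_distr V_closed N_add)
  show "w \<in> W a v \<Longrightarrow> C.\<rho> r \<cdot> w \<in> W a v"
    using N_\<rho>[of "C.\<rho> (fps_X ^ a) \<cdot> w" v r] \<rho>_act_commute[of "C.\<rho> (fps_X ^ a)" w r]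
    by (simp add: W_def V_\<rho> V_closed)
qed

end

locale torsion_free_module = C_module k n M for k n :: int and M :: "(path_elts set, 'm) module" +
  assumes torsion_free: "\<lbrakk>m \<in> carrier M; C.\<rho> fps_X \<cdot> m = \<zero>\<^bsub>M\<^esub>\<rbrakk> \<Longrightarrow> m = \<zero>\<^bsub>M\<^esub>"
begin

lemma torsion_free_pow:
  "\<lbrakk>m \<in> carrier M; C.\<rho> (fps_X ^ a) \<cdot> m = \<zero>\<^bsub>M\<^esub>\<rbrakk> \<Longrightarrow> m = \<zero>\<^bsub>M\<^esub>"
proof (induction a)
  case (Suc a)
  have "C.\<rho> fps_X \<cdot> C.\<rho> (fps_X ^ a) \<cdot> m = \<zero>\<^bsub>M\<^esub>"
    using Suc.prems by (simp add: \<rho>_act_mult[symmetric])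
  then show ?case
    using torsion_free[of "C.\<rho> (fps_X ^ a) \<cdot> m"] Suc by (simp add: M.smult_closed)
qed (simp add: M.smult_one)

lemma neg_act: "m \<in> carrier M \<Longrightarrow> m \<oplus>\<^bsub>M\<^esub> C.\<rho> (-1) \<cdot> m = \<zero>\<^bsub>M\<^esub>"
proof -
  assume m: "m \<in> carrier M"
  have "\<one>\<^bsub>C\<^esub> \<oplus>\<^bsub>C\<^esub> C.\<rho> (-1) = C.\<rho> 0" using C.\<rho>_add[of 1 "-1"] by simp
  then show ?thesis
    using M.smult_l_distr[of "\<one>\<^bsub>C\<^esub>" "C.\<rho> (-1)" m] m by (simp add: M.smult_one)
qed

lemma \<rho>_pow_cancel:
  assumes "m \<in> carrier M" "m' \<in> carrier M" "C.\<rho> (fps_X ^ a) \<cdot> m = C.\<rho> (fps_X ^ a) \<cdot> m'"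
  shows "m = m'"
proof -
  have "C.\<rho> (fps_X ^ a) \<cdot> (m \<oplus>\<^bsub>M\<^esub> C.\<rho> (-1) \<cdot> m')
      = C.\<rho> (fps_X ^ a) \<cdot> m' \<oplus>\<^bsub>M\<^esub> C.\<rho> (-1) \<cdot> C.\<rho> (fps_X ^ a) \<cdot> m'"
    using assms \<rho>_act_commute[of "C.\<rho> (fps_X ^ a)" m' "-1"]
    by (simp add: M.smult_r_distr M.smult_closed)
  also have "\<dots> = \<zero>\<^bsub>M\<^esub>" using assms(2) by (simp add: M.smult_closed neg_act)
  finally have "m \<oplus>\<^bsub>M\<^esub> C.\<rho> (-1) \<cdot> m' = \<zero>\<^bsub>M\<^esub>"
    using torsion_free_pow assms by (simp add: M.smult_closed)
  moreover have "m' \<oplus>\<^bsub>M\<^esub> C.\<rho> (-1) \<cdot> m' = \<zero>\<^bsub>M\<^esub>" using assms(2) by (rule neg_act)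
  ultimately show ?thesis
    using assms(1,2) M.M.add.right_cancel[of "C.\<rho> (-1) \<cdot> m'" m m'] by (simp add: M.smult_closed)
qed

text \<open>The product x^a y^a is t^a, which acts injectively on a torsion-free module.\<close>

lemma y_pow_cancel:
  assumes "m \<in> carrier M" "m' \<in> carrier M" "(y [^]\<^bsub>C\<^esub> (a::nat)) \<cdot> m = (y [^]\<^bsub>C\<^esub> a) \<cdot> m'"
  shows "m = m'"
proof (rule \<rho>_pow_cancel[of _ _ a])
  have "C.\<rho> (fps_X ^ a) \<cdot> m = (x [^]\<^bsub>C\<^esub> a) \<cdot> (y [^]\<^bsub>C\<^esub> a) \<cdot> m" if "m \<in> carrier M" for m
    using that by (simp add: M.smult_assoc[symmetric] x_pow_y_pow')
  then show "C.\<rho> (fps_X ^ a) \<cdot> m = C.\<rho> (fps_X ^ a) \<cdot> m'" using assms by simp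
qed (use assms in auto)

end

section \<open>Homomorphisms from a rank one module to a torsion-free module\<close>

lemma HomI:
  assumes "\<And>m. m \<in> carrier M \<Longrightarrow> f m \<in> carrier N"
    and "\<And>m m'. \<lbrakk>m \<in> carrier M; m' \<in> carrier M\<rbrakk> \<Longrightarrow> f (m \<oplus>\<^bsub>M\<^esub> m') = f m \<oplus>\<^bsub>N\<^esub> f m'"
    and "\<And>a m. \<lbrakk>a \<in> carrier \<Lambda>; m \<in> carrier M\<rbrakk> \<Longrightarrow> f (a \<odot>\<^bsub>M\<^esub> m) = a \<odot>\<^bsub>N\<^esub> f m"
    and "f \<in> extensional (carrier M)"
  shows "f \<in> Hom \<Lambda> M N"
  using assms by (auto simp: Hom_def LinearCombinations.module_hom_def)

lemma HomD:
  assumes "f \<in> Hom \<Lambda> M N"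
  shows "m \<in> carrier M \<Longrightarrow> f m \<in> carrier N"
    and "\<lbrakk>m \<in> carrier M; m' \<in> carrier M\<rbrakk> \<Longrightarrow> f (m \<oplus>\<^bsub>M\<^esub> m') = f m \<oplus>\<^bsub>N\<^esub> f m'"
    and "\<lbrakk>a \<in> carrier \<Lambda>; m \<in> carrier M\<rbrakk> \<Longrightarrow> f (a \<odot>\<^bsub>M\<^esub> m) = a \<odot>\<^bsub>N\<^esub> f m"
    and "f \<in> extensional (carrier M)"
  using assms by (auto simp: Hom_def LinearCombinations.module_hom_def)

locale rank_one_hom = torsion_free_module k n M + rank_one k n J
  for k n :: int and M :: "(path_elts set, 'm) module" and J :: "int set"
begin

sublocale T: left_module "Calg k n" "rank_one_module n J" by (rule T_left_module)

definition \<delta> :: "int \<Rightarrow> int \<Rightarrow> complex fps" where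
  "\<delta> i = (\<lambda>v\<in>{1..n}. if v = i then 1 else 0)"

lemma \<delta>_closed: "\<delta> i \<in> carrier T"
  by (simp add: \<delta>_def T_simps)

lemma E_act_T: "m \<in> carrier T \<Longrightarrow> i \<in> {1..n} \<Longrightarrow> E i \<odot>\<^bsub>T\<^esub> m = C.\<rho> (m i) \<odot>\<^bsub>T\<^esub> \<delta> i"
  unfolding T_E T_\<rho>[OF \<delta>_closed] by (intro restrict_ext) (auto simp: \<delta>_def)

text \<open>The elements that turn out to be the possible images of \<open>\<delta> n\<close>. In
  \<open>M_J\<close> the vector y^v \<open>\<delta> v\<close> is t^b \<open>\<delta> n\<close> with
  b the number of elements of \<open>J\<close> in [1,v], so t^b times the image of
  \<open>\<delta> n\<close> has to lie in \<open>N v\<close>.\<close>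

definition W_hom :: "'m set" where
  "W_hom = {w \<in> V. \<forall>v\<in>{1..nat n}. C.\<rho> (fps_X ^ card (J \<inter> {1..int v})) \<cdot> w \<in> N v}"

lemma Hom_\<delta>_n:
  assumes f: "f \<in> Hom C T M"
  shows "f (\<delta> n) \<in> W_hom"
proof -
  have n: "n \<in> {1..n}" using n_pos by simp
  have "E n \<cdot> f (\<delta> n) = f (E n \<odot>\<^bsub>T\<^esub> \<delta> n)" using HomD(3)[OF f _ \<delta>_closed] by simp
  also have "E n \<odot>\<^bsub>T\<^esub> \<delta> n = \<delta> n"
    unfolding T_E by (rule T_ext) (use n in \<open>auto simp: \<delta>_def T_simps\<close>)
  finally have V: "f (\<delta> n) \<in> V" using HomD(1)[OF f \<delta>_closed] by (simp add: V_def)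
  have "C.\<rho> (fps_X ^ card (J \<inter> {1..int v})) \<cdot> f (\<delta> n) \<in> N v" if v: "v \<in> {1..nat n}" for v
  proof -
    have vn: "v \<le> nat n" "int v \<in> {1..n}" using v by auto
    have "C.\<rho> (fps_X ^ card (J \<inter> {1..int v})) \<cdot> f (\<delta> n) = f (C.\<rho> (fps_X ^ card (J \<inter> {1..int v})) \<odot>\<^bsub>T\<^esub> \<delta> n)"
      using HomD(3)[OF f _ \<delta>_closed] by simp
    also have "C.\<rho> (fps_X ^ card (J \<inter> {1..int v})) \<odot>\<^bsub>T\<^esub> \<delta> n
        = (y [^]\<^bsub>C\<^esub> v \<otimes>\<^bsub>C\<^esub> E (int v)) \<odot>\<^bsub>T\<^esub> \<delta> (int v)"
      unfolding T_y_pow_E[OF vn(1)] T_\<rho>[OF \<delta>_closed] using vn n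
      by (intro restrict_ext) (auto simp: \<delta>_def)
    also have "f \<dots> = (y [^]\<^bsub>C\<^esub> v \<otimes>\<^bsub>C\<^esub> E (int v)) \<cdot> f (\<delta> (int v))"
      using HomD(3)[OF f _ \<delta>_closed] by simp
    finally show ?thesis unfolding N_def using HomD(1)[OF f \<delta>_closed] by blast
  qed
  then show ?thesis using V by (simp add: W_hom_def)
qed

lemma card_J_Suc:
  "card (J \<inter> {1..int (Suc v)}) = card (J \<inter> {1..int v}) + (if int (Suc v) \<in> J then 1 else 0)"
proof -
  have "J \<inter> {1..int (Suc v)} = (if int (Suc v) \<in> J then {int (Suc v)} else {}) \<union> J \<inter> {1..int v}"
  proof -
    have "{1..int (Suc v)} = insert (int (Suc v)) {1..int v}" by auto
    then show ?thesis by auto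
  qed
  moreover have "card ((if int (Suc v) \<in> J then {int (Suc v)} else {}) \<union> J \<inter> {1..int v})
      = (if int (Suc v) \<in> J then 1 else 0) + card (J \<inter> {1..int v})"
    by (subst card_Un_disjoint) auto
  ultimately show ?thesis by simp
qed

text \<open>At each vertex the membership in \<open>N v\<close> provides a preimage
  \<open>g v\<close> of t^b w under y^v. Cancelling powers of \<open>y\<close> and t shows that the
  \<open>g v\<close> are compatible with the arrows, so they define a homomorphism.\<close>

lemma ex_Hom:
  assumes w: "w \<in> W_hom"
  shows "\<exists>f\<in>Hom C T M. f (\<delta> n) = w"
proof -
  define b where "b v = card (J \<inter> {1..int v})" for v
  have wV: "w \<in> V" and wM: "w \<in> carrier M" using w by (auto simp: W_hom_def V_closed)
  have "\<exists>m\<in>carrier M. E v \<cdot> m = m \<and> (y [^]\<^bsub>C\<^esub> nat v) \<cdot> m = C.\<rho> (fps_X ^ b (nat v)) \<cdot> w" if v: "v \<in> {1..n}" for v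
  proof -
    have "nat v \<in> {1..nat n}" using v by auto
    then have "C.\<rho> (fps_X ^ b (nat v)) \<cdot> w \<in> N (nat v)" using w unfolding W_hom_def b_def by blast
    then obtain m where m: "m \<in> carrier M"
        "C.\<rho> (fps_X ^ b (nat v)) \<cdot> w = (y [^]\<^bsub>C\<^esub> nat v \<otimes>\<^bsub>C\<^esub> E (int (nat v))) \<cdot> m"
      unfolding N_def by blast
    have "(y [^]\<^bsub>C\<^esub> nat v) \<cdot> E v \<cdot> m = (y [^]\<^bsub>C\<^esub> nat v \<otimes>\<^bsub>C\<^esub> E v) \<cdot> m"
      by (rule M.smult_assoc[symmetric]) (use m in auto)
    moreover have "E v \<cdot> E v \<cdot> m = E v \<cdot> m"
      using m(1) by (simp add: M.smult_assoc[symmetric] E_idem)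
    moreover have "int (nat v) = v" using v by simp
    ultimately show ?thesis
      using m M.smult_closed[of "E v" m] by (intro bexI[of _ "E v \<cdot> m"]) (simp_all only: E_closed)
  qed
  then obtain g where g: "\<And>v. v \<in> {1..n} \<Longrightarrow> g v \<in> carrier M" "\<And>v. v \<in> {1..n} \<Longrightarrow> E v \<cdot> g v = g v"
    "\<And>v. v \<in> {1..n} \<Longrightarrow> (y [^]\<^bsub>C\<^esub> nat v) \<cdot> g v = C.\<rho> (fps_X ^ b (nat v)) \<cdot> w" by metis
  have n: "n \<in> {1..n}" using n_pos by simp
  have b_n: "b (nat n) = nat k"
  proof -
    have "J \<inter> {1..int (nat n)} = J" using J_sub by auto
    then show ?thesis using J_card by (simp add: b_def)
  qed
  \<comment> \<open>At the last vertex both sides carry the factor t^k: y^n acts as t^k, and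
    \<open>J\<close> has k elements.\<close>
  have g_n: "g n = w"
    using g(3)[OF n] b_n by (intro \<rho>_pow_cancel[OF g(1)[OF n] wM, of "nat k"]) (simp add: y_pow_n)
  \<comment> \<open>\<open>c v\<close> and \<open>d v\<close> are the scalars by which y and x act
    on \<open>M_J\<close> across the edge between v - 1 and v; their product is t.\<close>
  define c where "c v = (if v \<in> J then fps_X else 1 :: complex fps)" for v
  define d where "d v = (if v \<in> J then 1 else fps_X :: complex fps)" for v
  have g_vtx: "g (vtx n v) \<in> carrier M" for v by (rule g(1)) (rule vtx_range)
  have b_Suc: "fps_X ^ b (Suc u) = c (int (Suc u)) * fps_X ^ b u" for u
    using card_J_Suc[of u] by (simp add: b_def c_def)
  have y_g: "y \<cdot> g v = C.\<rho> (c v) \<cdot> g (vtx n (v - 1))" if v: "v \<in> {1..n}" for v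
  proof -
    define u where "u = nat v - 1"
    have u: "nat v = Suc u" "v = int (Suc u)" using v by (auto simp: u_def)
    \<comment> \<open>The predecessor of the vertex 1 is n, where the value is \<open>w\<close>
      itself and the power of \<open>y\<close> is trivial.\<close>
    have prev: "(y [^]\<^bsub>C\<^esub> u) \<cdot> g (vtx n (v - 1)) = C.\<rho> (fps_X ^ b u) \<cdot> w"
    proof (cases "u = 0")
      case True
      then have "vtx n (v - 1) = n" using u by (simp add: vtx_zero)
      then show ?thesis using True wM by (simp add: b_def g_n M.smult_one)
    next
      case False
      then have "vtx n (v - 1) = int u" "int u \<in> {1..n}" using u v by auto
      then show ?thesis using g(3)[of "int u"] by simp
    qed
    show ?thesis
    proof (rule y_pow_cancel[of _ _ u])
      have "(y [^]\<^bsub>C\<^esub> u) \<cdot> y \<cdot> g v = (y [^]\<^bsub>C\<^esub> Suc u) \<cdot> g v"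
        using g(1)[OF v] by (simp add: M.smult_assoc)
      also have "\<dots> = C.\<rho> (fps_X ^ b (Suc u)) \<cdot> w" using g(3)[OF v] u(1) by simp
      also have "\<dots> = C.\<rho> (c v) \<cdot> (y [^]\<^bsub>C\<^esub> u) \<cdot> g (vtx n (v - 1))"
        unfolding prev b_Suc u(2)[symmetric] using wM by (simp add: \<rho>_act_mult)
      also have "\<dots> = (y [^]\<^bsub>C\<^esub> u) \<cdot> C.\<rho> (c v) \<cdot> g (vtx n (v - 1))"
        by (rule \<rho>_act_commute) (auto intro: g_vtx)
      finally show "(y [^]\<^bsub>C\<^esub> u) \<cdot> y \<cdot> g v = (y [^]\<^bsub>C\<^esub> u) \<cdot> C.\<rho> (c v) \<cdot> g (vtx n (v - 1))" .
    qed (use g(1)[OF v] g_vtx in \<open>auto intro: M.smult_closed\<close>)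
  qed
  \<comment> \<open>For \<open>v\<close> in \<open>J\<close> the identity holds after multiplication
    by t, which is then cancelled; for the other \<open>v\<close> it is what t = x y gives
    directly.\<close>
  have x_g: "x \<cdot> g (vtx n (v - 1)) = C.\<rho> (d v) \<cdot> g v" if v: "v \<in> {1..n}" for v
  proof (rule \<rho>_pow_cancel[of _ _ "if v \<in> J then 1 else 0"])
    have *: "C.\<rho> fps_X \<cdot> g v = C.\<rho> (c v) \<cdot> x \<cdot> g (vtx n (v - 1))"
    proof -
      have "C.\<rho> fps_X \<cdot> g v = x \<cdot> y \<cdot> g v" using g(1)[OF v] by (simp add: x_y[symmetric] M.smult_assoc)
      then show ?thesis unfolding y_g[OF v] by (simp add: \<rho>_act_commute g_vtx)
    qed
    show "C.\<rho> (fps_X ^ (if v \<in> J then 1 else 0)) \<cdot> x \<cdot> g (vtx n (v - 1))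
        = C.\<rho> (fps_X ^ (if v \<in> J then 1 else 0)) \<cdot> C.\<rho> (d v) \<cdot> g v"
      using * g(1)[OF v] g_vtx by (simp add: c_def d_def M.smult_one M.smult_closed split: if_splits)
  qed (use g(1)[OF v] g_vtx in \<open>auto intro: M.smult_closed\<close>)
  define f where "f = (\<lambda>m\<in>carrier T. \<Oplus>\<^bsub>M\<^esub>v\<in>{1..n}. C.\<rho> (m v) \<cdot> g v)"
  have f_app: "m \<in> carrier T \<Longrightarrow> f m = (\<Oplus>\<^bsub>M\<^esub>v\<in>{1..n}. C.\<rho> (m v) \<cdot> g v)" for m by (simp add: f_def)
  have summand: "(\<lambda>v. C.\<rho> (m v) \<cdot> g v) \<in> {1..n} \<rightarrow> carrier M" for m
    using g(1) by (auto intro: M.smult_closed)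
  have f_closed: "f m \<in> carrier M" if "m \<in> carrier T" for m
    unfolding f_app[OF that] using summand by (rule M.M.finsum_closed)
  have f_add: "f (m \<oplus>\<^bsub>T\<^esub> m') = f m \<oplus>\<^bsub>M\<^esub> f m'" if m: "m \<in> carrier T" "m' \<in> carrier T" for m m'
  proof -
    have "f (m \<oplus>\<^bsub>T\<^esub> m') = (\<Oplus>\<^bsub>M\<^esub>v\<in>{1..n}. C.\<rho> (m v) \<cdot> g v \<oplus>\<^bsub>M\<^esub> C.\<rho> (m' v) \<cdot> g v)"
      unfolding f_app[OF T.M.add.m_closed[OF m, simplified]]
      by (intro M.M.finsum_cong')
        (auto simp: T_simps C.\<rho>_add M.smult_l_distr g(1) intro!: M.smult_closed M.M.add.m_closed)
    then show ?thesis using m summand by (simp add: f_app M.M.finsum_addf)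
  qed
  \<comment> \<open>Linearity is inherited by sums and products of scalars, so the generators of
    \<open>C\<close> suffice. For \<open>x\<close> and \<open>y\<close> the sum over the vertices is
    shifted once around the cycle.\<close>
  have f_act: "f (a \<odot>\<^bsub>T\<^esub> m) = a \<cdot> f m" if a: "a \<in> carrier C" and m: "m \<in> carrier T" for a m
    using a m
  proof (induction a arbitrary: m rule: C_induct)
    case (scalar r)
    have "f (C.\<rho> r \<odot>\<^bsub>T\<^esub> m) = (\<Oplus>\<^bsub>M\<^esub>v\<in>{1..n}. C.\<rho> r \<cdot> C.\<rho> (m v) \<cdot> g v)"
      unfolding f_app[OF T_closed[OF C.\<rho>_closed]] using summand scalar
      by (intro M.M.finsum_cong') (auto simp: T_\<rho> \<rho>_act_mult g(1) intro!: M.smult_closed)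
    then show ?case using scalar by (simp add: f_app act_finsum summand)
  next
    case (E i)
    have "f (E i \<odot>\<^bsub>T\<^esub> m) = (\<Oplus>\<^bsub>M\<^esub>v\<in>{1..n}. E i \<cdot> C.\<rho> (m v) \<cdot> g v)"
      unfolding f_app[OF T_closed[OF E_closed]]
    proof (intro M.M.finsum_cong' refl)
      fix v assume v: "v \<in> {1..n}"
      have "E i \<cdot> g v = (if v = vtx n i then g v else \<zero>\<^bsub>M\<^esub>)"
        using v g(1,2)[OF v] M.smult_assoc[of "E i" "E v" "g v"] by (auto simp: E_E)
      then show "C.\<rho> ((E i \<odot>\<^bsub>T\<^esub> m) v) \<cdot> g v = E i \<cdot> C.\<rho> (m v) \<cdot> g v"
        using v g(1)[OF v] by (simp add: T_E \<rho>_act_commute[symmetric])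
    qed (use g(1) in \<open>auto intro!: M.smult_closed\<close>)
    then show ?case using E by (simp add: f_app act_finsum summand)
  next
    case x
    have inj: "inj_on (\<lambda>v. vtx n (v - 1)) {1..n}" and im: "(\<lambda>v. vtx n (v - 1)) ` {1..n} = {1..n}"
    proof -
      show inj: "inj_on (\<lambda>v. vtx n (v - 1)) {1..n}"
        by (rule inj_on_inverseI[of _ "\<lambda>v. vtx n (v + 1)"]) (rule vtx_pred_succ)
      have "(\<lambda>v. vtx n (v - 1)) ` {1..n} \<subseteq> {1..n}" using vtx_range(1) by blast
      then show "(\<lambda>v. vtx n (v - 1)) ` {1..n} = {1..n}"
        using inj by (intro card_subset_eq) (auto simp: card_image)
    qed
    have "x \<cdot> f m = (\<Oplus>\<^bsub>M\<^esub>v\<in>{1..n}. x \<cdot> C.\<rho> (m v) \<cdot> g v)"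
      using x by (simp add: f_app act_finsum summand)
    also have "\<dots> = (\<Oplus>\<^bsub>M\<^esub>v\<in>(\<lambda>v. vtx n (v - 1)) ` {1..n}. x \<cdot> C.\<rho> (m v) \<cdot> g v)" unfolding im ..
    also have "\<dots> = (\<Oplus>\<^bsub>M\<^esub>v\<in>{1..n}. x \<cdot> C.\<rho> (m (vtx n (v - 1))) \<cdot> g (vtx n (v - 1)))"
      using inj by (intro M.M.finsum_reindex) (auto intro!: M.smult_closed g_vtx simp: im g(1))
    also have "\<dots> = (\<Oplus>\<^bsub>M\<^esub>v\<in>{1..n}. C.\<rho> ((x \<odot>\<^bsub>T\<^esub> m) v) \<cdot> g v)"
    proof (intro M.M.finsum_cong' refl)
      fix v assume v: "v \<in> {1..n}"
      show "x \<cdot> C.\<rho> (m (vtx n (v - 1))) \<cdot> g (vtx n (v - 1)) = C.\<rho> ((x \<odot>\<^bsub>T\<^esub> m) v) \<cdot> g v"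
        unfolding \<rho>_act_commute[OF x_closed g_vtx, symmetric] x_g[OF v] T_x using v g(1)[OF v]
        by (simp add: \<rho>_act_mult[symmetric] d_def mult.commute)
    qed (use g(1) in \<open>auto intro!: M.smult_closed\<close>)
    finally show ?case unfolding f_app[OF T_closed[OF x_closed]] by (rule sym)
  next
    case y
    have inj: "inj_on (\<lambda>v. vtx n (v + 1)) {1..n}" and im: "(\<lambda>v. vtx n (v + 1)) ` {1..n} = {1..n}"
    proof -
      show inj: "inj_on (\<lambda>v. vtx n (v + 1)) {1..n}"
        by (rule inj_on_inverseI[of _ "\<lambda>v. vtx n (v - 1)"]) (simp only: vtx_vtx add_diff_cancel_right', simp)
      have "(\<lambda>v. vtx n (v + 1)) ` {1..n} \<subseteq> {1..n}" using vtx_range(1) by blast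
      then show "(\<lambda>v. vtx n (v + 1)) ` {1..n} = {1..n}"
        using inj by (intro card_subset_eq) (auto simp: card_image)
    qed
    have y_g': "y \<cdot> g (vtx n (v + 1)) = C.\<rho> (c (vtx n (v + 1))) \<cdot> g v" if "v \<in> {1..n}" for v
    proof -
      have "vtx n (vtx n (v + 1) - 1) = v" using that by (simp only: vtx_vtx add_diff_cancel_right') simp
      then show ?thesis using y_g[OF vtx_range(1), of "v + 1"] by simp
    qed
    have "y \<cdot> f m = (\<Oplus>\<^bsub>M\<^esub>v\<in>{1..n}. y \<cdot> C.\<rho> (m v) \<cdot> g v)"
      using y by (simp add: f_app act_finsum summand)
    also have "\<dots> = (\<Oplus>\<^bsub>M\<^esub>v\<in>(\<lambda>v. vtx n (v + 1)) ` {1..n}. y \<cdot> C.\<rho> (m v) \<cdot> g v)" unfolding im ..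
    also have "\<dots> = (\<Oplus>\<^bsub>M\<^esub>v\<in>{1..n}. y \<cdot> C.\<rho> (m (vtx n (v + 1))) \<cdot> g (vtx n (v + 1)))"
      using inj by (intro M.M.finsum_reindex) (auto intro!: M.smult_closed g_vtx simp: im g(1))
    also have "\<dots> = (\<Oplus>\<^bsub>M\<^esub>v\<in>{1..n}. C.\<rho> ((y \<odot>\<^bsub>T\<^esub> m) v) \<cdot> g v)"
    proof (intro M.M.finsum_cong' refl)
      fix v assume v: "v \<in> {1..n}"
      show "y \<cdot> C.\<rho> (m (vtx n (v + 1))) \<cdot> g (vtx n (v + 1)) = C.\<rho> ((y \<odot>\<^bsub>T\<^esub> m) v) \<cdot> g v"
        unfolding \<rho>_act_commute[OF y_closed g_vtx, symmetric] y_g'[OF v] T_y using v g(1)[OF v]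
        by (simp add: \<rho>_act_mult[symmetric] c_def mult.commute)
    qed (use g(1) in \<open>auto intro!: M.smult_closed\<close>)
    finally show ?case unfolding f_app[OF T_closed[OF y_closed]] by (rule sym)
  next
    case (add a a')
    then show ?case
      by (simp add: T.smult_l_distr f_add T.smult_closed M.smult_l_distr f_closed)
  next
    case (mult a a')
    then show ?case by (simp add: T.smult_assoc T.smult_closed M.smult_assoc f_closed)
  qed
  have "f \<in> Hom C T M"
    using f_closed f_add f_act by (intro HomI) (auto simp: f_def)
  moreover have "f (\<delta> n) = w"
  proof -
    have "f (\<delta> n) = (\<Oplus>\<^bsub>M\<^esub>v\<in>{1..n}. if n = v then g v else \<zero>\<^bsub>M\<^esub>)"
      unfolding f_app[OF \<delta>_closed] using g(1)
      by (intro M.M.finsum_cong') (auto simp: \<delta>_def M.smult_one)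
    also have "\<dots> = g n" using n g(1) by (intro M.M.add.finprod_singleton) auto
    finally show ?thesis by (simp add: g_n)
  qed
  ultimately show ?thesis by blast
qed

lemma Hom_image: "(\<lambda>f. f (\<delta> n)) ` Hom C T M = W_hom"
  using Hom_\<delta>_n ex_Hom by blast

end

section \<open>Homomorphisms into \<open>J M\<close> and the invariant kappa\<close>

context rank_one_hom
begin

abbreviation JM :: "(path_elts set, path_elts set \<Rightarrow> 'm) module" where
  "JM \<equiv> J_module C (E n) M"

abbreviation EC :: "path_elts set set" where "EC \<equiv> carrier (e\<Lambda> C (E n))"

lemma EC_iff: "c \<in> EC \<longleftrightarrow> c \<in> carrier C \<and> E n \<otimes>\<^bsub>C\<^esub> c = c"
proof
  assume "c \<in> EC"
  then obtain c' where "c' \<in> carrier C" "c = E n \<otimes>\<^bsub>C\<^esub> c'" by (auto simp: e\<Lambda>_def)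
  then show "c \<in> carrier C \<and> E n \<otimes>\<^bsub>C\<^esub> c = c"
    by (simp add: C.\<Lambda>.m_assoc[symmetric] E_idem)
next
  assume "c \<in> carrier C \<and> E n \<otimes>\<^bsub>C\<^esub> c = c"
  then show "c \<in> EC" by (simp add: e\<Lambda>_def) (metis image_eqI)
qed

lemma JM_simps:
  "carrier JM = Hom class_ring (e\<Lambda> C (E n)) (eM C (E n) M)" "\<zero>\<^bsub>JM\<^esub> = (\<lambda>c\<in>EC. \<zero>\<^bsub>M\<^esub>)"
  "f \<oplus>\<^bsub>JM\<^esub> g = (\<lambda>c\<in>EC. f c \<oplus>\<^bsub>M\<^esub> g c)" "a \<odot>\<^bsub>JM\<^esub> f = (\<lambda>c\<in>EC. f (c \<otimes>\<^bsub>C\<^esub> a))"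
  by (simp_all add: J_module_def)

lemma eM_simps: "carrier (eM C (E n) M) = V" "add (eM C (E n) M) = add M"
  "r \<odot>\<^bsub>eM C (E n) M\<^esub> m = C.\<rho> r \<cdot> m"
  by (simp_all add: eM_def restrict_scalars_def V_image scalar_act_\<rho>)

lemma e\<Lambda>_simps: "add (e\<Lambda> C (E n)) = add C" "smult (e\<Lambda> C (E n)) = smult C"
  by (simp_all add: e\<Lambda>_def)

lemma T_at_n:
  assumes c: "c \<in> EC" and m: "m \<in> carrier T"
  shows "c \<odot>\<^bsub>T\<^esub> m = C.\<rho> ((c \<odot>\<^bsub>T\<^esub> m) n) \<odot>\<^bsub>T\<^esub> \<delta> n"
proof -
  have c': "c \<in> carrier C" "E n \<otimes>\<^bsub>C\<^esub> c = c" using c by (simp_all add: EC_iff)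
  have "c \<odot>\<^bsub>T\<^esub> m = E n \<odot>\<^bsub>T\<^esub> (c \<odot>\<^bsub>T\<^esub> m)"
    using T.smult_assoc[OF E_closed[of n] c'(1) m] unfolding c'(2) .
  also have "\<dots> = C.\<rho> ((c \<odot>\<^bsub>T\<^esub> m) n) \<odot>\<^bsub>T\<^esub> \<delta> n"
    by (rule E_act_T[OF T_closed[OF c'(1)]]) (use n_pos in simp)
  finally show ?thesis .
qed

text \<open>The homomorphism into \<open>J M\<close> attached to \<open>w\<close>. As e_*
  \<open>M_J\<close> is free of rank one on \<open>\<delta> n\<close>, an element c of e_* C applied
  to m only contributes the coordinate of c m at *.\<close>

definition \<Psi> :: "'m \<Rightarrow> (int \<Rightarrow> complex fps) \<Rightarrow> path_elts set \<Rightarrow> 'm" where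
  "\<Psi> w = (\<lambda>m\<in>carrier T. \<lambda>c\<in>EC. C.\<rho> ((c \<odot>\<^bsub>T\<^esub> m) n) \<cdot> w)"

lemma \<Psi>_app: "\<lbrakk>m \<in> carrier T; c \<in> EC\<rbrakk> \<Longrightarrow> \<Psi> w m c = C.\<rho> ((c \<odot>\<^bsub>T\<^esub> m) n) \<cdot> w"
  by (simp add: \<Psi>_def)

lemma E_EC: "E n \<in> EC" by (simp add: EC_iff E_idem)

lemma EC_mult: "\<lbrakk>c \<in> EC; a \<in> carrier C\<rbrakk> \<Longrightarrow> c \<otimes>\<^bsub>C\<^esub> a \<in> EC"
  by (simp add: EC_iff C.\<Lambda>.m_assoc[symmetric])

lemma n_range: "n \<in> {1..n}" using n_pos by simp

lemma \<Psi>_\<delta>: "w \<in> V \<Longrightarrow> \<Psi> w (\<delta> n) (E n) = w"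
  using n_range by (simp add: \<Psi>_app[OF \<delta>_closed E_EC] T_E) (simp add: \<delta>_def M.smult_one V_closed)

lemma \<Psi>_in_JM:
  assumes w: "w \<in> V" and m: "m \<in> carrier T"
  shows "\<Psi> w m \<in> carrier JM"
  unfolding JM_simps
proof (rule HomI)
  fix c assume c: "c \<in> EC"
  show "\<Psi> w m c \<in> carrier (eM C (E n) M)" unfolding eM_simps \<Psi>_app[OF m c] by (rule V_\<rho>[OF w])
  fix d assume d: "d \<in> EC"
  have cd: "c \<in> carrier C" "d \<in> carrier C" using c d by (simp_all add: EC_iff)
  have "c \<oplus>\<^bsub>C\<^esub> d \<in> EC" using c d by (simp add: EC_iff C.\<Lambda>.r_distr)
  then show "\<Psi> w m (c \<oplus>\<^bsub>e\<Lambda> C (E n)\<^esub> d) = \<Psi> w m c \<oplus>\<^bsub>eM C (E n) M\<^esub> \<Psi> w m d"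
    using n_range w c d
    by (simp add: e\<Lambda>_simps eM_simps \<Psi>_app[OF m] T.smult_l_distr[OF cd m] T_simps(3) C.\<rho>_add
        M.smult_l_distr V_closed)
next
  fix r c assume c: "c \<in> EC"
  have cc: "c \<in> carrier C" using c by (simp add: EC_iff)
  have "r \<odot>\<^bsub>C\<^esub> c = C.\<rho> r \<otimes>\<^bsub>C\<^esub> c" by (rule C.smult_\<rho>[OF cc])
  moreover have "C.\<rho> r \<otimes>\<^bsub>C\<^esub> c \<in> EC" unfolding C.\<rho>_central[OF cc] by (rule EC_mult[OF c]) simp
  ultimately show "\<Psi> w m (r \<odot>\<^bsub>e\<Lambda> C (E n)\<^esub> c) = r \<odot>\<^bsub>eM C (E n) M\<^esub> \<Psi> w m c"
    using n_range w c T_\<rho>[OF T_closed[OF cc]]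
    by (simp add: e\<Lambda>_simps eM_simps \<Psi>_app m T.smult_assoc[OF C.\<rho>_closed cc m] \<rho>_act_mult V_closed)
next
  show "\<Psi> w m \<in> extensional EC" using m by (simp add: \<Psi>_def)
qed

lemma \<Psi>_Hom:
  assumes w: "w \<in> V"
  shows "\<Psi> w \<in> Hom C T JM"
proof (rule HomI)
  fix m assume m: "m \<in> carrier T"
  show "\<Psi> w m \<in> carrier JM" by (rule \<Psi>_in_JM[OF w m])
  fix m' assume m': "m' \<in> carrier T"
  have mm: "m \<oplus>\<^bsub>T\<^esub> m' \<in> carrier T" using m m' by simp
  show "\<Psi> w (m \<oplus>\<^bsub>T\<^esub> m') = \<Psi> w m \<oplus>\<^bsub>JM\<^esub> \<Psi> w m'"
  proof (rule extensionalityI[of _ EC])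
    fix c assume c: "c \<in> EC"
    then have "c \<in> carrier C" by (simp add: EC_iff)
    from T.smult_r_distr[OF this m m'] show "\<Psi> w (m \<oplus>\<^bsub>T\<^esub> m') c = (\<Psi> w m \<oplus>\<^bsub>JM\<^esub> \<Psi> w m') c"
      using c w n_range m m' mm
      by (simp add: \<Psi>_app JM_simps) (simp add: T_simps C.\<rho>_add M.smult_l_distr V_closed)
  qed (use mm in \<open>simp_all add: \<Psi>_def JM_simps\<close>)
next
  fix a m assume a: "a \<in> carrier C" and m: "m \<in> carrier T"
  have am: "a \<odot>\<^bsub>T\<^esub> m \<in> carrier T" by (rule T_closed[OF a])
  show "\<Psi> w (a \<odot>\<^bsub>T\<^esub> m) = a \<odot>\<^bsub>JM\<^esub> \<Psi> w m"
  proof (rule extensionalityI[of _ EC])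
    fix c assume c: "c \<in> EC"
    then have cc: "c \<in> carrier C" by (simp add: EC_iff)
    show "\<Psi> w (a \<odot>\<^bsub>T\<^esub> m) c = (a \<odot>\<^bsub>JM\<^esub> \<Psi> w m) c"
      using c by (simp add: JM_simps \<Psi>_app[OF am] \<Psi>_app[OF m EC_mult[OF c a]] T.smult_assoc[OF cc a m])
  qed (use am in \<open>simp_all add: \<Psi>_def JM_simps\<close>)
qed (simp add: \<Psi>_def)

text \<open>The value of \<open>\<psi> m\<close> at c is the value of c acting on
  \<open>\<psi> m\<close> at the idempotent, hence that of \<open>\<psi>\<close> at c m, and c m is
  a multiple of \<open>\<delta> n\<close>. So homomorphisms into \<open>J M\<close> are parametrized
  by all of \<open>V\<close>.\<close>

lemma \<Psi>_unique:
  assumes \<psi>: "\<psi> \<in> Hom C T JM"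
  shows "\<psi> (\<delta> n) (E n) \<in> V" "\<psi> = \<Psi> (\<psi> (\<delta> n) (E n))"
proof -
  have h: "\<psi> m \<in> Hom class_ring (e\<Lambda> C (E n)) (eM C (E n) M)" if "m \<in> carrier T" for m
    using HomD(1)[OF \<psi> that] by (simp add: JM_simps)
  show "\<psi> (\<delta> n) (E n) \<in> V" using HomD(1)[OF h[OF \<delta>_closed] E_EC] by (simp add: eM_simps)
  show "\<psi> = \<Psi> (\<psi> (\<delta> n) (E n))"
  proof (rule extensionalityI[of _ "carrier T"])
    fix m assume m: "m \<in> carrier T"
    show "\<psi> m = \<Psi> (\<psi> (\<delta> n) (E n)) m"
    proof (rule extensionalityI[of _ EC])
      fix c assume c: "c \<in> EC"
      then have cc: "c \<in> carrier C" "E n \<otimes>\<^bsub>C\<^esub> c = c" by (simp_all add: EC_iff)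
      define r where "r = (c \<odot>\<^bsub>T\<^esub> m) n"
      have "\<psi> m c = (c \<odot>\<^bsub>JM\<^esub> \<psi> m) (E n)" using E_EC cc by (simp add: JM_simps)
      also have "\<dots> = \<psi> (c \<odot>\<^bsub>T\<^esub> m) (E n)" using HomD(3)[OF \<psi> cc(1) m] by simp
      also have "\<dots> = \<psi> (C.\<rho> r \<odot>\<^bsub>T\<^esub> \<delta> n) (E n)" unfolding r_def using T_at_n[OF c m] by simp
      also have "\<dots> = \<psi> (\<delta> n) (E n \<otimes>\<^bsub>C\<^esub> C.\<rho> r)"
        using HomD(3)[OF \<psi> C.\<rho>_closed \<delta>_closed] E_EC by (simp add: JM_simps)
      also have "E n \<otimes>\<^bsub>C\<^esub> C.\<rho> r = r \<odot>\<^bsub>C\<^esub> E n" by (simp add: C.smult_\<rho> C.\<rho>_central)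
      also have "\<psi> (\<delta> n) (r \<odot>\<^bsub>C\<^esub> E n) = C.\<rho> r \<cdot> \<psi> (\<delta> n) (E n)"
        using HomD(3)[OF h[OF \<delta>_closed] _ E_EC, of r] by (simp add: e\<Lambda>_simps eM_simps)
      finally show "\<psi> m c = \<Psi> (\<psi> (\<delta> n) (E n)) m c" unfolding \<Psi>_app[OF m c] r_def .
    qed (use HomD(4)[OF h[OF m]] m in \<open>simp_all add: \<Psi>_def\<close>)
  qed (use HomD(4)[OF \<psi>] in \<open>simp_all add: \<Psi>_def\<close>)
qed

lemma \<Psi>_embedding:
  assumes f: "f \<in> Hom C T M"
  shows "compose (carrier T) (J_embedding C (E n) M) f = \<Psi> (f (\<delta> n))"
proof (rule extensionalityI[of _ "carrier T"])
  fix m assume m: "m \<in> carrier T"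
  have fm: "f m \<in> carrier M" by (rule HomD(1)[OF f m])
  show "compose (carrier T) (J_embedding C (E n) M) f m = \<Psi> (f (\<delta> n)) m"
  proof (rule extensionalityI[of _ EC])
    fix c assume c: "c \<in> EC"
    then have cc: "c \<in> carrier C" by (simp add: EC_iff)
    have "c \<cdot> f m = f (c \<odot>\<^bsub>T\<^esub> m)" using HomD(3)[OF f cc m] by simp
    also have "\<dots> = f (C.\<rho> ((c \<odot>\<^bsub>T\<^esub> m) n) \<odot>\<^bsub>T\<^esub> \<delta> n)" using T_at_n[OF c m] by simp
    also have "\<dots> = C.\<rho> ((c \<odot>\<^bsub>T\<^esub> m) n) \<cdot> f (\<delta> n)" by (rule HomD(3)[OF f C.\<rho>_closed \<delta>_closed])
    finally show "compose (carrier T) (J_embedding C (E n) M) f m c = \<Psi> (f (\<delta> n)) m c"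
      using m c fm by (simp add: \<Psi>_app compose_def J_embedding_def)
  qed (use m fm in \<open>simp_all add: \<Psi>_def compose_def J_embedding_def\<close>)
qed (simp_all add: \<Psi>_def compose_def)

text \<open>Homomorphisms into \<open>J M\<close> correspond to \<open>V\<close>, and those that
  factor through \<open>M\<close> to \<open>W_hom\<close>. The coordinates \<open>\<eta>\<close>
  carry this pair into a function space, where \<open>codim\<close> is available.\<close>

lemma \<kappa>_eq_codim:
  fixes \<eta> :: "'m \<Rightarrow> 'i \<Rightarrow> complex fps"
  assumes bij: "bij_betw \<eta> V U"
    and add: "\<And>w w'. \<lbrakk>w \<in> V; w' \<in> V\<rbrakk> \<Longrightarrow> \<eta> (w \<oplus>\<^bsub>M\<^esub> w') = \<eta> w + \<eta> w'"
    and smult: "\<And>r w. w \<in> V \<Longrightarrow> \<eta> (C.\<rho> r \<cdot> w) = rscale r (\<eta> w)"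
    and W: "cx.subspace (\<eta> ` W_hom)" and d: "cx.codim U (\<eta> ` W_hom) d"
  shows "\<kappa> C (E n) T M = d"
proof -
  let ?P = "Hom_module C T JM"
  define L where "L \<psi> = \<eta> (\<psi> (\<delta> n) (E n))" for \<psi> :: "(int \<Rightarrow> complex fps) \<Rightarrow> path_elts set \<Rightarrow> 'm"
  have carr: "carrier ?P = \<Psi> ` V"
    using \<Psi>_Hom \<Psi>_unique by (auto simp: Hom_module_def)
  have L\<Psi>: "L (\<Psi> w) = \<eta> w" if "w \<in> V" for w using \<Psi>_\<delta>[OF that] by (simp add: L_def)
  have zero_eq: "\<zero>\<^bsub>?P\<^esub> = \<Psi> \<zero>\<^bsub>M\<^esub>"
  proof -
    have "\<zero>\<^bsub>?P\<^esub> = (\<lambda>m\<in>carrier T. \<lambda>c\<in>EC. \<zero>\<^bsub>M\<^esub>)" by (simp add: Hom_module_def JM_simps)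
    also have "\<dots> = \<Psi> \<zero>\<^bsub>M\<^esub>" unfolding \<Psi>_def by (intro restrict_ext) simp
    finally show ?thesis .
  qed
  have add_eq: "\<Psi> w \<oplus>\<^bsub>?P\<^esub> \<Psi> w' = \<Psi> (w \<oplus>\<^bsub>M\<^esub> w')" if "w \<in> V" "w' \<in> V" for w w'
  proof -
    have "\<Psi> w \<oplus>\<^bsub>?P\<^esub> \<Psi> w' = (\<lambda>m\<in>carrier T. \<Psi> w m \<oplus>\<^bsub>JM\<^esub> \<Psi> w' m)" by (simp add: Hom_module_def)
    also have "\<dots> = (\<lambda>m\<in>carrier T. \<lambda>c\<in>EC. \<Psi> w m c \<oplus>\<^bsub>M\<^esub> \<Psi> w' m c)" by (simp only: JM_simps)
    also have "\<dots> = \<Psi> (w \<oplus>\<^bsub>M\<^esub> w')"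
      unfolding \<Psi>_def[of "w \<oplus>\<^bsub>M\<^esub> w'"] using that
      by (intro restrict_ext) (simp add: \<Psi>_app M.smult_r_distr V_closed)
    finally show ?thesis .
  qed
  have smult_eq: "r \<odot>\<^bsub>?P\<^esub> \<Psi> w = \<Psi> (C.\<rho> r \<cdot> w)" if w: "w \<in> V" for r w
  proof (rule extensionalityI[of _ "carrier T"])
    fix m assume m: "m \<in> carrier T"
    have rm: "C.\<rho> r \<odot>\<^bsub>T\<^esub> m \<in> carrier T" by (rule T_closed) simp
    have "(r \<odot>\<^bsub>?P\<^esub> \<Psi> w) m = C.\<rho> r \<odot>\<^bsub>JM\<^esub> \<Psi> w m"
      using m by (simp add: Hom_module_def scalar_act_def C.\<rho>_def)
    also have "\<dots> = \<Psi> w (C.\<rho> r \<odot>\<^bsub>T\<^esub> m)" using HomD(3)[OF \<Psi>_Hom[OF w] C.\<rho>_closed m] by simp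
    also have "\<dots> = \<Psi> (C.\<rho> r \<cdot> w) m"
    proof (rule extensionalityI[of _ EC])
      fix c assume c: "c \<in> EC"
      then have cc: "c \<in> carrier C" by (simp add: EC_iff)
      have "c \<odot>\<^bsub>T\<^esub> (C.\<rho> r \<odot>\<^bsub>T\<^esub> m) = C.\<rho> r \<odot>\<^bsub>T\<^esub> (c \<odot>\<^bsub>T\<^esub> m)"
        by (simp add: T.smult_assoc[symmetric] cc m C.\<rho>_central)
      then have "(c \<odot>\<^bsub>T\<^esub> (C.\<rho> r \<odot>\<^bsub>T\<^esub> m)) n = (c \<odot>\<^bsub>T\<^esub> m) n * r"
        using n_range T_\<rho>[OF T_closed[OF cc]] by (simp add: mult.commute)
      then show "\<Psi> w (C.\<rho> r \<odot>\<^bsub>T\<^esub> m) c = \<Psi> (C.\<rho> r \<cdot> w) m c"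
        unfolding \<Psi>_app[OF rm c] \<Psi>_app[OF m c] using w by (simp add: \<rho>_act_mult V_closed)
    qed (use m rm in \<open>simp_all add: \<Psi>_def\<close>)
    finally show "(r \<odot>\<^bsub>?P\<^esub> \<Psi> w) m = \<Psi> (C.\<rho> r \<cdot> w) m" .
  qed (simp_all add: \<Psi>_def Hom_module_def)
  have \<eta>_inj: "inj_on \<eta> V" and \<eta>_im: "\<eta> ` V = U" using bij by (simp_all add: bij_betw_def)
  have \<eta>_zero: "\<eta> \<zero>\<^bsub>M\<^esub> = 0"
    using smult[OF V_zero, of 0] by (simp add: rscale_def zero_fun_def)
  have W_sub: "W_hom \<subseteq> V" by (auto simp: W_hom_def)
  let ?I = "(\<lambda>f. compose (carrier T) (J_embedding C (E n) M) f) ` Hom C T M"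
  have I: "?I = {\<psi> \<in> carrier ?P. L \<psi> \<in> \<eta> ` W_hom}"
  proof -
    have "?I = \<Psi> ` (\<lambda>f. f (\<delta> n)) ` Hom C T M" unfolding image_image using \<Psi>_embedding by (intro image_cong) auto
    also have "\<dots> = \<Psi> ` W_hom" unfolding Hom_image ..
    also have "\<dots> = {\<psi> \<in> carrier ?P. L \<psi> \<in> \<eta> ` W_hom}"
    proof (intro equalityI subsetI)
      fix \<psi> assume "\<psi> \<in> \<Psi> ` W_hom"
      then obtain w where w: "w \<in> W_hom" "\<psi> = \<Psi> w" by blast
      then have "w \<in> V" using W_sub by blast
      from L\<Psi>[OF this] show "\<psi> \<in> {\<psi> \<in> carrier ?P. L \<psi> \<in> \<eta> ` W_hom}"
        using w \<open>w \<in> V\<close> carr by auto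
    next
      fix \<psi> assume "\<psi> \<in> {\<psi> \<in> carrier ?P. L \<psi> \<in> \<eta> ` W_hom}"
      then obtain w w' where w: "w \<in> V" "\<psi> = \<Psi> w" "w' \<in> W_hom" "L \<psi> = \<eta> w'" using carr by auto
      then have "\<eta> w = \<eta> w'" using L\<Psi>[OF w(1)] by simp
      then have "w = w'" using inj_onD[OF \<eta>_inj _ w(1)] w(3) W_sub by blast
      then show "\<psi> \<in> \<Psi> ` W_hom" using w by blast
    qed
    finally show ?thesis .
  qed
  have "vectorspace.dim class_ring (complex_scalars (quotient_by ?P ?I)) = d"
  proof (rule dim_quotient_by[where L = L and U = U, OF _ _ _ _ _ _ _ W I d])
    show "bij_betw L (carrier ?P) U"
    proof (rule bij_betw_imageI)
      have "inj_on (L \<circ> \<Psi>) V \<longleftrightarrow> inj_on \<eta> V" by (rule inj_on_cong) (simp add: L\<Psi>)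
      then show "inj_on L (carrier ?P)" unfolding carr using \<eta>_inj by (intro inj_on_imageI) simp
      show "L ` carrier ?P = U" unfolding carr image_image \<eta>_im[symmetric] by (intro image_cong) (auto simp: L\<Psi>)
    qed
  qed (auto simp: carr add_eq zero_eq smult_eq L\<Psi> add smult \<eta>_zero V_add V_\<rho> V_zero)
  then show ?thesis by (simp add: \<kappa>_def)
qed

end

text \<open>The exchange argument for a set that is only independent modulo \<open>W\<close>. It
  bounds the finite subsets of a basis over the power series ring before that basis is known to be
  finite.\<close>

lemma (in codim_space) indep_mod_card_le:
  assumes B: "basis_mod U W B" and B': "finite B'" "B' \<subseteq> U"
    and ind': "\<And>c. (\<Sum>b\<in>B'. c b *s b) \<in> W \<Longrightarrow> \<forall>b\<in>B'. c b = 0" and W: "subspace W"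
  shows "card B' \<le> card B"
proof -
  have fin: "finite B" using B unfolding basis_mod_def by auto
  have "\<forall>b\<in>B'. \<exists>p. p \<in> span B \<and> b - p \<in> W"
    using basis_mod_span[OF B] B'(2) by blast
  then obtain p where p: "\<And>b. b \<in> B' \<Longrightarrow> p b \<in> span B" "\<And>b. b \<in> B' \<Longrightarrow> b - p b \<in> W"
    by metis
  have ind: "\<forall>b\<in>B'. c b = 0" if "(\<Sum>b\<in>B'. c b *s p b) = 0" for c
  proof (rule ind')
    have "(\<Sum>b\<in>B'. c b *s (b - p b)) \<in> W"
      using p(2) W by (intro subspace_sum subspace_scale) auto
    also have "(\<Sum>b\<in>B'. c b *s (b - p b)) = (\<Sum>b\<in>B'. c b *s b)"
      using that by (simp add: scale_right_diff_distrib sum_subtractf)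
    finally show "(\<Sum>b\<in>B'. c b *s b) \<in> W" .
  qed
  have inj: "inj_on p B'"
  proof
    fix a b assume ab: "a \<in> B'" "b \<in> B'" "p a = p b"
    show "a = b"
    proof (rule ccontr)
      assume ne: "a \<noteq> b"
      define c where "c = (\<lambda>x. if x = a then 1 else if x = b then -1 else (0::'a))"
      have "(\<Sum>x\<in>B'. c x *s p x) = (\<Sum>x\<in>{a, b}. c x *s p x)"
        using ab B' by (intro sum.mono_neutral_right) (auto simp: c_def)
      also have "\<dots> = 0" using ne ab(3) by (simp add: c_def)
      finally have "c a = 0" using ind ab(1) by blast
      then show False by (simp add: c_def)
    qed
  qed
  have "independent (p ` B')"
  proof
    assume "dependent (p ` B')"
    then obtain u where u: "\<exists>v\<in>p ` B'. u v \<noteq> 0" "(\<Sum>v\<in>p ` B'. u v *s v) = 0"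
      using B' by (auto simp: dependent_finite)
    then have "(\<Sum>b\<in>B'. u (p b) *s p b) = 0"
      by (simp add: sum.reindex[OF inj])
    then have "\<forall>b\<in>B'. u (p b) = 0" by (rule ind[of "u \<circ> p", simplified])
    then show False using u(1) by blast
  qed
  then have "card (p ` B') \<le> card B"
    using independent_span_bound[OF fin] p(1) by auto
  then show ?thesis using card_image[OF inj] by simp
qed

section \<open>Free modules over the ring of power series\<close>

lemma rscale_sum: "rscale r (\<Sum>i\<in>S. f i) = (\<Sum>i\<in>S. rscale r (f i))"
proof (induction S rule: infinite_finite_induct)
  case (insert i S)
  then show ?case by (simp only: sum.insert[OF insert(1,2)] rscale_add)
qed (simp_all only: sum.empty sum.infinite rscale_zero not_False_eq_True)

text \<open>\<open>free_rank\<close> measures a basis chosen by \<open>SOME\<close>, so every basis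
  has to be counted: modulo t it becomes a complex basis of U/tU, whose dimension is
  \<open>card S\<close>.\<close>

lemma free_rank_eq:
  fixes P :: "(complex fps, 'p) module" and \<eta> :: "'p \<Rightarrow> 'i \<Rightarrow> complex fps"
  assumes P: "Module.module class_ring P" and S: "finite S"
    and bij: "bij_betw \<eta> (carrier P) (supported_on S)"
    and add: "\<And>p q. \<lbrakk>p \<in> carrier P; q \<in> carrier P\<rbrakk> \<Longrightarrow> \<eta> (p \<oplus>\<^bsub>P\<^esub> q) = \<eta> p + \<eta> q"
    and smult: "\<And>r p. p \<in> carrier P \<Longrightarrow> \<eta> (r \<odot>\<^bsub>P\<^esub> p) = rscale r (\<eta> p)"
  shows "free_rank P = card S" "\<exists>B. finite B \<and> is_basis P B"
proof -
  interpret P: Module.module class_ring P by (rule P)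
  let ?U = "supported_on S :: ('i \<Rightarrow> complex fps) set"
  have inj: "inj_on \<eta> (carrier P)" and im: "\<eta> ` carrier P = ?U" using bij by (auto simp: bij_betw_def)
  have sm: "r \<odot>\<^bsub>P\<^esub> p \<in> carrier P" if "p \<in> carrier P" for r p using P.smult_closed[of r p] that by simp
  have \<eta>0: "\<eta> \<zero>\<^bsub>P\<^esub> = 0"
    using add[of "\<zero>\<^bsub>P\<^esub>" "\<zero>\<^bsub>P\<^esub>"] by simp
  have lc: "\<eta> (P.lincomb a A) = (\<Sum>v\<in>A. rscale (a v) (\<eta> v))" if "finite A" "A \<subseteq> carrier P" for a A
    using that
  proof (induction A)
    case empty
    then show ?case by (simp only: P.lincomb_def P.M.finsum_empty sum.empty \<eta>0)
  next
    case (insert v A)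
    have "P.lincomb a (insert v A) = a v \<odot>\<^bsub>P\<^esub> v \<oplus>\<^bsub>P\<^esub> P.lincomb a A"
      unfolding P.lincomb_def using insert by (intro P.M.finsum_insert) (auto intro: sm)
    moreover have "P.lincomb a A \<in> carrier P" using insert by (intro P.lincomb_closed) auto
    ultimately show ?case
      using insert by (simp only: sum.insert[OF insert(1,2)] add smult sm insert_subset)
  qed
  have lc_closed: "P.lincomb a A \<in> carrier P" if "A \<subseteq> carrier P" for a A
    using that by (intro P.lincomb_closed) auto
  define \<psi> where "\<psi> i = inv_into (carrier P) \<eta> (unit_fun i)" for i
  have unit: "unit_fun i \<in> ?U" if "i \<in> S" for i using that by (auto simp: unit_fun_def supported_on_def)
  have \<psi>: "\<psi> i \<in> carrier P" "\<eta> (\<psi> i) = unit_fun i" if "i \<in> S" for i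
    using unit[OF that] im by (auto simp: \<psi>_def inv_into_into f_inv_into_f)
  have \<psi>_inj: "inj_on \<psi> S"
  proof
    fix i j assume "i \<in> S" "j \<in> S" "\<psi> i = \<psi> j"
    then have "unit_fun i j = (unit_fun j j :: complex fps)" using \<psi>(2) by metis
    then show "i = j" by (simp add: unit_fun_def split: if_splits)
  qed
  have lc_unit: "\<eta> (P.lincomb a (\<psi> ` S)) j = (if j \<in> S then a (\<psi> j) else 0)" for a j
  proof -
    have "\<eta> (P.lincomb a (\<psi> ` S)) = (\<Sum>i\<in>S. rscale (a (\<psi> i)) (\<eta> (\<psi> i)))"
      using lc[of "\<psi> ` S" a] S \<psi>(1) by (simp add: sum.reindex[OF \<psi>_inj] image_subset_iff o_def)
    also have "\<dots> = (\<Sum>i\<in>S. rscale (a (\<psi> i)) (unit_fun i))" by (intro sum.cong refl) (simp add: \<psi>)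
    finally show ?thesis using S by (simp add: sum_apply rscale_def sum_unit_fun)
  qed
  have \<psi>S: "\<psi> ` S \<subseteq> carrier P" using \<psi>(1) by blast
  have basis0: "is_basis P (\<psi> ` S)"
    unfolding is_basis_def
  proof (intro conjI \<psi>S)
    show "\<not> P.lin_dep (\<psi> ` S)"
    proof (rule P.finite_lin_indpt2)
      fix a assume "P.lincomb a (\<psi> ` S) = \<zero>\<^bsub>P\<^esub>"
      then have "a (\<psi> j) = 0" if "j \<in> S" for j using lc_unit[of a j] that \<eta>0 by simp
      then show "\<forall>v\<in>\<psi> ` S. a v = \<zero>\<^bsub>class_ring\<^esub>" by simp
    qed (use S \<psi>S in auto)
    show "P.gen_set (\<psi> ` S)"
    proof
      show "P.span (\<psi> ` S) \<subseteq> carrier P" using \<psi>S by (rule P.span_is_subset2)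
      show "carrier P \<subseteq> P.span (\<psi> ` S)"
      proof
        fix p assume p: "p \<in> carrier P"
        have "\<eta> p \<in> ?U" using p im by blast
        define a where "a v = \<eta> p (inv_into S \<psi> v)" for v
        have "p = P.lincomb a (\<psi> ` S)"
        proof (rule inj_onD[OF inj _ p lc_closed[OF \<psi>S]])
          show "\<eta> p = \<eta> (P.lincomb a (\<psi> ` S))"
            using \<open>\<eta> p \<in> ?U\<close> \<psi>_inj by (auto simp: fun_eq_iff lc_unit a_def supported_on_def)
        qed
        then show "p \<in> P.span (\<psi> ` S)"
          unfolding P.span_def
          by (intro CollectI exI[of _ a] exI[of _ "\<psi> ` S"] conjI) (use S in auto)
      qed
    qed
  qed
  then show "\<exists>B. finite B \<and> is_basis P B" using S by blast
  let ?W = "rscale fps_X ` ?U"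
  have Wsub: "cx.subspace ?W"
  proof (rule R_submodule_subspace)
    show "R_submodule ?W"
      unfolding R_submodule_def
    proof (intro conjI ballI allI)
      show "0 \<in> ?W" by (rule image_eqI[of _ _ 0]) (simp_all add: supported_on_def)
    next
      fix p q assume "p \<in> ?W" "q \<in> ?W"
      then obtain u v where uv: "u \<in> ?U" "v \<in> ?U" "p = rscale fps_X u" "q = rscale fps_X v" by blast
      have "u + v \<in> ?U" using uv R_submodule_supported_on[of S] by (simp add: R_submodule_def)
      then show "p + q \<in> ?W" unfolding uv(3,4) rscale_add[symmetric] by (rule imageI)
    next
      fix r p assume "p \<in> ?W"
      then obtain u where u: "u \<in> ?U" "p = rscale fps_X u" by blast
      have "rscale r u \<in> ?U" using u R_submodule_supported_on[of S] by (simp add: R_submodule_def)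
      moreover have "rscale r p = rscale fps_X (rscale r u)"
        unfolding u(2) rscale_rscale by (simp add: mult.commute)
      ultimately show "rscale r p \<in> ?W" by blast
    qed
  qed
  obtain B0 where B0: "cx.basis_mod ?U ?W B0" "card B0 = card S"
    using codim_shift[OF S] unfolding cx.codim_def by blast
  have card_basis: "card B = card S" if B: "is_basis P B" for B
  proof -
    have Bc: "B \<subseteq> carrier P" and ind: "\<not> P.lin_dep B" and gen: "P.span B = carrier P"
      using B by (auto simp: is_basis_def)
    have \<eta>_inj: "inj_on \<eta> A" if "A \<subseteq> B" for A using inj Bc that by (meson inj_on_subset subset_trans)
    have indep: "\<forall>b\<in>\<eta> ` A. c b = 0"
      if A: "finite A" "A \<subseteq> B" and c: "(\<Sum>b\<in>\<eta> ` A. cscale (c b) b) \<in> ?W" for A c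
    proof -
      obtain u where u: "u \<in> ?U" "(\<Sum>b\<in>\<eta> ` A. cscale (c b) b) = rscale fps_X u" using c by blast
      obtain w where w: "w \<in> carrier P" "u = \<eta> w" using u(1) im by blast
      have "w \<in> P.span B" using w(1) gen by simp
      then obtain a A' where A': "finite A'" "A' \<subseteq> B" "w = P.lincomb a A'"
        unfolding P.span_def by auto
      \<comment> \<open>Subtracting the expansion of t u turns the congruence modulo t into a linear
        relation over the power series ring; the constant terms of its coefficients on
        \<open>A\<close> are the given \<open>c\<close>.\<close>
      define e where "e v = (if v \<in> A then fps_const (c (\<eta> v)) else 0) - fps_X * (if v \<in> A' then a v else 0)" for v
      have AA: "finite (A \<union> A')" "A \<union> A' \<subseteq> carrier P" "A' \<subseteq> carrier P" using A A' Bc by auto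
      have "(\<Sum>b\<in>\<eta> ` A. cscale (c b) b) = (\<Sum>v\<in>A. rscale (fps_const (c (\<eta> v))) (\<eta> v))"
        by (simp add: sum.reindex[OF \<eta>_inj[OF A(2)]] cscale_def o_def)
      also have "\<dots> = (\<Sum>v\<in>A \<union> A'. rscale (if v \<in> A then fps_const (c (\<eta> v)) else 0) (\<eta> v))"
        using AA(1) by (intro sum.mono_neutral_cong_left) (auto simp: rscale_def)
      finally have 1: "rscale fps_X u = (\<Sum>v\<in>A \<union> A'. rscale (if v \<in> A then fps_const (c (\<eta> v)) else 0) (\<eta> v))"
        using u(2) by simp
      have "rscale fps_X u = (\<Sum>v\<in>A'. rscale (fps_X * a v) (\<eta> v))"
        unfolding w(2) A'(3) lc[OF A'(1) AA(3)] rscale_sum rscale_rscale ..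
      also have "\<dots> = (\<Sum>v\<in>A \<union> A'. rscale (fps_X * (if v \<in> A' then a v else 0)) (\<eta> v))"
        using AA(1) by (intro sum.mono_neutral_cong_left) (auto simp: rscale_def)
      finally have 2: "rscale fps_X u = (\<Sum>v\<in>A \<union> A'. rscale (fps_X * (if v \<in> A' then a v else 0)) (\<eta> v))" .
      have "\<eta> (P.lincomb e (A \<union> A')) = (\<Sum>v\<in>A \<union> A'. rscale (e v) (\<eta> v))" by (rule lc[OF AA(1,2)])
      also have "\<dots> = (\<Sum>v\<in>A \<union> A'. rscale (if v \<in> A then fps_const (c (\<eta> v)) else 0) (\<eta> v)
          - rscale (fps_X * (if v \<in> A' then a v else 0)) (\<eta> v))"
        by (intro sum.cong refl) (simp add: e_def rscale_def fun_eq_iff algebra_simps)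
      also have "\<dots> = \<eta> \<zero>\<^bsub>P\<^esub>" unfolding sum_subtractf 1[symmetric] 2[symmetric] \<eta>0 by simp
      finally have "P.lincomb e (A \<union> A') = \<zero>\<^bsub>P\<^esub>"
        using inj_onD[OF inj _ lc_closed[OF AA(2)] P.M.zero_closed] by simp
      then have e0: "e v = 0" if "v \<in> A \<union> A'" for v
        using P.lin_dep_crit[of "A \<union> A'" B e v] ind AA(1) A(2) A'(2) that by auto
      show ?thesis
      proof
        fix b assume "b \<in> \<eta> ` A"
        then obtain v where v: "v \<in> A" "b = \<eta> v" by blast
        then have "fps_nth (e v) 0 = 0" using e0[of v] by simp
        then show "c b = 0" using v by (simp add: e_def)
      qed
    qed
    have \<eta>B: "\<eta> ` A \<subseteq> ?U" if "A \<subseteq> B" for A using that Bc im by blast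
    have bound: "card A \<le> card S" if A: "finite A" "A \<subseteq> B" for A
      using cx.indep_mod_card_le[OF B0(1) _ \<eta>B[OF A(2)] indep[OF A] Wsub] A(1) B0(2)
        card_image[OF \<eta>_inj[OF A(2)]] by simp
    \<comment> \<open>Finite subsets of \<open>B\<close> stay independent modulo t, which bounds
      their size.\<close>
    have fB: "finite B"
    proof (rule ccontr)
      assume "infinite B"
      then obtain A where "finite A" "card A = Suc (card S)" "A \<subseteq> B"
        using infinite_arbitrarily_large by metis
      then show False using bound[of A] by simp
    qed
    have "cx.basis_mod ?U ?W (\<eta> ` B)"
      unfolding cx.basis_mod_def
    proof (intro conjI ballI allI impI)
      show "finite (\<eta> ` B)" "\<eta> ` B \<subseteq> ?U" using fB \<eta>B by auto
    next
      fix u assume "u \<in> ?U"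
      then obtain w where w: "w \<in> carrier P" "u = \<eta> w" using im by blast
      have "w \<in> P.span B" using w(1) gen by simp
      then obtain a A where A: "finite A" "A \<subseteq> B" "w = P.lincomb a A"
        unfolding P.span_def by auto
      have Ac: "A \<subseteq> carrier P" using A(2) Bc by blast
      have "\<forall>v. \<exists>g. a v = fps_const (fps_nth (a v) 0) + fps_X * g" by (intro allI fps_split)
      then obtain g where g: "\<And>v. a v = fps_const (fps_nth (a v) 0) + fps_X * g v" by metis
      let ?b = "\<Sum>v\<in>A. cscale (fps_nth (a v) 0) (\<eta> v)"
      have "u = (\<Sum>v\<in>A. cscale (fps_nth (a v) 0) (\<eta> v) + rscale fps_X (rscale (g v) (\<eta> v)))"
        unfolding w(2) A(3) lc[OF A(1) Ac]
      proof (intro sum.cong refl ext)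
        fix v i
        have "rscale (a v) (\<eta> v) i = (fps_const (fps_nth (a v) 0) + fps_X * g v) * \<eta> v i"
          using g[of v] by (simp add: rscale_def)
        then show "rscale (a v) (\<eta> v) i = (cscale (fps_nth (a v) 0) (\<eta> v) + rscale fps_X (rscale (g v) (\<eta> v))) i"
          by (simp add: cscale_def rscale_def algebra_simps)
      qed
      also have "\<dots> = ?b + rscale fps_X (\<eta> (P.lincomb g A))"
        unfolding sum.distrib lc[OF A(1) Ac] rscale_sum ..
      finally have "u - ?b = rscale fps_X (\<eta> (P.lincomb g A))" by (simp only: add_diff_cancel_left')
      moreover have "\<eta> (P.lincomb g A) \<in> ?U" using lc_closed[OF Ac] im by blast
      ultimately have "u - ?b \<in> ?W" by (simp only: imageI)
      moreover have "?b \<in> cx.span (\<eta> ` B)"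
        using A(2) by (intro cx.span_sum cx.span_scale) (auto intro: cx.span_base)
      ultimately show "\<exists>b\<in>cx.span (\<eta> ` B). u - b \<in> ?W" by (intro bexI[of _ ?b])
    next
      fix c b assume "(\<Sum>b\<in>\<eta> ` B. cscale (c b) b) \<in> ?W" "b \<in> \<eta> ` B"
      then show "c b = 0" using indep[OF fB order_refl] by blast
    qed
    then have "cx.codim ?U ?W (card (\<eta> ` B))" unfolding cx.codim_def by blast
    from cx.codim_unique[OF codim_shift[OF S] this Wsub] show ?thesis
      by (simp only: card_image[OF \<eta>_inj[OF order_refl]])
  qed
  have "is_basis P (SOME B. is_basis P B)" using basis0 by (rule someI[where P = "is_basis P"])
  then show "free_rank P = card S" unfolding free_rank_def by (rule card_basis)
qed

lemma cring_fps: "cring (class_ring :: complex fps ring)"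
proof -
  interpret cring "class_ring :: complex fps ring" ..
  show ?thesis ..
qed

lemma fps_unit_mult: "fps_nth f 0 \<noteq> 0 \<Longrightarrow> inverse f * f = (1 :: complex fps)"
  by (rule inverse_mult_eq_1)

lemma fps_factor_X_power:
  "(\<And>i. i < m \<Longrightarrow> fps_nth f i = 0) \<Longrightarrow> f = fps_X ^ m * fps_shift m (f :: complex fps)"
  by (rule fps_ext) (simp add: fps_X_power_mult_nth)

context C_module
begin

lemma restrict_scalars_simps:
  "carrier (restrict_scalars C M) = carrier M" "add (restrict_scalars C M) = add M"
  "\<zero>\<^bsub>restrict_scalars C M\<^esub> = \<zero>\<^bsub>M\<^esub>" "r \<odot>\<^bsub>restrict_scalars C M\<^esub> m = C.\<rho> r \<cdot> m"
  by (simp_all add: restrict_scalars_def scalar_act_\<rho>)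

lemma neg_act': "m \<in> carrier M \<Longrightarrow> C.\<rho> (-1) \<cdot> m \<oplus>\<^bsub>M\<^esub> m = \<zero>\<^bsub>M\<^esub>"
proof -
  assume m: "m \<in> carrier M"
  have "C.\<rho> (-1) \<oplus>\<^bsub>C\<^esub> \<one>\<^bsub>C\<^esub> = C.\<rho> 0" using C.\<rho>_add[of "-1" 1] by simp
  then show ?thesis
    using M.smult_l_distr[of "C.\<rho> (-1)" "\<one>\<^bsub>C\<^esub>" m] m by (simp add: M.smult_one)
qed

lemma restrict_scalars_module: "Module.module class_ring (restrict_scalars C M)"
proof (rule module_criteria)
  show "cring (class_ring :: complex fps ring)" by (rule cring_fps)
  show "\<forall>v\<in>carrier (restrict_scalars C M). \<exists>w\<in>carrier (restrict_scalars C M).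
      v \<oplus>\<^bsub>restrict_scalars C M\<^esub> w = \<zero>\<^bsub>restrict_scalars C M\<^esub>"
    unfolding restrict_scalars_simps
    by (intro ballI bexI[of _ "\<ominus>\<^bsub>M\<^esub> _"]) (auto simp: M.M.r_neg)
qed (auto simp: restrict_scalars_simps M.smult_closed M.smult_l_distr M.smult_r_distr C.\<rho>_add
    \<rho>_act_mult M.smult_one M.M.a_ac)

lemma eM_module: "Module.module class_ring (eM C (E n) M)"
proof (rule module_criteria)
  have z: "\<zero>\<^bsub>eM C (E n) M\<^esub> = \<zero>\<^bsub>M\<^esub>" by (simp add: eM_def restrict_scalars_def)
  note eM = z
  have s: "carrier (eM C (E n) M) = V" "add (eM C (E n) M) = add M"
    "\<And>r m. r \<odot>\<^bsub>eM C (E n) M\<^esub> m = C.\<rho> r \<cdot> m"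
    by (simp_all add: eM_def restrict_scalars_def V_image scalar_act_\<rho>)
  show "cring (class_ring :: complex fps ring)" by (rule cring_fps)
  show "\<forall>v\<in>carrier (eM C (E n) M). \<exists>w\<in>carrier (eM C (E n) M). v \<oplus>\<^bsub>eM C (E n) M\<^esub> w = \<zero>\<^bsub>eM C (E n) M\<^esub>"
    unfolding s z
  proof
    fix v assume v: "v \<in> V"
    show "\<exists>w\<in>V. v \<oplus>\<^bsub>M\<^esub> w = \<zero>\<^bsub>M\<^esub>"
      using neg_act'[OF V_closed[OF v]] V_\<rho>[OF v, of "-1"] V_closed[OF v]
      by (intro bexI[of _ "C.\<rho> (-1) \<cdot> v"]) (auto simp: M.M.a_comm V_closed)
  qed
  show "\<zero>\<^bsub>eM C (E n) M\<^esub> \<in> carrier (eM C (E n) M)" unfolding s z by (rule V_zero)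
qed (simp_all add: eM_def restrict_scalars_def V_image[symmetric] scalar_act_\<rho> V_add V_\<rho> V_closed
    M.smult_l_distr M.smult_r_distr C.\<rho>_add \<rho>_act_mult M.smult_one M.M.a_ac)

definition Sub :: "'m set \<Rightarrow> 'm set" where
  "Sub S = {m. \<exists>f. m = (\<Oplus>\<^bsub>M\<^esub>s\<in>S. C.\<rho> (f s) \<cdot> s)}"

lemma summand_closed: "S \<subseteq> carrier M \<Longrightarrow> (\<lambda>s. C.\<rho> (f s) \<cdot> s) \<in> S \<rightarrow> carrier M"
  by (auto intro: M.smult_closed)

lemma Sub_closed: "S \<subseteq> carrier M \<Longrightarrow> Sub S \<subseteq> carrier M"
  using summand_closed by (auto simp: Sub_def intro!: M.M.finsum_closed)

lemma lc_add:
  assumes "finite S" "S \<subseteq> carrier M"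
  shows "(\<Oplus>\<^bsub>M\<^esub>s\<in>S. C.\<rho> (f s + g s) \<cdot> s) = (\<Oplus>\<^bsub>M\<^esub>s\<in>S. C.\<rho> (f s) \<cdot> s) \<oplus>\<^bsub>M\<^esub> (\<Oplus>\<^bsub>M\<^esub>s\<in>S. C.\<rho> (g s) \<cdot> s)"
proof -
  have "(\<Oplus>\<^bsub>M\<^esub>s\<in>S. C.\<rho> (f s + g s) \<cdot> s) = (\<Oplus>\<^bsub>M\<^esub>s\<in>S. C.\<rho> (f s) \<cdot> s \<oplus>\<^bsub>M\<^esub> C.\<rho> (g s) \<cdot> s)"
    using assms(2) by (intro M.M.finsum_cong') (auto simp: C.\<rho>_add M.smult_l_distr intro!: M.smult_closed)
  then show ?thesis using summand_closed[OF assms(2)] by (simp add: M.M.finsum_addf)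
qed

lemma lc_mult:
  assumes "finite S" "S \<subseteq> carrier M"
  shows "(\<Oplus>\<^bsub>M\<^esub>s\<in>S. C.\<rho> (r * f s) \<cdot> s) = C.\<rho> r \<cdot> (\<Oplus>\<^bsub>M\<^esub>s\<in>S. C.\<rho> (f s) \<cdot> s)"
  unfolding act_finsum[OF C.\<rho>_closed assms(1) summand_closed[OF assms(2)]]
  using assms(2) by (intro M.M.finsum_cong') (auto simp: \<rho>_act_mult intro!: M.smult_closed)

lemma lc_unit:
  assumes "finite S" "S \<subseteq> carrier M" "t \<in> S"
  shows "(\<Oplus>\<^bsub>M\<^esub>s\<in>S. C.\<rho> (if s = t then 1 else 0) \<cdot> s) = t"
proof -
  have "(\<Oplus>\<^bsub>M\<^esub>s\<in>S. C.\<rho> (if s = t then 1 else 0) \<cdot> s) = (\<Oplus>\<^bsub>M\<^esub>s\<in>S. if t = s then s else \<zero>\<^bsub>M\<^esub>)"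
    using assms(2) by (intro M.M.finsum_cong') (auto simp: M.smult_one)
  also have "\<dots> = t" using assms by (intro M.M.add.finprod_singleton) auto
  finally show ?thesis .
qed

lemma Sub_props:
  assumes S: "finite S" "S \<subseteq> carrier M"
  shows Sub_add: "\<lbrakk>a \<in> Sub S; b \<in> Sub S\<rbrakk> \<Longrightarrow> a \<oplus>\<^bsub>M\<^esub> b \<in> Sub S"
    and Sub_\<rho>: "a \<in> Sub S \<Longrightarrow> C.\<rho> r \<cdot> a \<in> Sub S"
    and Sub_base: "t \<in> S \<Longrightarrow> t \<in> Sub S"
    and Sub_zero: "\<zero>\<^bsub>M\<^esub> \<in> Sub S"
proof -
  show "a \<oplus>\<^bsub>M\<^esub> b \<in> Sub S" if ab: "a \<in> Sub S" "b \<in> Sub S"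
  proof -
    obtain f g where "a = (\<Oplus>\<^bsub>M\<^esub>s\<in>S. C.\<rho> (f s) \<cdot> s)" "b = (\<Oplus>\<^bsub>M\<^esub>s\<in>S. C.\<rho> (g s) \<cdot> s)"
      using ab by (auto simp: Sub_def)
    then show ?thesis
      unfolding Sub_def by (intro CollectI exI[of _ "\<lambda>s. f s + g s"]) (simp add: lc_add[OF S])
  qed
  show "C.\<rho> r \<cdot> a \<in> Sub S" if a: "a \<in> Sub S"
  proof -
    obtain f where "a = (\<Oplus>\<^bsub>M\<^esub>s\<in>S. C.\<rho> (f s) \<cdot> s)" using a by (auto simp: Sub_def)
    then show ?thesis
      unfolding Sub_def by (intro CollectI exI[of _ "\<lambda>s. r * f s"]) (simp add: lc_mult[OF S])
  qed
  show "t \<in> Sub S" if t: "t \<in> S"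
    unfolding Sub_def using lc_unit[OF S t, symmetric] by (intro CollectI exI)
  have "(\<Oplus>\<^bsub>M\<^esub>s\<in>S. C.\<rho> 0 \<cdot> s) = (\<Oplus>\<^bsub>M\<^esub>s\<in>S. \<zero>\<^bsub>M\<^esub>)"
    using S(2) by (intro M.M.finsum_cong') auto
  then have "\<zero>\<^bsub>M\<^esub> = (\<Oplus>\<^bsub>M\<^esub>s\<in>S. C.\<rho> 0 \<cdot> s)" using M.M.finsum_zero by simp
  then show "\<zero>\<^bsub>M\<^esub> \<in> Sub S" unfolding Sub_def by (intro CollectI exI[of _ "\<lambda>_. 0"])
qed

lemma Sub_finsum:
  assumes S: "finite S" "S \<subseteq> carrier M" and "finite A" "\<And>i. i \<in> A \<Longrightarrow> f i \<in> Sub S"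
  shows "(\<Oplus>\<^bsub>M\<^esub>i\<in>A. f i) \<in> Sub S"
  using assms(3,4)
proof (induction A)
  case (insert i A)
  then have "(\<Oplus>\<^bsub>M\<^esub>i\<in>insert i A. f i) = f i \<oplus>\<^bsub>M\<^esub> (\<Oplus>\<^bsub>M\<^esub>i\<in>A. f i)"
    using Sub_closed[OF S(2)] by (intro M.M.finsum_insert) auto
  then show ?case using insert Sub_add[OF S] by simp
qed (simp add: Sub_zero[OF S])

lemma Sub_act:
  assumes S: "finite S" "S \<subseteq> carrier M" and S': "finite S'" "S' \<subseteq> carrier M"
    and c: "c \<in> carrier C" "\<And>s. s \<in> S \<Longrightarrow> c \<cdot> s \<in> Sub S'" and m: "m \<in> Sub S"
  shows "c \<cdot> m \<in> Sub S'"
proof -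
  obtain f where f: "m = (\<Oplus>\<^bsub>M\<^esub>s\<in>S. C.\<rho> (f s) \<cdot> s)" using m by (auto simp: Sub_def)
  have "c \<cdot> m = (\<Oplus>\<^bsub>M\<^esub>s\<in>S. c \<cdot> C.\<rho> (f s) \<cdot> s)"
    unfolding f by (rule act_finsum[OF c(1) S(1) summand_closed[OF S(2)]])
  moreover have "c \<cdot> C.\<rho> (f s) \<cdot> s \<in> Sub S'" if s: "s \<in> S" for s
  proof -
    have "c \<cdot> C.\<rho> (f s) \<cdot> s = C.\<rho> (f s) \<cdot> c \<cdot> s" using s S by (intro \<rho>_act_commute[symmetric] c(1)) auto
    then show ?thesis using Sub_\<rho>[OF S' c(2)[OF s]] by simp
  qed
  ultimately show ?thesis using Sub_finsum[OF S' S(1)] by simp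
qed

lemma Sub_mono_gen:
  assumes "finite S" "S \<subseteq> carrier M" "finite S'" "S' \<subseteq> carrier M" "S \<subseteq> Sub S'"
  shows "Sub S \<subseteq> Sub S'"
proof
  fix m assume m: "m \<in> Sub S"
  have "\<one>\<^bsub>C\<^esub> \<cdot> m \<in> Sub S'"
    using assms by (intro Sub_act[OF assms(1-4) _ _ m]) (auto simp: M.smult_one subset_iff)
  then show "m \<in> Sub S'" using m Sub_closed[OF assms(2)] by (auto simp: M.smult_one subset_iff)
qed

lemma x_pow_shift: "x [^]\<^bsub>C\<^esub> (v::nat) \<otimes>\<^bsub>C\<^esub> E i = E (i + int v) \<otimes>\<^bsub>C\<^esub> x [^]\<^bsub>C\<^esub> v"
proof (induction v arbitrary: i)
  case (Suc v)
  have "x [^]\<^bsub>C\<^esub> Suc v \<otimes>\<^bsub>C\<^esub> E i = x [^]\<^bsub>C\<^esub> v \<otimes>\<^bsub>C\<^esub> (E (i + 1) \<otimes>\<^bsub>C\<^esub> x)"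
    by (simp add: C.\<Lambda>.m_assoc x_E)
  also have "\<dots> = (E (i + 1 + int v) \<otimes>\<^bsub>C\<^esub> x [^]\<^bsub>C\<^esub> v) \<otimes>\<^bsub>C\<^esub> x"
    by (subst Suc[symmetric]) (simp add: C.\<Lambda>.m_assoc)
  finally show ?case by (simp add: C.\<Lambda>.m_assoc algebra_simps)
qed simp

lemma x_pow_n: "x [^]\<^bsub>C\<^esub> nat n = C.\<rho> (fps_X ^ nat (n - k))"
proof -
  have "nat n = nat (n - k) + nat k" using k_pos k_less by simp
  then have "x [^]\<^bsub>C\<^esub> nat n = x [^]\<^bsub>C\<^esub> nat (n - k) \<otimes>\<^bsub>C\<^esub> x [^]\<^bsub>C\<^esub> nat k"
    by (simp add: C.\<Lambda>.nat_pow_mult)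
  also have "\<dots> = C.\<rho> (fps_X ^ nat (n - k))" by (simp only: x_pow_y_pow x_pow_y_pow')
  finally show ?thesis .
qed

text \<open>Every path in \<open>C\<close> is a power of \<open>t\<close> times \<open>x\<^sup>a\<close> or \<open>y\<^sup>a\<close> with \<open>a < n\<close>.\<close>

lemma finite_R_generators:
  assumes fg: "finitely_generated C M"
  obtains D where "finite D" "D \<subseteq> carrier M" "carrier M \<subseteq> Sub D"
proof -
  obtain S0 where S0: "finite S0" "S0 \<subseteq> carrier M"
    "\<And>m. m \<in> carrier M \<Longrightarrow> \<exists>a\<in>S0 \<rightarrow> carrier C. m = (\<Oplus>\<^bsub>M\<^esub>s\<in>S0. a s \<cdot> s)"
    using fg unfolding finitely_generated_def by blast
  \<comment> \<open>Cutting the generators by the idempotents puts each of them at a single vertex,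
    so that \<open>E i\<close> sends a path applied to one of them to itself or to zero.\<close>
  define G where "G = (\<lambda>(v, s). E v \<cdot> s) ` ({1..n} \<times> S0)"
  have G: "finite G" "G \<subseteq> carrier M" using S0 by (auto simp: G_def intro: M.smult_closed)
  define D where "D = (\<Union>z\<in>{x, y}. (\<lambda>(a, m). (z [^]\<^bsub>C\<^esub> (a::nat)) \<cdot> m) ` ({..<nat n} \<times> G))"
  have DI: "z \<in> {x, y} \<Longrightarrow> a < nat n \<Longrightarrow> m \<in> G \<Longrightarrow> (z [^]\<^bsub>C\<^esub> a) \<cdot> m \<in> D" for z a m
    unfolding D_def by fastforce
  have D: "finite D" "D \<subseteq> carrier M"
    using G unfolding D_def by (auto intro!: M.smult_closed simp: subset_iff)
  note Sub_D = Sub_props[OF D]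
  have n2: "2 \<le> nat n" using k_pos k_less by simp
  have G_Sub: "m \<in> Sub D" if "m \<in> G" for m
    using DI[of x 0 m] that n2 G(2) by (intro Sub_D(3)) (auto simp: M.smult_one subset_iff)
  \<comment> \<open>Treats z = x and z = y at once. On a power of the same letter the exponent grows
    until z^n becomes a scalar; on a positive power of the other letter one factor is absorbed into
    t.\<close>
  have zD: "z \<cdot> d \<in> Sub D"
    if z: "z \<in> carrier C" "z' \<in> carrier C" "{z, z'} = {x, y}" and zz: "z \<otimes>\<^bsub>C\<^esub> z' = C.\<rho> fps_X"
      and zn: "z [^]\<^bsub>C\<^esub> nat n = C.\<rho> r" and d: "d \<in> D" for z z' r d
  proof -
    have zxy: "z \<in> {x, y}" "z' \<in> {x, y}" using z(3) by (auto simp: doubleton_eq_iff)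
    from d obtain a m u where "u \<in> {x, y}" and am': "a < nat n" "m \<in> G" "d = (u [^]\<^bsub>C\<^esub> a) \<cdot> m"
      unfolding D_def by auto
    then have am: "a < nat n" "m \<in> G" "u = z \<or> u = z'" "d = (u [^]\<^bsub>C\<^esub> a) \<cdot> m"
      using z(3) by (auto simp: doubleton_eq_iff)
    have mM: "m \<in> carrier M" using am(2) G(2) by blast
    have "(u = z \<and> Suc a < nat n) \<or> (u = z \<and> Suc a = nat n) \<or> (u = z' \<and> a = 0) \<or> (u = z' \<and> (\<exists>b. a = Suc b))"
      using am(1,3) not0_implies_Suc[of a] Suc_lessI[of a "nat n"] by blast
    then consider "u = z" "Suc a < nat n" | "u = z" "Suc a = nat n" | "u = z'" "a = 0" | b where "u = z'" "a = Suc b"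
      by blast
    then show ?thesis
    proof cases
      case 1
      have "z \<cdot> d = (z [^]\<^bsub>C\<^esub> Suc a) \<cdot> m"
        unfolding am(4) 1(1) C.\<Lambda>.nat_pow_Suc2[OF z(1)] using z mM by (simp add: M.smult_assoc)
      then show ?thesis using Sub_D(3)[OF DI[OF zxy(1) 1(2) am(2)]] by simp
    next
      case 2
      have "z \<cdot> d = (z [^]\<^bsub>C\<^esub> Suc a) \<cdot> m"
        unfolding am(4) 2(1) C.\<Lambda>.nat_pow_Suc2[OF z(1)] using z mM by (simp add: M.smult_assoc)
      also have "\<dots> = C.\<rho> r \<cdot> m" unfolding 2(2) zn ..
      finally show ?thesis using Sub_D(2)[OF G_Sub[OF am(2)]] by simp
    next
      case 3
      have "z \<cdot> d = (z [^]\<^bsub>C\<^esub> (1::nat)) \<cdot> m"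
        unfolding am(4) 3(2) using z mM by (simp add: M.smult_one)
      then show ?thesis using Sub_D(3)[OF DI[OF zxy(1) _ am(2), of 1]] n2 by simp
    next
      case 4
      have zb: "z' [^]\<^bsub>C\<^esub> b \<in> carrier C" using z by simp
      have "z \<cdot> d = (z \<otimes>\<^bsub>C\<^esub> (z' \<otimes>\<^bsub>C\<^esub> z' [^]\<^bsub>C\<^esub> b)) \<cdot> m"
        unfolding am(4) 4 C.\<Lambda>.nat_pow_Suc2[OF z(2)] using z mM zb by (simp add: M.smult_assoc)
      also have "\<dots> = C.\<rho> fps_X \<cdot> (z' [^]\<^bsub>C\<^esub> b) \<cdot> m"
        using z zb mM by (simp only: C.\<Lambda>.m_assoc[symmetric] zz M.smult_assoc C.\<rho>_closed)
      finally show ?thesis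
        using Sub_D(2)[OF Sub_D(3)[OF DI[OF zxy(2) _ am(2), of b]]] am(1) 4 by simp
    qed
  qed
  have ED: "E i \<cdot> d \<in> Sub D" if d: "d \<in> D" for i d
  proof -
    from d obtain z a m where z: "z = x \<or> z = y" and am: "a < nat n" "m \<in> G" "d = (z [^]\<^bsub>C\<^esub> a) \<cdot> m"
      unfolding D_def by auto
    obtain v s where vs: "m = E v \<cdot> s" "s \<in> carrier M" using am(2) S0(2) by (auto simp: G_def)
    have zC: "z [^]\<^bsub>C\<^esub> a \<in> carrier C" using z by auto
    obtain j where j: "E i \<otimes>\<^bsub>C\<^esub> z [^]\<^bsub>C\<^esub> a = z [^]\<^bsub>C\<^esub> a \<otimes>\<^bsub>C\<^esub> E j"
    proof (cases "z = x")
      case True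
      then show ?thesis using that[of "i - int a"] x_pow_shift[of a "i - int a"] by simp
    next
      case False
      then show ?thesis using that[of "i + int a"] y_pow_shift[of a "i + int a"] z by simp
    qed
    have "E i \<cdot> d = (E i \<otimes>\<^bsub>C\<^esub> z [^]\<^bsub>C\<^esub> a) \<cdot> E v \<cdot> s"
      unfolding am(3) vs(1) using zC vs(2) by (simp add: M.smult_assoc M.smult_closed)
    also have "\<dots> = (z [^]\<^bsub>C\<^esub> a) \<cdot> (E j \<otimes>\<^bsub>C\<^esub> E v) \<cdot> s"
      unfolding j using zC vs(2) by (simp add: M.smult_assoc M.smult_closed)
    also have "\<dots> = (if vtx n j = vtx n v then d else \<zero>\<^bsub>M\<^esub>)"
      unfolding am(3) vs(1) using zC vs(2) by (simp add: E_E)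
    finally show ?thesis using Sub_D(3)[OF d] Sub_D(4) by simp
  qed
  have act: "\<forall>m\<in>Sub D. c \<cdot> m \<in> Sub D" if "c \<in> carrier C" for c
    using that
  proof (induction c rule: C_induct)
    case (scalar r)
    then show ?case using Sub_D(2) by blast
  next
    case (E i)
    then show ?case using Sub_act[OF D D E_closed ED] by blast
  next
    case x
    show ?case using Sub_act[OF D D x_closed zD[OF x_closed y_closed _ x_y x_pow_n]] by blast
  next
    case y
    show ?case using Sub_act[OF D D y_closed zD[OF y_closed x_closed _ y_x y_pow_n]] by blast
  next
    case (add a b)
    then show ?case using Sub_D(1) Sub_closed[OF D(2)] by (auto simp: M.smult_l_distr subset_iff)
  next
    case (mult a b)
    then show ?case using Sub_closed[OF D(2)] by (auto simp: M.smult_assoc subset_iff)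
  qed
  have S0_Sub: "s \<in> Sub D" if s: "s \<in> S0" for s
  proof -
    have sM: "s \<in> carrier M" using s S0(2) by blast
    have "(\<Oplus>\<^bsub>C\<^esub>i\<in>F. E i) \<cdot> s \<in> Sub D" if "finite F" "F \<subseteq> {1..n}" for F
      using that
    proof (induction F)
      case empty
      then show ?case using sM Sub_D(4) by simp
    next
      case (insert i F)
      have "(\<Oplus>\<^bsub>C\<^esub>i\<in>insert i F. E i) \<cdot> s = E i \<cdot> s \<oplus>\<^bsub>M\<^esub> (\<Oplus>\<^bsub>C\<^esub>i\<in>F. E i) \<cdot> s"
        using insert sM by (subst C.\<Lambda>.finsum_insert) (auto simp: M.smult_l_distr intro!: C.\<Lambda>.finsum_closed)
      moreover have "E i \<cdot> s \<in> G" using insert s by (auto simp: G_def)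
      ultimately show ?case using insert Sub_D(1) G_Sub by simp
    qed
    from this[of "{1..n}"] show ?thesis using sM by (simp add: sum_E M.smult_one)
  qed
  have "carrier M \<subseteq> Sub D"
  proof
    fix m assume "m \<in> carrier M"
    then obtain a where a: "a \<in> S0 \<rightarrow> carrier C" "m = (\<Oplus>\<^bsub>M\<^esub>s\<in>S0. a s \<cdot> s)" using S0(3) by blast
    show "m \<in> Sub D" unfolding a(2) using a(1) act S0_Sub by (intro Sub_finsum[OF D S0(1)]) auto
  qed
  then show thesis using D that by blast
qed

end

context torsion_free_module
begin

text \<open>A generating set of least size is a basis. From a nontrivial relation the highest common
  power of t can be divided out, as \<open>M\<close> is torsion free; then some coefficient is a
  unit and its generator is redundant.\<close>

lemma V_free:
  assumes fg: "finitely_generated C M"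
  obtains S and \<eta> :: "'m \<Rightarrow> 'm \<Rightarrow> complex fps" where "finite S" "bij_betw \<eta> V (supported_on S)"
    "\<And>w w'. \<lbrakk>w \<in> V; w' \<in> V\<rbrakk> \<Longrightarrow> \<eta> (w \<oplus>\<^bsub>M\<^esub> w') = \<eta> w + \<eta> w'"
    "\<And>r w. w \<in> V \<Longrightarrow> \<eta> (C.\<rho> r \<cdot> w) = rscale r (\<eta> w)"
proof -
  define gen where "gen S \<longleftrightarrow> finite S \<and> S \<subseteq> V \<and> V \<subseteq> Sub S" for S
  obtain D where D: "finite D" "D \<subseteq> carrier M" "carrier M \<subseteq> Sub D" using finite_R_generators[OF fg] .
  let ?E = "(\<lambda>d. E n \<cdot> d) ` D"
  have E: "finite ?E" "?E \<subseteq> V" using D E_act_V by auto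
  have EM: "?E \<subseteq> carrier M" using E(2) V_closed by blast
  have "V \<subseteq> Sub ?E"
  proof
    fix w assume w: "w \<in> V"
    have wD: "w \<in> Sub D" using D(3) V_closed[OF w] by blast
    have base: "E n \<cdot> d \<in> Sub ?E" if "d \<in> D" for d by (rule Sub_base[OF E(1) EM imageI[OF that]])
    have "E n \<cdot> w \<in> Sub ?E" by (rule Sub_act[OF D(1,2) E(1) EM E_closed base wD])
    then show "w \<in> Sub ?E" using w by (simp add: V_def)
  qed
  then have "gen ?E" using E by (simp add: gen_def)
  then obtain S where S: "gen S" and min: "\<And>S'. gen S' \<Longrightarrow> card S \<le> card S'"
    using ex_has_least_nat[of gen ?E card] by blast
  have fS: "finite S" and SV: "S \<subseteq> V" and VS: "V \<subseteq> Sub S" using S by (auto simp: gen_def)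
  have SM: "S \<subseteq> carrier M" using SV V_closed by blast
  define \<theta> where "\<theta> f = (\<Oplus>\<^bsub>M\<^esub>s\<in>S. C.\<rho> (f s) \<cdot> s)" for f
  have \<theta>V: "\<theta> f \<in> V" for f
  proof -
    have "(\<Oplus>\<^bsub>M\<^esub>s\<in>A. C.\<rho> (f s) \<cdot> s) \<in> V" if "finite A" "A \<subseteq> S" for A
      using that
    proof (induction A)
      case (insert a A)
      have "(\<Oplus>\<^bsub>M\<^esub>s\<in>insert a A. C.\<rho> (f s) \<cdot> s) = C.\<rho> (f a) \<cdot> a \<oplus>\<^bsub>M\<^esub> (\<Oplus>\<^bsub>M\<^esub>s\<in>A. C.\<rho> (f s) \<cdot> s)"
        using insert SM by (intro M.M.finsum_insert) (auto intro!: M.smult_closed)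
      then show ?case using insert SV V_add V_\<rho> by auto
    qed (simp add: V_zero)
    then show ?thesis using fS by (simp add: \<theta>_def)
  qed
  have \<theta>_add: "\<theta> (f + g) = \<theta> f \<oplus>\<^bsub>M\<^esub> \<theta> g" for f g
    unfolding \<theta>_def plus_fun_def by (rule lc_add[OF fS SM])
  have \<theta>_mult: "\<theta> (rscale r f) = C.\<rho> r \<cdot> \<theta> f" for r f
    unfolding \<theta>_def rscale_def by (rule lc_mult[OF fS SM])
  have indep: "f s = 0" if f: "\<theta> f = \<zero>\<^bsub>M\<^esub>" and s: "s \<in> S" for f s
  proof (rule ccontr)
    assume "f s \<noteq> 0"
    then obtain i where i: "fps_nth (f s) i \<noteq> 0" by (metis fps_nonzero_nth)
    define m where "m = (LEAST m. \<exists>s\<in>S. fps_nth (f s) m \<noteq> 0)"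
    obtain s0 where s0: "s0 \<in> S" "fps_nth (f s0) m \<noteq> 0"
    proof -
      have "\<exists>s\<in>S. fps_nth (f s) i \<noteq> 0" using i s by blast
      then have "\<exists>s\<in>S. fps_nth (f s) m \<noteq> 0" unfolding m_def by (rule LeastI)
      then show thesis using that by blast
    qed
    have low: "fps_nth (f s) j = 0" if "s \<in> S" "j < m" for s j
    proof (rule ccontr)
      assume "fps_nth (f s) j \<noteq> 0"
      then have "\<exists>s\<in>S. fps_nth (f s) j \<noteq> 0" using that(1) by blast
      then have "m \<le> j" unfolding m_def by (rule Least_le)
      then show False using that(2) by simp
    qed
    define g where "g s = fps_shift m (f s)" for s
    have fg: "f s = fps_X ^ m * g s" if "s \<in> S" for s
      unfolding g_def using low[OF that] by (rule fps_factor_X_power)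
    have "\<theta> f = \<theta> (rscale (fps_X ^ m) g)"
      unfolding \<theta>_def using SM by (intro M.M.finsum_cong') (auto simp: fg rscale_def intro!: M.smult_closed)
    then have g0: "\<theta> g = \<zero>\<^bsub>M\<^esub>"
      using f \<theta>_mult torsion_free_pow[of "\<theta> g" m] V_closed[OF \<theta>V] by simp
    \<comment> \<open>\<open>g s0\<close> has a nonzero constant term and is therefore a unit;
      normalising it to 1 solves the relation for \<open>s0\<close>.\<close>
    define h where "h = rscale (inverse (g s0)) g"
    have h: "\<theta> h = \<zero>\<^bsub>M\<^esub>" unfolding h_def \<theta>_mult g0 by simp
    have h1: "h s0 = 1" using s0(2) by (simp add: h_def rscale_def g_def fps_unit_mult)
    let ?S = "S - {s0}"
    have S': "finite ?S" "?S \<subseteq> carrier M" using fS SM by auto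
    define b where "b = (\<Oplus>\<^bsub>M\<^esub>s\<in>?S. C.\<rho> (h s) \<cdot> s)"
    have bM: "b \<in> carrier M" unfolding b_def by (rule M.M.finsum_closed[OF summand_closed[OF S'(2)]])
    have s0M: "s0 \<in> carrier M" using s0(1) SM by blast
    have "\<theta> h = (\<Oplus>\<^bsub>M\<^esub>s\<in>insert s0 ?S. C.\<rho> (h s) \<cdot> s)" using s0(1) by (simp add: \<theta>_def insert_absorb)
    also have "\<dots> = C.\<rho> (h s0) \<cdot> s0 \<oplus>\<^bsub>M\<^esub> b"
      unfolding b_def using S' s0M by (intro M.M.finsum_insert) (auto intro!: M.smult_closed)
    finally have sb: "s0 \<oplus>\<^bsub>M\<^esub> b = \<zero>\<^bsub>M\<^esub>" using h h1 s0M by (simp add: M.smult_one)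
    have "C.\<rho> (-1) \<cdot> b \<oplus>\<^bsub>M\<^esub> b = \<zero>\<^bsub>M\<^esub>" by (rule neg_act'[OF bM])
    then have "s0 = C.\<rho> (-1) \<cdot> b"
      using sb M.M.add.right_cancel[of b s0 "C.\<rho> (-1) \<cdot> b"] bM s0M by (simp add: M.smult_closed)
    moreover have "b \<in> Sub ?S" unfolding b_def Sub_def by blast
    ultimately have "s0 \<in> Sub ?S" using Sub_\<rho>[OF S'] by simp
    then have "S \<subseteq> Sub ?S" using Sub_base[OF S'] by blast
    then have "gen ?S" using Sub_mono_gen[OF fS SM S'] VS SV S'(1) by (auto simp: gen_def)
    from min[OF this] show False using card_Diff1_less[OF fS s0(1)] by simp
  qed
  let ?U = "supported_on S :: ('m \<Rightarrow> complex fps) set"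
  have bij: "bij_betw \<theta> ?U V"
  proof (rule bij_betw_imageI)
    show "inj_on \<theta> ?U"
    proof
      fix f g assume fg: "f \<in> ?U" "g \<in> ?U" "\<theta> f = \<theta> g"
      have "\<theta> (f + rscale (-1) g) = \<theta> g \<oplus>\<^bsub>M\<^esub> C.\<rho> (-1) \<cdot> \<theta> g" unfolding \<theta>_add \<theta>_mult fg(3) ..
      also have "\<dots> = \<zero>\<^bsub>M\<^esub>" by (rule neg_act[OF V_closed[OF \<theta>V]])
      finally have "\<forall>s\<in>S. (f + rscale (-1) g) s = 0" using indep by blast
      then show "f = g" using fg(1,2) by (auto simp: supported_on_def rscale_def fun_eq_iff)
    qed
    show "\<theta> ` ?U = V"
    proof
      show "\<theta> ` ?U \<subseteq> V" using \<theta>V by blast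
      show "V \<subseteq> \<theta> ` ?U"
      proof
        fix w assume "w \<in> V"
        then obtain f where f: "w = \<theta> f" using VS unfolding Sub_def \<theta>_def by blast
        let ?f = "\<lambda>s. if s \<in> S then f s else 0"
        have "\<theta> f = \<theta> ?f"
          unfolding \<theta>_def using SM by (intro M.M.finsum_cong') (auto intro!: M.smult_closed)
        moreover have "?f \<in> ?U" by (simp add: supported_on_def)
        ultimately show "w \<in> \<theta> ` ?U" using f by blast
      qed
    qed
  qed
  define \<eta> where "\<eta> = inv_into ?U \<theta>"
  have \<eta>: "\<eta> w \<in> ?U" "\<theta> (\<eta> w) = w" if "w \<in> V" for w
    using bij that by (auto simp: \<eta>_def bij_betw_def inv_into_into f_inv_into_f)
  have \<eta>I: "\<eta> (\<theta> f) = f" if "f \<in> ?U" for f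
    using bij that by (simp add: \<eta>_def bij_betw_def)
  have U: "f + g \<in> ?U" "rscale r f \<in> ?U" if "f \<in> ?U" "g \<in> ?U" for f g r
    using that R_submodule_supported_on[of S] by (auto simp: R_submodule_def)
  show thesis
  proof (rule that[OF fS])
    show "bij_betw \<eta> V ?U" unfolding \<eta>_def by (rule bij_betw_inv_into[OF bij])
    show "\<eta> (w \<oplus>\<^bsub>M\<^esub> w') = \<eta> w + \<eta> w'" if "w \<in> V" "w' \<in> V" for w w'
      using \<eta>I[OF U(1)[OF \<eta>(1)[OF that(1)] \<eta>(1)[OF that(2)]]] \<eta>(2) that by (simp add: \<theta>_add)
    show "\<eta> (C.\<rho> r \<cdot> w) = rscale r (\<eta> w)" if "w \<in> V" for r w
      using \<eta>I[OF U(2)[OF \<eta>(1)[OF that] \<eta>(1)[OF that]], of r] \<eta>(2) that by (simp add: \<theta>_mult)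
  qed
qed

end

text \<open>Multiplying \<open>m\<close> by t multiplies its coefficients in the basis by t, and
  power series have no zero divisors.\<close>

lemma (in C_module) torsion_free_if_basis:
  assumes "is_basis (restrict_scalars C M) B"
  shows "torsion_free_module k n M"
proof
  fix m assume m: "m \<in> carrier M" and tm: "C.\<rho> fps_X \<cdot> m = \<zero>\<^bsub>M\<^esub>"
  interpret R: Module.module class_ring "restrict_scalars C M" by (rule restrict_scalars_module)
  have Bc: "B \<subseteq> carrier M" and ind: "\<not> R.lin_dep B" and gen: "R.span B = carrier M"
    using assms by (simp_all add: is_basis_def restrict_scalars_simps)
  have "m \<in> R.span B" using m gen by simp
  then obtain a A where A: "finite A" "A \<subseteq> B" "m = R.lincomb a A"
    unfolding R.span_def by auto
  have Ac: "A \<subseteq> carrier (restrict_scalars C M)" using A(2) Bc by (auto simp: restrict_scalars_simps)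
  have "R.lincomb (\<lambda>v. fps_X * a v) A = C.\<rho> fps_X \<cdot> m"
    using R.lincomb_smult[OF Ac, of a fps_X] by (simp add: A(3) restrict_scalars_simps)
  then have "fps_X * a v = 0" if "v \<in> A" for v
    using R.lin_dep_crit[OF A(1,2), of "\<lambda>v. fps_X * a v" v] ind that tm
    by (auto simp: restrict_scalars_simps)
  then have "a v = 0" if "v \<in> A" for v using that by simp
  then have "R.lincomb a A = R.lincomb (\<lambda>_. 0) A" using Ac by (intro R.lincomb_cong) auto
  also have "\<dots> = 0 \<odot>\<^bsub>restrict_scalars C M\<^esub> R.lincomb (\<lambda>_. 0) A"
    using R.lincomb_smult[OF Ac, of "\<lambda>_. 0" 0] by simp
  also have "\<dots> = \<zero>\<^bsub>M\<^esub>"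
    using R.lincomb_closed[OF Ac, of "\<lambda>_. 0"] by (simp add: restrict_scalars_simps)
  finally show "m = \<zero>\<^bsub>M\<^esub>" by (simp add: A(3))
qed

section \<open>Codimensions along the chain and the Gelfand-Tsetlin inequalities\<close>

lemma R_submodule_add_shift:
  assumes "R_submodule W" "R_submodule U"
  shows "R_submodule {w + rscale r u |w u. w \<in> W \<and> u \<in> U}"
  unfolding R_submodule_def
proof (intro conjI ballI allI)
  have W: "0 \<in> W" "\<And>x y. \<lbrakk>x \<in> W; y \<in> W\<rbrakk> \<Longrightarrow> x + y \<in> W" "\<And>s x. x \<in> W \<Longrightarrow> rscale s x \<in> W"
    and U: "0 \<in> U" "\<And>x y. \<lbrakk>x \<in> U; y \<in> U\<rbrakk> \<Longrightarrow> x + y \<in> U" "\<And>s x. x \<in> U \<Longrightarrow> rscale s x \<in> U"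
    using assms by (simp_all add: R_submodule_def)
  show "0 \<in> {w + rscale r u |w u. w \<in> W \<and> u \<in> U}"
    using W(1) U(1) by (intro CollectI exI[of _ 0]) simp
  fix x s assume "x \<in> {w + rscale r u |w u. w \<in> W \<and> u \<in> U}"
  then obtain w u where x: "x = w + rscale r u" "w \<in> W" "u \<in> U" by blast
  have "rscale s x = rscale s w + rscale r (rscale s u)"
    unfolding x(1) by (simp add: rscale_add rscale_rscale mult.commute)
  then show "rscale s x \<in> {w + rscale r u |w u. w \<in> W \<and> u \<in> U}"
    using W(3)[OF x(2)] U(3)[OF x(3)] by blast
  fix y assume "y \<in> {w + rscale r u |w u. w \<in> W \<and> u \<in> U}"
  then obtain w' u' where y: "y = w' + rscale r u'" "w' \<in> W" "u' \<in> U" by blast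
  have "x + y = (w + w') + rscale r (u + u')" unfolding x(1) y(1) by (simp add: rscale_add)
  then show "x + y \<in> {w + rscale r u |w u. w \<in> W \<and> u \<in> U}"
    using W(2)[OF x(2) y(2)] U(2)[OF x(3) y(3)] by blast
qed

text \<open>The exponent at u is u on [0,a], constant on [a,v], grows by one per step on [v,w] and
  is k afterwards. Up to \<open>a\<close> the condition is automatic, as t moves \<open>N\<close> up
  by one; on [a,v] it follows from the condition at \<open>v\<close> since the chain decreases, on
  [v,w] it is propagated from \<open>v\<close> by t, and from \<open>w\<close> on it holds because
  t^k V lies in \<open>N\<close> at n.\<close>

lemma (in rank_one_hom) W_hom_rectangle:
  assumes J: "J = {1..int a} \<union> {int v + 1..int w}" and avw: "a \<le> v" "v \<le> w" "w \<le> nat n" "0 < v"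
  shows "W_hom = W a v"
proof -
  have int_card: "card (J \<inter> {1..int u}) = min u a + (min u w - v)" if "u \<le> nat n" for u
  proof -
    have "J \<inter> {1..int u} = {1..int (min u a)} \<union> {int v + 1..int (min u w)}" unfolding J by auto
    also have "card \<dots> = card {1..int (min u a)} + card {int v + 1..int (min u w)}"
      using avw by (intro card_Un_disjoint) auto
    finally show ?thesis by (auto simp: nat_diff_distrib)
  qed
  have "J \<inter> {1..int (nat n)} = J" using J_sub by auto
  moreover have "min (nat n) a = a" "min (nat n) w = w" using avw by auto
  ultimately have kk: "nat k = a + (w - v)" using int_card[of "nat n"] J_card by simp
  show ?thesis
  proof (intro equalityI subsetI)
    fix m assume "m \<in> W_hom"
    then have m: "m \<in> V" "\<And>u. u \<in> {1..nat n} \<Longrightarrow> C.\<rho> (fps_X ^ card (J \<inter> {1..int u})) \<cdot> m \<in> N u"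
      by (simp_all add: W_hom_def)
    have "min v a = a" "min v w = v" using avw by auto
    then have "card (J \<inter> {1..int v}) = a" using int_card[of v] avw by simp
    then show "m \<in> W a v" using m(1) m(2)[of v] avw by (simp add: W_def)
  next
    fix m assume "m \<in> W a v"
    then have m: "m \<in> V" "C.\<rho> (fps_X ^ a) \<cdot> m \<in> N v" by (simp_all add: W_def)
    have "C.\<rho> (fps_X ^ card (J \<inter> {1..int u})) \<cdot> m \<in> N u" if u: "u \<in> {1..nat n}" for u
    proof -
      have un: "u \<le> nat n" using u by simp
      consider "u \<le> a" | "a \<le> u" "u \<le> v" | "v \<le> u" "u \<le> w" | "w \<le> u" by linarith
      then show ?thesis
      proof cases
        case 1
        then show ?thesis using X_pow_N[of m 0 u] m(1) int_card[OF un] avw by (simp add: N_0 min_def)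
      next
        case 2
        then have c: "card (J \<inter> {1..int u}) = a" using int_card[OF un] avw by (simp add: min_def)
        show ?thesis unfolding c using N_mono[OF 2(2)] m(2) by blast
      next
        case 3
        then have "min u a = a" "min u w = u" using avw by auto
        then have c: "card (J \<inter> {1..int u}) = (u - v) + a" using int_card[OF un] by simp
        have "C.\<rho> (fps_X ^ (u - v)) \<cdot> C.\<rho> (fps_X ^ a) \<cdot> m \<in> N (v + (u - v))" by (rule X_pow_N[OF m(2)])
        then show ?thesis unfolding c power_add using 3 V_closed[OF m(1)] by (simp add: \<rho>_act_mult)
      next
        case 4
        then have "min u a = a" "min u w = w" using avw by auto
        then have c: "card (J \<inter> {1..int u}) = nat k" using int_card[OF un] kk by simp
        show ?thesis unfolding c using X_pow_V_n[OF m(1)] N_mono[OF un] by blast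
      qed
    qed
    then show "m \<in> W_hom" using m(1) by (simp add: W_hom_def)
  qed
qed

text \<open>The coordinates are a parameter so that one argument serves both an arbitrary module,
  with the map from \<open>V_free\<close>, and an explicit sum of rank one modules, where they are
  the identity.\<close>

locale lattice_chain = torsion_free_module k n M
  for k n :: int and M :: "(path_elts set, 'm) module" +
  fixes S :: "'i set" and \<eta> :: "'m \<Rightarrow> 'i \<Rightarrow> complex fps"
  assumes finite_S: "finite S" and \<eta>_bij: "bij_betw \<eta> V (supported_on S)"
    and \<eta>_add: "\<lbrakk>w \<in> V; w' \<in> V\<rbrakk> \<Longrightarrow> \<eta> (w \<oplus>\<^bsub>M\<^esub> w') = \<eta> w + \<eta> w'"
    and \<eta>_\<rho>: "w \<in> V \<Longrightarrow> \<eta> (C.\<rho> r \<cdot> w) = rscale r (\<eta> w)"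
begin

abbreviation U :: "('i \<Rightarrow> complex fps) set" where "U \<equiv> supported_on S"

lemma U_closed: "0 \<in> U" "\<lbrakk>f \<in> U; g \<in> U\<rbrakk> \<Longrightarrow> f + g \<in> U" "f \<in> U \<Longrightarrow> rscale r f \<in> U"
  using R_submodule_supported_on[of S] by (simp_all add: R_submodule_def)

lemma subspace_U: "cx.subspace U"
  by (rule R_submodule_subspace[OF R_submodule_supported_on])

lemma \<eta>_V: "w \<in> V \<Longrightarrow> \<eta> w \<in> U"
  using \<eta>_bij by (auto simp: bij_betw_def)

lemma \<eta>_surj: "f \<in> U \<Longrightarrow> \<exists>w\<in>V. f = \<eta> w"
  using \<eta>_bij unfolding bij_betw_def by blast

lemma \<eta>_inj: "\<lbrakk>\<eta> w = \<eta> w'; w \<in> V; w' \<in> V\<rbrakk> \<Longrightarrow> w = w'"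
  using \<eta>_bij unfolding bij_betw_def by (meson inj_onD)

lemma \<eta>_W_submodule: "R_submodule (\<eta> ` W a v)"
  unfolding R_submodule_def
proof (intro conjI ballI allI)
  have "\<eta> (C.\<rho> 0 \<cdot> \<zero>\<^bsub>M\<^esub>) = rscale 0 (\<eta> \<zero>\<^bsub>M\<^esub>)" by (rule \<eta>_\<rho>[OF V_zero])
  then have "\<eta> \<zero>\<^bsub>M\<^esub> = 0" by (simp add: rscale_def zero_fun_def)
  then show "0 \<in> \<eta> ` W a v" using W_submodule(1)[of a v] by (intro image_eqI[of _ _ "\<zero>\<^bsub>M\<^esub>"]) auto
  fix f r assume "f \<in> \<eta> ` W a v"
  then obtain w where w: "f = \<eta> w" "w \<in> W a v" by blast
  have wV: "w \<in> V" using w(2) W_sub_V by blast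
  show "rscale r f \<in> \<eta> ` W a v"
    using W_submodule(3)[OF w(2), of r] \<eta>_\<rho>[OF wV, of r] w(1) by (intro image_eqI[of _ _ "C.\<rho> r \<cdot> w"]) auto
  fix g assume "g \<in> \<eta> ` W a v"
  then obtain w' where w': "g = \<eta> w'" "w' \<in> W a v" by blast
  have wV': "w' \<in> V" using w'(2) W_sub_V by blast
  show "f + g \<in> \<eta> ` W a v"
    using W_submodule(2)[OF w(2) w'(2)] \<eta>_add[OF wV wV'] w(1) w'(1)
    by (intro image_eqI[of _ _ "w \<oplus>\<^bsub>M\<^esub> w'"]) auto
qed

lemma subspace_W: "cx.subspace (\<eta> ` W a v)"
  by (rule R_submodule_subspace[OF \<eta>_W_submodule])

definition cd :: "nat \<Rightarrow> nat \<Rightarrow> nat" where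
  "cd a v = (SOME d. cx.codim U (\<eta> ` W a v) d)"

text \<open>Its codimension is the difference of a pattern along a diagonal, by
  \<open>cd_Suc\<close>. It contains tU, so it only depends on the image of \<open>W a v\<close> in
  the finite-dimensional space U/tU.\<close>

definition slice :: "nat \<Rightarrow> nat \<Rightarrow> ('i \<Rightarrow> complex fps) set" where
  "slice a v = {w + rscale fps_X u |w u. w \<in> \<eta> ` W a v \<and> u \<in> U}"

definition slice_codim :: "nat \<Rightarrow> nat \<Rightarrow> nat" where
  "slice_codim a v = (SOME d. cx.codim U (slice a v) d)"

lemma codim_cd:
  assumes v: "v \<le> nat n"
  shows "cx.codim U (\<eta> ` W a v) (cd a v)"
proof -
  have "rscale (fps_X ^ nat k) ` U \<subseteq> \<eta> ` W a v"
  proof (rule image_subsetI)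
    fix f assume "f \<in> U"
    then obtain w where w: "w \<in> V" "f = \<eta> w" using \<eta>_surj by blast
    show "rscale (fps_X ^ nat k) f \<in> \<eta> ` W a v"
      using X_pow_W[OF v w(1)] \<eta>_\<rho>[OF w(1)] w(2)
      by (intro image_eqI[of _ _ "C.\<rho> (fps_X ^ nat k) \<cdot> w"]) auto
  qed
  then have "\<exists>d. cx.codim U (\<eta> ` W a v) d" by (rule codim_finite[OF finite_S \<eta>_W_submodule])
  then show ?thesis unfolding cd_def by (rule someI_ex)
qed

lemma cd_eq: "cx.codim U (\<eta> ` W a v) d \<Longrightarrow> v \<le> nat n \<Longrightarrow> cd a v = d"
  using cx.codim_unique[OF _ codim_cd subspace_W] by simp

lemma slice_submodule: "R_submodule (slice a v)"
  unfolding slice_def by (rule R_submodule_add_shift[OF \<eta>_W_submodule R_submodule_supported_on])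

lemma X_U_slice: "rscale fps_X ` U \<subseteq> slice a v"
proof (rule image_subsetI)
  fix f assume "f \<in> U"
  moreover have "0 \<in> \<eta> ` W a v" using \<eta>_W_submodule by (simp add: R_submodule_def)
  ultimately show "rscale fps_X f \<in> slice a v"
    unfolding slice_def by (intro CollectI exI[of _ 0] exI[of _ f]) simp
qed

lemma codim_slice: "cx.codim U (slice a v) (slice_codim a v)"
proof -
  have "rscale (fps_X ^ 1) ` U \<subseteq> slice a v" using X_U_slice by simp
  then have "\<exists>d. cx.codim U (slice a v) d" by (rule codim_finite[OF finite_S slice_submodule])
  then show ?thesis unfolding slice_codim_def by (rule someI_ex)
qed

lemma slice_codim_mono:
  assumes "W a v \<subseteq> W a' v'"
  shows "slice_codim a' v' \<le> slice_codim a v"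
proof (rule cx.codim_mono[OF codim_slice codim_slice _ R_submodule_subspace[OF slice_submodule]])
  show "slice a v \<subseteq> slice a' v'"
  proof
    fix f assume "f \<in> slice a v"
    then obtain w u where "f = w + rscale fps_X u" "w \<in> \<eta> ` W a v" "u \<in> U" by (auto simp: slice_def)
    then show "f \<in> slice a' v'"
      unfolding slice_def using image_mono[OF assms, of \<eta>] by (intro CollectI exI[of _ w] exI[of _ u]) auto
  qed
qed

lemma slice_codim_diag: "slice_codim (Suc a) (Suc v) \<le> slice_codim a v"
  by (rule slice_codim_mono[OF W_diag])

lemma slice_codim_anti: "slice_codim a v \<le> slice_codim a (Suc v)"
  by (rule slice_codim_mono[OF W_anti])

text \<open>The slice contains tU, whose codimension is the rank. This is the source of the upper
  bound r in the definition of patterns.\<close>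

lemma slice_codim_le: "slice_codim a v \<le> card S"
  by (rule cx.codim_mono[OF codim_shift[OF finite_S] codim_slice X_U_slice
        R_submodule_subspace[OF slice_submodule]])

text \<open>This is \<open>codim_exact\<close> for multiplication by t, under which the preimage of
  \<open>W a v\<close> is \<open>W (Suc a) v\<close>.\<close>

lemma cd_Suc:
  assumes v: "v \<le> nat n"
  shows "cd a v = slice_codim a v + cd (Suc a) v"
proof (rule cd_eq[OF _ v], rule cx.codim_exact[of "rscale fps_X"])
  show "inj (rscale fps_X :: ('i \<Rightarrow> complex fps) \<Rightarrow> _)" by (rule inj_rscale_X)
  show "rscale fps_X ` U \<subseteq> U" using U_closed(3) by blast
  show "cx.codim U {w + rscale fps_X u |w u. w \<in> \<eta> ` W a v \<and> u \<in> U} (slice_codim a v)"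
    using codim_slice unfolding slice_def .
  have "{u. rscale fps_X u \<in> \<eta> ` W a v} = \<eta> ` W (Suc a) v"
  proof (intro equalityI subsetI)
    fix u assume "u \<in> {u. rscale fps_X u \<in> \<eta> ` W a v}"
    then obtain w' where w': "w' \<in> W a v" "rscale fps_X u = \<eta> w'" by auto
    have w'V: "w' \<in> V" using w'(1) W_sub_V by blast
    have "u \<in> U"
      using \<eta>_V[OF w'V] unfolding w'(2)[symmetric] by (simp add: supported_on_def rscale_def)
    then obtain w where w: "w \<in> V" "u = \<eta> w" using \<eta>_surj by blast
    have "C.\<rho> fps_X \<cdot> w = w'"
      using \<eta>_\<rho>[OF w(1)] w'(2) w(2) by (intro \<eta>_inj[OF _ V_\<rho>[OF w(1)] w'V]) simp
    then show "u \<in> \<eta> ` W (Suc a) v" using w w'(1) by (auto simp: W_Suc)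
  next
    fix u assume "u \<in> \<eta> ` W (Suc a) v"
    then obtain w where w: "u = \<eta> w" "w \<in> V" "C.\<rho> fps_X \<cdot> w \<in> W a v" by (auto simp: W_Suc)
    then show "u \<in> {u. rscale fps_X u \<in> \<eta> ` W a v}" using \<eta>_\<rho>[OF w(2), symmetric] by simp
  qed
  then show "cx.codim U {u. rscale fps_X u \<in> \<eta> ` W a v} (cd (Suc a) v)"
    using codim_cd[OF v] by simp
qed (simp_all add: rscale_add rscale_X_cscale subspace_U subspace_W)

lemma cd_full:
  assumes "W a v = V" "v \<le> nat n"
  shows "cd a v = 0"
proof (rule cd_eq[OF _ assms(2)])
  show "cx.codim U (\<eta> ` W a v) 0"
    unfolding assms(1) using \<eta>_surj by (intro cx.codim_self[OF subspace_U]) blast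
qed

lemma \<kappa>_T_ij:
  assumes ij: "(i, j) \<in> \<Gamma> k n"
  shows "\<kappa> C (E n) (T_ij k n (i, j)) M = cd (nat (k - i)) (nat (k - i + j))"
proof -
  let ?J = "{1..k - i} \<union> {k - i + j + 1..k + j}"
  have ij': "1 \<le> i" "i \<le> k" "1 \<le> j" "j \<le> n - k" using ij by (auto simp: \<Gamma>_def)
  have "card ?J = card {1..k - i} + card {k - i + j + 1..k + j}"
    using ij' by (intro card_Un_disjoint) auto
  then have J: "?J \<subseteq> {1..n}" "int (card ?J) = k" using ij' by auto
  interpret H: rank_one_hom k n M ?J
    using J by unfold_locales
  have "H.W_hom = W (nat (k - i)) (nat (k - i + j))"
    by (rule H.W_hom_rectangle[where w = "nat (k + j)"]) (use ij' in auto)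
  then have "\<kappa> C (E n) (rank_one_module n ?J) M = cd (nat (k - i)) (nat (k - i + j))"
    using ij' subspace_W codim_cd
    by (intro H.\<kappa>_eq_codim[OF \<eta>_bij \<eta>_add \<eta>_\<rho>]) auto
  then show ?thesis by (simp add: T_ij_def)
qed

definition cdi :: "int \<Rightarrow> int \<Rightarrow> int" where
  "cdi i j = int (cd (nat (k - i)) (nat (k - i + j)))"

lemma cdi_boundary:
  assumes "0 \<le> i" "i \<le> k" "0 \<le> j" "j \<le> n - k" "i = 0 \<or> j = 0"
  shows "cdi i j = 0"
proof -
  have v: "nat (k - i + j) \<le> nat n" using assms by simp
  have "W (nat (k - i)) (nat (k - i + j)) = V" using assms(5) W_k[OF v] W_self by auto
  then show ?thesis using cd_full[OF _ v] by (simp add: cdi_def)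
qed

lemma cdi_step:
  assumes "1 \<le> i" "i \<le> k" "1 \<le> j" "j \<le> n - k"
  shows "cdi i j - cdi (i - 1) (j - 1) = int (slice_codim (nat (k - i)) (nat (k - i + j)))"
proof -
  \<comment> \<open>The diagonal step fixes \<open>v\<close> and raises \<open>a\<close> by one,
    which is the situation of \<open>cd_Suc\<close>.\<close>
  have e: "nat (k - (i - 1)) = Suc (nat (k - i))" "k - (i - 1) + (j - 1) = k - i + j" using assms by auto
  have v: "nat (k - i + j) \<le> nat n" using assms by simp
  show ?thesis unfolding cdi_def e cd_Suc[OF v, of "nat (k - i)"] by simp
qed

lemma cdi_GT: "(int (card S), \<lambda>(i, j)\<in>\<Gamma> k n. cdi i j) \<in> Mon_GT k n"
proof -
  let ?v = "\<lambda>(i, j)\<in>\<Gamma> k n. cdi i j"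
  define v' where "v' i j = (if i \<le> 0 \<or> j \<le> 0 then 0 else ?v (i, j))" for i j
  have v': "v' i j = cdi i j" if "0 \<le> i" "i \<le> k" "0 \<le> j" "j \<le> n - k" for i j
    using that cdi_boundary[OF that] by (auto simp: v'_def \<Gamma>_def)
  have step: "v' i j - v' (i - 1) (j - 1) = int (slice_codim (nat (k - i)) (nat (k - i + j)))"
    if "1 \<le> i" "i \<le> k" "1 \<le> j" "j \<le> n - k" for i j
    using that cdi_step[OF that] v'[of i j] v'[of "i - 1" "j - 1"] by simp
  have kn: "1 \<le> k" "1 \<le> n - k" using k_pos k_less by auto
  have 1: "0 \<le> v' 1 1" unfolding v'[of 1 1, simplified, OF kn] by (simp add: cdi_def)
  have 2: "v' k (n - k) - v' (k - 1) (n - k - 1) \<le> int (card S)"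
    unfolding step[OF kn(1) order_refl kn(2) order_refl] using slice_codim_le by simp
  \<comment> \<open>Lowering \<open>i\<close> alone raises both indices of the slice, so
    \<open>slice_codim_diag\<close> applies; lowering \<open>j\<close> alone, as in the next fact,
    lowers only the second index.\<close>
  have 3: "v' (i - 1) j - v' (i - 2) (j - 1) \<le> v' i j - v' (i - 1) (j - 1)"
    if "i \<in> {2..k}" "j \<in> {1..n - k}" for i j
  proof -
    have "nat (k - (i - 1)) = Suc (nat (k - i))" "nat (k - (i - 1) + j) = Suc (nat (k - i + j))"
      using that by auto
    then show ?thesis
      using that step[of i j] step[of "i - 1" j] slice_codim_diag[of "nat (k - i)" "nat (k - i + j)"] by simp
  qed
  have 4: "v' i (j - 1) - v' (i - 1) (j - 2) \<le> v' i j - v' (i - 1) (j - 1)"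
    if "i \<in> {1..k}" "j \<in> {2..n - k}" for i j
  proof -
    have "nat (k - i + j) = Suc (nat (k - i + (j - 1)))" using that by auto
    then show ?thesis
      using that step[of i j] step[of i "j - 1"] slice_codim_anti[of "nat (k - i)" "nat (k - i + (j - 1))"]
      by simp
  qed
  have car: "(int (card S), ?v) \<in> carrier (GT_lattice k n)"
    by (auto simp: GT_lattice_def DirProd_def)
  have eq: "(\<lambda>i j. if i \<le> 0 \<or> j \<le> 0 then 0 else ?v (i, j)) = v'" by (intro ext) (simp add: v'_def)
  show ?thesis
    unfolding Mon_GT_def mem_Collect_eq case_prod_conv eq unfolding Let_def
    by (intro conjI ballI car 1 2 3 4)
qed

lemma rk_C_eq: "rk_C k n M = card S"
  unfolding rk_C_def e_star_E
  by (rule free_rank_eq(1)[OF eM_module finite_S, where \<eta> = \<eta>])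
    (simp_all add: eM_def restrict_scalars_def V_image[symmetric] \<eta>_bij \<eta>_add \<eta>_\<rho> scalar_act_\<rho>)

lemma \<kappa>_vector_eq: "\<kappa>_vector k n M = (\<lambda>(i, j)\<in>\<Gamma> k n. cdi i j)"
  unfolding \<kappa>_vector_def e_star_E by (intro restrict_ext) (auto simp: \<kappa>_T_ij cdi_def)

end

lemma (in C_algebra) rank_\<kappa>_vector_GT:
  fixes M :: "(path_elts set, 'm) module"
  assumes "CM_fg C M"
  shows "(int (rk_C k n M), \<kappa>_vector k n M) \<in> Mon_GT k n"
proof -
  interpret M: C_module k n M
    using assms by (intro C_module.intro) (simp_all add: CM_fg_def C_algebra_axioms)
  obtain B where "is_basis (restrict_scalars C M) B" using assms by (auto simp: CM_fg_def)
  then interpret M: torsion_free_module k n M by (rule M.torsion_free_if_basis)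
  have "finitely_generated C M" using assms by (simp add: CM_fg_def)
  then obtain S and \<eta> :: "'m \<Rightarrow> 'm \<Rightarrow> complex fps" where \<eta>: "finite S" "bij_betw \<eta> M.V (supported_on S)"
    "\<And>w w'. \<lbrakk>w \<in> M.V; w' \<in> M.V\<rbrakk> \<Longrightarrow> \<eta> (w \<oplus>\<^bsub>M\<^esub> w') = \<eta> w + \<eta> w'"
    "\<And>r w. w \<in> M.V \<Longrightarrow> \<eta> (C.\<rho> r \<odot>\<^bsub>M\<^esub> w) = rscale r (\<eta> w)"
    using M.V_free by blast
  interpret L: lattice_chain k n M S \<eta>
    using \<eta> by unfold_locales
  show ?thesis unfolding L.rk_C_eq L.\<kappa>_vector_eq by (rule L.cdi_GT)
qed

section \<open>Realizing patterns by sums of rank one modules\<close>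

lemma card_image_atMost_iff:
  fixes f :: "nat \<Rightarrow> nat"
  assumes mono: "\<And>a b. \<lbrakk>a < b; b < m\<rbrakk> \<Longrightarrow> f a < f b" and a: "a < m"
  shows "a < card {b. b < m \<and> f b \<le> v} \<longleftrightarrow> f a \<le> v"
proof
  assume v: "f a \<le> v"
  \<comment> \<open>A sublevel set of an increasing function is an initial segment, so its
    cardinality exceeds \<open>a\<close> exactly when it contains \<open>a\<close>.\<close>
  have "{..a} \<subseteq> {b. b < m \<and> f b \<le> v}"
  proof
    fix b assume b: "b \<in> {..a}"
    have "b = a \<or> f b < f a"
    proof (cases "b = a")
      case False
      then have "b < a" using b by simp
      then show ?thesis using mono a by blast
    qed simp
    then show "b \<in> {b. b < m \<and> f b \<le> v}" using a v b by auto
  qed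
  then have "card {..a} \<le> card {b. b < m \<and> f b \<le> v}" by (intro card_mono) auto
  then show "a < card {b. b < m \<and> f b \<le> v}" by simp
next
  assume c: "a < card {b. b < m \<and> f b \<le> v}"
  show "f a \<le> v"
  proof (rule ccontr)
    assume v: "\<not> f a \<le> v"
    have "{b. b < m \<and> f b \<le> v} \<subseteq> {..<a}"
    proof
      fix b assume b: "b \<in> {b. b < m \<and> f b \<le> v}"
      then have "\<not> (a = b \<or> f a < f b)" using v by auto
      then show "b \<in> {..<a}" using mono[of a b] b by (cases a b rule: linorder_cases) auto
    qed
    then have "card {b. b < m \<and> f b \<le> v} \<le> card {..<a}" by (intro card_mono) auto
    then show False using c by simp
  qed
qed

text \<open>The boundary path of an up-closed set of boxes, read as a \<open>k\<close>-subset.\<close>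

lemma (in C_algebra) subset_of_up_set:
  fixes P :: "int \<Rightarrow> int \<Rightarrow> bool"
  assumes up_i: "\<And>i j. \<lbrakk>2 \<le> i; i \<le> k; 1 \<le> j; j \<le> n - k; P (i - 1) j\<rbrakk> \<Longrightarrow> P i j"
    and up_j: "\<And>i j. \<lbrakk>1 \<le> i; i \<le> k; 2 \<le> j; j \<le> n - k; P i (j - 1)\<rbrakk> \<Longrightarrow> P i j"
  obtains J where "J \<subseteq> {1..n}" "int (card J) = k"
    "\<And>v. card (J \<inter> {1..int v}) \<le> v" "\<And>v. card (J \<inter> {1..int v}) \<le> nat k"
    "\<And>i j. \<lbrakk>1 \<le> i; i \<le> k; 1 \<le> j; j \<le> n - k\<rbrakk> \<Longrightarrow>
       nat (k - i) < card (J \<inter> {1..int (nat (k - i + j))}) \<longleftrightarrow> P i j"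
proof -
  define q where "q = nat (n - k)"
  \<comment> \<open>Row \<open>a\<close> stands for i = k - a. Columns beyond q = n - k belong to
    every row, so that the first column \<open>m a\<close> of a row always exists.\<close>
  define Q where "Q a j \<longleftrightarrow> q < j \<or> 1 \<le> j \<and> P (k - int a) (int j)" for a j :: nat
  define m where "m a = (LEAST j. Q a j)" for a
  have Qm: "Q a (m a)" for a unfolding m_def by (rule LeastI[of _ "Suc q"]) (simp add: Q_def)
  have m_le: "Q a j \<Longrightarrow> m a \<le> j" for a j unfolding m_def by (rule Least_le)
  have m1: "1 \<le> m a" "m a \<le> Suc q" for a
    using Qm[of a] m_le[of a "Suc q"] by (auto simp: Q_def)
  have Q_up: "Q a j" if "Q a j0" "j0 \<le> j" "a < nat k" for a j j0
    using that(2,1)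
  proof (induction rule: dec_induct)
    case (step j)
    show ?case
    proof (cases "q < Suc j")
      case False
      then have "1 \<le> j" "P (k - int a) (int j)" using step.IH[OF step.prems] by (auto simp: Q_def)
      then have "P (k - int a) (int (Suc j))"
        using that(3) False by - (rule up_j, auto simp: q_def)
      then show ?thesis by (simp add: Q_def)
    qed (simp add: Q_def)
  qed
  have m_iff: "m a \<le> j \<longleftrightarrow> Q a j" if "a < nat k" for a j
    using m_le Q_up[OF Qm _ that] by blast
  have m_mono: "m a \<le> m (Suc a)" if "Suc a < nat k" for a
  proof (rule m_le)
    have "Q (Suc a) (m (Suc a))" by (rule Qm)
    moreover have "P (k - int a) (int (m (Suc a)))" if P: "P (k - int (Suc a)) (int (m (Suc a)))" "m (Suc a) \<le> q"
    proof (rule up_i)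
      show "P (k - int a - 1) (int (m (Suc a)))" using P(1) by (simp add: algebra_simps)
    qed (use \<open>Suc a < nat k\<close> m1[of "Suc a"] P(2) in \<open>auto simp: q_def\<close>)
    ultimately show "Q a (m (Suc a))" unfolding Q_def by (cases "q < m (Suc a)") simp_all
  qed
  \<comment> \<open>Lists the elements of \<open>J\<close> in increasing order, starting with a = 0.
    More than \<open>a\<close> of them are at most a + j iff \<open>f a\<close> is, that is iff
    \<open>m a\<close> is at most j, and this says that the box in row \<open>a\<close> and column j
    belongs to the up-set.\<close>
  define f where "f a = a + m a" for a
  have f_mono: "f a < f b" if "a < b" "b < nat k" for a b
    using that
  proof (induction rule: less_Suc_induct)
    case (1 a)
    then show ?case using m_mono[of a] by (simp add: f_def)
  next
    case (2 a b c)
    then show ?case by simp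
  qed
  have inj: "inj_on (\<lambda>a. int (f a)) {..<nat k}"
  proof (rule inj_onI, rule ccontr)
    fix a b assume ab: "a \<in> {..<nat k}" "b \<in> {..<nat k}" "int (f a) = int (f b)" "a \<noteq> b"
    show False
    proof (cases "a < b")
      case True
      then show ?thesis using f_mono[OF True] ab by simp
    next
      case False
      then have "b < a" using ab(4) by simp
      then show ?thesis using f_mono[of b a] ab by simp
    qed
  qed
  define J where "J = (\<lambda>a. int (f a)) ` {..<nat k}"
  have f1: "1 \<le> f a" "f a \<le> a + Suc q" for a using m1[of a] by (auto simp: f_def)
  have card_J: "card (J \<inter> {1..int v}) = card {b. b < nat k \<and> f b \<le> v}" for v
  proof -
    have "J \<inter> {1..int v} = (\<lambda>a. int (f a)) ` {b. b < nat k \<and> f b \<le> v}"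
    proof (intro equalityI subsetI)
      fix z assume z: "z \<in> J \<inter> {1..int v}"
      then obtain a where a: "a < nat k" "z = int (f a)" by (auto simp: J_def)
      show "z \<in> (\<lambda>a. int (f a)) ` {b. b < nat k \<and> f b \<le> v}"
        using a z by (intro image_eqI[of _ _ a]) auto
    next
      fix z assume "z \<in> (\<lambda>a. int (f a)) ` {b. b < nat k \<and> f b \<le> v}"
      then obtain a where a: "a < nat k" "f a \<le> v" "z = int (f a)" by auto
      show "z \<in> J \<inter> {1..int v}" using a f1(1)[of a] by (simp add: J_def)
    qed
    moreover have "{b. b < nat k \<and> f b \<le> v} \<subseteq> {..<nat k}" by auto
    ultimately show ?thesis by (simp add: card_image[OF inj_on_subset[OF inj]])
  qed
  show thesis
  proof
    show "J \<subseteq> {1..n}"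
    proof
      fix z assume "z \<in> J"
      then obtain a where a: "a < nat k" "z = int (f a)" by (auto simp: J_def)
      then show "z \<in> {1..n}" using f1[of a] k_less by (simp add: q_def)
    qed
    show "int (card J) = k" using inj k_pos by (simp add: J_def card_image)
    fix v
    have "{b. b < nat k \<and> f b \<le> v} \<subseteq> {..<v}"
    proof
      fix b assume "b \<in> {b. b < nat k \<and> f b \<le> v}"
      then show "b \<in> {..<v}" using m1(1)[of b] by (simp add: f_def)
    qed
    from card_mono[OF finite_lessThan this] show "card (J \<inter> {1..int v}) \<le> v" unfolding card_J by simp
    have "card {b. b < nat k \<and> f b \<le> v} \<le> card {..<nat k}" by (intro card_mono) auto
    then show "card (J \<inter> {1..int v}) \<le> nat k" unfolding card_J by simp
  next
    fix i j assume ij: "1 \<le> i" "i \<le> k" "1 \<le> j" "j \<le> n - k"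
    let ?a = "nat (k - i)"
    have a: "?a < nat k" using ij by simp
    have v: "nat (k - i + j) = ?a + nat j" using ij by simp
    have "?a < card {b. b < nat k \<and> f b \<le> nat (k - i + j)} \<longleftrightarrow> f ?a \<le> nat (k - i + j)"
      by (rule card_image_atMost_iff[OF f_mono a])
    also have "\<dots> \<longleftrightarrow> m ?a \<le> nat j" unfolding v f_def by simp
    also have "\<dots> \<longleftrightarrow> P i j"
    proof -
      have "Suc 0 \<le> nat j" "\<not> q < nat j" "k - int ?a = i" "int (nat j) = j" using ij by (auto simp: q_def)
      then show ?thesis unfolding m_iff[OF a] Q_def by simp
    qed
    finally show "?a < card (J \<inter> {1..int (nat (k - i + j))}) \<longleftrightarrow> P i j" unfolding card_J .
  qed
qed

lemma rscale_apply: "rscale r f i = r * f i"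
  by (simp add: rscale_def)

lemma cscale_apply: "cscale z f i = fps_const z * f i"
  by (simp add: cscale_def rscale_def)

text \<open>The monomials t^j at position i with j below \<open>e i\<close> represent a basis of the
  quotient.\<close>

lemma codim_divisible:
  fixes S :: "'i set"
  assumes S: "finite S"
  shows "cx.codim (supported_on S) {f \<in> supported_on S. \<forall>i\<in>S. \<forall>j<e i. fps_nth (f i) j = 0} (\<Sum>i\<in>S. e i)"
proof -
  define u where "u = (\<lambda>(i :: 'i, j). rscale (fps_X ^ j) (unit_fun i))"
  define I where "I = Sigma S (\<lambda>i. {..<e i})"
  have fI: "finite I" using S by (auto simp: I_def)
  have cu: "fps_nth (u p i) j = (if p = (i, j) then 1 else 0)" for p i j
    by (cases p) (auto simp: u_def rscale_def unit_fun_def fps_X_power_nth)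
  have inj: "inj_on u I"
  proof
    fix p q assume "u p = u q"
    then have "fps_nth (u p (fst p)) (snd p) = fps_nth (u q (fst p)) (snd p)" by simp
    then show "p = q" by (simp add: cu split: if_splits)
  qed
  have coef: "fps_nth ((\<Sum>p\<in>I. cscale (c p) (u p)) i) j = (if (i, j) \<in> I then c (i, j) else 0)" for c i j
  proof -
    have "fps_nth ((\<Sum>p\<in>I. cscale (c p) (u p)) i) j = (\<Sum>p\<in>I. if p = (i, j) then c p else 0)"
      unfolding sum_apply fps_sum_nth cscale_apply by (intro sum.cong refl) (simp add: cu)
    then show ?thesis using fI by simp
  qed
  have I: "(i, j) \<in> I \<longleftrightarrow> i \<in> S \<and> j < e i" for i j by (simp add: I_def)
  have u_supp: "u p \<in> supported_on S" if "p \<in> I" for p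
    using that by (auto simp: I_def u_def supported_on_def rscale_def unit_fun_def)
  let ?W = "{f \<in> supported_on S. \<forall>i\<in>S. \<forall>j<e i. fps_nth (f i) j = 0}"
  have "cx.basis_mod (supported_on S) ?W (u ` I)"
    unfolding cx.basis_mod_def
  proof (intro conjI ballI allI impI)
    show "finite (u ` I)" using fI by simp
    show "u ` I \<subseteq> supported_on S" using u_supp by blast
  next
    fix f assume f: "f \<in> supported_on S"
    let ?b = "\<Sum>p\<in>I. cscale (fps_nth (f (fst p)) (snd p)) (u p)"
    have b: "fps_nth (?b i) j = (if (i, j) \<in> I then fps_nth (f i) j else 0)" for i j
      using coef[of "\<lambda>p. fps_nth (f (fst p)) (snd p)" i j] by simp
    have b0: "?b i = 0" if "i \<notin> S" for i
      by (rule fps_ext) (simp only: b I that, simp)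
    have "f - ?b \<in> supported_on S"
      using f unfolding supported_on_def by (simp add: b0)
    moreover have "fps_nth ((f - ?b) i) j = 0" if "i \<in> S" "j < e i" for i j
      unfolding minus_apply fps_sub_nth b using that by (simp add: I)
    ultimately have "f - ?b \<in> ?W" by blast
    moreover have "?b \<in> cx.span (u ` I)"
      by (intro cx.span_sum cx.span_scale cx.span_base) simp
    ultimately show "\<exists>b\<in>cx.span (u ` I). f - b \<in> ?W" by blast
  next
    fix c b assume c: "(\<Sum>b\<in>u ` I. cscale (c b) b) \<in> ?W" and b: "b \<in> u ` I"
    obtain i j where ij: "b = u (i, j)" "(i, j) \<in> I" using b by auto
    have "(\<Sum>b\<in>u ` I. cscale (c b) b) = (\<Sum>p\<in>I. cscale (c (u p)) (u p))"
      by (rule sum.reindex[OF inj, unfolded comp_def])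
    then have "fps_nth ((\<Sum>p\<in>I. cscale (c (u p)) (u p)) i) j = 0"
      using c ij(2) unfolding I by simp
    then show "c b = 0" unfolding coef[of "\<lambda>p. c (u p)" i j] using ij by simp
  qed
  moreover have "card (u ` I) = (\<Sum>i\<in>S. e i)" using card_image[OF inj] S by (simp add: I_def)
  ultimately show ?thesis unfolding cx.codim_def by blast
qed

locale rank_one_sum = C_algebra k n for k n :: int +
  fixes J :: "nat \<Rightarrow> int set" and r :: nat
  assumes J: "s < r \<Longrightarrow> J s \<subseteq> {1..n}" "s < r \<Longrightarrow> int (card (J s)) = k"
begin

lemma rank_one: "s < r \<Longrightarrow> rank_one k n (J s)"
  using J by (intro rank_one.intro rank_one_axioms.intro C_algebra_axioms)

text \<open>The sum of the modules \<open>M_J\<close> has to live in the fixed type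
  \<open>univ\<close>, so summand and vertex are packed into one natural number; vertices start at
  1, positions at 0.\<close>

definition idx :: "nat \<Rightarrow> int \<Rightarrow> nat" where
  "idx s v = s * nat n + nat (v - 1)"

definition component :: "nat \<Rightarrow> univ \<Rightarrow> int \<Rightarrow> complex fps" where
  "component s f = (\<lambda>v\<in>{1..n}. f (idx s v))"

definition M :: "(path_elts set, univ) module" where
  "M = \<lparr>carrier = supported_on {..<r * nat n}, monoid.mult = undefined, one = undefined,
     ring.zero = 0, add = (+),
     smult = (\<lambda>c f m. if m < r * nat n
       then (c \<odot>\<^bsub>rank_one_module n (J (m div nat n))\<^esub> component (m div nat n) f) (int (m mod nat n) + 1)
       else 0)\<rparr>"

lemma M_simps: "carrier M = supported_on {..<r * nat n}" "\<zero>\<^bsub>M\<^esub> = 0" "f \<oplus>\<^bsub>M\<^esub> g = f + g"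
  by (simp_all add: M_def)

lemma idx_div_mod:
  assumes "v \<in> {1..n}"
  shows "idx s v div nat n = s" "idx s v mod nat n = nat (v - 1)"
proof -
  have "nat (v - 1) < nat n" using assms by auto
  then show "idx s v div nat n = s" "idx s v mod nat n = nat (v - 1)" by (simp_all add: idx_def)
qed

lemma idx_inj: "\<lbrakk>v \<in> {1..n}; v' \<in> {1..n}; idx s v = idx s' v'\<rbrakk> \<Longrightarrow> s = s' \<and> v = v'"
  using idx_div_mod[of v s] idx_div_mod[of v' s'] by auto

lemma idx_less:
  assumes "s < r" "v \<in> {1..n}"
  shows "idx s v < r * nat n"
proof -
  have "idx s v < Suc s * nat n" using assms(2) by (auto simp: idx_def)
  also have "\<dots> \<le> r * nat n" using assms(1) by (intro mult_right_mono) auto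
  finally show ?thesis .
qed

lemma idx_cases:
  assumes "m < r * nat n"
  obtains s v where "s < r" "v \<in> {1..n}" "m = idx s v"
proof
  have n: "0 < nat n" using n_pos by simp
  show "m div nat n < r" using assms n by (simp add: less_mult_imp_div_less)
  have "m mod nat n < nat n" using n by simp
  then show "int (m mod nat n) + 1 \<in> {1..n}" by auto
  show "m = idx (m div nat n) (int (m mod nat n) + 1)" by (simp add: idx_def)
qed

lemma component_ext:
  assumes "f \<in> carrier M" "g \<in> carrier M" "\<And>s. s < r \<Longrightarrow> component s f = component s g"
  shows "f = g"
proof
  fix m
  show "f m = g m"
  proof (cases "m < r * nat n")
    case True
    then obtain s v where sv: "s < r" "v \<in> {1..n}" "m = idx s v" by (rule idx_cases)
    have "component s f v = component s g v" using assms(3)[OF sv(1)] by simp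
    then show ?thesis using sv by (simp add: component_def)
  next
    case False
    then show ?thesis using assms(1,2) by (simp add: M_simps supported_on_def)
  qed
qed

lemma component_closed: "component s f \<in> carrier (rank_one_module n J')"
  by (simp add: component_def rank_one_module_def)

lemma component_add:
  "component s (f + g) = component s f \<oplus>\<^bsub>rank_one_module n J'\<^esub> component s g"
  unfolding rank_one_module_def by (auto simp: component_def)

lemma smult_closed: "c \<odot>\<^bsub>M\<^esub> f \<in> carrier M"
  by (simp add: M_def supported_on_def)

lemma component_smult:
  assumes "s < r" "c \<in> carrier C"
  shows "component s (c \<odot>\<^bsub>M\<^esub> f) = c \<odot>\<^bsub>rank_one_module n (J s)\<^esub> component s f"
proof -
  interpret R: rank_one k n "J s" by (rule rank_one[OF assms(1)])
  show ?thesis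
  proof (rule R.T_ext[OF component_closed R.T_closed[OF assms(2)]])
    fix v assume v: "v \<in> {1..n}"
    have "int (nat (v - 1)) + 1 = v" using v by simp
    then show "component s (c \<odot>\<^bsub>M\<^esub> f) v = (c \<odot>\<^bsub>rank_one_module n (J s)\<^esub> component s f) v"
      using v idx_less[OF assms(1) v] unfolding component_def[of s "c \<odot>\<^bsub>M\<^esub> f"]
      by (simp add: M_def idx_div_mod[OF v])
  qed
qed

lemma M_left_module: "left_module C M"
proof (intro left_module.intro left_module_axioms.intro)
  show "ring C" by (rule C.\<Lambda>_ring)
  have sum: "f + g \<in> carrier M" if "f \<in> carrier M" "g \<in> carrier M" for f g
    using that by (simp add: M_simps supported_on_def)
  show "abelian_group M"
  proof (rule abelian_groupI)
    fix f assume f: "f \<in> carrier M"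
    have "- f \<in> carrier M" using f by (simp add: M_simps supported_on_def)
    then show "\<exists>g\<in>carrier M. g \<oplus>\<^bsub>M\<^esub> f = \<zero>\<^bsub>M\<^esub>" by (intro bexI[of _ "- f"]) (simp_all add: M_simps)
  qed (simp_all add: M_simps add_ac supported_on_def)
  have L: "left_module C (rank_one_module n (J s))" if "s < r" for s
    by (rule rank_one.T_left_module[OF rank_one[OF that]])
  fix a f assume a: "a \<in> carrier C" and f: "f \<in> carrier M"
  show "a \<odot>\<^bsub>M\<^esub> f \<in> carrier M" by (rule smult_closed)
  { fix g assume g: "g \<in> carrier M"
    show "a \<odot>\<^bsub>M\<^esub> (f \<oplus>\<^bsub>M\<^esub> g) = a \<odot>\<^bsub>M\<^esub> f \<oplus>\<^bsub>M\<^esub> a \<odot>\<^bsub>M\<^esub> g"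
      unfolding M_simps
    proof (rule component_ext)
      fix s assume s: "s < r"
      show "component s (a \<odot>\<^bsub>M\<^esub> (f + g)) = component s (a \<odot>\<^bsub>M\<^esub> f + a \<odot>\<^bsub>M\<^esub> g)"
        unfolding component_smult[OF s a] component_add[of s _ _ "J s"]
        by (rule left_module.smult_r_distr[OF L[OF s] a component_closed component_closed])
    qed (intro smult_closed sum)+ }
  { fix b assume b: "b \<in> carrier C"
    have ab: "a \<oplus>\<^bsub>C\<^esub> b \<in> carrier C" "a \<otimes>\<^bsub>C\<^esub> b \<in> carrier C" using a b by auto
    show "(a \<oplus>\<^bsub>C\<^esub> b) \<odot>\<^bsub>M\<^esub> f = a \<odot>\<^bsub>M\<^esub> f \<oplus>\<^bsub>M\<^esub> b \<odot>\<^bsub>M\<^esub> f"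
      unfolding M_simps
    proof (rule component_ext)
      fix s assume s: "s < r"
      show "component s ((a \<oplus>\<^bsub>C\<^esub> b) \<odot>\<^bsub>M\<^esub> f) = component s (a \<odot>\<^bsub>M\<^esub> f + b \<odot>\<^bsub>M\<^esub> f)"
        unfolding component_add[of s _ _ "J s"] component_smult[OF s a] component_smult[OF s b]
          component_smult[OF s ab(1)]
        by (rule left_module.smult_l_distr[OF L[OF s] a b component_closed])
    qed (intro smult_closed sum)+
    show "(a \<otimes>\<^bsub>C\<^esub> b) \<odot>\<^bsub>M\<^esub> f = a \<odot>\<^bsub>M\<^esub> (b \<odot>\<^bsub>M\<^esub> f)"
    proof (rule component_ext[OF smult_closed smult_closed])
      fix s assume s: "s < r"
      show "component s ((a \<otimes>\<^bsub>C\<^esub> b) \<odot>\<^bsub>M\<^esub> f) = component s (a \<odot>\<^bsub>M\<^esub> (b \<odot>\<^bsub>M\<^esub> f))"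
        unfolding component_smult[OF s a] component_smult[OF s b] component_smult[OF s ab(2)]
        by (rule left_module.smult_assoc[OF L[OF s] a b component_closed])
    qed }
next
  fix f assume f: "f \<in> carrier M"
  show "\<one>\<^bsub>C\<^esub> \<odot>\<^bsub>M\<^esub> f = f"
  proof (rule component_ext[OF smult_closed f])
    fix s assume s: "s < r"
    show "component s (\<one>\<^bsub>C\<^esub> \<odot>\<^bsub>M\<^esub> f) = component s f"
      unfolding component_smult[OF s C.\<Lambda>.one_closed]
      by (rule left_module.smult_one[OF rank_one.T_left_module[OF rank_one[OF s]] component_closed])
  qed
qed

lemma rscale_closed: "f \<in> carrier M \<Longrightarrow> rscale a f \<in> carrier M"
  by (simp add: M_simps supported_on_def rscale_def)

lemma M_\<rho>:
  assumes f: "f \<in> carrier M"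
  shows "C.\<rho> a \<odot>\<^bsub>M\<^esub> f = rscale a f"
proof (rule component_ext[OF smult_closed rscale_closed[OF f]])
  fix s assume s: "s < r"
  interpret R: rank_one k n "J s" by (rule rank_one[OF s])
  show "component s (C.\<rho> a \<odot>\<^bsub>M\<^esub> f) = component s (rscale a f)"
    unfolding component_smult[OF s C.\<rho>_closed] R.T_\<rho>[OF component_closed]
    by (auto simp: component_def rscale_def)
qed

sublocale M: C_module k n M
  by (intro C_module.intro C_algebra_axioms M_left_module)

sublocale M: torsion_free_module k n M
proof unfold_locales
  fix f assume f: "f \<in> carrier M" "C.\<rho> fps_X \<odot>\<^bsub>M\<^esub> f = \<zero>\<^bsub>M\<^esub>"
  then have "rscale fps_X f = rscale fps_X 0" by (simp add: M_\<rho> M_simps)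
  then show "f = \<zero>\<^bsub>M\<^esub>" unfolding M_simps by (rule injD[OF inj_rscale_X])
qed

text \<open>The positions of the vertex *, one in each summand; they index a basis of e_* M.\<close>

definition Sn :: "nat set" where "Sn = (\<lambda>s. idx s n) ` {..<r}"

lemma inj_idx_n: "inj_on (\<lambda>s. idx s n) {..<r}"
  using idx_inj[of n n] n_pos by (intro inj_onI) auto

lemma n_in: "n \<in> {1..n}"
  using n_pos by simp

lemma M_V: "M.V = supported_on Sn"
proof (intro equalityI subsetI)
  fix f assume "f \<in> M.V"
  then have f: "f \<in> carrier M" "E n \<odot>\<^bsub>M\<^esub> f = f" by (simp_all add: M.V_def)
  have "f m = 0" if m: "m \<notin> Sn" for m
  proof (cases "m < r * nat n")
    case True
    then obtain s v where sv: "s < r" "v \<in> {1..n}" "m = idx s v" by (rule idx_cases)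
    interpret R: rank_one k n "J s" by (rule rank_one[OF sv(1)])
    have "v \<noteq> n" using sv m by (auto simp: Sn_def)
    then have "component s (E n \<odot>\<^bsub>M\<^esub> f) v = 0"
      unfolding component_smult[OF sv(1) E_closed] R.T_E using sv(2) n_in by simp
    then show ?thesis unfolding f(2) using sv by (simp add: component_def)
  next
    case False
    then show ?thesis using f(1) by (simp add: M_simps supported_on_def)
  qed
  then show "f \<in> supported_on Sn" by (simp add: supported_on_def)
next
  fix f assume f: "f \<in> supported_on Sn"
  have "Sn \<subseteq> {..<r * nat n}" using idx_less n_in by (auto simp: Sn_def)
  then have fM: "f \<in> carrier M" using f by (auto simp: M_simps supported_on_def)
  have "E n \<odot>\<^bsub>M\<^esub> f = f"
  proof (rule component_ext[OF smult_closed fM])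
    fix s assume s: "s < r"
    interpret R: rank_one k n "J s" by (rule rank_one[OF s])
    have "f (idx s v) = 0" if v: "v \<in> {1..n}" "v \<noteq> n" for v
    proof -
      have "idx s v \<notin> Sn" using idx_inj[OF v(1) n_in, of s] v(2) by (auto simp: Sn_def)
      then show ?thesis using f by (simp add: supported_on_def)
    qed
    then show "component s (E n \<odot>\<^bsub>M\<^esub> f) = component s f"
      unfolding component_smult[OF s E_closed] R.T_E unfolding component_def
      using n_in by (intro restrict_ext) auto
  qed
  then show "f \<in> M.V" using fM by (simp add: M.V_def)
qed

abbreviation b :: "nat \<Rightarrow> nat \<Rightarrow> nat" where "b s v \<equiv> card (J s \<inter> {1..int v})"

text \<open>On summand \<open>s\<close> the element y^v is multiplication by the power
  \<open>b s v\<close> of t from the vertex \<open>v\<close> to *, so lying in its image means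
  divisibility in each coordinate.\<close>

lemma M_N:
  assumes v: "v \<le> nat n" and w: "w \<in> M.V"
  shows "w \<in> M.N v \<longleftrightarrow> (\<forall>s<r. \<forall>j<b s v. fps_nth (w (idx s n)) j = 0)"
proof -
  let ?c = "y [^]\<^bsub>C\<^esub> v \<otimes>\<^bsub>C\<^esub> E (int v)"
  have c: "?c \<in> carrier C" by simp
  have wM: "w \<in> carrier M" using w by (rule M.V_closed)
  have comp: "component s (?c \<odot>\<^bsub>M\<^esub> m)
      = (\<lambda>u\<in>{1..n}. if u = n then fps_X ^ b s v * component s m (vtx n (int v)) else 0)" if "s < r" for s m
  proof -
    interpret R: rank_one k n "J s" by (rule rank_one[OF that])
    show ?thesis unfolding component_smult[OF that c] by (rule R.T_y_pow_E[OF v])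
  qed
  show ?thesis
  proof
    assume "w \<in> M.N v"
    then obtain m where m: "w = ?c \<odot>\<^bsub>M\<^esub> m" by (auto simp: M.N_def)
    have "fps_nth (w (idx s n)) j = 0" if "s < r" "j < b s v" for s j
    proof -
      have "w (idx s n) = component s w n" using n_in by (simp add: component_def)
      also have "\<dots> = fps_X ^ b s v * component s m (vtx n (int v))"
        unfolding m comp[OF that(1)] using n_in by simp
      finally show ?thesis using that(2) by (simp add: fps_X_power_mult_nth)
    qed
    then show "\<forall>s<r. \<forall>j<b s v. fps_nth (w (idx s n)) j = 0" by blast
  next
    assume z: "\<forall>s<r. \<forall>j<b s v. fps_nth (w (idx s n)) j = 0"
    \<comment> \<open>Each coordinate at * is divided by its power of t. The quotient is stored at
      every vertex of its summand, where the value at the vertex \<open>v\<close> is the one that is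
      read.\<close>
    define m where "m i = (if i < r * nat n then fps_shift (b (i div nat n) v) (w (idx (i div nat n) n)) else 0)" for i
    have mM: "m \<in> carrier M" by (simp add: M_simps supported_on_def m_def)
    have "?c \<odot>\<^bsub>M\<^esub> m = w"
    proof (rule component_ext[OF smult_closed wM])
      fix s assume s: "s < r"
      have vv: "vtx n (int v) \<in> {1..n}" by (rule vtx_range)
      have "component s m (vtx n (int v)) = fps_shift (b s v) (w (idx s n))"
        using vv idx_less[OF s vv] by (simp add: component_def m_def idx_div_mod[OF vv])
      moreover have "w (idx s n) = fps_X ^ b s v * fps_shift (b s v) (w (idx s n))"
        using z s by (intro fps_factor_X_power) blast
      moreover have "w (idx s u) = 0" if u: "u \<in> {1..n}" "u \<noteq> n" for u
      proof -
        have "idx s u \<notin> Sn" using idx_inj[OF u(1) n_in, of s] u(2) by (auto simp: Sn_def)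
        then show ?thesis using w by (simp add: M_V supported_on_def)
      qed
      ultimately show "component s (?c \<odot>\<^bsub>M\<^esub> m) = component s w"
        unfolding comp[OF s] by (auto simp: component_def[of s w])
    qed
    then show "w \<in> M.N v" unfolding M.N_def using mM by (intro image_eqI[of _ _ m]) auto
  qed
qed

lemma M_W:
  assumes v: "v \<le> nat n"
  shows "M.W a v = {f \<in> supported_on Sn. \<forall>i\<in>Sn. \<forall>j<b (i div nat n) v - a. fps_nth (f i) j = 0}"
proof -
  \<comment> \<open>The coefficients of t^a g below B vanish iff those of g below B - a do; for B at
    most \<open>a\<close> both conditions are empty.\<close>
  have shift: "(\<forall>j<B. j < a \<or> fps_nth g (j - a) = 0) \<longleftrightarrow> (\<forall>j<B - a. fps_nth g j = 0)" for B and g :: "complex fps"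
  proof
    assume *: "\<forall>j<B. j < a \<or> fps_nth g (j - a) = 0"
    show "\<forall>j<B - a. fps_nth g j = 0"
    proof (intro allI impI)
      fix j assume "j < B - a"
      then show "fps_nth g j = 0" using *[rule_format, of "j + a"] by simp
    qed
  next
    assume *: "\<forall>j<B - a. fps_nth g j = 0"
    show "\<forall>j<B. j < a \<or> fps_nth g (j - a) = 0"
    proof (intro allI impI)
      fix j assume "j < B"
      then show "j < a \<or> fps_nth g (j - a) = 0" using *[rule_format, of "j - a"] by linarith
    qed
  qed
  have "f \<in> M.W a v \<longleftrightarrow> (\<forall>s<r. \<forall>j<b s v - a. fps_nth (f (idx s n)) j = 0)" if f: "f \<in> M.V" for f
  proof -
    have "f \<in> M.W a v \<longleftrightarrow> rscale (fps_X ^ a) f \<in> M.N v"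
      using f M_\<rho>[OF M.V_closed[OF f]] by (simp add: M.W_def)
    also have "\<dots> \<longleftrightarrow> (\<forall>s<r. \<forall>j<b s v. fps_nth (rscale (fps_X ^ a) f (idx s n)) j = 0)"
      using M.V_\<rho>[OF f, of "fps_X ^ a"] M_\<rho>[OF M.V_closed[OF f]] by (intro M_N[OF v]) simp
    also have "\<dots> \<longleftrightarrow> (\<forall>s<r. \<forall>j<b s v. j < a \<or> fps_nth (f (idx s n)) (j - a) = 0)"
      by (auto simp: rscale_apply fps_X_power_mult_nth)
    also have "\<dots> \<longleftrightarrow> (\<forall>s<r. \<forall>j<b s v - a. fps_nth (f (idx s n)) j = 0)" by (simp only: shift)
    finally show ?thesis .
  qed
  moreover have "M.W a v \<subseteq> M.V" by (rule M.W_sub_V)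
  ultimately have "M.W a v = {f \<in> M.V. \<forall>s<r. \<forall>j<b s v - a. fps_nth (f (idx s n)) j = 0}" by blast
  then show ?thesis
    unfolding M_V Sn_def by (simp add: idx_div_mod[OF n_in] Ball_def[of "{..<r}"])
qed

sublocale L: lattice_chain k n M Sn "\<lambda>f. f"
proof
  show "finite Sn" by (simp add: Sn_def)
  show "bij_betw (\<lambda>f. f) M.V (supported_on Sn)" unfolding M_V by (auto simp: bij_betw_def)
qed (simp_all add: M_simps(3) M_\<rho>[OF M.V_closed])

text \<open>The subtraction is truncated: a summand with \<open>b s v\<close> at most
  \<open>a\<close> contributes nothing, because t^a already carries its part of \<open>V\<close>
  into \<open>N v\<close>.\<close>

lemma L_cd:
  assumes v: "v \<le> nat n"
  shows "L.cd a v = (\<Sum>s<r. b s v - a)"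
proof (rule L.cd_eq[OF _ v])
  have "(\<Sum>i\<in>Sn. b (i div nat n) v - a) = (\<Sum>s<r. b s v - a)"
    unfolding Sn_def by (subst sum.reindex[OF inj_idx_n]) (simp add: idx_div_mod[OF n_in])
  then show "cx.codim (supported_on Sn) ((\<lambda>f. f) ` M.W a v) (\<Sum>s<r. b s v - a)"
    using codim_divisible[OF L.finite_S, of "\<lambda>i. b (i div nat n) v - a"] M_W[OF v, of a] by simp
qed

lemma rk: "rk_C k n M = r"
  unfolding L.rk_C_eq using card_image[OF inj_idx_n] by (simp add: Sn_def)

lemma M_CM: "CM_fg C M"
  unfolding CM_fg_def
proof (intro conjI)
  let ?A = "{..<r * nat n}"
  show "left_module C M" by (rule M_left_module)
  have "\<exists>B. finite B \<and> is_basis (restrict_scalars C M) B"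
  proof (rule free_rank_eq(2)[OF M.restrict_scalars_module, of ?A "\<lambda>f. f"])
    show "bij_betw (\<lambda>f. f) (carrier (restrict_scalars C M)) (supported_on ?A)"
      unfolding M.restrict_scalars_simps(1) M_simps(1) by (simp add: bij_betw_def)
    show "f \<oplus>\<^bsub>restrict_scalars C M\<^esub> g = f + g" for f g
      unfolding M.restrict_scalars_simps(2) by (rule M_simps(3))
    show "a \<odot>\<^bsub>restrict_scalars C M\<^esub> f = rscale a f" if "f \<in> carrier (restrict_scalars C M)" for a f
      using that unfolding M.restrict_scalars_simps(1,4) by (rule M_\<rho>)
  qed simp
  then show "\<exists>B. is_basis (restrict_scalars C M) B" by blast
  have uM: "unit_fun i \<in> carrier M" if "i \<in> ?A" for i using that by (auto simp: M_simps supported_on_def unit_fun_def)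
  have inj: "inj_on unit_fun ?A" by (auto simp: inj_on_def unit_fun_def fun_eq_iff)
  show "finitely_generated C M"
    unfolding finitely_generated_def
  proof (intro exI[of _ "unit_fun ` ?A"] conjI ballI)
    show "unit_fun ` ?A \<subseteq> carrier M" using uM by blast
    fix f assume f: "f \<in> carrier M"
    have fin: "(\<Oplus>\<^bsub>M\<^esub>i\<in>F. rscale (f i) (unit_fun i)) = (\<Sum>i\<in>F. rscale (f i) (unit_fun i))"
      if "finite F" "F \<subseteq> ?A" for F
      using that
    proof (induction F)
      case (insert i F)
      have "(\<Oplus>\<^bsub>M\<^esub>i\<in>insert i F. rscale (f i) (unit_fun i))
          = rscale (f i) (unit_fun i) \<oplus>\<^bsub>M\<^esub> (\<Oplus>\<^bsub>M\<^esub>i\<in>F. rscale (f i) (unit_fun i))"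
        using insert uM by (intro M.M.finsum_insert) (auto intro!: rscale_closed)
      then show ?case using insert by (simp only: sum.insert[OF insert(1,2)] M_simps(3)) simp
    qed (simp only: M.M.finsum_empty sum.empty M_simps(2))
    define a where "a u = C.\<rho> (f (inv_into ?A unit_fun u))" for u
    have "(\<Oplus>\<^bsub>M\<^esub>u\<in>unit_fun ` ?A. a u \<odot>\<^bsub>M\<^esub> u) = (\<Oplus>\<^bsub>M\<^esub>i\<in>?A. a (unit_fun i) \<odot>\<^bsub>M\<^esub> unit_fun i)"
      using inj uM by (intro M.M.finsum_reindex) (auto intro: smult_closed)
    also have "\<dots> = (\<Oplus>\<^bsub>M\<^esub>i\<in>?A. rscale (f i) (unit_fun i))"
      using uM by (intro M.M.finsum_cong') (auto simp: a_def inv_into_f_f[OF inj] M_\<rho> intro!: rscale_closed)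
    also have "\<dots> = (\<Sum>i\<in>?A. rscale (f i) (unit_fun i))" by (rule fin) auto
    also have "\<dots> = f" using f by (intro supported_on_split[symmetric]) (auto simp: M_simps)
    finally have "f = (\<Oplus>\<^bsub>M\<^esub>u\<in>unit_fun ` ?A. a u \<odot>\<^bsub>M\<^esub> u)" by (rule sym)
    then show "\<exists>a\<in>unit_fun ` ?A \<rightarrow> carrier C. f = (\<Oplus>\<^bsub>M\<^esub>u\<in>unit_fun ` ?A. a u \<odot>\<^bsub>M\<^esub> u)"
      by (intro bexI[of _ a]) (auto simp: a_def)
  qed simp
qed

end

section \<open>Patterns described by their diagonal differences\<close>

lemma int_mono_on:
  fixes f :: "int \<Rightarrow> int"
  assumes "\<And>i. i \<in> {a + 1..b} \<Longrightarrow> f (i - 1) \<le> f i" "a \<le> i" "i \<le> j" "j \<le> b"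
  shows "f i \<le> f j"
  using assms(3,4)
proof (induction j rule: int_ge_induct)
  case (step j)
  then show ?case using assms(1)[of "j + 1"] assms(2) by simp
qed simp

text \<open>The difference along a diagonal. The second term tests against 1 because it refers to
  the box shifted by (1,1), to which the convention assigns 0 outside the rectangle.\<close>

definition gt_slice :: "(int \<times> int \<Rightarrow> int) \<Rightarrow> int \<Rightarrow> int \<Rightarrow> int" where
  "gt_slice v i j = (if i \<le> 0 \<or> j \<le> 0 then 0 else v (i, j)) - (if i \<le> 1 \<or> j \<le> 1 then 0 else v (i - 1, j - 1))"

text \<open>Monotonicity propagates the two corner conditions of a pattern to every box, and the
  resulting bounds force r to be nonnegative. In this form the patterns are the lattice points of
  the cone over an order polytope.\<close>

lemma (in C_algebra) Mon_GT_iff: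
  "(r, v) \<in> Mon_GT k n \<longleftrightarrow> (r, v) \<in> carrier (GT_lattice k n) \<and> 0 \<le> r \<and>
     (\<forall>i\<in>{1..k}. \<forall>j\<in>{1..n - k}. 0 \<le> gt_slice v i j \<and> gt_slice v i j \<le> r) \<and>
     (\<forall>i\<in>{2..k}. \<forall>j\<in>{1..n - k}. gt_slice v (i - 1) j \<le> gt_slice v i j) \<and>
     (\<forall>i\<in>{1..k}. \<forall>j\<in>{2..n - k}. gt_slice v i (j - 1) \<le> gt_slice v i j)"
proof -
  define v' where "v' = (\<lambda>i j. if i \<le> 0 \<or> j \<le> 0 then 0 else v (i, j))"
  define G where "G i j = v' i j - v' (i - 1) (j - 1)" for i j
  have slice: "gt_slice v = G" by (intro ext) (auto simp: gt_slice_def G_def v'_def)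
  have kn: "1 \<le> k" "1 \<le> n - k" using k_pos k_less by auto
  have e: "i - 1 - 1 = i - 2" for i :: int by simp
  have iff: "(r, v) \<in> Mon_GT k n \<longleftrightarrow> (r, v) \<in> carrier (GT_lattice k n) \<and> 0 \<le> G 1 1 \<and> G k (n - k) \<le> r \<and>
     (\<forall>i\<in>{2..k}. \<forall>j\<in>{1..n - k}. G (i - 1) j \<le> G i j) \<and>
     (\<forall>i\<in>{1..k}. \<forall>j\<in>{2..n - k}. G i (j - 1) \<le> G i j)"
  proof -
    have "v' 1 1 = G 1 1" by (simp add: G_def v'_def)
    then show ?thesis
      unfolding Mon_GT_def mem_Collect_eq case_prod_conv v'_def[symmetric] unfolding Let_def G_def e by simp
  qed
  show ?thesis
    unfolding slice iff
  proof (intro iffI; elim conjE; intro conjI)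
    assume G11: "0 \<le> G 1 1" and Gkn: "G k (n - k) \<le> r"
      and Gi: "\<forall>i\<in>{2..k}. \<forall>j\<in>{1..n - k}. G (i - 1) j \<le> G i j"
      and Gj: "\<forall>i\<in>{1..k}. \<forall>j\<in>{2..n - k}. G i (j - 1) \<le> G i j"
    have bounds: "0 \<le> G i j \<and> G i j \<le> r" if ij: "i \<in> {1..k}" "j \<in> {1..n - k}" for i j
    proof
      note G11
      also have "G 1 1 \<le> G i 1" by (rule int_mono_on[of 1 k "\<lambda>i. G i 1"]) (use ij kn Gi in auto)
      also have "G i 1 \<le> G i j" by (rule int_mono_on[of 1 "n - k" "G i"]) (use ij kn Gj in auto)
      finally show "0 \<le> G i j" .
      have "G i j \<le> G k j" by (rule int_mono_on[of 1 k "\<lambda>i. G i j"]) (use ij kn Gi in auto)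
      also have "\<dots> \<le> G k (n - k)" by (rule int_mono_on[of 1 "n - k" "G k"]) (use ij kn Gj in auto)
      also note Gkn
      finally show "G i j \<le> r" .
    qed
    then show "\<forall>i\<in>{1..k}. \<forall>j\<in>{1..n - k}. 0 \<le> G i j \<and> G i j \<le> r" by blast
    show "0 \<le> r" using bounds[of 1 1] kn by auto
  qed (use kn in auto)
qed

lemma (in C_algebra) GT_realizable:
  assumes rv: "(r, v) \<in> Mon_GT k n"
  obtains M :: "(path_elts set, univ) module"
  where "CM_fg C M" "int (rk_C k n M) = r" "\<kappa>_vector k n M = v"
proof -
  define v' where "v' = (\<lambda>i j. if i \<le> 0 \<or> j \<le> 0 then 0 else v (i, j))"
  define G where "G i j = v' i j - v' (i - 1) (j - 1)" for i j
  have slice: "gt_slice v = G" by (intro ext) (auto simp: gt_slice_def G_def v'_def)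
  have car: "(r, v) \<in> carrier (GT_lattice k n)" and r0: "0 \<le> r"
    and G_bounds: "\<And>i j. \<lbrakk>1 \<le> i; i \<le> k; 1 \<le> j; j \<le> n - k\<rbrakk> \<Longrightarrow> 0 \<le> G i j"
      "\<And>i j. \<lbrakk>1 \<le> i; i \<le> k; 1 \<le> j; j \<le> n - k\<rbrakk> \<Longrightarrow> G i j \<le> r"
    and G_i: "\<And>i j. \<lbrakk>i \<in> {2..k}; j \<in> {1..n - k}\<rbrakk> \<Longrightarrow> G (i - 1) j \<le> G i j"
    and G_j: "\<And>i j. \<lbrakk>i \<in> {1..k}; j \<in> {2..n - k}\<rbrakk> \<Longrightarrow> G i (j - 1) \<le> G i j"
    using rv unfolding Mon_GT_iff slice by auto
  \<comment> \<open>Layer \<open>s\<close> consists of the boxes whose difference exceeds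
    \<open>s\<close>. The inequalities of the pattern make it an up-set, which yields one rank one
    summand.\<close>
  have "\<exists>J. J \<subseteq> {1..n} \<and> int (card J) = k \<and>
      (\<forall>i j. 1 \<le> i \<and> i \<le> k \<and> 1 \<le> j \<and> j \<le> n - k \<longrightarrow>
        (nat (k - i) < card (J \<inter> {1..int (nat (k - i + j))}) \<longleftrightarrow> int s < G i j))" for s
  proof -
    obtain J where "J \<subseteq> {1..n}" "int (card J) = k" "\<And>i j. \<lbrakk>1 \<le> i; i \<le> k; 1 \<le> j; j \<le> n - k\<rbrakk> \<Longrightarrow>
       nat (k - i) < card (J \<inter> {1..int (nat (k - i + j))}) \<longleftrightarrow> int s < G i j"
    proof (rule subset_of_up_set[of "\<lambda>i j. int s < G i j"])
      show "int s < G i j" if "2 \<le> i" "i \<le> k" "1 \<le> j" "j \<le> n - k" "int s < G (i - 1) j" for i j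
        using G_i[of i j] that by simp
      show "int s < G i j" if "1 \<le> i" "i \<le> k" "2 \<le> j" "j \<le> n - k" "int s < G i (j - 1)" for i j
        using G_j[of i j] that by simp
    qed (rule that)
    then show ?thesis by blast
  qed
  then obtain J where J: "\<And>s. J s \<subseteq> {1..n}" "\<And>s. int (card (J s)) = k"
    "\<And>s i j. \<lbrakk>1 \<le> i; i \<le> k; 1 \<le> j; j \<le> n - k\<rbrakk> \<Longrightarrow>
        nat (k - i) < card (J s \<inter> {1..int (nat (k - i + j))}) \<longleftrightarrow> int s < G i j"
    by metis
  interpret D: rank_one_sum k n J "nat r"
    using J by unfold_locales
  have step: "D.L.cdi i j = D.L.cdi (i - 1) (j - 1) + G i j" if ij: "1 \<le> i" "i \<le> k" "1 \<le> j" "j \<le> n - k" for i j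
  proof -
    let ?a = "nat (k - i)" and ?v = "nat (k - i + j)"
    have e: "nat (k - (i - 1)) = Suc ?a" "k - (i - 1) + (j - 1) = k - i + j" using ij by auto
    have v: "?v \<le> nat n" using ij by simp
    \<comment> \<open>Replacing \<open>Suc a\<close> by \<open>a\<close> in a truncated difference
      gains one exactly for the \<open>s\<close> with b > a. These are the \<open>s\<close> below
      \<open>G i j\<close>, and the bound by \<open>r\<close> keeps all of them in the range of
      summation.\<close>
    have "(\<Sum>s<nat r. D.b s ?v - ?a) = (\<Sum>s<nat r. (D.b s ?v - Suc ?a) + (if int s < G i j then 1 else 0))"
      by (intro sum.cong refl) (auto simp: J(3)[OF ij, symmetric])
    also have "\<dots> = (\<Sum>s<nat r. D.b s ?v - Suc ?a) + card {s. s < nat r \<and> int s < G i j}"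
      by (simp add: sum.distrib sum.If_cases Int_def lessThan_def)
    also have "{s. s < nat r \<and> int s < G i j} = {..<nat (G i j)}"
      using G_bounds[OF ij] by auto
    finally show ?thesis
      using G_bounds[OF ij] unfolding D.L.cdi_def e D.L_cd[OF v] by simp
  qed
  \<comment> \<open>Both sides vanish on the boundary and have the same diagonal
    differences.\<close>
  have cdi: "D.L.cdi (int m) j = v' (int m) j" if "int m \<le> k" "0 \<le> j" "j \<le> n - k" for m j
    using that
  proof (induction m arbitrary: j)
    case 0
    then show ?case using D.L.cdi_boundary[of 0 j] k_pos by (simp add: v'_def)
  next
    case (Suc m)
    show ?case
    proof (cases "j = 0")
      case True
      then show ?thesis using D.L.cdi_boundary[of "int (Suc m)" j] Suc.prems by (simp add: v'_def)
    next
      case False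
      then show ?thesis
        using step[of "int (Suc m)" j] Suc.IH[of "j - 1"] Suc.prems by (simp add: G_def)
    qed
  qed
  have "v \<in> extensional (\<Gamma> k n)"
    using car by (auto simp: GT_lattice_def DirProd_def product_group_def PiE_def)
  then have "\<kappa>_vector k n D.M = v"
    unfolding D.L.\<kappa>_vector_eq
  proof (intro extensionalityI[where A = "\<Gamma> k n"])
    fix p assume p: "p \<in> \<Gamma> k n"
    obtain i j where ij: "p = (i, j)" by (cases p)
    have "1 \<le> i" "i \<le> k" "1 \<le> j" "j \<le> n - k" using p ij by (auto simp: \<Gamma>_def)
    then have "D.L.cdi i j = v (i, j)" using cdi[of "nat i" j] by (simp add: v'_def)
    then show "(\<lambda>(i, j)\<in>\<Gamma> k n. D.L.cdi i j) p = v p" using p ij by simp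
  qed auto
  then show thesis using that[OF D.M_CM] D.rk r0 by simp
qed

section \<open>The real extension of an abelian group and its functionals\<close>

definition frag_eval :: "('x \<Rightarrow> real) \<Rightarrow> ('x \<Rightarrow>\<^sub>0 int) \<Rightarrow> real" where
  "frag_eval w c = (\<Sum>p\<in>Poly_Mapping.keys c. of_int (Poly_Mapping.lookup c p) * w p)"

lemma frag_eval_superset:
  assumes "finite A" "Poly_Mapping.keys c \<subseteq> A"
  shows "frag_eval w c = (\<Sum>p\<in>A. of_int (Poly_Mapping.lookup c p) * w p)"
  unfolding frag_eval_def using assms by (intro sum.mono_neutral_left) (auto simp: in_keys_iff)

lemma frag_eval_diff: "frag_eval w (c - d) = frag_eval w c - frag_eval w d"
proof -
  let ?A = "Poly_Mapping.keys c \<union> Poly_Mapping.keys d"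
  have "frag_eval w (c - d) = (\<Sum>p\<in>?A. of_int (Poly_Mapping.lookup (c - d) p) * w p)"
    using keys_diff[of c d] by (intro frag_eval_superset) auto
  also have "\<dots> = (\<Sum>p\<in>?A. of_int (Poly_Mapping.lookup c p) * w p) - (\<Sum>p\<in>?A. of_int (Poly_Mapping.lookup d p) * w p)"
    by (simp add: lookup_minus left_diff_distrib sum_subtractf)
  also have "\<dots> = frag_eval w c - frag_eval w d"
    using frag_eval_superset[of ?A c w] frag_eval_superset[of ?A d w] by simp
  finally show ?thesis .
qed

lemma frag_eval_zero: "frag_eval w 0 = 0"
  by (simp add: frag_eval_def)

lemma frag_eval_add: "frag_eval w (c + d) = frag_eval w c + frag_eval w d"
  using frag_eval_diff[of w "c + d" d] by simp

lemma frag_eval_minus: "frag_eval w (- c) = - frag_eval w c"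
  using frag_eval_diff[of w 0 c] by (simp add: frag_eval_zero)

lemma frag_eval_of: "frag_eval w (frag_of p) = w p"
  by (simp add: frag_eval_def)

locale real_tensor_group = comm_group G for G :: "'a monoid" (structure)
begin

abbreviation "RT \<equiv> real_tensor G"
abbreviation "rels \<equiv> tensor_rels G"

lemma tensor_rels_subgroup: "subgroup rels (tensor_gens G)"
  unfolding tensor_rels_def
proof (rule group.generate_is_subgroup[OF group_free_Abelian_group], rule subsetI)
  have k: "Poly_Mapping.keys (frag_of p - frag_of q - frag_of q') \<subseteq> carrier G \<times> UNIV"
    if "p \<in> carrier G \<times> (UNIV :: real set)" "q \<in> carrier G \<times> UNIV" "q' \<in> carrier G \<times> UNIV" for p q q'
  proof -
    have "Poly_Mapping.keys (frag_of p - frag_of q - frag_of q')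
        \<subseteq> Poly_Mapping.keys (frag_of p) \<union> Poly_Mapping.keys (frag_of q) \<union> Poly_Mapping.keys (frag_of q')"
      using keys_diff[of "frag_of p - frag_of q" "frag_of q'"] keys_diff[of "frag_of p" "frag_of q"] by blast
    then show ?thesis using that by auto
  qed
  fix c assume "c \<in> {frag_of (a \<otimes> b, r) - frag_of (a, r) - frag_of (b, r) | a b (r :: real). a \<in> carrier G \<and> b \<in> carrier G} \<union>
      {frag_of (a, r + s) - frag_of (a, r) - frag_of (a, s) | a r s. a \<in> carrier G}"
  moreover have "frag_of (a \<otimes> b, r) - frag_of (a, r) - frag_of (b, r) \<in> carrier (tensor_gens G)"
    if "a \<in> carrier G" "b \<in> carrier G" for a b and r :: real
    unfolding carrier_free_Abelian_group_iff by (rule k) (use that in auto)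
  moreover have "frag_of (a, r + s) - frag_of (a, r) - frag_of (a, s) \<in> carrier (tensor_gens G)"
    if "a \<in> carrier G" for a and r s :: real
    unfolding carrier_free_Abelian_group_iff by (rule k) (use that in auto)
  ultimately show "c \<in> carrier (tensor_gens G)" by (auto simp del: carrier_free_Abelian_group_iff)
qed

lemma rels_normal: "rels \<lhd> tensor_gens G"
  by (rule comm_group.normal_iff_subgroup[OF abelian_free_Abelian_group, THEN iffD2, OF tensor_rels_subgroup])

lemma RT_comm_group: "comm_group RT"
  unfolding real_tensor_def
  by (rule comm_group.abelian_FactGroup[OF abelian_free_Abelian_group tensor_rels_subgroup])

sublocale RT: comm_group RT by (rule RT_comm_group)

abbreviation coset :: "('a \<times> real \<Rightarrow>\<^sub>0 int) \<Rightarrow> ('a \<times> real \<Rightarrow>\<^sub>0 int) set" where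
  "coset c \<equiv> rels #>\<^bsub>tensor_gens G\<^esub> c"

lemma RT_carrier: "x \<in> carrier RT \<longleftrightarrow> (\<exists>c. Poly_Mapping.keys c \<subseteq> carrier G \<times> UNIV \<and> x = coset c)"
proof
  assume "x \<in> carrier RT"
  then obtain c where "c \<in> carrier (tensor_gens G)" "x = coset c"
    by (auto simp: real_tensor_def FactGroup_def RCOSETS_def)
  then show "\<exists>c. Poly_Mapping.keys c \<subseteq> carrier G \<times> UNIV \<and> x = coset c" by (intro exI[of _ c]) simp
qed (auto simp: real_tensor_def FactGroup_def RCOSETS_def)

lemma coset_mult:
  "\<lbrakk>Poly_Mapping.keys c \<subseteq> carrier G \<times> UNIV; Poly_Mapping.keys d \<subseteq> carrier G \<times> UNIV\<rbrakk>
    \<Longrightarrow> coset c \<otimes>\<^bsub>RT\<^esub> coset d = coset (c + d)"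
  using normal.rcos_sum[OF rels_normal, of c d] by (simp add: real_tensor_def FactGroup_def)

lemma coset_zero: "coset 0 = \<one>\<^bsub>RT\<^esub>"
  using group.coset_mult_one[OF group_free_Abelian_group subgroup.subset[OF tensor_rels_subgroup]]
  by (simp add: real_tensor_def FactGroup_def)

lemma coset_eqI:
  assumes "c - d \<in> rels" "Poly_Mapping.keys d \<subseteq> carrier G \<times> UNIV"
  shows "coset d = coset c"
proof (rule group.repr_independence[OF group_free_Abelian_group _ _ tensor_rels_subgroup])
  show "c \<in> coset d" unfolding r_coset_def using assms(1) by (intro UN_I[of "c - d"]) auto
qed (use assms(2) in simp)

lemma keys_tensor: "a \<in> carrier G \<Longrightarrow> Poly_Mapping.keys (frag_of (a, r)) \<subseteq> carrier G \<times> (UNIV :: real set)"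
  by simp

lemma keys_tensor_add:
  "\<lbrakk>a \<in> carrier G; b \<in> carrier G\<rbrakk> \<Longrightarrow>
    Poly_Mapping.keys (frag_of (a, r) + frag_of (b, s)) \<subseteq> carrier G \<times> (UNIV :: real set)"
  using keys_add[of "frag_of (a, r)" "frag_of (b, s)"] by auto

lemma tensor_closed: "a \<in> carrier G \<Longrightarrow> tensor G a r \<in> carrier RT"
  unfolding RT_carrier tensor_def by (intro exI[of _ "frag_of (a, r)"]) simp

lemma tensor_mult_left:
  assumes a: "a \<in> carrier G" and b: "b \<in> carrier G"
  shows "tensor G (a \<otimes> b) r = tensor G a r \<otimes>\<^bsub>RT\<^esub> tensor G b r"
proof -
  have "frag_of (a \<otimes> b, r) - (frag_of (a, r) + frag_of (b, r)) \<in> rels"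
    unfolding tensor_rels_def diff_diff_eq[symmetric] using a b by (intro generate.incl) blast
  from coset_eqI[OF this keys_tensor_add[OF a b]]
  show ?thesis unfolding tensor_def coset_mult[OF keys_tensor[OF a] keys_tensor[OF b]] by (rule sym)
qed

lemma tensor_add_right:
  assumes a: "a \<in> carrier G"
  shows "tensor G a (r + s) = tensor G a r \<otimes>\<^bsub>RT\<^esub> tensor G a s"
proof -
  have "frag_of (a, r + s) - (frag_of (a, r) + frag_of (a, s)) \<in> rels"
    unfolding tensor_rels_def diff_diff_eq[symmetric] using a by (intro generate.incl) blast
  from coset_eqI[OF this keys_tensor_add[OF a a]]
  show ?thesis unfolding tensor_def coset_mult[OF keys_tensor[OF a] keys_tensor[OF a]] by (rule sym)
qed

definition additive :: "('a \<Rightarrow> real) \<Rightarrow> bool" where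
  "additive l \<longleftrightarrow> (\<forall>a\<in>carrier G. \<forall>b\<in>carrier G. l (a \<otimes> b) = l a + l b)"

text \<open>The real functional sending the tensor of a and r to r times \<open>l a\<close>. It is
  read off an arbitrary representative; for additive \<open>l\<close> the relations evaluate to
  zero, so the choice does not matter.\<close>

definition extend :: "('a \<Rightarrow> real) \<Rightarrow> ('a \<times> real \<Rightarrow>\<^sub>0 int) set \<Rightarrow> real" where
  "extend l X = frag_eval (\<lambda>(a, r). r * l a) (SOME c. c \<in> X)"

lemma frag_eval_rels:
  assumes l: "additive l" and c: "c \<in> rels"
  shows "frag_eval (\<lambda>(a, r). r * l a) c = 0"
proof -
  have "frag_eval (\<lambda>(a, r). r * l a) c = 0 \<and> c \<in> carrier (tensor_gens G)"
    using c unfolding tensor_rels_def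
  proof (induction rule: generate.induct)
    case one
    then show ?case by (simp add: frag_eval_zero)
  next
    case (incl h)
    then have "h \<in> rels" unfolding tensor_rels_def by (rule generate.incl)
    then have "h \<in> carrier (tensor_gens G)" using subgroup.subset[OF tensor_rels_subgroup] by blast
    moreover have "frag_eval (\<lambda>(a, r). r * l a) h = 0"
      using incl l by (auto simp: frag_eval_diff frag_eval_of additive_def distrib_left distrib_right)
    ultimately show ?case by blast
  next
    case (inv h)
    then have "h \<in> rels" unfolding tensor_rels_def by (rule generate.incl)
    then have h: "h \<in> carrier (tensor_gens G)" using subgroup.subset[OF tensor_rels_subgroup] by blast
    moreover have "frag_eval (\<lambda>(a, r). r * l a) h = 0"
      using inv l by (auto simp: frag_eval_diff frag_eval_of additive_def distrib_left distrib_right)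
    ultimately show ?case by (simp add: frag_eval_minus)
  next
    case (eng h1 h2)
    then show ?case using keys_add[of h1 h2] by (auto simp: frag_eval_add)
  qed
  then show ?thesis by blast
qed

lemma extend_coset:
  assumes l: "additive l"
  shows "extend l (coset c) = frag_eval (\<lambda>(a, r). r * l a) c"
proof -
  have "0 \<in> rels" using subgroup.one_closed[OF tensor_rels_subgroup] by simp
  then have "c \<in> coset c" unfolding r_coset_def by (intro UN_I[of 0]) auto
  then have "(SOME d. d \<in> coset c) \<in> coset c" by (rule someI)
  then obtain h where h: "h \<in> rels" "(SOME d. d \<in> coset c) = h + c" by (auto simp: r_coset_def)
  show ?thesis unfolding extend_def h(2) frag_eval_add frag_eval_rels[OF l h(1)] by simp
qed

lemma extend_tensor: "additive l \<Longrightarrow> extend l (tensor G a r) = r * l a"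
  unfolding tensor_def by (simp add: extend_coset frag_eval_of)

lemma extend_mult:
  assumes l: "additive l" and "x \<in> carrier RT" "y \<in> carrier RT"
  shows "extend l (x \<otimes>\<^bsub>RT\<^esub> y) = extend l x + extend l y"
proof -
  obtain c d where "Poly_Mapping.keys c \<subseteq> carrier G \<times> UNIV" "x = coset c"
    "Poly_Mapping.keys d \<subseteq> carrier G \<times> UNIV" "y = coset d"
    using assms(2,3) unfolding RT_carrier by blast
  then show ?thesis by (simp add: coset_mult extend_coset[OF l] frag_eval_add)
qed

lemma extend_functional: "additive l \<Longrightarrow> real_functional G (extend l)"
  unfolding real_functional_def by (simp add: extend_mult extend_tensor)

lemma extend_one: "additive l \<Longrightarrow> extend l \<one>\<^bsub>RT\<^esub> = 0"
  unfolding coset_zero[symmetric] by (simp add: extend_coset frag_eval_zero)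

lemma extend_finprod:
  assumes l: "additive l" and "finite F" "F \<subseteq> carrier G"
  shows "extend l (finprod RT (\<lambda>a. tensor G a (c a)) F) = (\<Sum>a\<in>F. c a * l a)"
  using assms(2,3)
proof (induction F)
  case (insert a F)
  have t: "(\<lambda>a. tensor G a (c a)) \<in> F \<rightarrow> carrier RT" "tensor G a (c a) \<in> carrier RT"
    using insert.prems by (auto intro: tensor_closed)
  show ?case
    unfolding RT.finprod_insert[OF insert(1,2) t] sum.insert[OF insert(1,2)]
    using insert t by (simp add: extend_mult[OF l _ RT.finprod_closed] extend_tensor[OF l])
qed (simp add: extend_one[OF l])

lemma extend_diff: "extend (\<lambda>a. l a - l' a) x = extend l x - extend l' x"
proof -
  have "(\<lambda>(a, r). r * (l a - l' a)) = (\<lambda>p. (case p of (a, r) \<Rightarrow> r * l a) - (case p of (a, r) \<Rightarrow> r * l' a))"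
    by (auto simp: right_diff_distrib)
  then show ?thesis unfolding extend_def frag_eval_def by (simp add: right_diff_distrib sum_subtractf)
qed

lemma topspace_real_tensor: "topspace (real_tensor_topology G) = carrier RT"
proof -
  have "additive (\<lambda>_. 0)" by (simp add: additive_def)
  from extend_functional[OF this] have "{x \<in> carrier RT. extend (\<lambda>_. 0) x \<in> UNIV} \<in> {{x \<in> carrier RT. \<phi> x \<in> U} |\<phi> U. real_functional G \<phi> \<and> open U}"
    by (intro CollectI exI[of _ "extend (\<lambda>_. 0)"] exI[of _ UNIV] conjI refl open_UNIV)
  from Union_upper[OF this] have "carrier RT \<subseteq> \<Union> {{x \<in> carrier RT. \<phi> x \<in> U} |\<phi> U. real_functional G \<phi> \<and> open U}"
    by simp
  moreover have "\<Union> {{x \<in> carrier RT. \<phi> x \<in> U} |\<phi> U. real_functional G \<phi> \<and> open U} \<subseteq> carrier RT" by auto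
  ultimately show ?thesis
    unfolding real_tensor_topology_def topology_generated_by_topspace by (rule equalityI[rotated])
qed

lemma openin_functional:
  assumes "additive l" "open U"
  shows "openin (real_tensor_topology G) {x \<in> carrier RT. extend l x \<in> U}"
  unfolding real_tensor_topology_def
  by (rule topology_generated_by_Basis)
    (intro CollectI exI[of _ "extend l"] exI[of _ U] conjI refl extend_functional[OF assms(1)] assms(2))

lemma nonneg_spanI:
  "\<lbrakk>finite F; F \<subseteq> S; \<And>a. a \<in> F \<Longrightarrow> 0 \<le> c a\<rbrakk>
    \<Longrightarrow> finprod RT (\<lambda>a. tensor G a (c a)) F \<in> nonneg_span G S"
  unfolding nonneg_span_def by (intro CollectI exI[of _ F] exI[of _ c] conjI refl ballI)

lemma nonneg_spanE:
  assumes "x \<in> nonneg_span G S"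
  obtains F c where "x = finprod RT (\<lambda>a. tensor G a (c a)) F" "finite F" "F \<subseteq> S" "\<forall>a\<in>F. 0 \<le> c a"
proof -
  have "\<exists>F c. x = finprod RT (\<lambda>a. tensor G a (c a)) F \<and> finite F \<and> F \<subseteq> S \<and> (\<forall>a\<in>F. 0 \<le> c a)"
    using assms unfolding nonneg_span_def by (rule CollectD)
  then show thesis using that by blast
qed

text \<open>The half space on which the functional is negative is open and misses the span, hence it
  also misses the closure.\<close>

lemma closure_nonneg:
  assumes l: "additive l" and S: "\<And>a. a \<in> S \<Longrightarrow> 0 \<le> l a" "S \<subseteq> carrier G"
    and x: "x \<in> real_tensor_topology G closure_of nonneg_span G S"
  shows "0 \<le> extend l x"
proof (rule ccontr)
  assume "\<not> 0 \<le> extend l x"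
  moreover have xc: "x \<in> carrier RT"
    using in_closure_of[THEN iffD1, OF x] unfolding topspace_real_tensor by (rule conjunct1)
  ultimately have "x \<in> {x \<in> carrier RT. extend l x \<in> {..<0}}" by simp
  moreover have "openin (real_tensor_topology G) {x \<in> carrier RT. extend l x \<in> {..<0}}"
    by (rule openin_functional[OF l open_lessThan])
  ultimately have "\<exists>y. y \<in> nonneg_span G S \<and> y \<in> {x \<in> carrier RT. extend l x \<in> {..<0}}"
    by (intro in_closure_of[THEN iffD1, OF x, THEN conjunct2, rule_format] conjI)
  then obtain y where y: "y \<in> nonneg_span G S" "extend l y < 0" by auto
  obtain F c where F: "y = finprod RT (\<lambda>a. tensor G a (c a)) F" "finite F" "F \<subseteq> S" "\<forall>a\<in>F. 0 \<le> c a"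
    by (rule nonneg_spanE[OF y(1)])
  have "F \<subseteq> carrier G" using F(3) S(2) by blast
  then have "extend l y = (\<Sum>a\<in>F. c a * l a)" unfolding F(1) by (rule extend_finprod[OF l F(2)])
  also have "\<dots> \<ge> 0" using F(3,4) S(1) by (intro sum_nonneg mult_nonneg_nonneg) auto
  finally show False using y(2) by simp
qed

lemma nonneg_span_closed: "S \<subseteq> carrier G \<Longrightarrow> nonneg_span G S \<subseteq> carrier RT"
proof
  fix x assume S: "S \<subseteq> carrier G" and "x \<in> nonneg_span G S"
  then obtain F c where F: "x = finprod RT (\<lambda>a. tensor G a (c a)) F" "F \<subseteq> S" by (elim nonneg_spanE)
  show "x \<in> carrier RT" unfolding F(1) using F(2) S tensor_closed by (intro RT.finprod_closed) auto
qed

lemma hom_eq_on_generators: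
  assumes f: "f \<in> hom G RT" and g: "g \<in> hom G RT" and I: "finite I" "\<And>e. e \<in> I \<Longrightarrow> \<beta> e \<in> carrier G"
    and eq: "\<And>e. e \<in> I \<Longrightarrow> f (\<beta> e) = g (\<beta> e)"
  shows "f (finprod G (\<lambda>e. \<beta> e [^] (m e :: int)) I) = g (finprod G (\<lambda>e. \<beta> e [^] m e) I)"
proof -
  interpret f: group_hom G RT f using f by unfold_locales
  interpret g: group_hom G RT g using g by unfold_locales
  show ?thesis
    using I eq
  proof (induction I)
    case (insert e I)
    have c: "\<beta> e [^] m e \<in> carrier G" "(\<lambda>e. \<beta> e [^] m e) \<in> I \<rightarrow> carrier G" using insert.prems by auto
    have "f (\<beta> e [^] m e) = g (\<beta> e [^] m e)"
      using insert.prems by (simp add: f.hom_int_pow g.hom_int_pow)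
    then show ?case
      unfolding finprod_insert[OF insert(1,2) c(2,1)] using insert c finprod_closed[OF c(2)] by simp
  qed simp
qed

end

text \<open>The assumptions say that \<open>\<gamma>\<close>, restricted to the finite set
  \<open>I\<close>, is an isomorphism from \<open>G\<close> onto the group of integer functions on
  \<open>I\<close>.\<close>

locale coordinate_group = real_tensor_group G for G :: "'k monoid" (structure) +
  fixes I :: "'i set" and \<gamma> :: "'k \<Rightarrow> 'i \<Rightarrow> int"
  assumes finite_I: "finite I"
    and \<gamma>_mult: "\<lbrakk>a \<in> carrier G; b \<in> carrier G; e \<in> I\<rbrakk> \<Longrightarrow> \<gamma> (a \<otimes> b) e = \<gamma> a e + \<gamma> b e"
    and \<gamma>_inj: "\<lbrakk>a \<in> carrier G; b \<in> carrier G; \<And>e. e \<in> I \<Longrightarrow> \<gamma> a e = \<gamma> b e\<rbrakk> \<Longrightarrow> a = b"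
    and \<gamma>_surj: "\<exists>a\<in>carrier G. \<forall>e\<in>I. \<gamma> a e = h e"
begin

abbreviation coord :: "'i \<Rightarrow> 'k \<Rightarrow> real" where "coord e a \<equiv> real_of_int (\<gamma> a e)"

lemma coord_additive: "e \<in> I \<Longrightarrow> additive (coord e)"
  by (simp add: additive_def \<gamma>_mult)

lemma \<gamma>_hom: "e \<in> I \<Longrightarrow> (\<lambda>a. \<gamma> a e) \<in> hom G integer_group"
  by (auto simp: hom_def \<gamma>_mult)

definition \<beta> :: "'i \<Rightarrow> 'k" where
  "\<beta> e = (SOME a. a \<in> carrier G \<and> (\<forall>e'\<in>I. \<gamma> a e' = (if e' = e then 1 else 0)))"

lemma \<beta>: "\<beta> e \<in> carrier G" "e' \<in> I \<Longrightarrow> \<gamma> (\<beta> e) e' = (if e' = e then 1 else 0)"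
proof -
  have "\<exists>a. a \<in> carrier G \<and> (\<forall>e'\<in>I. \<gamma> a e' = (if e' = e then 1 else 0))"
    using \<gamma>_surj[of "\<lambda>e'. if e' = e then 1 else 0"] by blast
  from someI_ex[OF this] show "\<beta> e \<in> carrier G" "e' \<in> I \<Longrightarrow> \<gamma> (\<beta> e) e' = (if e' = e then 1 else 0)"
    unfolding \<beta>_def by blast+
qed

lemma basis_expansion:
  assumes a: "a \<in> carrier G"
  shows "a = finprod G (\<lambda>e. \<beta> e [^] \<gamma> a e) I"
proof (rule \<gamma>_inj[OF a])
  have pow: "(\<lambda>e. \<beta> e [^] \<gamma> a e) \<in> A \<rightarrow> carrier G" for A using \<beta>(1) by auto
  then show "finprod G (\<lambda>e. \<beta> e [^] \<gamma> a e) I \<in> carrier G" by (rule finprod_closed)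
  fix e assume e: "e \<in> I"
  interpret h: group_hom G integer_group "\<lambda>a. \<gamma> a e"
    by (intro group_hom.intro group_hom_axioms.intro \<gamma>_hom[OF e] group_axioms) simp
  have "\<gamma> (finprod G (\<lambda>e. \<beta> e [^] \<gamma> a e) A) e = (\<Sum>e'\<in>A. if e' = e then \<gamma> a e' else 0)" if "finite A" for A
    using that
  proof (induction A)
    case empty
    then show ?case using h.hom_one by simp
  next
    case (insert e' A)
    have "\<gamma> (\<beta> e' [^] \<gamma> a e') e = (if e' = e then \<gamma> a e' else 0)"
      using h.hom_int_pow[OF \<beta>(1)] \<beta>(2)[OF e] by simp
    then show ?case
      unfolding finprod_insert[OF insert(1,2) pow int_pow_closed[OF \<beta>(1)]] sum.insert[OF insert(1,2)]
      using insert \<gamma>_mult[OF int_pow_closed[OF \<beta>(1)] finprod_closed[OF pow] e] by simp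
  qed
  from this[OF finite_I] show "\<gamma> a e = \<gamma> (finprod G (\<lambda>e. \<beta> e [^] \<gamma> a e) I) e"
    using e finite_I by simp
qed

definition combine :: "('i \<Rightarrow> real) \<Rightarrow> ('k \<times> real \<Rightarrow>\<^sub>0 int) set" where
  "combine c = finprod RT (\<lambda>e. tensor G (\<beta> e) (c e)) I"

lemma combine_closed: "combine c \<in> carrier RT"
  unfolding combine_def using \<beta>(1) tensor_closed by (intro RT.finprod_closed) auto

lemma combine_add: "combine (\<lambda>e. c e + d e) = combine c \<otimes>\<^bsub>RT\<^esub> combine d"
proof -
  have t: "(\<lambda>e. tensor G (\<beta> e) (c e)) \<in> I \<rightarrow> carrier RT" for c using \<beta>(1) tensor_closed by auto
  show ?thesis unfolding combine_def tensor_add_right[OF \<beta>(1)] by (rule RT.finprod_multf[OF t t])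
qed

lemma combine_zero: "combine (\<lambda>_. 0) = \<one>\<^bsub>RT\<^esub>"
proof -
  have "combine (\<lambda>_. 0) \<otimes>\<^bsub>RT\<^esub> combine (\<lambda>_. 0) = combine (\<lambda>_. 0)"
    unfolding combine_add[symmetric] by (simp only: add_0)
  then show ?thesis by (rule RT.l_cancel_one[OF combine_closed combine_closed, THEN iffD1])
qed

lemma tensor_zero:
  assumes a: "a \<in> carrier G"
  shows "tensor G a 0 = \<one>\<^bsub>RT\<^esub>"
proof -
  have "tensor G a 0 \<otimes>\<^bsub>RT\<^esub> tensor G a 0 = tensor G a 0"
    unfolding tensor_add_right[OF a, symmetric] by (simp only: add_0)
  then show ?thesis by (rule RT.l_cancel_one[OF tensor_closed[OF a] tensor_closed[OF a], THEN iffD1])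
qed

text \<open>Both sides are homomorphisms in \<open>a\<close>, so it suffices to compare them on the
  basis \<open>\<beta>\<close> dual to the coordinates.\<close>

lemma tensor_expansion:
  assumes a: "a \<in> carrier G"
  shows "tensor G a r = combine (\<lambda>e. r * coord e a)"
proof -
  have f: "(\<lambda>a. tensor G a r) \<in> hom G RT"
    using tensor_closed tensor_mult_left by (auto simp: hom_def)
  have g: "(\<lambda>a. combine (\<lambda>e. r * coord e a)) \<in> hom G RT"
  proof (rule homI)
    fix a b assume ab: "a \<in> carrier G" "b \<in> carrier G"
    have "combine (\<lambda>e. r * coord e (a \<otimes> b)) = combine (\<lambda>e. r * coord e a + r * coord e b)"
      unfolding combine_def using \<gamma>_mult[OF ab] \<beta>(1) tensor_closed
      by (intro RT.finprod_cong') (auto simp: algebra_simps)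
    then show "combine (\<lambda>e. r * coord e (a \<otimes> b)) = combine (\<lambda>e. r * coord e a) \<otimes>\<^bsub>RT\<^esub> combine (\<lambda>e. r * coord e b)"
      by (simp only: combine_add)
  qed (rule combine_closed)
  have eq: "tensor G (\<beta> e) r = combine (\<lambda>e'. r * coord e' (\<beta> e))" if e: "e \<in> I" for e
  proof -
    have "combine (\<lambda>e'. r * coord e' (\<beta> e)) = finprod RT (\<lambda>e'. if e = e' then tensor G (\<beta> e') r else \<one>\<^bsub>RT\<^esub>) I"
      unfolding combine_def using \<beta> tensor_closed by (intro RT.finprod_cong') (auto simp: tensor_zero)
    also have "\<dots> = tensor G (\<beta> e) r"
      using e finite_I \<beta>(1) tensor_closed by (intro RT.finprod_singleton) auto
    finally show ?thesis by (rule sym)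
  qed
  have "tensor G (finprod G (\<lambda>e. \<beta> e [^] \<gamma> a e) I) r
      = combine (\<lambda>e'. r * coord e' (finprod G (\<lambda>e. \<beta> e [^] \<gamma> a e) I))"
    by (rule hom_eq_on_generators[OF f g finite_I \<beta>(1) eq])
  then show ?thesis unfolding basis_expansion[OF a, symmetric] .
qed

text \<open>Pure tensors generate and both sides are additive. As a consequence the functionals
  \<open>extend (coord e)\<close> separate the points of the tensor product.\<close>

lemma real_tensor_expansion:
  assumes "x \<in> carrier RT"
  shows "x = combine (\<lambda>e. extend (coord e) x)"
proof -
  obtain c where c: "Poly_Mapping.keys c \<subseteq> carrier G \<times> UNIV" "x = coset c" using assms unfolding RT_carrier by blast
  define w where "w e = (\<lambda>(a, r :: real). r * coord e a)" for e
  have "coset c = combine (\<lambda>e. frag_eval (w e) c)"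
  proof (rule free_Abelian_group_induct[OF c(1), where P = "\<lambda>c. coset c = combine (\<lambda>e. frag_eval (w e) c)"])
    show "coset 0 = combine (\<lambda>e. frag_eval (w e) 0)" unfolding frag_eval_zero combine_zero coset_zero ..
  next
    fix c d :: "'k \<times> real \<Rightarrow>\<^sub>0 int"
    assume k: "Poly_Mapping.keys c \<subseteq> carrier G \<times> UNIV" "Poly_Mapping.keys d \<subseteq> carrier G \<times> UNIV"
      and c: "coset c = combine (\<lambda>e. frag_eval (w e) c)" and d: "coset d = combine (\<lambda>e. frag_eval (w e) d)"
    have kcd: "Poly_Mapping.keys (c - d) \<subseteq> carrier G \<times> UNIV" using keys_diff[of c d] k by blast
    have cl: "coset (c - d) \<in> carrier RT" "coset d \<in> carrier RT" unfolding RT_carrier using kcd k(2) by blast+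
    have "coset (c - d) \<otimes>\<^bsub>RT\<^esub> coset d = coset c" unfolding coset_mult[OF kcd k(2)] by simp
    also have "\<dots> = combine (\<lambda>e. frag_eval (w e) (c - d) + frag_eval (w e) d)" unfolding c by (simp add: frag_eval_diff)
    also have "\<dots> = combine (\<lambda>e. frag_eval (w e) (c - d)) \<otimes>\<^bsub>RT\<^esub> coset d" unfolding combine_add d[symmetric] ..
    finally show "coset (c - d) = combine (\<lambda>e. frag_eval (w e) (c - d))"
      by (rule RT.right_cancel[OF cl(2) cl(1) combine_closed, THEN iffD1])
  next
    fix p :: "'k \<times> real" assume "p \<in> carrier G \<times> UNIV"
    then obtain a r where p: "p = (a, r)" "a \<in> carrier G" by auto
    show "coset (frag_of p) = combine (\<lambda>e. frag_eval (w e) (frag_of p))"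
      unfolding p(1) frag_eval_of w_def case_prod_conv using tensor_expansion[OF p(2), of r] unfolding tensor_def .
  qed
  also have "\<dots> = combine (\<lambda>e. extend (coord e) x)"
    unfolding combine_def c(2) using \<beta>(1) tensor_closed
    by (intro RT.finprod_cong') (auto simp: extend_coset[OF coord_additive] w_def)
  finally show ?thesis unfolding c(2) .
qed

lemma real_tensor_eqI:
  assumes "x \<in> carrier RT" "y \<in> carrier RT" "\<And>e. e \<in> I \<Longrightarrow> extend (coord e) x = extend (coord e) y"
  shows "x = y"
proof -
  have "combine (\<lambda>e. extend (coord e) x) = combine (\<lambda>e. extend (coord e) y)"
    unfolding combine_def using assms(3) \<beta>(1) tensor_closed by (intro RT.finprod_cong') auto
  then show ?thesis using real_tensor_expansion[OF assms(1)] real_tensor_expansion[OF assms(2)] by simp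
qed

end

text \<open>Peel off the least positive value on the support, which is an up-set.\<close>

lemma layer_cake:
  fixes g :: "'p \<Rightarrow> real"
  assumes P: "finite P" and g: "\<And>p. p \<in> P \<Longrightarrow> 0 \<le> g p" "\<And>p. p \<in> P \<Longrightarrow> g p \<le> r" "0 \<le> r"
    and R: "\<And>p q. (p, q) \<in> R \<Longrightarrow> p \<in> P \<Longrightarrow> q \<in> P \<Longrightarrow> g p \<le> g q"
  shows "\<exists>c. (\<forall>U. 0 \<le> c U) \<and>
    r = (\<Sum>U\<in>{U. U \<subseteq> P \<and> (\<forall>(p, q)\<in>R. p \<in> U \<longrightarrow> q \<in> P \<longrightarrow> q \<in> U)}. c U) \<and>
    (\<forall>p\<in>P. g p = (\<Sum>U\<in>{U. U \<subseteq> P \<and> (\<forall>(p, q)\<in>R. p \<in> U \<longrightarrow> q \<in> P \<longrightarrow> q \<in> U)}. if p \<in> U then c U else 0))"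
  using g R
proof (induction "card {p \<in> P. 0 < g p}" arbitrary: g r rule: less_induct)
  case less
  let ?D = "{U. U \<subseteq> P \<and> (\<forall>(p, q)\<in>R. p \<in> U \<longrightarrow> q \<in> P \<longrightarrow> q \<in> U)}"
  have fD: "finite ?D" by (rule finite_subset[of _ "Pow P"]) (use P in auto)
  define S where "S = {p \<in> P. 0 < g p}"
  have fS: "finite S" using P by (simp add: S_def)
  have "q \<in> S" if "(p, q) \<in> R" "p \<in> S" "q \<in> P" for p q
    using less.prems(4)[of p q] that by (simp add: S_def)
  then have SD: "S \<in> ?D" by (auto simp: S_def)
  show ?case
  proof (cases "S = {}")
    case True
    have g0: "g p = 0" if p: "p \<in> P" for p using True less.prems(1)[OF p] p by (force simp: S_def)
    \<comment> \<open>The function vanishes, so the whole height \<open>r\<close> is given to the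
      empty up-set.\<close>
    have "{} \<in> ?D" by simp
    then have "r = (\<Sum>U\<in>?D. if U = {} then r else 0)" unfolding sum.delta[OF fD] by (simp only: if_True)
    moreover have "g p = (\<Sum>U\<in>?D. if p \<in> U then if U = {} then r else 0 else 0)" if "p \<in> P" for p
      unfolding g0[OF that] by (intro sum.neutral[symmetric] ballI) simp
    ultimately show ?thesis
      using less.prems(3) by (intro exI[of _ "\<lambda>U. if U = {} then r else 0"] conjI allI ballI) simp_all
  next
    case False
    define m where "m = Min (g ` S)"
    have m_in: "m \<in> g ` S" using fS False by (simp add: m_def)
    then have m0: "0 < m" and mr: "m \<le> r" using less.prems(2) by (auto simp: S_def)
    have m_le: "m \<le> g p" if "p \<in> S" for p using fS that by (simp add: m_def)
    define g' where "g' p = (if p \<in> S then g p - m else g p)" for p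
    have g_out: "g p = 0" if "p \<in> P" "p \<notin> S" for p using that less.prems(1)[of p] by (simp add: S_def)
    obtain p0 where p0: "p0 \<in> S" "g p0 = m" using m_in by auto
    \<comment> \<open>The minimum is attained at \<open>p0\<close>, which leaves the support, so the
      induction measure drops.\<close>
    have "{p \<in> P. 0 < g' p} \<subset> {p \<in> P. 0 < g p}"
    proof (rule psubsetI)
      show "{p \<in> P. 0 < g' p} \<subseteq> {p \<in> P. 0 < g p}" by (auto simp: g'_def S_def split: if_splits)
      have "p0 \<notin> {p \<in> P. 0 < g' p}" using p0 by (simp add: g'_def)
      moreover have "p0 \<in> {p \<in> P. 0 < g p}" using p0(1) by (simp add: S_def)
      ultimately show "{p \<in> P. 0 < g' p} \<noteq> {p \<in> P. 0 < g p}" by blast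
    qed
    then have cl: "card {p \<in> P. 0 < g' p} < card {p \<in> P. 0 < g p}" using P by (intro psubset_card_mono) auto
    have "\<exists>c. (\<forall>U. 0 \<le> c U) \<and> r - m = (\<Sum>U\<in>?D. c U) \<and> (\<forall>p\<in>P. g' p = (\<Sum>U\<in>?D. if p \<in> U then c U else 0))"
    proof (rule less.hyps[OF cl])
      show "0 \<le> g' p" if "p \<in> P" for p using that m_le[of p] less.prems(1)[of p] by (simp add: g'_def)
      show "g' p \<le> r - m" if "p \<in> P" for p
        using that less.prems(2)[of p] g_out[of p] mr by (simp add: g'_def)
      show "0 \<le> r - m" using mr by simp
      show "g' p \<le> g' q" if pq: "(p, q) \<in> R" "p \<in> P" "q \<in> P" for p q
      proof (cases "p \<in> S")
        case True
        then have "q \<in> S" using SD pq by auto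
        then show ?thesis using True less.prems(4)[OF pq] by (simp add: g'_def)
      next
        case False
        then show ?thesis using g_out[OF pq(2)] m_le[of q] less.prems(1)[OF pq(3)] by (simp add: g'_def)
      qed
    qed
    then obtain c where c: "\<And>U. 0 \<le> c U" "r - m = (\<Sum>U\<in>?D. c U)"
      "\<And>p. p \<in> P \<Longrightarrow> g' p = (\<Sum>U\<in>?D. if p \<in> U then c U else 0)" by blast
    define c' where "c' U = c U + (if U = S then m else 0)" for U
    have "r = (\<Sum>U\<in>?D. c' U)"
      unfolding c'_def sum.distrib using c(2) fD SD by simp
    moreover have "g p = (\<Sum>U\<in>?D. if p \<in> U then c' U else 0)" if p: "p \<in> P" for p
    proof -
      have "(\<Sum>U\<in>?D. if p \<in> U then c' U else 0)
          = (\<Sum>U\<in>?D. (if p \<in> U then c U else 0) + (if U = S then if p \<in> S then m else 0 else 0))"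
        by (intro sum.cong refl) (auto simp: c'_def)
      also have "\<dots> = g' p + (if p \<in> S then m else 0)"
        unfolding sum.distrib c(3)[OF p, symmetric] using fD SD by simp
      finally show ?thesis by (simp add: g'_def)
    qed
    moreover have "0 \<le> c' U" for U using c(1) m0 by (simp add: c'_def)
    ultimately show ?thesis by blast
  qed
qed

text \<open>The cone over an order polytope; \<open>None\<close> is the height coordinate.\<close>

locale order_cone = coordinate_group G "insert None (Some ` P)" \<gamma>
  for G :: "'k monoid" (structure) and P :: "'p set" and \<gamma> :: "'k \<Rightarrow> 'p option \<Rightarrow> int" +
  fixes R :: "('p \<times> 'p) set"
begin

lemma finite_P: "finite P"
  using finite_I by (simp add: finite_image_iff)

definition Mon :: "'k set" where
  "Mon = {a \<in> carrier G. 0 \<le> \<gamma> a None \<and> (\<forall>p\<in>P. 0 \<le> \<gamma> a (Some p) \<and> \<gamma> a (Some p) \<le> \<gamma> a None) \<and>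
     (\<forall>(p, q)\<in>R. p \<in> P \<longrightarrow> q \<in> P \<longrightarrow> \<gamma> a (Some p) \<le> \<gamma> a (Some q))}"

definition up_sets :: "'p set set" where
  "up_sets = {U. U \<subseteq> P \<and> (\<forall>(p, q)\<in>R. p \<in> U \<longrightarrow> q \<in> P \<longrightarrow> q \<in> U)}"

text \<open>A vertex of the order polytope, placed at height one: the lattice point whose
  coordinates form the indicator function of \<open>U\<close>.\<close>

definition vertex :: "'p set \<Rightarrow> 'k" where
  "vertex U = (SOME a. a \<in> carrier G \<and>
     (\<forall>e\<in>insert None (Some ` P). \<gamma> a e = (case e of None \<Rightarrow> 1 | Some p \<Rightarrow> if p \<in> U then 1 else 0)))"

lemma vertex: "vertex U \<in> carrier G" "\<gamma> (vertex U) None = 1"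
  "p \<in> P \<Longrightarrow> \<gamma> (vertex U) (Some p) = (if p \<in> U then 1 else 0)"
proof -
  have "\<exists>a. a \<in> carrier G \<and>
     (\<forall>e\<in>insert None (Some ` P). \<gamma> a e = (case e of None \<Rightarrow> 1 | Some p \<Rightarrow> if p \<in> U then 1 else 0))"
    using \<gamma>_surj[of "\<lambda>e. case e of None \<Rightarrow> 1 | Some p \<Rightarrow> if p \<in> U then 1 else 0"] by blast
  from someI_ex[OF this] show "vertex U \<in> carrier G" "\<gamma> (vertex U) None = 1"
    "p \<in> P \<Longrightarrow> \<gamma> (vertex U) (Some p) = (if p \<in> U then 1 else 0)"
    unfolding vertex_def[symmetric] by auto
qed

lemma vertex_Mon: "U \<in> up_sets \<Longrightarrow> vertex U \<in> Mon"
  by (auto simp: Mon_def up_sets_def vertex)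

lemma finite_up_sets: "finite up_sets"
  by (rule finite_subset[of _ "Pow P"]) (use finite_P in \<open>auto simp: up_sets_def\<close>)

lemma inj_vertex: "inj_on vertex up_sets"
proof (rule inj_onI)
  fix U V assume UV: "U \<in> up_sets" "V \<in> up_sets" "vertex U = vertex V"
  have "p \<in> U \<longleftrightarrow> p \<in> V" if "p \<in> P" for p
    using vertex(3)[OF that, of U] vertex(3)[OF that, of V] UV(3) by (simp split: if_splits)
  then show "U = V" using UV(1,2) by (auto simp: up_sets_def)
qed

lemma in_vertex_span:
  assumes x: "x \<in> carrier RT" and nonneg: "0 \<le> extend (coord None) x"
    and bound: "\<And>p. p \<in> P \<Longrightarrow> 0 \<le> extend (coord (Some p)) x"
      "\<And>p. p \<in> P \<Longrightarrow> extend (coord (Some p)) x \<le> extend (coord None) x"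
    and mono: "\<And>p q. \<lbrakk>(p, q) \<in> R; p \<in> P; q \<in> P\<rbrakk> \<Longrightarrow> extend (coord (Some p)) x \<le> extend (coord (Some q)) x"
  shows "x \<in> nonneg_span G (vertex ` up_sets)"
proof -
  have "\<exists>c. (\<forall>U. 0 \<le> c U) \<and> extend (coord None) x = (\<Sum>U\<in>up_sets. c U) \<and>
      (\<forall>p\<in>P. extend (coord (Some p)) x = (\<Sum>U\<in>up_sets. if p \<in> U then c U else 0))"
    unfolding up_sets_def
    by (rule layer_cake[where g = "\<lambda>p. extend (coord (Some p)) x" and r = "extend (coord None) x"
          and R = R and P = P, OF finite_P bound nonneg mono])
  then obtain c where c: "\<And>U. 0 \<le> c U" "extend (coord None) x = (\<Sum>U\<in>up_sets. c U)"
    "\<And>p. p \<in> P \<Longrightarrow> extend (coord (Some p)) x = (\<Sum>U\<in>up_sets. if p \<in> U then c U else 0)"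
    by blast
  define d where "d a = c (inv_into up_sets vertex a)" for a
  let ?F = "vertex ` up_sets"
  let ?y = "finprod RT (\<lambda>a. tensor G a (d a)) ?F"
  have F: "finite ?F" "?F \<subseteq> carrier G" using finite_up_sets vertex(1) by auto
  have sum: "(\<Sum>a\<in>?F. d a * l a) = (\<Sum>U\<in>up_sets. c U * l (vertex U))" for l
    using inv_into_f_f[OF inj_vertex] by (simp add: sum.reindex[OF inj_vertex] d_def)
  have xy: "x = ?y"
  proof (rule real_tensor_eqI[OF x])
    show "?y \<in> carrier RT" using F(2) tensor_closed by (intro RT.finprod_closed) auto
    fix e assume e: "e \<in> insert None (Some ` P)"
    have "extend (coord e) ?y = (\<Sum>U\<in>up_sets. c U * coord e (vertex U))"
      unfolding extend_finprod[OF coord_additive[OF e] F] by (rule sum)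
    also have "\<dots> = extend (coord e) x"
    proof (cases e)
      case None
      then show ?thesis using c(2) by (simp add: vertex)
    next
      case (Some p)
      then have p: "p \<in> P" using e by auto
      show ?thesis unfolding Some c(3)[OF p] by (intro sum.cong refl) (simp add: vertex(3)[OF p])
    qed
    finally show "extend (coord e) x = extend (coord e) ?y" by (rule sym)
  qed
  have "0 \<le> d a" for a using c(1) by (simp add: d_def)
  then show ?thesis unfolding xy by (intro nonneg_spanI F(1) order_refl)
qed

lemma Mon_sub: "Mon \<subseteq> carrier G"
  by (auto simp: Mon_def)

text \<open>Each inequality states that an additive functional, namely a coordinate or a difference
  of two coordinates, is nonnegative on \<open>Mon\<close>; such statements pass to the closure by
  \<open>closure_nonneg\<close>.\<close>

lemma closure_inequalities:
  assumes x: "x \<in> real_tensor_topology G closure_of nonneg_span G Mon"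
  shows "0 \<le> extend (coord None) x" "p \<in> P \<Longrightarrow> 0 \<le> extend (coord (Some p)) x"
    "p \<in> P \<Longrightarrow> extend (coord (Some p)) x \<le> extend (coord None) x"
    "\<lbrakk>(p, q) \<in> R; p \<in> P; q \<in> P\<rbrakk> \<Longrightarrow> extend (coord (Some p)) x \<le> extend (coord (Some q)) x"
proof -
  have add: "additive (\<lambda>a. coord e a - coord e' a)" "additive (coord e)"
    if "e \<in> insert None (Some ` P)" "e' \<in> insert None (Some ` P)" for e e'
    using that by (simp_all add: additive_def \<gamma>_mult)
  note cn = closure_nonneg[OF _ _ Mon_sub x]
  show "0 \<le> extend (coord None) x"
    by (rule cn[OF add(2)[of None None]]) (auto simp: Mon_def)
  show "0 \<le> extend (coord (Some p)) x" if "p \<in> P"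
    by (rule cn[OF add(2)[of "Some p" None]]) (use that in \<open>auto simp: Mon_def\<close>)
  have "0 \<le> extend (\<lambda>a. coord None a - coord (Some p) a) x" if "p \<in> P"
    by (rule cn[OF add(1)[of None "Some p"]]) (use that in \<open>auto simp: Mon_def\<close>)
  then show "extend (coord (Some p)) x \<le> extend (coord None) x" if "p \<in> P"
    using that by (simp add: extend_diff)
  have "0 \<le> extend (\<lambda>a. coord (Some q) a - coord (Some p) a) x" if "(p, q) \<in> R" "p \<in> P" "q \<in> P"
    by (rule cn[OF add(1)[of "Some q" "Some p"]]) (use that in \<open>auto simp: Mon_def\<close>)
  then show "extend (coord (Some p)) x \<le> extend (coord (Some q)) x" if "(p, q) \<in> R" "p \<in> P" "q \<in> P"
    using that by (simp add: extend_diff)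
qed

lemma nonneg_span_mono: "S \<subseteq> S' \<Longrightarrow> nonneg_span G S \<subseteq> nonneg_span G S'"
  by (auto elim!: nonneg_spanE intro!: nonneg_spanI)

text \<open>The inequalities survive the closure, and every point satisfying them is a nonnegative
  combination of the finitely many vertices. As these lie in \<open>Mon\<close>, the span was closed
  already.\<close>

lemma closure_eq: "real_tensor_topology G closure_of nonneg_span G Mon = nonneg_span G (vertex ` up_sets)"
proof
  show "real_tensor_topology G closure_of nonneg_span G Mon \<subseteq> nonneg_span G (vertex ` up_sets)"
  proof
    fix x assume x: "x \<in> real_tensor_topology G closure_of nonneg_span G Mon"
    have "x \<in> carrier RT"
      using in_closure_of[THEN iffD1, OF x] unfolding topspace_real_tensor by (rule conjunct1)
    then show "x \<in> nonneg_span G (vertex ` up_sets)"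
      by (rule in_vertex_span) (rule closure_inequalities[OF x]; assumption)+
  qed
  have "nonneg_span G (vertex ` up_sets) \<subseteq> nonneg_span G Mon"
    by (rule nonneg_span_mono) (use vertex_Mon in blast)
  also have "\<dots> \<subseteq> real_tensor_topology G closure_of nonneg_span G Mon"
    by (rule closure_of_subset) (use nonneg_span_closed[OF Mon_sub] topspace_real_tensor in blast)
  finally show "nonneg_span G (vertex ` up_sets) \<subseteq> real_tensor_topology G closure_of nonneg_span G Mon" .
qed

theorem order_cone_polyhedral:
  "rational_polyhedral_cone G (real_tensor_topology G closure_of nonneg_span G Mon)"
  unfolding rational_polyhedral_cone_def closure_eq
  using finite_up_sets vertex(1) by (intro exI[of _ "vertex ` up_sets"]) auto

text \<open>The image of \<open>a\<close> in the tensor product has the same coordinates as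
  \<open>a\<close>, so the inequalities valid on the closed cone are exactly the ones that define
  \<open>Mon\<close>.\<close>

theorem order_cone_saturated:
  "Mon = integral_points G (real_tensor_topology G closure_of nonneg_span G Mon)"
proof (intro equalityI subsetI)
  fix a assume a: "a \<in> Mon"
  then have ac: "a \<in> carrier G" using Mon_sub by blast
  have "finprod RT (\<lambda>a. tensor G a 1) {a} \<in> nonneg_span G Mon"
    using a by (intro nonneg_spanI) auto
  then have "tensor G a 1 \<in> nonneg_span G Mon"
    using tensor_closed[OF ac, of 1] by simp
  then have "tensor G a 1 \<in> real_tensor_topology G closure_of nonneg_span G Mon"
    using closure_of_subset[of "nonneg_span G Mon" "real_tensor_topology G"]
      nonneg_span_closed[OF Mon_sub] topspace_real_tensor by blast
  then show "a \<in> integral_points G (real_tensor_topology G closure_of nonneg_span G Mon)"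
    using ac by (simp add: integral_points_def)
next
  fix a assume "a \<in> integral_points G (real_tensor_topology G closure_of nonneg_span G Mon)"
  then have ac: "a \<in> carrier G" and x: "tensor G a 1 \<in> real_tensor_topology G closure_of nonneg_span G Mon"
    by (simp_all add: integral_points_def)
  have e: "extend (coord e) (tensor G a 1) = coord e a" if "e \<in> insert None (Some ` P)" for e
    by (simp add: extend_tensor[OF coord_additive[OF that]])
  have eN: "extend (coord None) (tensor G a 1) = coord None a" by (rule e) simp
  have eS: "extend (coord (Some p)) (tensor G a 1) = coord (Some p) a" if "p \<in> P" for p
    by (rule e) (use that in simp)
  have 1: "0 \<le> \<gamma> a None" using closure_inequalities(1)[OF x] by (simp add: eN)
  have 2: "0 \<le> \<gamma> a (Some p)" "\<gamma> a (Some p) \<le> \<gamma> a None" if "p \<in> P" for p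
    using closure_inequalities(2,3)[OF x that] by (simp_all add: eN eS[OF that])
  have 3: "\<gamma> a (Some p) \<le> \<gamma> a (Some q)" if "(p, q) \<in> R" "p \<in> P" "q \<in> P" for p q
    using closure_inequalities(4)[OF x that] by (simp add: eS[OF that(2)] eS[OF that(3)])
  show "a \<in> Mon" unfolding Mon_def using ac 1 2 3 by blast
qed

end

text \<open>Evaluation will embed Hom(T,M) in a free module merely as a submodule. Induction on
  \<open>S\<close>: the elements with vanishing coordinate \<open>i\<close> are free by hypothesis,
  and the projection to the coordinate \<open>i\<close> is zero or generated by a power of t, so it
  splits off.\<close>

lemma submodule_free:
  fixes L :: "('i \<Rightarrow> complex fps) set"
  assumes "finite S" "R_submodule L" "L \<subseteq> supported_on S"
  shows "\<exists>S' \<eta>. S' \<subseteq> S \<and> bij_betw \<eta> L (supported_on S' :: ('i \<Rightarrow> complex fps) set) \<and>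
    (\<forall>f\<in>L. \<forall>g\<in>L. \<eta> (f + g) = \<eta> f + \<eta> g) \<and> (\<forall>r. \<forall>f\<in>L. \<eta> (rscale r f) = rscale r (\<eta> f))"
  using assms
proof (induction S arbitrary: L)
  case empty
  have s: "supported_on {} = {0 :: 'i \<Rightarrow> complex fps}" by (auto simp: supported_on_def fun_eq_iff)
  have "0 \<in> L" using empty.prems(1) by (simp add: R_submodule_def)
  then have "L = supported_on {}" using empty.prems(2) unfolding s by blast
  then show ?case by (intro exI[of _ "{}"] exI[of _ "\<lambda>f. f"]) (simp add: bij_betw_def)
next
  case (insert i S)
  have L: "0 \<in> L" "\<And>f g. \<lbrakk>f \<in> L; g \<in> L\<rbrakk> \<Longrightarrow> f + g \<in> L" "\<And>r f. f \<in> L \<Longrightarrow> rscale r f \<in> L"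
    using insert.prems(1) by (simp_all add: R_submodule_def)
  define L0 where "L0 = {f \<in> L. f i = 0}"
  have L0: "R_submodule L0"
    unfolding R_submodule_def L0_def by (auto simp: L rscale_def) (use L(3) in \<open>simp add: rscale_def\<close>)
  have "L0 \<subseteq> supported_on S" using insert.prems(2) by (auto simp: L0_def supported_on_def)
  then obtain S0 \<eta>0 where S0: "S0 \<subseteq> S" and b0: "bij_betw \<eta>0 L0 (supported_on S0 :: ('i \<Rightarrow> complex fps) set)"
    and add0: "\<And>f g. \<lbrakk>f \<in> L0; g \<in> L0\<rbrakk> \<Longrightarrow> \<eta>0 (f + g) = \<eta>0 f + \<eta>0 g"
    and sc0: "\<And>r f. f \<in> L0 \<Longrightarrow> \<eta>0 (rscale r f) = rscale r (\<eta>0 f)"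
    using insert.IH[OF L0] by blast
  show ?case
  proof (cases "\<forall>f\<in>L. f i = 0")
    case True
    then have eq: "L0 = L" by (auto simp: L0_def)
    show ?thesis
      by (intro exI[of _ S0] exI[of _ \<eta>0] conjI ballI allI subset_insertI2[OF S0] b0[unfolded eq]
          add0[unfolded eq] sc0[unfolded eq])
  next
    case False
    then obtain f1 j1 where f1: "f1 \<in> L" "fps_nth (f1 i) j1 \<noteq> 0" by (metis fps_nonzero_nth)
    \<comment> \<open>The least order of the coordinate \<open>i\<close> on \<open>L\<close>. An
      element attaining it generates, after division by a unit, the projection of \<open>L\<close>
      to that coordinate.\<close>
    define d where "d = (LEAST d. \<exists>f\<in>L. fps_nth (f i) d \<noteq> 0)"
    have "\<exists>f\<in>L. fps_nth (f i) j1 \<noteq> 0" using f1 by blast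
    then have "\<exists>f\<in>L. fps_nth (f i) d \<noteq> 0" unfolding d_def by (rule LeastI)
    then obtain g0 where g0: "g0 \<in> L" "fps_nth (g0 i) d \<noteq> 0" by blast
    have low: "fps_nth (f i) j = 0" if "f \<in> L" "j < d" for f j
      using not_less_Least[OF that(2)[unfolded d_def]] that(1) by blast
    define q where "q f = fps_shift d (f i)" for f :: "'i \<Rightarrow> complex fps"
    have q: "f i = fps_X ^ d * q f" if "f \<in> L" for f
      unfolding q_def using low[OF that] by (rule fps_factor_X_power)
    have q_eq: "q f = h" if "f \<in> L" "f i = fps_X ^ d * h" for f h
      using q[OF that(1)] that(2) by simp
    define g where "g = rscale (inverse (q g0)) g0"
    have gL: "g \<in> L" unfolding g_def by (rule L(3)[OF g0(1)])
    have "fps_nth (q g0) 0 \<noteq> 0" using g0(2) by (simp add: q_def)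
    then have gi: "g i = fps_X ^ d"
      using fps_unit_mult[of "q g0"] q[OF g0(1)] by (simp add: g_def rscale_def mult.left_commute[of "inverse _"])
    \<comment> \<open>Subtracting the multiple of \<open>g\<close> with the same coordinate
      \<open>i\<close> splits \<open>L\<close> into \<open>L0\<close> and the free module on
      \<open>g\<close>.\<close>
    define \<pi> where "\<pi> f = f + rscale (- q f) g" for f
    have \<pi>: "\<pi> f \<in> L0" if f: "f \<in> L" for f
    proof -
      have "\<pi> f \<in> L" unfolding \<pi>_def by (intro L(2) L(3) f gL)
      moreover have "\<pi> f i = 0" using q[OF f] by (simp add: \<pi>_def rscale_def gi mult.commute)
      ultimately show ?thesis by (simp add: L0_def)
    qed
    have q_add: "q (f + f') = q f + q f'" if "f \<in> L" "f' \<in> L" for f f'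
      using q[OF that(1)] q[OF that(2)] L(2)[OF that] by (intro q_eq) (simp_all add: distrib_left)
    have q_sc: "q (rscale r f) = r * q f" if "f \<in> L" for r f
      using q[OF that] L(3)[OF that] by (intro q_eq) (simp_all add: rscale_def mult.left_commute)
    have iS0: "i \<notin> S0" using S0 insert.hyps by blast
    have \<eta>0_i: "\<eta>0 f i = 0" if "f \<in> L0" for f
      using b0 that iS0 by (auto simp: bij_betw_def supported_on_def)
    define \<eta> where "\<eta> f = (\<eta>0 (\<pi> f))(i := q f)" for f
    have inj: "inj_on \<eta> L"
    proof (rule inj_onI)
      fix f f' assume f: "f \<in> L" "f' \<in> L" "\<eta> f = \<eta> f'"
      have "q f = q f'" using fun_cong[OF f(3), of i] by (simp add: \<eta>_def)
      moreover have "\<eta>0 (\<pi> f) = \<eta>0 (\<pi> f')"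
      proof
        fix j
        show "\<eta>0 (\<pi> f) j = \<eta>0 (\<pi> f') j"
          using fun_cong[OF f(3), of j] \<eta>0_i[OF \<pi>[OF f(1)]] \<eta>0_i[OF \<pi>[OF f(2)]]
          by (cases "j = i") (simp_all add: \<eta>_def)
      qed
      then have "\<pi> f = \<pi> f'" using b0 \<pi>[OF f(1)] \<pi>[OF f(2)] unfolding bij_betw_def by (meson inj_onD)
      ultimately show "f = f'" by (simp add: \<pi>_def)
    qed
    have im: "\<eta> ` L = supported_on (insert i S0)"
    proof (intro equalityI subsetI)
      fix h assume "h \<in> \<eta> ` L"
      then obtain f where f: "f \<in> L" "h = \<eta> f" by blast
      have "\<eta>0 (\<pi> f) \<in> supported_on S0" using b0 \<pi>[OF f(1)] by (auto simp: bij_betw_def)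
      then show "h \<in> supported_on (insert i S0)" unfolding f(2) by (simp add: \<eta>_def supported_on_def)
    next
      fix h :: "'i \<Rightarrow> complex fps" assume h: "h \<in> supported_on (insert i S0)"
      then have "h(i := 0) \<in> supported_on S0" by (simp add: supported_on_def)
      then obtain l where l: "l \<in> L0" "h(i := 0) = \<eta>0 l" using b0 unfolding bij_betw_def by blast
      have lL: "l \<in> L" and li: "l i = 0" using l(1) by (simp_all add: L0_def)
      let ?f = "l + rscale (h i) g"
      have f: "?f \<in> L" by (intro L(2) L(3) lL gL)
      have qf: "q ?f = h i" by (rule q_eq[OF f]) (simp add: li rscale_def gi mult.commute)
      have "\<pi> ?f = l" unfolding \<pi>_def qf by (auto simp: rscale_def fun_eq_iff)
      then have "\<eta> ?f = h" unfolding \<eta>_def qf l(2)[symmetric] using l(2)[symmetric] by simp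
      then show "h \<in> \<eta> ` L" using imageI[OF f, of \<eta>] by (simp only:)
    qed
    have add: "\<eta> (f + f') = \<eta> f + \<eta> f'" if "f \<in> L" "f' \<in> L" for f f'
    proof -
      have "\<pi> (f + f') = \<pi> f + \<pi> f'"
        unfolding \<pi>_def q_add[OF that] by (rule ext) (simp add: rscale_def algebra_simps)
      then have e: "\<eta>0 (\<pi> (f + f')) = \<eta>0 (\<pi> f) + \<eta>0 (\<pi> f')"
        using add0[OF \<pi>[OF that(1)] \<pi>[OF that(2)]] by (simp only:)
      show ?thesis unfolding \<eta>_def e q_add[OF that] by (rule ext) simp
    qed
    have sc: "\<eta> (rscale r f) = rscale r (\<eta> f)" if "f \<in> L" for r f
    proof -
      have "\<pi> (rscale r f) = rscale r (\<pi> f)"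
        unfolding \<pi>_def q_sc[OF that] by (rule ext) (simp add: rscale_def algebra_simps)
      then have e: "\<eta>0 (\<pi> (rscale r f)) = rscale r (\<eta>0 (\<pi> f))"
        using sc0[OF \<pi>[OF that], of r] by (simp only:)
      show ?thesis unfolding \<eta>_def e q_sc[OF that] by (rule ext) (simp add: rscale_def)
    qed
    show ?thesis
      by (intro exI[of _ "insert i S0"] exI[of _ \<eta>] conjI ballI allI insert_mono[OF S0]
          bij_betw_imageI[OF inj im] add sc)
  qed
qed

section \<open>Modules of homomorphisms over the endomorphism algebra\<close>

locale hom_pair = C_algebra k n + T: C_module k n T + M: C_module k n M
  for k n :: int and T :: "(path_elts set, 't) module" and M :: "(path_elts set, 'm) module"
begin

lemma Hom_eqI: "\<lbrakk>f \<in> Hom C T M; g \<in> Hom C T M; \<And>m. m \<in> carrier T \<Longrightarrow> f m = g m\<rbrakk> \<Longrightarrow> f = g"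
  by (rule extensionalityI[OF HomD(4) HomD(4)])

lemma Hom_add:
  assumes f: "f \<in> Hom C T M" and g: "g \<in> Hom C T M"
  shows "(\<lambda>m\<in>carrier T. f m \<oplus>\<^bsub>M\<^esub> g m) \<in> Hom C T M"
  using HomD(1)[OF f] HomD(1)[OF g]
  by (intro HomI) (simp_all add: HomD(2,3)[OF f] HomD(2,3)[OF g] M.M.M.a_ac M.M.smult_r_distr T.M.smult_closed)

lemma Hom_zero: "(\<lambda>m\<in>carrier T. \<zero>\<^bsub>M\<^esub>) \<in> Hom C T M"
  by (intro HomI) (simp_all add: T.M.smult_closed)

text \<open>The scalar acts by a central element, which keeps the map linear over
  \<open>C\<close>.\<close>

lemma Hom_scalar:
  assumes f: "f \<in> Hom C T M"
  shows "(\<lambda>m\<in>carrier T. f (C.\<rho> r \<odot>\<^bsub>T\<^esub> m)) \<in> Hom C T M"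
proof (rule HomI)
  fix a m assume a: "a \<in> carrier C" and m: "m \<in> carrier T"
  have "f (C.\<rho> r \<odot>\<^bsub>T\<^esub> (a \<odot>\<^bsub>T\<^esub> m)) = f (a \<odot>\<^bsub>T\<^esub> (C.\<rho> r \<odot>\<^bsub>T\<^esub> m))" by (simp only: T.\<rho>_act_commute[OF a m])
  also have "\<dots> = a \<odot>\<^bsub>M\<^esub> f (C.\<rho> r \<odot>\<^bsub>T\<^esub> m)" using a m by (intro HomD(3)[OF f]) (simp_all add: T.M.smult_closed)
  finally show "(\<lambda>m\<in>carrier T. f (C.\<rho> r \<odot>\<^bsub>T\<^esub> m)) (a \<odot>\<^bsub>T\<^esub> m) = a \<odot>\<^bsub>M\<^esub> (\<lambda>m\<in>carrier T. f (C.\<rho> r \<odot>\<^bsub>T\<^esub> m)) m"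
    using a m by (simp add: T.M.smult_closed)
qed (use HomD(1)[OF f] in \<open>simp_all add: T.M.smult_closed T.M.smult_r_distr HomD(2)[OF f]\<close>)

lemma Hom_comp:
  assumes a: "a \<in> Hom C T T" and f: "f \<in> Hom C T M"
  shows "compose (carrier T) f a \<in> Hom C T M"
  using HomD(1)[OF a] HomD(1)[OF f]
  by (intro HomI) (simp_all add: compose_def HomD(2,3)[OF a] HomD(2,3)[OF f] T.M.smult_closed)

lemma Hom_abelian_group:
  assumes P: "carrier P = Hom C T M" "\<And>f g. f \<oplus>\<^bsub>P\<^esub> g = (\<lambda>m\<in>carrier T. f m \<oplus>\<^bsub>M\<^esub> g m)"
    "\<zero>\<^bsub>P\<^esub> = (\<lambda>m\<in>carrier T. \<zero>\<^bsub>M\<^esub>)"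
  shows "abelian_group P"
proof (rule abelian_groupI, unfold P)
  fix f assume f: "f \<in> Hom C T M"
  have fc: "m \<in> carrier T \<Longrightarrow> f m \<in> carrier M" for m by (rule HomD(1)[OF f])
  show "(\<lambda>m\<in>carrier T. (\<lambda>m\<in>carrier T. \<zero>\<^bsub>M\<^esub>) m \<oplus>\<^bsub>M\<^esub> f m) = f"
    by (rule Hom_eqI[OF Hom_add[OF Hom_zero f] f]) (simp add: fc)
  let ?g = "\<lambda>m\<in>carrier T. f (C.\<rho> (- 1) \<odot>\<^bsub>T\<^esub> m)"
  have "(\<lambda>m\<in>carrier T. ?g m \<oplus>\<^bsub>M\<^esub> f m) = (\<lambda>m\<in>carrier T. \<zero>\<^bsub>M\<^esub>)"
    by (intro restrict_ext) (simp add: HomD(3)[OF f] fc M.neg_act')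
  then show "\<exists>g\<in>Hom C T M. (\<lambda>m\<in>carrier T. g m \<oplus>\<^bsub>M\<^esub> f m) = (\<lambda>m\<in>carrier T. \<zero>\<^bsub>M\<^esub>)"
    using Hom_scalar[OF f, of "- 1"] by blast
  fix g assume g: "g \<in> Hom C T M"
  have gc: "m \<in> carrier T \<Longrightarrow> g m \<in> carrier M" for m by (rule HomD(1)[OF g])
  show "(\<lambda>m\<in>carrier T. f m \<oplus>\<^bsub>M\<^esub> g m) \<in> Hom C T M" by (rule Hom_add[OF f g])
  show "(\<lambda>m\<in>carrier T. f m \<oplus>\<^bsub>M\<^esub> g m) = (\<lambda>m\<in>carrier T. g m \<oplus>\<^bsub>M\<^esub> f m)"
    by (intro restrict_ext) (simp add: fc gc M.M.M.a_comm)
  fix h assume h: "h \<in> Hom C T M"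
  have hc: "m \<in> carrier T \<Longrightarrow> h m \<in> carrier M" for m by (rule HomD(1)[OF h])
  show "(\<lambda>m\<in>carrier T. (\<lambda>m\<in>carrier T. f m \<oplus>\<^bsub>M\<^esub> g m) m \<oplus>\<^bsub>M\<^esub> h m)
      = (\<lambda>m\<in>carrier T. f m \<oplus>\<^bsub>M\<^esub> (\<lambda>m\<in>carrier T. g m \<oplus>\<^bsub>M\<^esub> h m) m)"
    by (intro restrict_ext) (simp add: fc gc hc M.M.M.a_assoc)
qed (rule Hom_zero)

end

lemma End_op_simps:
  "carrier (End_op \<Lambda> T) = Hom \<Lambda> T T" "f \<otimes>\<^bsub>End_op \<Lambda> T\<^esub> g = compose (carrier T) g f"
  "\<one>\<^bsub>End_op \<Lambda> T\<^esub> = (\<lambda>x\<in>carrier T. x)" "\<zero>\<^bsub>End_op \<Lambda> T\<^esub> = (\<lambda>m\<in>carrier T. \<zero>\<^bsub>T\<^esub>)"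
  "f \<oplus>\<^bsub>End_op \<Lambda> T\<^esub> g = (\<lambda>m\<in>carrier T. f m \<oplus>\<^bsub>T\<^esub> g m)"
  "r \<odot>\<^bsub>End_op \<Lambda> T\<^esub> f = (\<lambda>m\<in>carrier T. scalar_act \<Lambda> T r (f m))"
  by (simp_all add: End_op_def Hom_module_def)

lemma Hom_from_simps:
  "carrier (Hom_from \<Lambda> T M) = Hom \<Lambda> T M" "\<zero>\<^bsub>Hom_from \<Lambda> T M\<^esub> = (\<lambda>m\<in>carrier T. \<zero>\<^bsub>M\<^esub>)"
  "f \<oplus>\<^bsub>Hom_from \<Lambda> T M\<^esub> g = (\<lambda>m\<in>carrier T. f m \<oplus>\<^bsub>M\<^esub> g m)"
  "a \<odot>\<^bsub>Hom_from \<Lambda> T M\<^esub> f = compose (carrier T) f a"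
  by (simp_all add: Hom_from_def Hom_module_def)

lemma (in C_algebra) End_op_ring:
  fixes T :: "(path_elts set, 't) module"
  assumes "left_module C T"
  shows "ring (End_op C T)"
proof -
  interpret T: hom_pair k n T T
    using assms by (intro hom_pair.intro C_module.intro C_algebra_axioms)
  have one: "(\<lambda>x\<in>carrier T. x) \<in> Hom C T T" by (intro HomI) (simp_all add: T.T.M.smult_closed)
  show ?thesis
  proof (rule ringI)
    show "abelian_group (End_op C T)" by (rule T.Hom_abelian_group) (simp_all add: End_op_simps)
    show "monoid (End_op C T)"
    proof (rule monoidI, unfold End_op_simps)
      fix f assume f: "f \<in> Hom C T T"
      show "compose (carrier T) f (\<lambda>x\<in>carrier T. x) = f"
        by (rule T.Hom_eqI[OF T.Hom_comp[OF one f] f]) (simp add: compose_def)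
      show "compose (carrier T) (\<lambda>x\<in>carrier T. x) f = f"
        by (rule T.Hom_eqI[OF T.Hom_comp[OF f one] f]) (simp add: compose_def HomD(1)[OF f])
      fix g assume g: "g \<in> Hom C T T"
      show "compose (carrier T) g f \<in> Hom C T T" by (rule T.Hom_comp[OF f g])
      fix h assume h: "h \<in> Hom C T T"
      show "compose (carrier T) h (compose (carrier T) g f) = compose (carrier T) (compose (carrier T) h g) f"
        unfolding compose_def by (intro restrict_ext) (simp add: HomD(1)[OF f])
    qed (rule one)
    fix f g h assume fgh: "f \<in> carrier (End_op C T)" "g \<in> carrier (End_op C T)" "h \<in> carrier (End_op C T)"
    then have f: "f \<in> Hom C T T" and g: "g \<in> Hom C T T" and h: "h \<in> Hom C T T" by (simp_all add: End_op_simps)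
    show "(f \<oplus>\<^bsub>End_op C T\<^esub> g) \<otimes>\<^bsub>End_op C T\<^esub> h = f \<otimes>\<^bsub>End_op C T\<^esub> h \<oplus>\<^bsub>End_op C T\<^esub> g \<otimes>\<^bsub>End_op C T\<^esub> h"
      unfolding End_op_simps compose_def
      by (intro restrict_ext) (simp add: HomD(1)[OF f] HomD(1)[OF g] HomD(2)[OF h])
    show "h \<otimes>\<^bsub>End_op C T\<^esub> (f \<oplus>\<^bsub>End_op C T\<^esub> g) = h \<otimes>\<^bsub>End_op C T\<^esub> f \<oplus>\<^bsub>End_op C T\<^esub> h \<otimes>\<^bsub>End_op C T\<^esub> g"
      unfolding End_op_simps compose_def by (intro restrict_ext) (simp add: HomD(1)[OF h])
  qed
qed

text \<open>Precomposition reverses the order of composition, which matches the opposite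
  multiplication of \<open>End_op\<close>.\<close>

lemma (in hom_pair) Hom_from_left_module: "left_module (End_op C T) (Hom_from C T M)"
proof (intro left_module.intro left_module_axioms.intro)
  show "ring (End_op C T)" by (rule End_op_ring[OF T.M.left_module_axioms])
  show "abelian_group (Hom_from C T M)" by (rule Hom_abelian_group) (simp_all add: Hom_from_simps)
next
  fix a f assume "a \<in> carrier (End_op C T)" "f \<in> carrier (Hom_from C T M)"
  then have a: "a \<in> Hom C T T" and f: "f \<in> Hom C T M" by (simp_all add: End_op_simps Hom_from_simps)
  show "a \<odot>\<^bsub>Hom_from C T M\<^esub> f \<in> carrier (Hom_from C T M)" unfolding Hom_from_simps by (rule Hom_comp[OF a f])
  { fix g assume "g \<in> carrier (Hom_from C T M)"
    show "a \<odot>\<^bsub>Hom_from C T M\<^esub> (f \<oplus>\<^bsub>Hom_from C T M\<^esub> g)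
        = a \<odot>\<^bsub>Hom_from C T M\<^esub> f \<oplus>\<^bsub>Hom_from C T M\<^esub> a \<odot>\<^bsub>Hom_from C T M\<^esub> g"
      unfolding Hom_from_simps compose_def by (intro restrict_ext) (simp add: HomD(1)[OF a]) }
  { fix b assume "b \<in> carrier (End_op C T)"
    then have b: "b \<in> Hom C T T" by (simp add: End_op_simps)
    show "(a \<oplus>\<^bsub>End_op C T\<^esub> b) \<odot>\<^bsub>Hom_from C T M\<^esub> f
        = a \<odot>\<^bsub>Hom_from C T M\<^esub> f \<oplus>\<^bsub>Hom_from C T M\<^esub> b \<odot>\<^bsub>Hom_from C T M\<^esub> f"
      unfolding Hom_from_simps End_op_simps compose_def
      by (intro restrict_ext) (simp add: HomD(1)[OF a] HomD(1)[OF b] HomD(2)[OF f])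
    show "(a \<otimes>\<^bsub>End_op C T\<^esub> b) \<odot>\<^bsub>Hom_from C T M\<^esub> f = a \<odot>\<^bsub>Hom_from C T M\<^esub> (b \<odot>\<^bsub>Hom_from C T M\<^esub> f)"
      unfolding Hom_from_simps End_op_simps compose_def by (intro restrict_ext) (simp add: HomD(1)[OF a]) }
next
  fix f assume "f \<in> carrier (Hom_from C T M)"
  then have f: "f \<in> Hom C T M" by (simp add: Hom_from_simps)
  have one: "(\<lambda>x\<in>carrier T. x) \<in> Hom C T T" by (intro HomI) (simp_all add: T.M.smult_closed)
  show "\<one>\<^bsub>End_op C T\<^esub> \<odot>\<^bsub>Hom_from C T M\<^esub> f = f"
    unfolding Hom_from_simps End_op_simps
    by (rule Hom_eqI[OF Hom_comp[OF one f] f]) (simp add: compose_def)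
qed

lemma (in hom_pair) Hom_from_scalar:
  assumes f: "f \<in> Hom C T M"
  shows "scalar_act (End_op C T) (Hom_from C T M) r f = (\<lambda>m\<in>carrier T. C.\<rho> r \<odot>\<^bsub>M\<^esub> f m)"
  unfolding scalar_act_def[of "End_op C T"] Hom_from_simps End_op_simps compose_def
  by (intro restrict_ext) (simp add: T.scalar_act_\<rho> HomD(3)[OF f])

lemma (in hom_pair) scalar_End: "r \<odot>\<^bsub>End_op C T\<^esub> \<one>\<^bsub>End_op C T\<^esub> \<in> carrier (End_op C T)"
proof -
  interpret TT: hom_pair k n T T
    by (intro hom_pair.intro C_algebra_axioms T.C_module_axioms)
  have "(\<lambda>x\<in>carrier T. x) \<in> Hom C T T" by (intro HomI) (simp_all add: T.M.smult_closed)
  from TT.Hom_scalar[OF this, of r]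
  have "(\<lambda>m\<in>carrier T. C.\<rho> r \<odot>\<^bsub>T\<^esub> m) \<in> Hom C T T"
    by (rule subst[where P = "\<lambda>h. h \<in> Hom C T T", rotated]) (intro restrict_ext, simp add: T.M.smult_closed)
  then show ?thesis
    unfolding End_op_simps by (simp add: T.scalar_act_\<rho> cong: restrict_cong)
qed

text \<open>Classes in \<open>K_CM\<close> are formed from modules on the type \<open>univ\<close>.
  The structure of \<open>X\<close> is transported there along the coordinates
  \<open>h\<close>.\<close>

lemma CM_fr_transport:
  fixes X :: "('a, 'x) module" and h :: "'x \<Rightarrow> nat \<Rightarrow> complex fps" and \<Lambda> :: "(complex fps, 'a) module"
  assumes X: "left_module \<Lambda> X" and S: "finite S" and bij: "bij_betw h (carrier X) (supported_on S)"
    and add: "\<And>x y. \<lbrakk>x \<in> carrier X; y \<in> carrier X\<rbrakk> \<Longrightarrow> h (x \<oplus>\<^bsub>X\<^esub> y) = h x + h y"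
    and scalar: "\<And>r x. x \<in> carrier X \<Longrightarrow> h (scalar_act \<Lambda> X r x) = rscale r (h x)"
  shows "\<exists>N :: ('a, univ) module. CM_fr \<Lambda> N \<and> isomorphic_modules \<Lambda> X N"
proof -
  interpret X: left_module \<Lambda> X by (rule X)
  let ?U = "supported_on S :: univ set"
  define u where "u = inv_into (carrier X) h"
  have u: "u f \<in> carrier X" "h (u f) = f" if "f \<in> ?U" for f
    using bij that by (auto simp: u_def bij_betw_def inv_into_into f_inv_into_f)
  have hu: "u (h x) = x" "h x \<in> ?U" if "x \<in> carrier X" for x
    using bij that by (auto simp: u_def bij_betw_def)
  have U: "0 \<in> ?U" "\<And>f g. \<lbrakk>f \<in> ?U; g \<in> ?U\<rbrakk> \<Longrightarrow> f + g \<in> ?U" "\<And>r f. f \<in> ?U \<Longrightarrow> rscale r f \<in> ?U"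
    using R_submodule_supported_on[of S] by (simp_all add: R_submodule_def)
  have u_add: "u (f + g) = u f \<oplus>\<^bsub>X\<^esub> u g" if "f \<in> ?U" "g \<in> ?U" for f g
    using hu(1)[of "u f \<oplus>\<^bsub>X\<^esub> u g"] add[OF u(1)[OF that(1)] u(1)[OF that(2)]] u[OF that(1)] u[OF that(2)] by simp
  define N :: "('a, univ) module" where "N = \<lparr>carrier = ?U, monoid.mult = undefined, one = undefined,
     ring.zero = 0, add = (+), smult = (\<lambda>a f. h (a \<odot>\<^bsub>X\<^esub> u f))\<rparr>"
  have N: "carrier N = ?U" "\<zero>\<^bsub>N\<^esub> = 0" "f \<oplus>\<^bsub>N\<^esub> g = f + g" "a \<odot>\<^bsub>N\<^esub> f = h (a \<odot>\<^bsub>X\<^esub> u f)" for f g a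
    by (simp_all add: N_def)
  have LN: "left_module \<Lambda> N"
  proof (intro left_module.intro left_module_axioms.intro, unfold N)
    show "ring \<Lambda>" by (rule X.ring_axioms)
    show "abelian_group N"
    proof (rule abelian_groupI, unfold N)
      fix f assume f: "f \<in> ?U"
      have "rscale (- 1) f + f = 0" by (simp add: rscale_def fun_eq_iff)
      then show "\<exists>g\<in>?U. g + f = 0" using U(3)[OF f] by blast
    qed (use U in \<open>simp_all add: add_ac\<close>)
    fix a f assume a: "a \<in> carrier \<Lambda>" and f: "f \<in> ?U"
    note au = X.smult_closed[OF a u(1)[OF f]]
    show "h (a \<odot>\<^bsub>X\<^esub> u f) \<in> ?U" by (rule hu(2)[OF au])
    show "h (a \<odot>\<^bsub>X\<^esub> u (f + g)) = h (a \<odot>\<^bsub>X\<^esub> u f) + h (a \<odot>\<^bsub>X\<^esub> u g)" if g: "g \<in> ?U" for g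
      unfolding u_add[OF f g] X.smult_r_distr[OF a u(1)[OF f] u(1)[OF g]]
      by (rule add[OF au X.smult_closed[OF a u(1)[OF g]]])
    fix b assume b: "b \<in> carrier \<Lambda>"
    note bu = X.smult_closed[OF b u(1)[OF f]]
    show "h ((a \<oplus>\<^bsub>\<Lambda>\<^esub> b) \<odot>\<^bsub>X\<^esub> u f) = h (a \<odot>\<^bsub>X\<^esub> u f) + h (b \<odot>\<^bsub>X\<^esub> u f)"
      unfolding X.smult_l_distr[OF a b u(1)[OF f]] by (rule add[OF au bu])
    show "h ((a \<otimes>\<^bsub>\<Lambda>\<^esub> b) \<odot>\<^bsub>X\<^esub> u f) = h (a \<odot>\<^bsub>X\<^esub> u (h (b \<odot>\<^bsub>X\<^esub> u f)))"
      unfolding X.smult_assoc[OF a b u(1)[OF f]] hu(1)[OF bu] ..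
  next
    fix f assume f: "f \<in> ?U"
    show "h (\<one>\<^bsub>\<Lambda>\<^esub> \<odot>\<^bsub>X\<^esub> u f) = f" unfolding X.smult_one[OF u(1)[OF f]] by (rule u(2)[OF f])
  qed
  have RN: "carrier (restrict_scalars \<Lambda> N) = ?U" "\<zero>\<^bsub>restrict_scalars \<Lambda> N\<^esub> = 0"
    "f \<oplus>\<^bsub>restrict_scalars \<Lambda> N\<^esub> g = f + g" for f g
    by (simp_all add: restrict_scalars_def N)
  have RN_smult: "r \<odot>\<^bsub>restrict_scalars \<Lambda> N\<^esub> f = rscale r f" if f: "f \<in> ?U" for r f
    using scalar[OF u(1)[OF f], of r] u(2)[OF f] by (simp add: restrict_scalars_def scalar_act_def N)
  have "Module.module class_ring (restrict_scalars \<Lambda> N)"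
  proof (rule module_criteria)
    show "cring (class_ring :: complex fps ring)" by (rule cring_fps)
    show "\<forall>v\<in>carrier (restrict_scalars \<Lambda> N). \<exists>w\<in>carrier (restrict_scalars \<Lambda> N).
        v \<oplus>\<^bsub>restrict_scalars \<Lambda> N\<^esub> w = \<zero>\<^bsub>restrict_scalars \<Lambda> N\<^esub>"
      unfolding RN
    proof
      fix f assume f: "f \<in> ?U"
      have "f + rscale (- 1) f = 0" by (simp add: rscale_def fun_eq_iff)
      then show "\<exists>g\<in>?U. f + g = 0" using U(3)[OF f] by blast
    qed
  qed (use U in \<open>simp_all add: RN RN_smult add_ac rscale_add rscale_rscale\<close>,
      simp_all add: rscale_def fun_eq_iff distrib_right)
  then have "\<exists>B. finite B \<and> is_basis (restrict_scalars \<Lambda> N) B"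
    by (rule free_rank_eq(2)[OF _ S, where \<eta> = "\<lambda>f. f"]) (simp_all add: RN RN_smult bij_betw_def)
  then have "CM_fr \<Lambda> N" using LN by (simp add: CM_fr_def)
  moreover have "isomorphic_modules \<Lambda> X N"
    unfolding isomorphic_modules_def
  proof (intro bexI[of _ "restrict h (carrier X)"])
    show "bij_betw (restrict h (carrier X)) (carrier X) (carrier N)"
      using bij unfolding N by (simp cong: bij_betw_cong)
    show "restrict h (carrier X) \<in> Hom \<Lambda> X N"
      by (rule HomI) (simp_all add: N hu add X.smult_closed)
  qed
  ultimately show ?thesis by blast
qed

text \<open>In \<open>M_J\<close> the element y^v takes \<open>\<delta> v\<close> to a multiple of
  \<open>\<delta> n\<close>, and it acts injectively on \<open>M\<close>. So the value at
  \<open>\<delta> n\<close> fixes the values at all \<open>\<delta> v\<close>, and these fix the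
  image of \<open>m\<close> at every vertex.\<close>

lemma (in rank_one_hom) Hom_determined:
  assumes f: "f \<in> Hom C T M" and g: "g \<in> Hom C T M" and eq: "f (\<delta> n) = g (\<delta> n)" and m: "m \<in> carrier T"
  shows "f m = g m"
proof -
  have n: "n \<in> {1..n}" using n_pos by simp
  have \<delta>: "f (\<delta> v) = g (\<delta> v)" if v: "v \<in> {1..n}" for v
  proof (rule y_pow_cancel[of _ _ "nat v"])
    let ?t = "C.\<rho> (fps_X ^ card (J \<inter> {1..int (nat v)}))"
    have "nat v \<le> nat n" using v by (intro nat_mono) simp
    have e: "(y [^]\<^bsub>C\<^esub> nat v) \<odot>\<^bsub>T\<^esub> \<delta> v = ?t \<odot>\<^bsub>T\<^esub> \<delta> n"
    proof -
      have "E v \<odot>\<^bsub>T\<^esub> \<delta> v = \<delta> v"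
        unfolding T_E using v by (intro T_ext) (auto simp: \<delta>_def T_simps)
      moreover have "(y [^]\<^bsub>C\<^esub> nat v \<otimes>\<^bsub>C\<^esub> E v) \<odot>\<^bsub>T\<^esub> \<delta> v = (y [^]\<^bsub>C\<^esub> nat v) \<odot>\<^bsub>T\<^esub> (E v \<odot>\<^bsub>T\<^esub> \<delta> v)"
        by (rule T.smult_assoc) (simp_all only: \<delta>_closed E_closed y_closed C.\<Lambda>.nat_pow_closed)
      moreover have "int (nat v) = v" using v by simp
      ultimately have "(y [^]\<^bsub>C\<^esub> nat v) \<odot>\<^bsub>T\<^esub> \<delta> v = (y [^]\<^bsub>C\<^esub> nat v \<otimes>\<^bsub>C\<^esub> E (int (nat v))) \<odot>\<^bsub>T\<^esub> \<delta> v"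
        by (simp only:)
      also have "\<dots> = ?t \<odot>\<^bsub>T\<^esub> \<delta> n"
        unfolding T_y_pow_E[OF \<open>nat v \<le> nat n\<close>] T_\<rho>[OF \<delta>_closed] using v n
        by (intro restrict_ext) (auto simp: \<delta>_def)
      finally show ?thesis .
    qed
    have "(y [^]\<^bsub>C\<^esub> nat v) \<cdot> h (\<delta> v) = ?t \<cdot> h (\<delta> n)" if h: "h \<in> Hom C T M" for h
      using HomD(3)[OF h _ \<delta>_closed, of "y [^]\<^bsub>C\<^esub> nat v" v] HomD(3)[OF h _ \<delta>_closed, of ?t n] e by simp
    then show "(y [^]\<^bsub>C\<^esub> nat v) \<cdot> f (\<delta> v) = (y [^]\<^bsub>C\<^esub> nat v) \<cdot> g (\<delta> v)" using f g eq by simp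
  qed (auto intro: HomD(1)[OF f \<delta>_closed] HomD(1)[OF g \<delta>_closed])
  have E: "E v \<cdot> f m = E v \<cdot> g m" if v: "v \<in> {1..n}" for v
  proof -
    have "E v \<cdot> h m = C.\<rho> (m v) \<cdot> h (\<delta> v)" if h: "h \<in> Hom C T M" for h
      using HomD(3)[OF h _ m, of "E v"] HomD(3)[OF h _ \<delta>_closed, of "C.\<rho> (m v)" v] E_act_T[OF m v] by simp
    then show ?thesis using f g \<delta>[OF v] by simp
  qed
  have "(\<Oplus>\<^bsub>C\<^esub>v\<in>F. E v) \<cdot> f m = (\<Oplus>\<^bsub>C\<^esub>v\<in>F. E v) \<cdot> g m" if "finite F" "F \<subseteq> {1..n}" for F
    using that
  proof (induction F)
    case empty
    then show ?case using HomD(1)[OF f m] HomD(1)[OF g m] by simp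
  next
    case (insert v F)
    have "(\<Oplus>\<^bsub>C\<^esub>v\<in>insert v F. E v) \<cdot> w = E v \<cdot> w \<oplus>\<^bsub>M\<^esub> (\<Oplus>\<^bsub>C\<^esub>v\<in>F. E v) \<cdot> w" if "w \<in> carrier M" for w
      using insert that by (subst C.\<Lambda>.finsum_insert) (auto simp: M.smult_l_distr intro!: C.\<Lambda>.finsum_closed)
    then show ?case using insert E HomD(1)[OF f m] HomD(1)[OF g m] by simp
  qed
  from this[of "{1..n}"] show ?thesis
    using HomD(1)[OF f m] HomD(1)[OF g m] by (simp add: sum_E M.smult_one)
qed

locale rank_one_family = C_algebra k n for k n :: int +
  fixes I :: "'e set" and K :: "'e \<Rightarrow> int set"
  assumes finite_I: "finite I" and K: "e \<in> I \<Longrightarrow> rank_one k n (K e)"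
begin

abbreviation D :: "(path_elts set, 'e \<Rightarrow> int \<Rightarrow> complex fps) module" where
  "D \<equiv> direct_sum_family I (\<lambda>e. rank_one_module n (K e))"

lemma D_simps: "carrier D = (\<Pi>\<^sub>E e\<in>I. carrier (rank_one_module n (K e)))"
  "\<zero>\<^bsub>D\<^esub> = (\<lambda>e\<in>I. \<zero>\<^bsub>rank_one_module n (K e)\<^esub>)"
  "p \<oplus>\<^bsub>D\<^esub> q = (\<lambda>e\<in>I. p e \<oplus>\<^bsub>rank_one_module n (K e)\<^esub> q e)"
  "a \<odot>\<^bsub>D\<^esub> p = (\<lambda>e\<in>I. a \<odot>\<^bsub>rank_one_module n (K e)\<^esub> p e)"
  by (simp_all add: direct_sum_family_def)

lemma summand: "e \<in> I \<Longrightarrow> left_module C (rank_one_module n (K e))"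
  by (rule rank_one.T_left_module[OF K])

lemma summand_abelian: "e \<in> I \<Longrightarrow> abelian_group (rank_one_module n (K e))"
  using summand by (simp add: left_module_def)

lemma D_ext: "\<lbrakk>p \<in> carrier D; q \<in> carrier D; \<And>e. e \<in> I \<Longrightarrow> p e = q e\<rbrakk> \<Longrightarrow> p = q"
  unfolding D_simps by (rule PiE_ext)

lemma D_component: "p \<in> carrier D \<Longrightarrow> e \<in> I \<Longrightarrow> p e \<in> carrier (rank_one_module n (K e))"
  unfolding D_simps by blast

lemma D_closed: "p \<in> carrier D \<Longrightarrow> q \<in> carrier D \<Longrightarrow> p \<oplus>\<^bsub>D\<^esub> q \<in> carrier D"
  "a \<in> carrier C \<Longrightarrow> p \<in> carrier D \<Longrightarrow> a \<odot>\<^bsub>D\<^esub> p \<in> carrier D"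
  unfolding D_simps
  by (auto intro!: abelian_groupE(1)[OF summand_abelian] left_module.smult_closed[OF summand])

lemma D_left_module: "left_module C D"
proof (intro left_module.intro left_module_axioms.intro)
  show "ring C" by (rule C.\<Lambda>_ring)
  show "abelian_group D"
  proof (rule abelian_groupI)
    show "\<zero>\<^bsub>D\<^esub> \<in> carrier D" unfolding D_simps by (auto intro: abelian_groupE(2)[OF summand_abelian])
    fix p assume p: "p \<in> carrier D"
    show "\<zero>\<^bsub>D\<^esub> \<oplus>\<^bsub>D\<^esub> p = p"
      by (rule D_ext[OF D_closed(1)[OF \<open>\<zero>\<^bsub>D\<^esub> \<in> carrier D\<close> p] p])
        (simp add: D_simps(2,3) abelian_groupE(5)[OF summand_abelian D_component[OF p]])
    have "\<forall>e\<in>I. \<exists>w\<in>carrier (rank_one_module n (K e)). w \<oplus>\<^bsub>rank_one_module n (K e)\<^esub> p e = \<zero>\<^bsub>rank_one_module n (K e)\<^esub>"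
      using abelian_groupE(6)[OF summand_abelian D_component[OF p]] by blast
    then obtain w where w: "\<And>e. e \<in> I \<Longrightarrow> w e \<in> carrier (rank_one_module n (K e))"
      "\<And>e. e \<in> I \<Longrightarrow> w e \<oplus>\<^bsub>rank_one_module n (K e)\<^esub> p e = \<zero>\<^bsub>rank_one_module n (K e)\<^esub>" by metis
    show "\<exists>q\<in>carrier D. q \<oplus>\<^bsub>D\<^esub> p = \<zero>\<^bsub>D\<^esub>"
    proof (rule bexI[of _ "restrict w I"])
      show "restrict w I \<oplus>\<^bsub>D\<^esub> p = \<zero>\<^bsub>D\<^esub>" unfolding D_simps by (intro restrict_ext) (simp add: w)
      show "restrict w I \<in> carrier D" unfolding D_simps using w(1) by auto
    qed
    fix q assume q: "q \<in> carrier D"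
    show "p \<oplus>\<^bsub>D\<^esub> q \<in> carrier D" by (rule D_closed(1)[OF p q])
    show "p \<oplus>\<^bsub>D\<^esub> q = q \<oplus>\<^bsub>D\<^esub> p" unfolding D_simps(3)
      by (intro restrict_ext abelian_groupE(4)[OF summand_abelian D_component[OF p] D_component[OF q]])
    fix s assume s: "s \<in> carrier D"
    show "p \<oplus>\<^bsub>D\<^esub> q \<oplus>\<^bsub>D\<^esub> s = p \<oplus>\<^bsub>D\<^esub> (q \<oplus>\<^bsub>D\<^esub> s)" unfolding D_simps(3)
      by (intro restrict_ext)
        (simp add: abelian_groupE(3)[OF summand_abelian D_component[OF p] D_component[OF q] D_component[OF s]])
  qed
  fix a p assume a: "a \<in> carrier C" and p: "p \<in> carrier D"
  show "a \<odot>\<^bsub>D\<^esub> p \<in> carrier D" by (rule D_closed(2)[OF a p])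
  show "a \<odot>\<^bsub>D\<^esub> (p \<oplus>\<^bsub>D\<^esub> q) = a \<odot>\<^bsub>D\<^esub> p \<oplus>\<^bsub>D\<^esub> a \<odot>\<^bsub>D\<^esub> q" if q: "q \<in> carrier D" for q
    unfolding D_simps(3,4) by (intro restrict_ext)
      (simp add: left_module.smult_r_distr[OF summand a D_component[OF p] D_component[OF q]])
  fix b assume b: "b \<in> carrier C"
  show "(a \<oplus>\<^bsub>C\<^esub> b) \<odot>\<^bsub>D\<^esub> p = a \<odot>\<^bsub>D\<^esub> p \<oplus>\<^bsub>D\<^esub> b \<odot>\<^bsub>D\<^esub> p"
    unfolding D_simps(3,4) by (intro restrict_ext)
      (simp add: left_module.smult_l_distr[OF summand a b D_component[OF p]])
  show "(a \<otimes>\<^bsub>C\<^esub> b) \<odot>\<^bsub>D\<^esub> p = a \<odot>\<^bsub>D\<^esub> (b \<odot>\<^bsub>D\<^esub> p)"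
    unfolding D_simps(4) by (intro restrict_ext)
      (simp add: left_module.smult_assoc[OF summand a b D_component[OF p]])
next
  fix p assume p: "p \<in> carrier D"
  show "\<one>\<^bsub>C\<^esub> \<odot>\<^bsub>D\<^esub> p = p"
    by (rule D_ext[OF D_closed(2)[OF _ p] p]) (simp_all add: D_simps(4) left_module.smult_one[OF summand D_component[OF p]])
qed

definition \<iota> :: "'e \<Rightarrow> (int \<Rightarrow> complex fps) \<Rightarrow> 'e \<Rightarrow> int \<Rightarrow> complex fps" where
  "\<iota> e u = (\<lambda>e'\<in>I. if e' = e then u else \<zero>\<^bsub>rank_one_module n (K e')\<^esub>)"

lemma \<iota>_Hom:
  assumes e: "e \<in> I"
  shows "restrict (\<iota> e) (carrier (rank_one_module n (K e))) \<in> Hom C (rank_one_module n (K e)) D"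
proof (rule HomI)
  let ?T = "rank_one_module n (K e)"
  interpret R: rank_one k n "K e" by (rule K[OF e])
  have z: "\<zero>\<^bsub>rank_one_module n J\<^esub> = (\<lambda>i\<in>{1..n}. 0)" for J by (simp add: rank_one_module_def)
  have zz: "\<zero>\<^bsub>rank_one_module n (K e')\<^esub> \<oplus>\<^bsub>rank_one_module n (K e')\<^esub> \<zero>\<^bsub>rank_one_module n (K e')\<^esub>
      = \<zero>\<^bsub>rank_one_module n (K e')\<^esub>" if "e' \<in> I" for e'
    by (rule abelian_groupE(5)[OF summand_abelian[OF that] abelian_groupE(2)[OF summand_abelian[OF that]]])
  have az: "a \<odot>\<^bsub>rank_one_module n (K e')\<^esub> \<zero>\<^bsub>rank_one_module n (K e')\<^esub> = \<zero>\<^bsub>rank_one_module n (K e')\<^esub>"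
    if "e' \<in> I" "a \<in> carrier C" for e' a
    by (rule C_module.act_zero[OF C_module.intro[OF C_algebra_axioms summand[OF that(1)]] that(2)])
  have c: "\<iota> e x \<in> carrier D" if "x \<in> carrier ?T" for x
    unfolding D_simps \<iota>_def using that by (auto intro: abelian_groupE(2)[OF summand_abelian])
  show "restrict (\<iota> e) (carrier ?T) x \<in> carrier D" if "x \<in> carrier ?T" for x using c that by simp
  show "restrict (\<iota> e) (carrier ?T) (x \<oplus>\<^bsub>?T\<^esub> y) = restrict (\<iota> e) (carrier ?T) x \<oplus>\<^bsub>D\<^esub> restrict (\<iota> e) (carrier ?T) y"
    if "x \<in> carrier ?T" "y \<in> carrier ?T" for x y
  proof -
    have "x \<oplus>\<^bsub>?T\<^esub> y \<in> carrier ?T" by (rule abelian_groupE(1)[OF summand_abelian[OF e] that])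
    then show ?thesis using that unfolding D_simps(3) by (auto simp: \<iota>_def zz)
  qed
  show "restrict (\<iota> e) (carrier ?T) (a \<odot>\<^bsub>?T\<^esub> x) = a \<odot>\<^bsub>D\<^esub> restrict (\<iota> e) (carrier ?T) x"
    if "a \<in> carrier C" "x \<in> carrier ?T" for a x
    using that R.T_closed[OF that(1)] unfolding D_simps(4) by (auto simp: \<iota>_def az)
qed simp

end

locale torsion_free_hom = rank_one_family k n I K + M: torsion_free_module k n M
  for k n :: int and I :: "'e set" and K :: "'e \<Rightarrow> int set" and M :: "(path_elts set, 'm) module"
begin

sublocale H: hom_pair k n D M
  by (intro hom_pair.intro C_module.intro C_algebra_axioms D_left_module M.M.left_module_axioms)

text \<open>The generator at * of the summand \<open>e\<close>. Homomorphisms out of the direct sum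
  are determined by their values at these elements, which lie in \<open>V\<close>.\<close>

definition \<epsilon> :: "'e \<Rightarrow> 'e \<Rightarrow> int \<Rightarrow> complex fps" where
  "\<epsilon> e = \<iota> e (\<lambda>v\<in>{1..n}. if v = n then 1 else 0)"

lemma \<delta>_T: "(\<lambda>v\<in>{1..n}. if v = n then 1 else 0) \<in> carrier (rank_one_module n J)"
  by (simp add: rank_one_module_def)

lemma \<iota>_component:
  assumes e: "e \<in> I" and f: "f \<in> Hom C D M"
  shows "compose (carrier (rank_one_module n (K e))) f (restrict (\<iota> e) (carrier (rank_one_module n (K e))))
    \<in> Hom C (rank_one_module n (K e)) M"
proof (rule HomI)
  let ?T = "rank_one_module n (K e)"
  note i = \<iota>_Hom[OF e]
  show "compose (carrier ?T) f (restrict (\<iota> e) (carrier ?T)) x \<in> carrier M" if "x \<in> carrier ?T" for x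
    using HomD(1)[OF f HomD(1)[OF i that]] that by (simp add: compose_def)
  show "compose (carrier ?T) f (restrict (\<iota> e) (carrier ?T)) (x \<oplus>\<^bsub>?T\<^esub> y)
      = compose (carrier ?T) f (restrict (\<iota> e) (carrier ?T)) x \<oplus>\<^bsub>M\<^esub> compose (carrier ?T) f (restrict (\<iota> e) (carrier ?T)) y"
    if xy: "x \<in> carrier ?T" "y \<in> carrier ?T" for x y
    using HomD(2)[OF f HomD(1)[OF i xy(1)] HomD(1)[OF i xy(2)]] HomD(2)[OF i xy] xy
      abelian_groupE(1)[OF summand_abelian[OF e] xy] by (simp add: compose_def)
  show "compose (carrier ?T) f (restrict (\<iota> e) (carrier ?T)) (a \<odot>\<^bsub>?T\<^esub> x)
      = a \<odot>\<^bsub>M\<^esub> compose (carrier ?T) f (restrict (\<iota> e) (carrier ?T)) x"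
    if a: "a \<in> carrier C" and x: "x \<in> carrier ?T" for a x
    using HomD(3)[OF f a HomD(1)[OF i x]] HomD(3)[OF i a x] x left_module.smult_closed[OF summand[OF e] a x]
    by (simp add: compose_def)
qed (simp add: compose_def)

lemma \<epsilon>_closed: "e \<in> I \<Longrightarrow> \<epsilon> e \<in> carrier D"
  using HomD(1)[OF \<iota>_Hom \<delta>_T] by (simp add: \<epsilon>_def \<delta>_T)

lemma \<epsilon>_V:
  assumes e: "e \<in> I" and f: "f \<in> Hom C D M"
  shows "f (\<epsilon> e) \<in> M.V"
proof -
  interpret R: rank_one_hom k n M "K e"
    by (intro rank_one_hom.intro M.torsion_free_module_axioms K[OF e])
  have "f (\<epsilon> e) \<in> R.W_hom"
    using R.Hom_\<delta>_n[OF \<iota>_component[OF e f]] R.\<delta>_closed[of n] by (simp add: compose_def \<epsilon>_def R.\<delta>_def)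
  then show ?thesis by (simp add: R.W_hom_def)
qed

lemma Hom_D_determined:
  assumes f: "f \<in> Hom C D M" and g: "g \<in> Hom C D M" and eq: "\<And>e. e \<in> I \<Longrightarrow> f (\<epsilon> e) = g (\<epsilon> e)"
  shows "f = g"
proof (rule H.Hom_eqI[OF f g])
  have comp: "f (\<iota> e x) = g (\<iota> e x)" if e: "e \<in> I" and x: "x \<in> carrier (rank_one_module n (K e))" for e x
  proof -
    interpret R: rank_one_hom k n M "K e"
      by (intro rank_one_hom.intro M.torsion_free_module_axioms K[OF e])
    have "compose (carrier (rank_one_module n (K e))) f (restrict (\<iota> e) (carrier (rank_one_module n (K e)))) x
        = compose (carrier (rank_one_module n (K e))) g (restrict (\<iota> e) (carrier (rank_one_module n (K e)))) x"
    proof (rule R.Hom_determined[OF \<iota>_component[OF e f] \<iota>_component[OF e g] _ x])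
      show "compose (carrier (rank_one_module n (K e))) f (restrict (\<iota> e) (carrier (rank_one_module n (K e)))) (R.\<delta> n)
          = compose (carrier (rank_one_module n (K e))) g (restrict (\<iota> e) (carrier (rank_one_module n (K e)))) (R.\<delta> n)"
        using eq[OF e] R.\<delta>_closed[of n] by (simp add: compose_def \<epsilon>_def R.\<delta>_def)
    qed
    then show ?thesis using x by (simp add: compose_def)
  qed
  \<comment> \<open>Induction on the set \<open>F\<close> of components that may be nonzero; each
    step splits off one summand.\<close>
  have "\<forall>m\<in>carrier D. (\<forall>e\<in>I - F. m e = \<zero>\<^bsub>rank_one_module n (K e)\<^esub>) \<longrightarrow> f m = g m" if "finite F" "F \<subseteq> I" for F
    using that
  proof (induction F)
    case empty
    show ?case
    proof (intro ballI impI)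
      fix m assume m: "m \<in> carrier D" "\<forall>e\<in>I - {}. m e = \<zero>\<^bsub>rank_one_module n (K e)\<^esub>"
      have m0: "m = \<zero>\<^bsub>D\<^esub>"
        by (rule D_ext[OF m(1)]) (use m(2) H.T.M.M.zero_closed in \<open>simp_all add: D_simps(2)\<close>)
      have hz: "h \<zero>\<^bsub>D\<^esub> = \<zero>\<^bsub>M\<^esub>" if h: "h \<in> Hom C D M" for h
      proof -
        have "h (C.\<rho> 0 \<odot>\<^bsub>D\<^esub> \<zero>\<^bsub>D\<^esub>) = C.\<rho> 0 \<odot>\<^bsub>M\<^esub> h \<zero>\<^bsub>D\<^esub>" by (rule HomD(3)[OF h]) simp_all
        then show ?thesis using HomD(1)[OF h H.T.M.M.zero_closed] by simp
      qed
      show "f m = g m" unfolding m0 hz[OF f] hz[OF g] ..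
    qed
  next
    case (insert e F)
    show ?case
    proof (intro ballI impI)
      fix m assume m: "m \<in> carrier D" "\<forall>e'\<in>I - insert e F. m e' = \<zero>\<^bsub>rank_one_module n (K e')\<^esub>"
      have e: "e \<in> I" using insert.prems by simp
      note me = D_component[OF m(1) e]
      define m' where "m' = (\<lambda>e'\<in>I. if e' = e then \<zero>\<^bsub>rank_one_module n (K e')\<^esub> else m e')"
      have m': "m' \<in> carrier D"
        unfolding D_simps m'_def using D_component[OF m(1)] abelian_groupE(2)[OF summand_abelian] by auto
      have i: "\<iota> e (m e) \<in> carrier D" using HomD(1)[OF \<iota>_Hom[OF e] me] me by simp
      have sum: "m = m' \<oplus>\<^bsub>D\<^esub> \<iota> e (m e)"
      proof (rule D_ext[OF m(1) D_closed(1)[OF m' i]])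
        fix e' assume e': "e' \<in> I"
        note c = abelian_groupE(5)[OF summand_abelian[OF e'] D_component[OF m(1) e']]
        have "m e' \<oplus>\<^bsub>rank_one_module n (K e')\<^esub> \<zero>\<^bsub>rank_one_module n (K e')\<^esub> = m e'"
          unfolding abelian_groupE(4)[OF summand_abelian[OF e'] D_component[OF m(1) e'] abelian_groupE(2)[OF summand_abelian[OF e']]]
          by (rule c)
        then show "m e' = (m' \<oplus>\<^bsub>D\<^esub> \<iota> e (m e)) e'" using e' c by (auto simp: D_simps(3) m'_def \<iota>_def)
      qed
      have "f m' = g m'" using insert.IH insert.prems m' m(2) by (auto simp: m'_def)
      then have "f (m' \<oplus>\<^bsub>D\<^esub> \<iota> e (m e)) = g (m' \<oplus>\<^bsub>D\<^esub> \<iota> e (m e))"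
        unfolding HomD(2)[OF f m' i] HomD(2)[OF g m' i] comp[OF e me] by simp
      then show "f m = g m" unfolding sum[symmetric] .
    qed
  qed
  from this[OF finite_I order_refl] show "f m = g m" if "m \<in> carrier D" for m using that by simp
qed

text \<open>Evaluation at the \<open>\<epsilon> e\<close>, followed by coordinates on
  \<open>V\<close>, embeds the homomorphisms as a submodule of a free module with basis indexed by
  \<open>I \<times> S\<close>. It is free by \<open>submodule_free\<close>, and
  \<open>CM_fr_transport\<close> produces the copy in \<open>univ\<close>.\<close>

lemma Hom_from_CM:
  assumes fg: "finitely_generated C M"
  shows "\<exists>N :: (_, univ) module. CM_fr (End_op C D) N \<and> isomorphic_modules (End_op C D) (Hom_from C D M) N"
proof -
  obtain S and \<eta> :: "'m \<Rightarrow> 'm \<Rightarrow> complex fps" where \<eta>: "finite S" "bij_betw \<eta> M.V (supported_on S)"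
    "\<And>w w'. \<lbrakk>w \<in> M.V; w' \<in> M.V\<rbrakk> \<Longrightarrow> \<eta> (w \<oplus>\<^bsub>M\<^esub> w') = \<eta> w + \<eta> w'"
    "\<And>r w. w \<in> M.V \<Longrightarrow> \<eta> (C.\<rho> r \<odot>\<^bsub>M\<^esub> w) = rscale r (\<eta> w)"
    using M.V_free[OF fg] by blast
  \<comment> \<open>Elements of \<open>univ\<close> are functions on the natural numbers, so the
    index set has to be enumerated.\<close>
  from ex_bij_betw_nat_finite[OF finite_cartesian_product[OF finite_I \<eta>(1)]]
  obtain c where c: "bij_betw c {0..<card (I \<times> S)} (I \<times> S)" ..
  let ?A = "{0..<card (I \<times> S)}"
  define \<Phi> :: "_ \<Rightarrow> univ" where "\<Phi> f = (\<lambda>j. if j \<in> ?A then \<eta> (f (\<epsilon> (fst (c j)))) (snd (c j)) else 0)" for f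
  have cI: "fst (c j) \<in> I" if "j \<in> ?A" for j
    using bij_betw_apply[OF c that] by (simp add: mem_Times_iff)
  let ?X = "Hom_from C D M"
  have X: "carrier ?X = Hom C D M" by (rule Hom_from_simps)
  have \<Phi>_add: "\<Phi> (f \<oplus>\<^bsub>?X\<^esub> g) = \<Phi> f + \<Phi> g" if "f \<in> Hom C D M" "g \<in> Hom C D M" for f g
  proof
    fix j
    show "\<Phi> (f \<oplus>\<^bsub>?X\<^esub> g) j = (\<Phi> f + \<Phi> g) j"
      using cI[of j] \<epsilon>_closed \<eta>(3)[OF \<epsilon>_V \<epsilon>_V, of "fst (c j)" f "fst (c j)" g] that
      by (simp add: \<Phi>_def Hom_from_simps)
  qed
  have \<Phi>_scalar: "\<Phi> (scalar_act (End_op C D) ?X r f) = rscale r (\<Phi> f)" if "f \<in> Hom C D M" for r f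
  proof
    fix j
    show "\<Phi> (scalar_act (End_op C D) ?X r f) j = rscale r (\<Phi> f) j"
      unfolding H.Hom_from_scalar[OF that]
      using cI[of j] \<epsilon>_closed \<eta>(4)[OF \<epsilon>_V, of "fst (c j)" f r] that by (simp add: \<Phi>_def rscale_def)
  qed
  have \<Phi>_inj: "inj_on \<Phi> (Hom C D M)"
  proof (rule inj_onI)
    fix f g assume fg: "f \<in> Hom C D M" "g \<in> Hom C D M" "\<Phi> f = \<Phi> g"
    show "f = g"
    proof (rule Hom_D_determined[OF fg(1,2)])
      fix e assume e: "e \<in> I"
      have V: "f (\<epsilon> e) \<in> M.V" "g (\<epsilon> e) \<in> M.V" using \<epsilon>_V[OF e] fg by auto
      have supp: "\<eta> (f (\<epsilon> e)) \<in> supported_on S" "\<eta> (g (\<epsilon> e)) \<in> supported_on S"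
        using \<eta>(2) V by (auto simp: bij_betw_def)
      have "\<eta> (f (\<epsilon> e)) s = \<eta> (g (\<epsilon> e)) s" for s
      proof (cases "s \<in> S")
        case True
        then have "(e, s) \<in> c ` ?A" using c e by (simp add: bij_betw_def)
        then obtain j where j: "j \<in> ?A" "c j = (e, s)" by auto
        then show ?thesis using fun_cong[OF fg(3), of j] by (simp add: \<Phi>_def)
      next
        case False
        then show ?thesis using supp by (simp add: supported_on_def)
      qed
      then have "\<eta> (f (\<epsilon> e)) = \<eta> (g (\<epsilon> e))" by (rule ext)
      then show "f (\<epsilon> e) = g (\<epsilon> e)" using \<eta>(2) V unfolding bij_betw_def by (meson inj_onD)
    qed
  qed
  let ?L = "\<Phi> ` Hom C D M"
  have scl: "scalar_act (End_op C D) ?X r f \<in> Hom C D M" if "f \<in> Hom C D M" for r f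
    using left_module.smult_closed[OF H.Hom_from_left_module H.scalar_End] that
    by (simp add: scalar_act_def[of "End_op C D"] X)
  have sub: "R_submodule ?L"
    unfolding R_submodule_def
  proof (intro conjI ballI allI)
    have "\<Phi> (scalar_act (End_op C D) ?X 0 (\<lambda>m\<in>carrier D. \<zero>\<^bsub>M\<^esub>)) = 0"
      unfolding \<Phi>_scalar[OF H.Hom_zero] by (simp add: rscale_def zero_fun_def)
    then show "0 \<in> ?L" using scl[OF H.Hom_zero, of 0] by (intro image_eqI[of 0 \<Phi>]) auto
    fix x r assume "x \<in> ?L"
    then obtain f where f: "f \<in> Hom C D M" "x = \<Phi> f" by blast
    show "rscale r x \<in> ?L" unfolding f(2) \<Phi>_scalar[OF f(1), symmetric] using scl[OF f(1)] by blast
    fix y assume "y \<in> ?L"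
    then obtain g where g: "g \<in> Hom C D M" "y = \<Phi> g" by blast
    have "f \<oplus>\<^bsub>?X\<^esub> g \<in> Hom C D M" unfolding Hom_from_simps by (rule H.Hom_add[OF f(1) g(1)])
    then show "x + y \<in> ?L" unfolding f(2) g(2) \<Phi>_add[OF f(1) g(1), symmetric] by blast
  qed
  have "?L \<subseteq> supported_on ?A" by (auto simp: supported_on_def \<Phi>_def)
  from submodule_free[OF finite_atLeastLessThan sub this]
  obtain S' \<eta>' where S': "S' \<subseteq> ?A" and b: "bij_betw \<eta>' ?L (supported_on S' :: univ set)"
    and add: "\<forall>f\<in>?L. \<forall>g\<in>?L. \<eta>' (f + g) = \<eta>' f + \<eta>' g"
    and sc: "\<forall>r. \<forall>f\<in>?L. \<eta>' (rscale r f) = rscale r (\<eta>' f)"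
    by (elim exE conjE) (rule that)
  have add': "\<eta>' (\<Phi> f + \<Phi> g) = \<eta>' (\<Phi> f) + \<eta>' (\<Phi> g)" if "f \<in> Hom C D M" "g \<in> Hom C D M" for f g
    by (rule add[rule_format]) (intro imageI that)+
  have sc': "\<eta>' (rscale r (\<Phi> f)) = rscale r (\<eta>' (\<Phi> f))" if "f \<in> Hom C D M" for r f
    by (rule sc[rule_format]) (intro imageI that)
  show ?thesis
  proof (rule CM_fr_transport[OF H.Hom_from_left_module, of S' "\<eta>' \<circ> \<Phi>"])
    show "finite S'" using S' by (rule finite_subset) simp
    show "bij_betw (\<eta>' \<circ> \<Phi>) (carrier ?X) (supported_on S')"
      unfolding X by (rule bij_betw_trans[OF inj_on_imp_bij_betw[OF \<Phi>_inj] b])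
    show "(\<eta>' \<circ> \<Phi>) (f \<oplus>\<^bsub>?X\<^esub> g) = (\<eta>' \<circ> \<Phi>) f + (\<eta>' \<circ> \<Phi>) g" if "f \<in> carrier ?X" "g \<in> carrier ?X" for f g
      using that unfolding X comp_def by (simp add: \<Phi>_add add')
    show "(\<eta>' \<circ> \<Phi>) (scalar_act (End_op C D) ?X r f) = rscale r ((\<eta>' \<circ> \<Phi>) f)" if "f \<in> carrier ?X" for r f
      using that unfolding X comp_def by (simp add: \<Phi>_scalar sc')
  qed
qed

end

section \<open>Classes in the Grothendieck group and coordinates on the lattice of patterns\<close>

lemma K_rels_subgroup: "subgroup (K_rels \<Lambda>) (K_gens \<Lambda>)"
  unfolding K_rels_def
proof (rule group.generate_is_subgroup[OF group_free_Abelian_group], rule subsetI)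
  fix c :: "('a, univ) module \<Rightarrow>\<^sub>0 int"
  assume "c \<in> {frag_of M - frag_of L - frag_of N | L M N.
        CM_fr \<Lambda> L \<and> CM_fr \<Lambda> M \<and> CM_fr \<Lambda> N \<and> short_exact \<Lambda> L M N}"
  then obtain L M N where c: "c = frag_of M - frag_of L - frag_of N" "CM_fr \<Lambda> L" "CM_fr \<Lambda> M" "CM_fr \<Lambda> N" by auto
  have "Poly_Mapping.keys c \<subseteq> Poly_Mapping.keys (frag_of M) \<union> Poly_Mapping.keys (frag_of L) \<union> Poly_Mapping.keys (frag_of N)"
    unfolding c(1) using keys_diff[of "frag_of M - frag_of L" "frag_of N"] keys_diff[of "frag_of M" "frag_of L"] by blast
  then show "c \<in> carrier (K_gens \<Lambda>)" using c(2-4) by auto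
qed

lemma K_CM_comm_group: "comm_group (K_CM \<Lambda>)"
  unfolding K_CM_def by (rule comm_group.abelian_FactGroup[OF abelian_free_Abelian_group K_rels_subgroup])

text \<open>\<open>K_class\<close> chooses a representative in \<open>univ\<close>; its value is a
  genuine class as soon as such a representative exists.\<close>

lemma K_class_closed:
  fixes X :: "('a, 'm) module" and \<Lambda> :: "(complex fps, 'a) module"
  assumes "\<exists>N :: ('a, univ) module. CM_fr \<Lambda> N \<and> isomorphic_modules \<Lambda> X N"
  shows "K_class \<Lambda> X \<in> carrier (K_CM \<Lambda>)"
proof -
  from someI_ex[OF assms]
  have "frag_of (SOME N :: ('a, univ) module. CM_fr \<Lambda> N \<and> isomorphic_modules \<Lambda> X N) \<in> carrier (K_gens \<Lambda>)" by simp
  then show ?thesis unfolding K_class_def K_CM_def FactGroup_def by (auto simp: RCOSETS_def)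
qed

definition K_square :: "int \<Rightarrow> (int \<times> int) option \<Rightarrow> int set" where
  "K_square k = case_option {1..k} (\<lambda>(i, j). {1..k - i} \<union> {k - i + j + 1..k + j})"

lemma T_square_eq:
  "T_square k n = direct_sum_family (insert None (Some ` \<Gamma> k n)) (\<lambda>e. rank_one_module n (K_square k e))"
proof -
  have "case_option (T_empty k n) (T_ij k n) = (\<lambda>e. rank_one_module n (K_square k e))"
    by (intro ext) (simp add: K_square_def T_empty_def T_ij_def split: option.split prod.split)
  then show ?thesis unfolding T_square_def by simp
qed

context C_algebra
begin

lemma finite_\<Gamma>: "finite (\<Gamma> k n)"
  by (simp add: \<Gamma>_def)

lemma K_square_rank_one:
  assumes "e \<in> insert None (Some ` \<Gamma> k n)"
  shows "rank_one k n (K_square k e)"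
proof (intro rank_one.intro rank_one_axioms.intro C_algebra_axioms)
  have "K_square k e \<subseteq> {1..n} \<and> int (card (K_square k e)) = k"
  proof (cases e)
    case None
    then show ?thesis using k_pos k_less by (simp add: K_square_def)
  next
    case (Some p)
    then obtain i j where p: "e = Some (i, j)" by (cases p) simp
    have ij: "1 \<le> i" "i \<le> k" "1 \<le> j" "j \<le> n - k" using assms p by (auto simp: \<Gamma>_def)
    have "card ({1..k - i} \<union> {k - i + j + 1..k + j}) = card {1..k - i} + card {k - i + j + 1..k + j}"
      using ij by (intro card_Un_disjoint) auto
    then show ?thesis using ij p by (auto simp: K_square_def)
  qed
  then show "K_square k e \<subseteq> {1..n}" "int (card (K_square k e)) = k" by simp_all
qed

lemma GV_class_closed:
  fixes M :: "(path_elts set, univ) module"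
  assumes "CM_fg C M"
  shows "GV_class k n (T_square k n) M \<in> carrier (K_GV k n (T_square k n))"
proof -
  interpret M: C_module k n M
    using assms by (intro C_module.intro) (simp_all add: CM_fg_def C_algebra_axioms)
  obtain B where "is_basis (restrict_scalars C M) B" using assms by (auto simp: CM_fg_def)
  then have tf: "torsion_free_module k n M" by (rule M.torsion_free_if_basis)
  have "torsion_free_hom k n (insert None (Some ` \<Gamma> k n)) (K_square k) M"
    using finite_\<Gamma> K_square_rank_one
    by (intro torsion_free_hom.intro tf rank_one_family.intro rank_one_family_axioms.intro C_algebra_axioms) auto
  moreover have "finitely_generated C M" using assms by (simp add: CM_fg_def)
  ultimately show ?thesis
    unfolding GV_class_def K_GV_def T_square_eq by (intro K_class_closed torsion_free_hom.Hom_from_CM)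
qed

lemma GT_lattice_simps:
  "carrier (GT_lattice k n) = UNIV \<times> (\<Pi>\<^sub>E p\<in>\<Gamma> k n. UNIV)"
  "p \<otimes>\<^bsub>GT_lattice k n\<^esub> q = (fst p + fst q, \<lambda>e\<in>\<Gamma> k n. snd p e + snd q e)"
  by (simp_all add: GT_lattice_def DirProd_def product_group_def split_beta)

lemma gt_slice_add:
  assumes "(i, j) \<in> \<Gamma> k n"
  shows "gt_slice (\<lambda>e\<in>\<Gamma> k n. v e + w e) i j = gt_slice v i j + gt_slice w i j"
  using assms by (auto simp: gt_slice_def \<Gamma>_def)

lemma gt_slice_inj:
  assumes v: "v \<in> extensional (\<Gamma> k n)" and w: "w \<in> extensional (\<Gamma> k n)"
    and eq: "\<And>i j. (i, j) \<in> \<Gamma> k n \<Longrightarrow> gt_slice v i j = gt_slice w i j"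
  shows "v = w"
proof (rule extensionalityI[OF v w])
  have *: "(i, j) \<in> \<Gamma> k n \<Longrightarrow> i \<le> int m \<Longrightarrow> v (i, j) = w (i, j)" for i j m
  proof (induction m arbitrary: i j)
    case 0
    then show ?case by (simp add: \<Gamma>_def)
  next
    case (Suc m)
    show ?case
    proof (cases "i \<le> 1 \<or> j \<le> 1")
      case True
      then show ?thesis using eq[OF Suc.prems(1)] Suc.prems(1) by (simp add: gt_slice_def \<Gamma>_def)
    next
      case False
      then have "v (i - 1, j - 1) = w (i - 1, j - 1)"
        using Suc.prems by (intro Suc.IH) (simp_all add: \<Gamma>_def)
      then show ?thesis using eq[OF Suc.prems(1)] Suc.prems(1) False by (simp add: gt_slice_def \<Gamma>_def)
    qed
  qed
  fix p assume p: "p \<in> \<Gamma> k n"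
  obtain i j where ij: "p = (i, j)" by (cases p)
  show "v p = w p" unfolding ij using p *[of i j "nat i"] by (simp add: ij)
qed

lemma gt_slice_surj: "\<exists>v\<in>extensional (\<Gamma> k n). \<forall>i j. (i, j) \<in> \<Gamma> k n \<longrightarrow> gt_slice v i j = h (i, j)"
proof -
  \<comment> \<open>Summing \<open>h\<close> down the diagonal inverts the passage to
    differences.\<close>
  define s :: "int \<Rightarrow> int \<Rightarrow> int" where "s i j = (\<Sum>l<nat (min i j). h (i - int l, j - int l))" for i j
  let ?v = "\<lambda>(i, j)\<in>\<Gamma> k n. s i j"
  have "gt_slice ?v i j = h (i, j)" if ij: "(i, j) \<in> \<Gamma> k n" for i j
  proof (cases "i \<le> 1 \<or> j \<le> 1")
    case True
    then have "nat (min i j) = Suc 0" using ij by (auto simp: \<Gamma>_def min_def)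
    then have "s i j = h (i, j)" by (simp add: s_def)
    then show ?thesis using True ij by (auto simp: gt_slice_def \<Gamma>_def)
  next
    case False
    then have m: "nat (min i j) = Suc (nat (min (i - 1) (j - 1)))" by (auto simp: min_def)
    have "s i j = h (i, j) + s (i - 1) (j - 1)"
      unfolding s_def m sum.lessThan_Suc_shift by (simp add: algebra_simps)
    moreover have "(i - 1, j - 1) \<in> \<Gamma> k n" using ij False by (auto simp: \<Gamma>_def)
    ultimately show ?thesis using ij False by (auto simp: gt_slice_def)
  qed
  then show ?thesis by (intro bexI[of _ ?v]) auto
qed

end

theorem theorem11p4:
  fixes k n :: int
    and wt :: "((T_elts \<Rightarrow> T_elts, univ) module \<Rightarrow>\<^sub>0 int) set \<Rightarrow> int \<times> (int \<times> int \<Rightarrow> int)"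
  assumes "0 < k" and "k < n"
    and "wt \<in> iso (K_GV k n (T_square k n)) (GT_lattice k n)"
    and "\<And>M :: (path_elts set, univ) module. CM_fg (Calg k n) M \<Longrightarrow>
           wt (GV_class k n (T_square k n) M) = (int (rk_C k n M), \<kappa>_vector k n M)"
  shows "wt ` Mon_GV k n (T_square k n) = Mon_GT k n
    \<and> Mon_GV k n (T_square k n)
        = integral_points (K_GV k n (T_square k n)) (Cone_GV k n (T_square k n))
    \<and> rational_polyhedral_cone (K_GV k n (T_square k n)) (Cone_GV k n (T_square k n))"
proof -
  interpret C_algebra k n using assms(1,2) by unfold_locales
  let ?G = "K_GV k n (T_square k n)" and ?Mon = "Mon_GV k n (T_square k n)"
  \<comment> \<open>\<open>wt\<close> is injective on the carrier, so the classes have to be located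
    there before the description of the image can be pulled back.\<close>
  have sub: "?Mon \<subseteq> carrier ?G" using GV_class_closed by (auto simp: Mon_GV_def)
  have image: "wt ` ?Mon = Mon_GT k n"
  proof (intro equalityI subsetI)
    fix u assume "u \<in> wt ` ?Mon"
    then obtain M :: "(path_elts set, univ) module" where "CM_fg C M" "u = wt (GV_class k n (T_square k n) M)"
      by (auto simp: Mon_GV_def)
    then show "u \<in> Mon_GT k n" using rank_\<kappa>_vector_GT[of M] assms(4)[of M] by simp
  next
    fix u assume u: "u \<in> Mon_GT k n"
    obtain r v where rv: "u = (r, v)" by (cases u)
    obtain M :: "(path_elts set, univ) module" where M: "CM_fg C M" "int (rk_C k n M) = r" "\<kappa>_vector k n M = v"
      using GT_realizable[OF u[unfolded rv]] .
    have "wt (GV_class k n (T_square k n) M) = u" using assms(4)[OF M(1)] M rv by simp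
    moreover have "GV_class k n (T_square k n) M \<in> ?Mon" using M(1) by (auto simp: Mon_GV_def)
    ultimately show "u \<in> wt ` ?Mon" by (intro image_eqI[of u wt]) simp_all
  qed
  have wt_hom: "wt \<in> hom ?G (GT_lattice k n)" and wt_bij: "bij_betw wt (carrier ?G) (carrier (GT_lattice k n))"
    using assms(3) by (auto simp: iso_def)
  have wt_inj: "\<lbrakk>a \<in> carrier ?G; b \<in> carrier ?G; wt a = wt b\<rbrakk> \<Longrightarrow> a = b" for a b
    using wt_bij unfolding bij_betw_def by (meson inj_onD)
  have wt_ext: "snd (wt a) \<in> extensional (\<Gamma> k n)" if "a \<in> carrier ?G" for a
    using bij_betw_apply[OF wt_bij that] unfolding GT_lattice_simps by (auto simp: PiE_def)
  \<comment> \<open>The coordinates are the rank and the diagonal differences instead of the entries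
    of a pattern; in them the inequalities become those of an order polytope.\<close>
  define \<gamma> :: "_ \<Rightarrow> (int \<times> int) option \<Rightarrow> int" where
    "\<gamma> a = case_option (fst (wt a)) (\<lambda>(i, j). gt_slice (snd (wt a)) i j)" for a
  \<comment> \<open>The covering relations of the order on the boxes; they correspond to the two
    families of Gelfand-Tsetlin inequalities.\<close>
  define R :: "((int \<times> int) \<times> (int \<times> int)) set" where
    "R = {(p, q). q = (fst p + 1, snd p) \<or> q = (fst p, snd p + 1)}"
  interpret G: comm_group ?G unfolding K_GV_def by (rule K_CM_comm_group)
  interpret OC: order_cone ?G "\<Gamma> k n" \<gamma> R
  proof unfold_locales
    show "finite (insert None (Some ` \<Gamma> k n))" using finite_\<Gamma> by simp
    fix a b e assume a: "a \<in> carrier ?G" and b: "b \<in> carrier ?G"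
    have wab: "wt (a \<otimes>\<^bsub>?G\<^esub> b) = (fst (wt a) + fst (wt b), \<lambda>e\<in>\<Gamma> k n. snd (wt a) e + snd (wt b) e)"
      using hom_mult[OF wt_hom a b] by (simp only: GT_lattice_simps)
    show "\<gamma> (a \<otimes>\<^bsub>?G\<^esub> b) e = \<gamma> a e + \<gamma> b e" if "e \<in> insert None (Some ` \<Gamma> k n)"
    proof (cases e)
      case None
      then show ?thesis by (simp add: \<gamma>_def wab)
    next
      case (Some p)
      obtain i j where p: "p = (i, j)" by (cases p)
      have "(i, j) \<in> \<Gamma> k n" using that Some p by auto
      then show ?thesis by (simp add: Some p \<gamma>_def wab gt_slice_add)
    qed
    show "a = b" if eq: "\<And>e. e \<in> insert None (Some ` \<Gamma> k n) \<Longrightarrow> \<gamma> a e = \<gamma> b e"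
    proof (rule wt_inj[OF a b])
      have "snd (wt a) = snd (wt b)"
      proof (rule gt_slice_inj[OF wt_ext[OF a] wt_ext[OF b]])
        fix i j assume "(i, j) \<in> \<Gamma> k n"
        then have "Some (i, j) \<in> insert None (Some ` \<Gamma> k n)" by simp
        from eq[OF this] show "gt_slice (snd (wt a)) i j = gt_slice (snd (wt b)) i j" by (simp add: \<gamma>_def)
      qed
      moreover have "fst (wt a) = fst (wt b)" using eq[of None] by (simp add: \<gamma>_def)
      ultimately show "wt a = wt b" by (rule prod_eqI[rotated])
    qed
  next
    fix h :: "(int \<times> int) option \<Rightarrow> int"
    from gt_slice_surj[of "\<lambda>p. h (Some p)"]
    obtain v where v: "v \<in> extensional (\<Gamma> k n)"
      "\<forall>i j. (i, j) \<in> \<Gamma> k n \<longrightarrow> gt_slice v i j = h (Some (i, j))" by (rule bexE)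
    have "(h None, v) \<in> carrier (GT_lattice k n)" unfolding GT_lattice_simps using v(1) by (simp add: PiE_def)
    then have "(h None, v) \<in> wt ` carrier ?G" using wt_bij by (simp only: bij_betw_def)
    then obtain a where "(h None, v) = wt a" and ac: "a \<in> carrier ?G" by (rule imageE)
    then have a: "wt a = (h None, v)" by (simp only:)
    have "\<gamma> a e = h e" if "e \<in> insert None (Some ` \<Gamma> k n)" for e
    proof (cases e)
      case None
      then show ?thesis by (simp add: \<gamma>_def a)
    next
      case (Some p)
      obtain i j where p: "p = (i, j)" by (cases p)
      have "(i, j) \<in> \<Gamma> k n" using that Some p by auto
      then show ?thesis by (simp add: Some p \<gamma>_def a v(2)[rule_format])
    qed
    then show "\<exists>a\<in>carrier ?G. \<forall>e\<in>insert None (Some ` \<Gamma> k n). \<gamma> a e = h e" using ac by (intro bexI[of _ a] ballI)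
  qed
  have Mon_iff: "a \<in> OC.Mon \<longleftrightarrow> wt a \<in> Mon_GT k n" if a: "a \<in> carrier ?G" for a
  proof -
    let ?s = "gt_slice (snd (wt a))"
    have car: "(fst (wt a), snd (wt a)) \<in> carrier (GT_lattice k n)" using bij_betw_apply[OF wt_bij a] by simp
    have R: "(\<forall>(p, q)\<in>R. p \<in> \<Gamma> k n \<longrightarrow> q \<in> \<Gamma> k n \<longrightarrow> \<gamma> a (Some p) \<le> \<gamma> a (Some q)) \<longleftrightarrow>
        (\<forall>i\<in>{2..k}. \<forall>j\<in>{1..n - k}. ?s (i - 1) j \<le> ?s i j) \<and> (\<forall>i\<in>{1..k}. \<forall>j\<in>{2..n - k}. ?s i (j - 1) \<le> ?s i j)"
      (is "?l \<longleftrightarrow> ?r")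
    proof
      assume l: ?l
      have "\<gamma> a (Some p) \<le> \<gamma> a (Some q)" if "(p, q) \<in> R" "p \<in> \<Gamma> k n" "q \<in> \<Gamma> k n" for p q 
        using bspec[OF l that(1)] that(2,3) by (simp only: case_prod_conv)
      note l = this
      have r1: "?s (i - 1) j \<le> ?s i j" if "i \<in> {2..k}" "j \<in> {1..n - k}" for i j
        using l[of "(i - 1, j)" "(i, j)"] that by (simp add: R_def \<Gamma>_def \<gamma>_def)
      have r2: "?s i (j - 1) \<le> ?s i j" if "i \<in> {1..k}" "j \<in> {2..n - k}" for i j
        using l[of "(i, j - 1)" "(i, j)"] that by (simp add: R_def \<Gamma>_def \<gamma>_def)
      show ?r by (intro conjI ballI r1 r2)
    next
      assume r: ?r
      have *: "\<gamma> a (Some (i, j)) \<le> \<gamma> a (Some q)" if "((i, j), q) \<in> R" "(i, j) \<in> \<Gamma> k n" "q \<in> \<Gamma> k n" for i j q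
      proof -
        have "q = (i + 1, j) \<or> q = (i, j + 1)" using that(1) by (simp add: R_def)
        then consider "q = (i + 1, j)" | "q = (i, j + 1)" by (elim disjE)
        then show ?thesis
        proof cases
          case 1
          then show ?thesis using conjunct1[OF r, rule_format, of "i + 1" j] that(2,3) by (simp add: \<Gamma>_def \<gamma>_def)
        next
          case 2
          then show ?thesis using conjunct2[OF r, rule_format, of i "j + 1"] that(2,3) by (simp add: \<Gamma>_def \<gamma>_def)
        qed
      qed
      show ?l
      proof (rule ballI)
        fix z assume z: "z \<in> R"
        obtain i j q where ijq: "z = ((i, j), q)" by (metis surj_pair)
        show "case z of (p, q) \<Rightarrow> p \<in> \<Gamma> k n \<longrightarrow> q \<in> \<Gamma> k n \<longrightarrow> \<gamma> a (Some p) \<le> \<gamma> a (Some q)"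
          unfolding ijq case_prod_conv using *[OF z[unfolded ijq]] by (intro impI)
      qed
    qed
    have bounds: "(\<forall>p\<in>\<Gamma> k n. 0 \<le> \<gamma> a (Some p) \<and> \<gamma> a (Some p) \<le> \<gamma> a None) \<longleftrightarrow>
        (\<forall>i\<in>{1..k}. \<forall>j\<in>{1..n - k}. 0 \<le> ?s i j \<and> ?s i j \<le> fst (wt a))"
      unfolding \<Gamma>_def split_paired_Ball_Sigma by (simp add: \<gamma>_def)
    have "wt a \<in> Mon_GT k n \<longleftrightarrow> (fst (wt a), snd (wt a)) \<in> Mon_GT k n" by simp
    also have "\<dots> \<longleftrightarrow> a \<in> OC.Mon"
      unfolding Mon_GT_iff OC.Mon_def mem_Collect_eq R bounds using car a by (simp add: \<gamma>_def)
    finally show ?thesis by (rule sym)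
  qed
  \<comment> \<open>Both sets lie in the group and have the image \<open>Mon_GT k n\<close> under
    \<open>wt\<close>, which is injective there.\<close>
  have Mon: "OC.Mon = ?Mon"
  proof (intro equalityI subsetI)
    fix a assume a: "a \<in> OC.Mon"
    have ac: "a \<in> carrier ?G" by (rule subsetD[OF OC.Mon_sub a])
    have "wt a \<in> wt ` ?Mon" unfolding image by (rule Mon_iff[OF ac, THEN iffD1, OF a])
    then obtain b where b: "wt a = wt b" "b \<in> ?Mon" by (rule imageE)
    have "a = b" by (rule wt_inj[OF ac subsetD[OF sub b(2)] b(1)])
    then show "a \<in> ?Mon" using b(2) by (simp only:)
  next
    fix a assume a: "a \<in> ?Mon"
    then have "wt a \<in> Mon_GT k n" unfolding image[symmetric] by (rule imageI)
    then show "a \<in> OC.Mon" by (rule Mon_iff[OF subsetD[OF sub a], THEN iffD2])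
  qed
  show ?thesis
    unfolding Cone_GV_def
    by (intro conjI image OC.order_cone_saturated[unfolded Mon] OC.order_cone_polyhedral[unfolded Mon])
qed

end
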